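(* For real $\nu$ with $-1<\nu<0$ let $y_1(t),\dots,y_{15}(t)$, $0\le t\le 1$, be the solution of the Cauchy problem $$ \begin{aligned} \dot y_1&=-2u_p^2,\quad \dot y_2=4\big(y_1+2y_4u_p-2(2t-1)u_p^2\big),\\ \dot y_3&=2(7t-3)y_1+4y_2-4y_4^2+8(5t-3)y_4u_p+8y_5u_p-2(47t^2-46t+9)u_p^2,\\ \dot y_4&=-2u_p,\quad \dot y_5=4\big(y_4+(1-3t)u_p\big),\quad \dot y_6=-4(t+1)u_p-4y_4,\\ \dot y_7&=-2u_q^2,\quad \dot y_8=4\big(y_7+2y_{10}u_q-2(2t-1)u_q^2\big),\\ \dot y_9&=2(7t-3)y_7+4y_8-4y_{10}^2+8(5t-3)y_{10}u_q+8y_{11}u_q-2(47t^2-46t+9)u_q^2,\\ \dot y_{10}&=-2u_q,\quad \dot y_{11}=4\big(y_{10}+(1-3t)u_q\big),\quad \dot y_{12}=-4(t+1)u_q-4y_{10}-4,\\ \dot y_{13}&=-2u_pu_q,\quad \dot y_{14}=4(y_{13}+y_4u_q+y_{10}u_p)-8(2t-1)u_pu_q,\\ \dot y_{15}&=2(7t-3)y_{13}+4y_{14}-4y_4y_{10}+4(5t-3)(y_4u_q+y_{10}u_p)+4y_5u_q+4y_{11}u_p-2(47t^2-46t+9)u_pu_q, \end{aligned} $$ with initial values $y_6(0)=1$ and $y_k(0)=0$ for all $k\neq 6$, where $$ u_p=\frac{2(3-5t)y_4+2y_5-y_6}{16t^2-8t+\nu+2},\qquad u_q=\frac{2(3-5t)y_{10}+2y_{11}-y_{12}+2(1-3t)}{16t^2-8t+\nu+2}.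 $$ Then the Bombieri number $\sigma_{24}$ equals $-\nu^*$, where $\nu^*$ is the maximum of all negative roots $\nu$ of the two equations $$ \nu y_1(1)+y_3(1)=0 $$ and $$ \big(\nu y_1(1)+y_3(1)\big)\big(\nu y_7(1)+y_9(1)\big)-\big(\nu y_{13}(1)+y_{15}(1)\big)^2=0 . $$
   Context: $S$ is the class of all holomorphic univalent functions $f(z)=z+\sum_{n\ge2}a_nz^n$ in the unit disk $U=\{z:|z|<1\}$, and $K(z)=z/(1-z)^2=\sum_{n\ge1}nz^n\in S$ is the Koebe function. For integers $m,n\ge2$ the Bombieri number is $$\sigma_{mn}=\liminf_{f\to K,\ f\in S}\frac{n-\operatorname{Re}a_n}{m-\operatorname{Re}a_m},$$ where $f\to K$ locally uniformly in $U$ (and the quotient is taken where the denominator is nonzero). In particular $\sigma_{24}$ is the case $m=2$, $n=4$. The letters $u_p,u_q$ are merely names for the displayed expressions in $t,\nu,y_k$; the dot denotes $d/dt$. *)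

theory Defs
  imports "HOL-Complex_Analysis.Complex_Analysis"
begin

definition class_S :: "(complex \<Rightarrow> complex) set" where
  "class_S = {f. f holomorphic_on ball 0 1 \<and> inj_on f (ball 0 1) \<and> f 0 = 0 \<and> deriv f 0 = 1}"

abbreviation taylor_coeff :: "(complex \<Rightarrow> complex) \<Rightarrow> nat \<Rightarrow> complex" where
  "taylor_coeff f n \<equiv> fps_nth (fps_expansion f 0) n"

definition koebe :: "complex \<Rightarrow> complex" where
  "koebe z = z / (1 - z)\<^sup>2"

(* The neighbourhood filter of g for locally uniform convergence on U.  Elements of class_S are
   total functions, but this filter only sees their values on the open set U. *)
definition locally_uniformly_on ::
    "complex set \<Rightarrow> (complex \<Rightarrow> complex) \<Rightarrow> (complex \<Rightarrow> complex) filter" where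
  "locally_uniformly_on U g = (INF C \<in> {C. compact C \<and> C \<subseteq> U}. uniformly_on C g)"

(* The limes inferior runs over f in class_S tending to koebe along which the quotient is defined;
   in particular f = koebe itself is excluded. *)
definition bombieri_number :: "nat \<Rightarrow> nat \<Rightarrow> ereal" where
  "bombieri_number m n =
     Liminf (inf (locally_uniformly_on (ball 0 1) koebe)
                 (principal {f \<in> class_S. real m - Re (taylor_coeff f m) \<noteq> 0}))
       (\<lambda>f. ereal ((real n - Re (taylor_coeff f n)) / (real m - Re (taylor_coeff f m))))"

definition u_p :: "real \<Rightarrow> (nat \<Rightarrow> real \<Rightarrow> real) \<Rightarrow> real \<Rightarrow> real" where
  "u_p \<nu> y t = (2 * (3 - 5 * t) * y 4 t + 2 * y 5 t - y 6 t) / (16 * t\<^sup>2 - 8 * t + \<nu> + 2)"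

definition u_q :: "real \<Rightarrow> (nat \<Rightarrow> real \<Rightarrow> real) \<Rightarrow> real \<Rightarrow> real" where
  "u_q \<nu> y t = (2 * (3 - 5 * t) * y 10 t + 2 * y 11 t - y 12 t + 2 * (1 - 3 * t))
                 / (16 * t\<^sup>2 - 8 * t + \<nu> + 2)"

(* Only the components 1, ..., 15 of y are constrained; at the end points t = 0 and t = 1 the
   derivative is one-sided. *)
definition solves_cauchy_problem :: "real \<Rightarrow> (nat \<Rightarrow> real \<Rightarrow> real) \<Rightarrow> bool" where
  "solves_cauchy_problem \<nu> y \<longleftrightarrow>
     y 6 0 = 1 \<and> (\<forall>k\<in>{1..15}. k \<noteq> 6 \<longrightarrow> y k 0 = 0) \<and>
     (\<forall>t\<in>{0..1}.
        let p = u_p \<nu> y t; q = u_q \<nu> y t in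
        (y 1 has_real_derivative (- 2 * p\<^sup>2)) (at t within {0..1}) \<and>
        (y 2 has_real_derivative
           4 * (y 1 t + 2 * y 4 t * p - 2 * (2 * t - 1) * p\<^sup>2)) (at t within {0..1}) \<and>
        (y 3 has_real_derivative
           2 * (7 * t - 3) * y 1 t + 4 * y 2 t - 4 * (y 4 t)\<^sup>2 + 8 * (5 * t - 3) * y 4 t * p
           + 8 * y 5 t * p - 2 * (47 * t\<^sup>2 - 46 * t + 9) * p\<^sup>2) (at t within {0..1}) \<and>
        (y 4 has_real_derivative (- 2 * p)) (at t within {0..1}) \<and>
        (y 5 has_real_derivative 4 * (y 4 t + (1 - 3 * t) * p)) (at t within {0..1}) \<and>
        (y 6 has_real_derivative (- 4 * (t + 1) * p - 4 * y 4 t)) (at t within {0..1}) \<and>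
        (y 7 has_real_derivative (- 2 * q\<^sup>2)) (at t within {0..1}) \<and>
        (y 8 has_real_derivative
           4 * (y 7 t + 2 * y 10 t * q - 2 * (2 * t - 1) * q\<^sup>2)) (at t within {0..1}) \<and>
        (y 9 has_real_derivative
           2 * (7 * t - 3) * y 7 t + 4 * y 8 t - 4 * (y 10 t)\<^sup>2 + 8 * (5 * t - 3) * y 10 t * q
           + 8 * y 11 t * q - 2 * (47 * t\<^sup>2 - 46 * t + 9) * q\<^sup>2) (at t within {0..1}) \<and>
        (y 10 has_real_derivative (- 2 * q)) (at t within {0..1}) \<and>
        (y 11 has_real_derivative 4 * (y 10 t + (1 - 3 * t) * q)) (at t within {0..1}) \<and>
        (y 12 has_real_derivative (- 4 * (t + 1) * q - 4 * y 10 t - 4)) (at t within {0..1}) \<and>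
        (y 13 has_real_derivative (- 2 * p * q)) (at t within {0..1}) \<and>
        (y 14 has_real_derivative
           4 * (y 13 t + y 4 t * q + y 10 t * p) - 8 * (2 * t - 1) * p * q)
           (at t within {0..1}) \<and>
        (y 15 has_real_derivative
           2 * (7 * t - 3) * y 13 t + 4 * y 14 t - 4 * y 4 t * y 10 t
           + 4 * (5 * t - 3) * (y 4 t * q + y 10 t * p) + 4 * y 5 t * q + 4 * y 11 t * p
           - 2 * (47 * t\<^sup>2 - 46 * t + 9) * p * q) (at t within {0..1}))"

end

theory Submission
  imports Defs "HOL-Real_Asymp.Real_Asymp"
begin

text \<open>Near \<open>K\<close> the quotient is governed by the defect \<open>(4 - Re a\<^sub>4) + \<nu> (2 - Re a\<^sub>2)\<close>.  Along a Loewner chain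
  driven by \<open>\<kappa> = e\<^sup>i\<^sup>\<theta>\<close>, with time one minus the conformal radius, its second order part is the quadratic
  form \<open>\<integral> (P u\<^sup>2 - 4 z\<^sup>2) + 24 z(1)\<^sup>2 - 16 z(1) \<integral> z\<close> with \<open>z' = u = -\<theta>\<close>, \<open>z 0 = 0\<close> and Legendre coefficient
  \<open>P t = 16 t\<^sup>2 - 8 t + \<nu> + 2\<close>.  The functions \<open>u\<^sub>p, u\<^sub>q\<close> span the solutions of its Jacobi equation, and
  on their combinations the form is, up to the factor \<open>-1/2\<close>, the binary form whose first coefficient
  and determinant are the left-hand sides of the two equations.  If a strict Riccati inequality has a
  solution, the form is positive and so is the defect up to a third order error; the set of such
  \<open>\<nu>\<close> is open and upward closed, and at its infimum the form has a null vector of the above kind,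
  which makes that infimum the largest root.

  For the lower bound no Loewner differential equation is needed: Koebe's osculation factors a
  bounded univalent function into maps that are explicitly close to Euler steps of a Loewner chain,
  and all estimates are made uniformly for such discrete chains.  For the upper bound the null vector
  \<open>u\<close> is turned into functions in \<open>S\<close> by composing univalent Euler steps with driving angle
  \<open>-\<epsilon> u\<close>.\<close>

section \<open>Riccati certificates and the second variation\<close>

text \<open>The form is not a classical one because of the product of z(1) with the integral of z.
  With a = z(1), the shifted function Z = z + 2a satisfies -4 Z^2 = -4 z^2 - 16 a z - 16 a^2, so the
  form becomes the integral of P u^2 - 4 Z^2, plus 40 a^2, with Z(0) = 2a and Z(1) = 3a. Adding the
  derivative of w Z^2 and completing the square leaves a Riccati inequality for w and the boundary
  condition 9 w(1) < 40 + 4 w(0); this is the origin of 40, 9 and 4. The restriction -1 < \<nu> is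
  the Legendre condition, since P attains its minimum 1 + \<nu> at t = 1/4.

  The remainder must be controlled by 2 - Re a_2 alone, because locally uniform convergence gives no
  pointwise control of the driving function. The energy, the time integral of 1 - cos \<theta>, is
  half of 2 - Re a_2, and up to the mesh every error is bounded by its power 3/2, even where
  \<theta> is large. The constants do not depend on the mesh, so for a fixed function in S the mesh
  can tend to 0 before the function tends to K.\<close>

definition leg :: "real \<Rightarrow> real \<Rightarrow> real" where
  "leg \<nu> t = 16 * t\<^sup>2 - 8 * t + \<nu> + 2"

lemma leg_ge: "leg \<nu> t \<ge> 1 + \<nu>"
proof -
  have "leg \<nu> t = 16 * (t - 1/4)\<^sup>2 + 1 + \<nu>"
    by (simp add: leg_def power2_eq_square algebra_simps)
  then show ?thesis by simp
qed

lemma leg_pos: "-1 < \<nu> \<Longrightarrow> 0 < leg \<nu> t"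
  using leg_ge[of \<nu> t] by linarith

lemma leg_le: "\<nu> < 0 \<Longrightarrow> t \<in> {0..1} \<Longrightarrow> leg \<nu> t \<le> 10"
proof -
  assume "\<nu> < 0" "t \<in> {0..1}"
  then have "t * t \<le> 1 * t" by (intro mult_right_mono) auto
  with \<open>\<nu> < 0\<close> \<open>t \<in> {0..1}\<close> show ?thesis by (simp add: leg_def power2_eq_square)
qed

lemma leg_cont [continuous_intros]: "continuous_on S f \<Longrightarrow> continuous_on S (\<lambda>t. leg \<nu> (f t))"
  unfolding leg_def by (intro continuous_intros)

text \<open>The Lipschitz bound on \<open>w'\<close> makes Euler steps of \<open>w\<close> along a
  discrete chain accurate to second order, see \<open>rate_of_function\<close>. Strictness of the
  two inequalities yields \<open>certified_open\<close> and the uniqueness part of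
  \<open>form_value_ge\<close>.\<close>

definition riccati_certificate :: "real \<Rightarrow> (real \<Rightarrow> real) \<Rightarrow> (real \<Rightarrow> real) \<Rightarrow> bool" where
  "riccati_certificate \<nu> w w' \<longleftrightarrow>
     (\<forall>t\<in>{0..1}. (w has_real_derivative w' t) (at t within {0..1})) \<and>
     (\<exists>K. K-lipschitz_on {0..1} w') \<and>
     (\<forall>t\<in>{0..1}. 4 + (w t)\<^sup>2 / leg \<nu> t < w' t) \<and> 9 * w 1 < 40 + 4 * w 0"

definition certified :: "real set" where
  "certified = {\<nu>. -1 < \<nu> \<and> \<nu> < 0 \<and> (\<exists>w w'. riccati_certificate \<nu> w w')}"

lemma riccati_certificate_mono:
  assumes "riccati_certificate \<nu> w w'" "-1 < \<nu>" "\<nu> \<le> \<mu>"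
  shows "riccati_certificate \<mu> w w'"
proof -
  have "(w t)\<^sup>2 / leg \<mu> t \<le> (w t)\<^sup>2 / leg \<nu> t" for t
    using assms leg_pos[of \<nu> t] by (intro divide_left_mono mult_pos_pos leg_pos) (auto simp: leg_def)
  with assms(1) show ?thesis unfolding riccati_certificate_def
    by (metis add_le_cancel_left order_le_less_trans)
qed

lemma certified_mono: "\<nu> \<in> certified \<Longrightarrow> \<nu> \<le> \<mu> \<Longrightarrow> \<mu> < 0 \<Longrightarrow> \<mu> \<in> certified"
  unfolding certified_def using riccati_certificate_mono by force

lemma lipschitz_of_C1:
  fixes f :: "real \<Rightarrow> real"
  assumes "\<And>t. t \<in> {0..1} \<Longrightarrow> (f has_real_derivative f' t) (at t within {0..1})" "continuous_on {0..1} f'"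
  shows "\<exists>K. K-lipschitz_on {0..1} f"
proof -
  have "bounded (f' ` {0..1})" using assms(2) compact_Icc compact_continuous_image compact_imp_bounded by blast
  then obtain K where K: "\<And>t. t \<in> {0..1} \<Longrightarrow> norm (f' t) \<le> K" unfolding bounded_iff by (metis imageI)
  have "norm (f x - f y) \<le> K * norm (x - y)" if "x \<in> {0..1}" "y \<in> {0..1}" for x y
    using field_differentiable_bound[of "{0..1}" f f' K x y] assms(1) K that by auto
  then have "K-lipschitz_on {0..1} f" using K[of 0] norm_ge_zero[of "f' 0"]
    by (intro lipschitz_onI) (auto simp: dist_norm intro: order_trans)
  then show ?thesis by blast
qed


text \<open>Completion of the square: once the derivative of \<open>w * Z\<^sup>2\<close> is added,
  the integrand is P (u + w Z / P)^2 plus a nonnegative multiple of Z^2.\<close>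

lemma riccati_square:
  assumes "-1 < \<nu>" "4 + (w t)\<^sup>2 / leg \<nu> t \<le> w' t"
  shows "0 \<le> leg \<nu> t * u\<^sup>2 - 4 * Z\<^sup>2 + w' t * Z\<^sup>2 + 2 * w t * Z * u"
proof -
  have D: "0 < leg \<nu> t" using leg_pos assms by blast
  have "0 \<le> leg \<nu> t * (u + w t * Z / leg \<nu> t)\<^sup>2 + (w' t - 4 - (w t)\<^sup>2 / leg \<nu> t) * Z\<^sup>2"
    using D assms by (intro add_nonneg_nonneg mult_nonneg_nonneg) auto
  also have "\<dots> = leg \<nu> t * u\<^sup>2 - 4 * Z\<^sup>2 + w' t * Z\<^sup>2 + 2 * w t * Z * u"
    using D by (simp add: field_simps power2_eq_square)
  finally show ?thesis .
qed

lemma DERIV_within_nonneg_imp_le: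
  fixes f f' :: "real \<Rightarrow> real"
  assumes "\<And>t. t \<in> {0..1} \<Longrightarrow> (f has_real_derivative f' t) (at t within {0..1})"
    and "\<And>t. t \<in> {0..1} \<Longrightarrow> 0 \<le> f' t" and "0 \<le> a" "a \<le> b" "b \<le> 1"
  shows "f a \<le> f b"
proof (cases "a = b")
  case False
  have d: "(f has_real_derivative f' t) (at t)" if "0 < t" "t < 1" for t
    using assms(1)[of t] that at_within_interior[of t "{0..1}"] by (simp add: interior_atLeastAtMost_real)
  have "continuous_on {0..1} f" using assms(1) DERIV_continuous_on by blast
  then have c: "continuous_on {a..b} f" by (rule continuous_on_subset) (use assms in auto)
  show ?thesis
  proof (rule DERIV_nonneg_imp_increasing_open[OF \<open>a \<le> b\<close> _ c])
    fix x assume "a < x" "x < b"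
    then have "0 < x" "x < 1" using assms by auto
    with d assms(2) show "\<exists>y. DERIV f x :> y \<and> 0 \<le> y" by (meson atLeastAtMost_iff less_eq_real_def)
  qed
qed simp

section \<open>Explicit parameters on both sides of the threshold\<close>

lemma certified_nonempty: "-1/100 \<in> certified"
proof -
  \<comment> \<open>A cubic is enough; its end values -5/2 and 3 turn the boundary condition into 27
    < 30.\<close>
  define w where "w = (\<lambda>t::real. 3 * t^3 - 11/2 * t\<^sup>2 + 8 * t - 5/2)"
  define w' where "w' = (\<lambda>t::real. 9 * t\<^sup>2 - 11 * t + 8)"
  have d: "(w has_real_derivative w' t) (at t within {0..1})" for t
    unfolding w_def w'_def by (auto intro!: derivative_eq_intros)
  have "\<exists>K. K-lipschitz_on {0..1} w'"
    by (rule lipschitz_of_C1[where f'="\<lambda>t. 18 * t - 11"])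
       (auto intro!: derivative_eq_intros continuous_intros simp: w'_def)
  moreover have "4 + (w t)\<^sup>2 / leg (-1/100) t < w' t" if t: "t \<in> {0..1}" for t
  proof -
    \<comment> \<open>A polynomial of degree 6. On each half of the interval, rescaled to the unit
      interval, the constant 2/5 is split off and the rest is expanded in the Bernstein basis of
      degree 6, where all coefficients are positive.\<close>
    have "0 < leg (-1/100) t * w' t - 4 * leg (-1/100) t - (w t)\<^sup>2"
    proof (cases "t \<le> 1/2")
      case True
      define x where "x = 2 * t"
      have x: "0 \<le> x" "0 \<le> 1 - x" "t = x/2" using True t by (auto simp: x_def)
      have "leg (-1/100) t * w' t - 4 * leg (-1/100) t - (w t)\<^sup>2 =
        2/5 + 131/100 * (x^0 * (1-x)^6) + 183/200 * (x^1 * (1-x)^5) + 1811/400 * (x^2 * (1-x)^4) + 3407/200 * (x^3 * (1-x)^3) + 28079/1600 * (x^4 * (1-x)^2) + 321/50 * (x^5 * (1-x)^1) + 337/400 * (x^6 * (1-x)^0)"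
        unfolding x(3) leg_def w_def w'_def by (simp add: field_simps power2_eq_square power3_eq_cube) algebra
      also have "\<dots> > 0" using x by (intro add_pos_nonneg add_nonneg_nonneg mult_nonneg_nonneg zero_le_power) auto
      finally show ?thesis .
    next
      case False
      define x where "x = 2 * t - 1"
      have x: "0 \<le> x" "0 \<le> 1 - x" "t = (x+1)/2" using False t by (auto simp: x_def)
      have "leg (-1/100) t * w' t - 4 * leg (-1/100) t - (w t)\<^sup>2 =
        2/5 + 337/400 * (x^0 * (1-x)^6) + 369/100 * (x^1 * (1-x)^5) + 6239/1600 * (x^2 * (1-x)^4) + 34/25 * (x^3 * (1-x)^3) + 4841/400 * (x^4 * (1-x)^2) + 4503/200 * (x^5 * (1-x)^1) + 529/50 * (x^6 * (1-x)^0)"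
        unfolding x(3) leg_def w_def w'_def by (simp add: field_simps power2_eq_square power3_eq_cube) algebra
      also have "\<dots> > 0" using x by (intro add_pos_nonneg add_nonneg_nonneg mult_nonneg_nonneg zero_le_power) auto
      finally show ?thesis .
    qed
    then show ?thesis using leg_pos[of "-1/100" t] by (simp add: field_simps)
  qed
  moreover have "9 * w 1 < 40 + 4 * w 0" by (simp add: w_def)
  ultimately have "riccati_certificate (-1/100) w w'" using d unfolding riccati_certificate_def by blast
  then show ?thesis unfolding certified_def by auto
qed

text \<open>A certificate makes the form nonnegative on all shifted functions with a = 1, so one
  test function with end values 2 and 3 whose integral lies below -40 refutes it. Near t = 1/4 the
  Legendre coefficient is only about 1/1000, hence steep test functions are cheap there. The lemma
  keeps the infimum of \<open>certified\<close> away from -1.\<close>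

lemma not_certified: "-999/1000 \<notin> certified"
proof
  assume "-999/1000 \<in> certified"
  then obtain w w' where
    dw: "\<And>t. t\<in>{0..1} \<Longrightarrow> (w has_real_derivative w' t) (at t within {0..1})" and
    ric: "\<And>t. t\<in>{0..1} \<Longrightarrow> 4 + (w t)\<^sup>2 / leg (-999/1000) t < w' t" and bd: "9 * w 1 < 40 + 4 * w 0"
    unfolding certified_def riccati_certificate_def by blast
  define Z :: "real poly" where "Z = [:2, -2, 341, -8446, 99180, -612512, 2256544, -5345536, 8452672, -9013504, 6386176, -2867200, 732160, -79872:]"
  \<comment> \<open>The exact primitive of the integrand belonging to \<open>Z\<close>, so that the
    integral is just \<open>poly P 1\<close>.\<close>
  define P :: "real poly" where "P = [:0, -2999/250, -341341/250, 145864619/750, -5077365489/500, 373161431641/1250, -718063971492/125, 68092912087008/875, -96891334706564/125, 439033015126976/75, -4289788493043136/125, 218772209845334144/1375, -221939045877371008/375, 2902080467402294272/1625, -3856287214209194496/875, 16768384879630318592/1875, -1870975268584169984/125, 43935018744422899712/2125, -2941048508967698432/125, 52153804180276379648/2375, -10424944619323785216/625, 8916614256025796608/875, -1353406567353155584/275, 210634991609053184/115, -37900150322757632/75, 303261265978458112/3125, -11541726363648, 637953638400:]"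
  have P': "pderiv P = [:1001/1000, -8, 16:] * (pderiv Z)\<^sup>2 - smult 4 (Z\<^sup>2)"
    unfolding P_def Z_def by (simp add: pderiv_pCons power2_eq_square numeral_mult)
  have leg: "poly [:1001/1000, -8, 16:] t = leg (-999/1000) t" for t
    by (simp add: leg_def power2_eq_square algebra_simps)
  have P1: "poly (pderiv P) t = leg (-999/1000) t * (poly (pderiv Z) t)\<^sup>2 - 4 * (poly Z t)\<^sup>2" for t
    by (simp only: P' poly_mult leg poly_diff poly_smult poly_power)
  define H where "H = (\<lambda>t. poly P t + w t * (poly Z t)\<^sup>2)"
  have dH: "(H has_real_derivative
      leg (-999/1000) t * (poly (pderiv Z) t)\<^sup>2 - 4 * (poly Z t)\<^sup>2 + w' t * (poly Z t)\<^sup>2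
       + 2 * w t * poly Z t * poly (pderiv Z) t) (at t within {0..1})" if "t \<in> {0..1}" for t
    unfolding H_def
    by (auto intro!: derivative_eq_intros dw[OF that] simp: P1)
  have nn: "0 \<le> leg (-999/1000) t * (poly (pderiv Z) t)\<^sup>2 - 4 * (poly Z t)\<^sup>2 + w' t * (poly Z t)\<^sup>2
       + 2 * w t * poly Z t * poly (pderiv Z) t" if "t \<in> {0..1}" for t
    using riccati_square[of "-999/1000" w t w' "poly (pderiv Z) t" "poly Z t"] ric[OF that] by simp
  have "H 0 \<le> H 1" by (rule DERIV_within_nonneg_imp_le[OF dH nn]) auto
  then have "4 * w 0 \<le> poly P 1 + 9 * w 1" by (simp add: H_def P_def Z_def)
  moreover have "poly P 1 < -40" by (simp add: P_def)
  ultimately show False using bd by linarith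
qed

lemma DERIV_unit_constant:
  fixes f :: "real \<Rightarrow> real"
  assumes "(f has_real_derivative d) (at t within {0..1})" "t \<in> {0..1}" "\<And>s. s \<in> {0..1} \<Longrightarrow> f s = c"
  shows "d = 0"
proof -
  have "(f has_real_derivative 0) (at t within {0..1})"
    by (rule has_field_derivative_transform_within[of "\<lambda>_. c" _ _ _ 1]) (use assms in auto)
  moreover have "at t within {0..1} \<noteq> bot"
    using assms(2) by (simp add: trivial_limit_within islimpt_Icc)
  ultimately show ?thesis using has_field_derivative_unique assms(1) by blast
qed

text \<open>\<open>I\<close> is the running integral of \<open>z\<close> and \<open>F\<close> the
  running value of the local part of the form. Carrying both as functions turns every estimate of
  the form into the monotonicity of one explicit function.\<close>

definition jacobi_path ::
    "real \<Rightarrow> (real \<Rightarrow> real) \<Rightarrow> (real \<Rightarrow> real) \<Rightarrow> (real \<Rightarrow> real) \<Rightarrow> (real \<Rightarrow> real) \<Rightarrow> bool" where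
  "jacobi_path \<nu> z u I F \<longleftrightarrow> z 0 = 0 \<and> I 0 = 0 \<and> F 0 = 0 \<and>
     (\<forall>t\<in>{0..1}. (z has_real_derivative u t) (at t within {0..1}) \<and>
        (I has_real_derivative z t) (at t within {0..1}) \<and>
        (F has_real_derivative (leg \<nu> t * (u t)\<^sup>2 - 4 * (z t)\<^sup>2)) (at t within {0..1}))"

definition form_value :: "(real \<Rightarrow> real) \<Rightarrow> (real \<Rightarrow> real) \<Rightarrow> (real \<Rightarrow> real) \<Rightarrow> real" where
  "form_value z I F = F 1 + 24 * (z 1)\<^sup>2 - 16 * z 1 * I 1"

text \<open>Shifting \<open>z\<close> by twice its end value \<open>a\<close> absorbs the nonlocal term
  \<open>-16 a \<integral> z\<close> of the form, so that a scalar Riccati certificate suffices.\<close>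

lemma form_value_ge:
  assumes c: "riccati_certificate \<mu> w w'" and "-1 < \<mu>" and p: "jacobi_path \<nu> z u I F"
    and K: "\<And>t. t \<in> {0..1} \<Longrightarrow> (\<mu> - \<nu>) * (u t)\<^sup>2 \<le> K"
  shows "0 \<le> form_value z I F + K"
    and "form_value z I F + K \<le> 0 \<Longrightarrow> t \<in> {0..1} \<Longrightarrow> z t = 0"
proof -
  define a where "a = z 1"
  define Z where "Z = (\<lambda>t. z t + 2 * a)"
  \<comment> \<open>The term \<open>K * t\<close> pays for using a certificate of \<mu> with the
    form of \<nu>. The cases that occur are \<mu> = \<nu> with K = 0, and \<mu> decreasing to
    \<nu>.\<close>
  define H where "H = (\<lambda>t. F t + K * t - 16 * a * I t - 16 * a\<^sup>2 * t + w t * (Z t)\<^sup>2)"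
  define H' where "H' = (\<lambda>t. leg \<nu> t * (u t)\<^sup>2 + K - 4 * (Z t)\<^sup>2 + w' t * (Z t)\<^sup>2 + 2 * w t * Z t * u t)"
  have dw: "(w has_real_derivative w' t) (at t within {0..1})"
    and ric: "4 + (w t)\<^sup>2 / leg \<mu> t < w' t" if "t \<in> {0..1}" for t
    using c that unfolding riccati_certificate_def by auto
  have bd: "9 * w 1 < 40 + 4 * w 0" using c unfolding riccati_certificate_def by auto
  have dz: "(z has_real_derivative u t) (at t within {0..1})"
    and dI: "(I has_real_derivative z t) (at t within {0..1})"
    and dF: "(F has_real_derivative (leg \<nu> t * (u t)\<^sup>2 - 4 * (z t)\<^sup>2)) (at t within {0..1})"
    if "t \<in> {0..1}" for t
    using p that unfolding jacobi_path_def by auto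
  have dH: "(H has_real_derivative H' t) (at t within {0..1})" if "t \<in> {0..1}" for t
    unfolding H_def Z_def H'_def
    by (rule derivative_eq_intros dw[OF that] dz[OF that] dI[OF that] dF[OF that] refl)+
       (simp add: power2_eq_square algebra_simps)
  have H'ge: "(w' t - 4 - (w t)\<^sup>2 / leg \<mu> t) * (Z t)\<^sup>2 \<le> H' t" if t: "t \<in> {0..1}" for t
  proof -
    have D: "0 < leg \<mu> t" using leg_pos assms(2) by blast
    have "0 \<le> leg \<mu> t * (u t + w t * Z t / leg \<mu> t)\<^sup>2" using D by simp
    also have "\<dots> = leg \<mu> t * (u t)\<^sup>2 + 2 * w t * Z t * u t + (w t)\<^sup>2 / leg \<mu> t * (Z t)\<^sup>2"
      using D by (simp add: field_simps power2_eq_square)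
    finally have "(w' t - 4 - (w t)\<^sup>2 / leg \<mu> t) * (Z t)\<^sup>2 \<le> (w' t - 4) * (Z t)\<^sup>2 + leg \<mu> t * (u t)\<^sup>2 + 2 * w t * Z t * u t"
      by (simp add: algebra_simps)
    moreover have "leg \<mu> t * (u t)\<^sup>2 \<le> leg \<nu> t * (u t)\<^sup>2 + K" using K[OF t] by (simp add: leg_def algebra_simps)
    ultimately show ?thesis by (simp add: H'_def algebra_simps)
  qed
  have H'nn: "0 \<le> H' t" if "t \<in> {0..1}" for t
    using H'ge[OF that] ric[OF that] by (smt (verit) mult_nonneg_nonneg zero_le_power2)
  have mono: "H s \<le> H t" if "0 \<le> s" "s \<le> t" "t \<le> 1" for s t
    by (rule DERIV_within_nonneg_imp_le[OF dH H'nn that])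
  have H0: "H 0 = 4 * a\<^sup>2 * w 0" using p by (simp add: H_def Z_def jacobi_path_def power2_eq_square)
  have H1: "H 1 = F 1 + K - 16 * a * I 1 - 16 * a\<^sup>2 + 9 * a\<^sup>2 * w 1"
    by (simp add: H_def Z_def a_def power2_eq_square)
  have e: "form_value z I F + K = H 1 - H 0 + a\<^sup>2 * (40 + 4 * w 0 - 9 * w 1)"
    unfolding H0 H1 form_value_def a_def by (simp add: algebra_simps)
  have nn: "0 \<le> a\<^sup>2 * (40 + 4 * w 0 - 9 * w 1)" using bd by simp
  show "0 \<le> form_value z I F + K" unfolding e using mono[of 0 1] nn by simp
  assume le: "form_value z I F + K \<le> 0" and t: "t \<in> {0..1}"
  have "a\<^sup>2 * (40 + 4 * w 0 - 9 * w 1) = 0" and H01: "H 1 = H 0"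
    using le nn mono[of 0 1] unfolding e by linarith+
  then have a: "a = 0" using bd by simp
  \<comment> \<open>A monotone function with equal end values is constant; the strict Riccati
    inequality then leaves only \<open>Z t = 0\<close>.\<close>
  have Hc: "H s = H 0" if "s \<in> {0..1}" for s
    using mono[of 0 s] mono[of s 1] H01 that by simp
  have "H' t = 0"
    using DERIV_unit_constant[OF dH[OF t] t] Hc by blast
  then have "(w' t - 4 - (w t)\<^sup>2 / leg \<mu> t) * (Z t)\<^sup>2 \<le> 0" using H'ge[OF t] by simp
  then have "Z t = 0" using ric[OF t] by (smt (verit) mult_pos_pos zero_less_power2)
  then show "z t = 0" using a by (simp add: Z_def)
qed

section \<open>Extremals from the Cauchy problem\<close>

locale cauchy_solution =
  fixes \<nu> :: real and y :: "nat \<Rightarrow> real \<Rightarrow> real"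
  assumes nu: "-1 < \<nu>" "\<nu> < 0" and sol: "solves_cauchy_problem \<nu> y"
begin

abbreviation "p \<equiv> u_p \<nu> y"
abbreviation "q \<equiv> u_q \<nu> y"

lemma init: "y 6 0 = 1" "y 1 0 = 0" "y 2 0 = 0" "y 3 0 = 0" "y 4 0 = 0" "y 5 0 = 0" "y 7 0 = 0"
  "y 8 0 = 0" "y 9 0 = 0" "y 10 0 = 0" "y 11 0 = 0" "y 12 0 = 0" "y 13 0 = 0" "y 14 0 = 0" "y 15 0 = 0"
  using sol unfolding solves_cauchy_problem_def by auto

lemma ode:
  assumes "t \<in> {0..1}"
  shows "(y 1 has_real_derivative (- 2 * (p t)\<^sup>2)) (at t within {0..1})"
    "(y 2 has_real_derivative
           4 * (y 1 t + 2 * y 4 t * p t - 2 * (2 * t - 1) * (p t)\<^sup>2)) (at t within {0..1})"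
    "(y 3 has_real_derivative
           2 * (7 * t - 3) * y 1 t + 4 * y 2 t - 4 * (y 4 t)\<^sup>2 + 8 * (5 * t - 3) * y 4 t * p t
           + 8 * y 5 t * p t - 2 * (47 * t\<^sup>2 - 46 * t + 9) * (p t)\<^sup>2) (at t within {0..1})"
    "(y 4 has_real_derivative (- 2 * p t)) (at t within {0..1})"
    "(y 5 has_real_derivative 4 * (y 4 t + (1 - 3 * t) * p t)) (at t within {0..1})"
    "(y 6 has_real_derivative (- 4 * (t + 1) * p t - 4 * y 4 t)) (at t within {0..1})"
    "(y 7 has_real_derivative (- 2 * (q t)\<^sup>2)) (at t within {0..1})"
    "(y 8 has_real_derivative
           4 * (y 7 t + 2 * y 10 t * q t - 2 * (2 * t - 1) * (q t)\<^sup>2)) (at t within {0..1})"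
    "(y 9 has_real_derivative
           2 * (7 * t - 3) * y 7 t + 4 * y 8 t - 4 * (y 10 t)\<^sup>2 + 8 * (5 * t - 3) * y 10 t * q t
           + 8 * y 11 t * q t - 2 * (47 * t\<^sup>2 - 46 * t + 9) * (q t)\<^sup>2) (at t within {0..1})"
    "(y 10 has_real_derivative (- 2 * q t)) (at t within {0..1})"
    "(y 11 has_real_derivative 4 * (y 10 t + (1 - 3 * t) * q t)) (at t within {0..1})"
    "(y 12 has_real_derivative (- 4 * (t + 1) * q t - 4 * y 10 t - 4)) (at t within {0..1})"
    "(y 13 has_real_derivative (- 2 * p t * q t)) (at t within {0..1})"
    "(y 14 has_real_derivative
           4 * (y 13 t + y 4 t * q t + y 10 t * p t) - 8 * (2 * t - 1) * p t * q t)
           (at t within {0..1})"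
    "(y 15 has_real_derivative
           2 * (7 * t - 3) * y 13 t + 4 * y 14 t - 4 * y 4 t * y 10 t
           + 4 * (5 * t - 3) * (y 4 t * q t + y 10 t * p t) + 4 * y 5 t * q t + 4 * y 11 t * p t
           - 2 * (47 * t\<^sup>2 - 46 * t + 9) * p t * q t) (at t within {0..1})"
  using sol assms unfolding solves_cauchy_problem_def Let_def by blast+

text \<open>The extremal \<open>\<alpha> u_p + \<beta> u_q\<close>: \<open>ext_z\<close> is its primitive, \<open>ext_v\<close> its product with the
  Legendre coefficient; \<open>ext_I\<close> and \<open>ext_F\<close> are the primitives that enter the quadratic form,
  expressed through the components of \<open>y\<close>.\<close>

definition "ext_u \<alpha> \<beta> t = \<alpha> * p t + \<beta> * q t"
definition "ext_z \<alpha> \<beta> t = - (1/2) * (\<alpha> * y 4 t + \<beta> * y 10 t)"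
definition "ext_v \<alpha> \<beta> t = \<alpha> * (2 * (3 - 5 * t) * y 4 t + 2 * y 5 t - y 6 t)
  + \<beta> * (2 * (3 - 5 * t) * y 10 t + 2 * y 11 t - y 12 t + 2 * (1 - 3 * t))"
definition "ext_I \<alpha> \<beta> t = (1/4) * (\<alpha> * y 5 t + \<beta> * y 11 t - (4 - 12 * t) * ext_z \<alpha> \<beta> t)"
definition "ext_F \<alpha> \<beta> t = - (1/2) * ((\<alpha>\<^sup>2 * y 3 t + 2 * \<alpha> * \<beta> * y 15 t + \<beta>\<^sup>2 * y 9 t)
     + 4 * (1 - t) * (\<alpha>\<^sup>2 * y 2 t + 2 * \<alpha> * \<beta> * y 14 t + \<beta>\<^sup>2 * y 8 t)
     + (\<nu> + (1 - t) * (9 - t)) * (\<alpha>\<^sup>2 * y 1 t + 2 * \<alpha> * \<beta> * y 13 t + \<beta>\<^sup>2 * y 7 t))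
   - ((28 * t - 4) * (ext_z \<alpha> \<beta> t)\<^sup>2 - 16 * ext_z \<alpha> \<beta> t * ext_I \<alpha> \<beta> t)"

lemma ext_u_eq: "ext_u \<alpha> \<beta> t = ext_v \<alpha> \<beta> t / leg \<nu> t"
proof -
  have "\<alpha> * (a / c) + \<beta> * (b / c) = (\<alpha> * a + \<beta> * b) / c" for a b c :: real
    by (simp add: add_divide_distrib)
  then show ?thesis unfolding ext_u_def ext_v_def u_p_def u_q_def leg_def .
qed

lemma ext_v_eq: "ext_v \<alpha> \<beta> t = leg \<nu> t * ext_u \<alpha> \<beta> t"
  using leg_pos[OF nu(1), of t] by (simp add: ext_u_eq)

lemma ext_z_deriv:
  assumes "t \<in> {0..1}"
  shows "(ext_z \<alpha> \<beta> has_real_derivative ext_u \<alpha> \<beta> t) (at t within {0..1})"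
  unfolding ext_z_def[abs_def] ext_u_def
  by (rule derivative_eq_intros ode[OF assms] refl)+ (simp add: algebra_simps)

text \<open>The Jacobi equation of the form is (P z')' = -4 z - 8 a with a = z(1). Here
  \<open>2 * \<beta>\<close> stands for 8 a; the relation \<beta> = 4 z(1) that ties them together
  is only imposed in \<open>critical_null\<close>.\<close>

lemma ext_v_deriv:
  assumes "t \<in> {0..1}"
  shows "(ext_v \<alpha> \<beta> has_real_derivative (- 4 * ext_z \<alpha> \<beta> t - 2 * \<beta>)) (at t within {0..1})"
  unfolding ext_z_def ext_v_def[abs_def]
  by (rule derivative_eq_intros ode[OF assms] refl)+ (simp add: algebra_simps)

lemma ext_I_deriv:
  assumes "t \<in> {0..1}"
  shows "(ext_I \<alpha> \<beta> has_real_derivative ext_z \<alpha> \<beta> t) (at t within {0..1})"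
  unfolding ext_I_def[abs_def]
  by (rule derivative_eq_intros ode[OF assms] ext_z_deriv[OF assms] refl)+ (simp add: ext_u_def ext_z_def algebra_simps)

text \<open>The weights \<open>4 * (1 - t)\<close> and \<open>\<nu> + (1 - t) * (9 - t)\<close> in
  \<open>ext_F\<close> are the multipliers of the coefficient equations along the Koebe chain, the
  same as in \<open>\<Lambda>\<close>. They make all terms in \<open>y 1\<close>, \<open>y 2\<close>
  and their analogues drop out of the derivative.\<close>

lemma ext_F_deriv:
  assumes "t \<in> {0..1}"
  shows "(ext_F \<alpha> \<beta> has_real_derivative (leg \<nu> t * (ext_u \<alpha> \<beta> t)\<^sup>2 - 4 * (ext_z \<alpha> \<beta> t)\<^sup>2)) (at t within {0..1})"
  unfolding ext_F_def[abs_def]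
  apply (rule derivative_eq_intros ode[OF assms] ext_z_deriv[OF assms] ext_I_deriv[OF assms] refl)+
  apply (simp add: ext_u_def ext_z_def ext_I_def leg_def power2_eq_square field_simps)
  done

lemma jacobi_path: "jacobi_path \<nu> (ext_z \<alpha> \<beta>) (ext_u \<alpha> \<beta>) (ext_I \<alpha> \<beta>) (ext_F \<alpha> \<beta>)"
proof -
  have "ext_z \<alpha> \<beta> 0 = 0" "ext_I \<alpha> \<beta> 0 = 0" "ext_F \<alpha> \<beta> 0 = 0" by (simp_all add: ext_z_def ext_I_def ext_F_def init del: One_nat_def)
  then show ?thesis unfolding jacobi_path_def using ext_z_deriv ext_I_deriv ext_F_deriv by blast
qed

definition "coef_pp = \<nu> * y 1 1 + y 3 1"
definition "coef_qq = \<nu> * y 7 1 + y 9 1"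
definition "coef_pq = \<nu> * y 13 1 + y 15 1"

definition "ext_form \<alpha> \<beta> = form_value (ext_z \<alpha> \<beta>) (ext_I \<alpha> \<beta>) (ext_F \<alpha> \<beta>)"

text \<open>At t = 1 the weights with the factor 1 - t vanish and 28 t - 4 equals 24, so the
  quadratic correction in \<open>ext_F\<close> cancels the boundary terms of
  \<open>form_value\<close>.\<close>

lemma ext_form_eq: "ext_form \<alpha> \<beta> = - (\<alpha>\<^sup>2 * coef_pp + 2 * \<alpha> * \<beta> * coef_pq + \<beta>\<^sup>2 * coef_qq) / 2"
  unfolding ext_form_def form_value_def ext_F_def coef_pp_def coef_pq_def coef_qq_def by (simp add: algebra_simps)

text \<open>Both parameters can be read off at t = 0, where \<open>ext_v\<close> has value 2 \<beta>
  - \<alpha> and, for vanishing \<open>ext_z\<close>, slope -2 \<beta>.\<close>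

lemma trivial_extremal:
  assumes "\<And>t. t \<in> {0..1} \<Longrightarrow> ext_z \<alpha> \<beta> t = 0"
  shows "\<alpha> = 0 \<and> \<beta> = 0"
proof -
  have u0: "ext_u \<alpha> \<beta> t = 0" if "t \<in> {0..1}" for t
    using DERIV_unit_constant[OF ext_z_deriv[OF that] that, of \<alpha> \<beta> 0] assms by simp
  then have V0: "ext_v \<alpha> \<beta> t = 0" if "t \<in> {0..1}" for t using ext_v_eq that by simp
  have "- 4 * ext_z \<alpha> \<beta> 0 - 2 * \<beta> = 0"
    by (rule DERIV_unit_constant[OF ext_v_deriv, of 0 \<alpha> \<beta> 0]) (use V0 in auto)
  then have "\<beta> = 0" using assms[of 0] by simp
  moreover have "ext_v \<alpha> \<beta> 0 = 0" using V0 by simp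
  ultimately show ?thesis by (simp add: ext_v_def init)
qed

lemma ext_v_0: "ext_v \<alpha> \<beta> 0 = 2 * \<beta> - \<alpha>" and ext_z_0: "ext_z \<alpha> \<beta> 0 = 0"
  by (simp_all add: ext_v_def ext_z_def init)

text \<open>On the extremals the form is positive definite, so the first coefficient is negative.
  The vector (\<open>coef_pq\<close>, - \<open>coef_pp\<close>) makes the form a multiple of the
  determinant, which is therefore nonzero too.\<close>

lemma certified_no_root:
  assumes "\<nu> \<in> certified"
  shows "coef_pp \<noteq> 0" "coef_pp * coef_qq - coef_pq\<^sup>2 \<noteq> 0"
proof -
  from assms obtain w w' where c: "riccati_certificate \<nu> w w'" unfolding certified_def by blast
  have pos: "0 < ext_form \<alpha> \<beta>" if "\<alpha> \<noteq> 0 \<or> \<beta> \<noteq> 0" for \<alpha> \<beta>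
  proof (rule ccontr)
    assume "\<not> 0 < ext_form \<alpha> \<beta>"
    then have "\<And>t. t \<in> {0..1} \<Longrightarrow> ext_z \<alpha> \<beta> t = 0"
      using form_value_ge(2)[OF c nu(1) jacobi_path[of \<alpha> \<beta>], of 0] unfolding ext_form_def by simp
    then show False using trivial_extremal that by blast
  qed
  have A: "coef_pp < 0" using pos[of 1 0] by (simp add: ext_form_eq)
  then show "coef_pp \<noteq> 0" by simp
  have "0 < ext_form coef_pq (- coef_pp)" using pos A by simp
  also have "ext_form coef_pq (- coef_pp) = - coef_pp * (coef_pp * coef_qq - coef_pq\<^sup>2) / 2" by (simp add: ext_form_eq power2_eq_square algebra_simps)
  finally show "coef_pp * coef_qq - coef_pq\<^sup>2 \<noteq> 0" using A by auto
qed

end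

section \<open>The critical parameter\<close>

lemma DERIV_within_Icc_nonneg_imp_le:
  fixes f f' :: "real \<Rightarrow> real"
  assumes "a \<le> b" "\<And>t. t \<in> {a..b} \<Longrightarrow> (f has_real_derivative f' t) (at t within {a..b})"
    and "\<And>t. t \<in> {a..b} \<Longrightarrow> 0 \<le> f' t"
  shows "f a \<le> f b"
proof (cases "a = b")
  case False
  have d: "(f has_real_derivative f' t) (at t)" if "a < t" "t < b" for t
    using assms(2)[of t] that at_within_interior[of t "{a..b}"] by (simp add: interior_atLeastAtMost_real)
  have c: "continuous_on {a..b} f" using assms(2) DERIV_continuous_on by blast
  show ?thesis
  proof (rule DERIV_nonneg_imp_increasing_open[OF \<open>a \<le> b\<close> _ c])
    fix x assume "a < x" "x < b"
    with d assms(3) show "\<exists>y. DERIV f x :> y \<and> 0 \<le> y" by (meson atLeastAtMost_iff less_eq_real_def)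
  qed
qed simp

lemma eq_of_same_deriv:
  fixes f g :: "real \<Rightarrow> real"
  assumes "\<And>t. t \<in> {0..1} \<Longrightarrow> (f has_real_derivative h t) (at t within {0..1})"
    and "\<And>t. t \<in> {0..1} \<Longrightarrow> (g has_real_derivative h t) (at t within {0..1})"
    and "f 0 = g 0" "t \<in> {0..1}"
  shows "f t = g t"
proof -
  have "((\<lambda>t. f t - g t) has_real_derivative 0) (at t within {0..1})" if "t \<in> {0..1}" for t
    using DERIV_diff[OF assms(1,2)] that by fastforce
  then obtain c where "\<And>t. t \<in> {0..1} \<Longrightarrow> f t - g t = c"
    using has_field_derivative_zero_constant[of "{0..1}" "\<lambda>t. f t - g t"] by auto
  then have "f t - g t = f 0 - g 0" using assms(4) by auto
  then show ?thesis using assms(3) by simp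
qed

section \<open>Continuously differentiable functions on the unit interval\<close>

definition C1 :: "(real \<Rightarrow> real) \<Rightarrow> bool" where
  "C1 f \<longleftrightarrow> (\<exists>f'. (\<forall>t\<in>{0..1}. (f has_real_derivative f' t) (at t within {0..1})) \<and> continuous_on {0..1} f')"

lemma C1_I:
  "(\<And>t. t \<in> {0..1} \<Longrightarrow> (f has_real_derivative f' t) (at t within {0..1})) \<Longrightarrow> continuous_on {0..1} f' \<Longrightarrow> C1 f"
  unfolding C1_def by blast

lemma C1_cont: "C1 f \<Longrightarrow> continuous_on {0..1} f"
  unfolding C1_def using DERIV_continuous_on by blast

lemma C1_lipschitz: "C1 f \<Longrightarrow> \<exists>K. K-lipschitz_on {0..1} f"
  unfolding C1_def using lipschitz_of_C1 by blast

lemma C1_const: "C1 (\<lambda>t. c)" and C1_ident: "C1 (\<lambda>t. t)"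
  by (auto intro!: C1_I derivative_eq_intros)

lemma C1_add: assumes "C1 f" "C1 g" shows "C1 (\<lambda>t. f t + g t)"
proof -
  obtain f' g' where "\<And>t. t \<in> {0..1} \<Longrightarrow> (f has_real_derivative f' t) (at t within {0..1})"
    "\<And>t. t \<in> {0..1} \<Longrightarrow> (g has_real_derivative g' t) (at t within {0..1})"
    "continuous_on {0..1} f'" "continuous_on {0..1} g'" using assms unfolding C1_def by blast
  then show ?thesis by (intro C1_I[of _ "\<lambda>t. f' t + g' t"] DERIV_add continuous_intros)
qed

lemma C1_mult: assumes "C1 f" "C1 g" shows "C1 (\<lambda>t. f t * g t)"
proof -
  obtain f' g' where "\<And>t. t \<in> {0..1} \<Longrightarrow> (f has_real_derivative f' t) (at t within {0..1})"
    "\<And>t. t \<in> {0..1} \<Longrightarrow> (g has_real_derivative g' t) (at t within {0..1})"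
    "continuous_on {0..1} f'" "continuous_on {0..1} g'" using assms unfolding C1_def by blast
  then show ?thesis using C1_cont[OF assms(1)] C1_cont[OF assms(2)]
    by (intro C1_I[of _ "\<lambda>t. f' t * g t + g' t * f t"] DERIV_mult continuous_intros)
qed

lemma C1_inverse: assumes "C1 f" "\<And>t. t \<in> {0..1} \<Longrightarrow> f t \<noteq> 0" shows "C1 (\<lambda>t. inverse (f t))"
proof -
  obtain f' where "\<And>t. t \<in> {0..1} \<Longrightarrow> (f has_real_derivative f' t) (at t within {0..1})"
    "continuous_on {0..1} f'" using assms unfolding C1_def by blast
  then show ?thesis using C1_cont[OF assms(1)] assms(2)
    by (intro C1_I[of _ "\<lambda>t. - (inverse (f t) * f' t * inverse (f t))"] DERIV_inverse' continuous_intros) auto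
qed

lemma C1_power: "C1 f \<Longrightarrow> C1 (\<lambda>t. f t ^ n)"
  by (induction n) (auto intro: C1_const C1_mult)

lemma C1_leg: "C1 (leg \<nu>)"
  by (rule C1_I[of _ "\<lambda>t. 32 * t - 8"]) (auto simp: leg_def[abs_def] intro!: derivative_eq_intros continuous_intros)

lemma C1_cmult: "C1 f \<Longrightarrow> C1 (\<lambda>t. c * f t)"
  using C1_mult[OF C1_const] .

text \<open>Since P is at most 10, w' exceeds w^2 / 10, and a value above 10 / (1 - \<tau>) would
  blow up before time 1. The bound does not involve \<mu>, so it survives the passage to the
  critical parameter, where certificates are lost.\<close>

lemma riccati_certificate_upper:
  assumes c: "riccati_certificate \<mu> w w'" and mu: "-1 < \<mu>" "\<mu> < 0" and tau: "0 \<le> \<tau>" "\<tau> < 1"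
  shows "w \<tau> \<le> 10 / (1 - \<tau>)"
proof -
  have dw: "(w has_real_derivative w' t) (at t within {0..1})"
    and ric: "4 + (w t)\<^sup>2 / leg \<mu> t < w' t" if "t \<in> {0..1}" for t
    using c that unfolding riccati_certificate_def by auto
  \<comment> \<open>The derivative of this function is at least (w (1 - t) - 10)^2 / 10, whatever
    the sign of w.\<close>
  define H where "H = (\<lambda>t. w t * (1 - t)\<^sup>2 + 10 * t)"
  have dH: "(H has_real_derivative w' t * (1 - t)\<^sup>2 - 2 * w t * (1 - t) + 10) (at t within {0..1})" if "t \<in> {0..1}" for t
    unfolding H_def by (rule derivative_eq_intros dw[OF that] refl)+ (simp add: algebra_simps)
  have nn: "0 \<le> w' t * (1 - t)\<^sup>2 - 2 * w t * (1 - t) + 10" if t: "t \<in> {0..1}" for t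
  proof -
    have "(w t)\<^sup>2 / 10 \<le> (w t)\<^sup>2 / leg \<mu> t"
      using leg_le[OF mu(2) t] leg_pos[OF mu(1), of t] by (intro divide_left_mono) auto
    then have "(w t)\<^sup>2 / 10 \<le> w' t" using ric[OF t] by linarith
    then have "(w t)\<^sup>2 / 10 * (1 - t)\<^sup>2 \<le> w' t * (1 - t)\<^sup>2" by (rule mult_right_mono) simp
    moreover have "(w t)\<^sup>2 / 10 * (1 - t)\<^sup>2 = (w t * (1 - t))\<^sup>2 / 10" by (simp add: power_mult_distrib)
    moreover have "0 \<le> (w t * (1 - t) - 10)\<^sup>2 / 10" by simp
    moreover have "(w t * (1 - t) - 10)\<^sup>2 / 10 = (w t * (1 - t))\<^sup>2 / 10 - 2 * w t * (1 - t) + 10"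
      by (simp add: power2_diff)
    ultimately show ?thesis by linarith
  qed
  have "H \<tau> \<le> H 1" by (rule DERIV_within_nonneg_imp_le[OF dH nn]) (use tau in auto)
  then have "w \<tau> * (1 - \<tau>) * (1 - \<tau>) \<le> 10 * (1 - \<tau>)" by (simp add: H_def power2_eq_square algebra_simps)
  then have "w \<tau> * (1 - \<tau>) \<le> 10" by (rule mult_right_le_imp_le) (use tau in simp)
  then show ?thesis using tau by (simp add: field_simps)
qed

text \<open>The same \<open>w\<close> still works for a slightly smaller parameter: on the compact
  interval the Riccati inequality has a slack m, and lowering \<nu> by d raises w^2 / P by at most W
  d / k^2, which is at most m / 2.\<close>

lemma certified_open:
  assumes "\<nu> \<in> certified" shows "\<exists>\<mu>\<in>certified. \<mu> < \<nu>"
proof -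
  obtain w w' where c: "riccati_certificate \<nu> w w'" and nu: "-1 < \<nu>" "\<nu> < 0"
    using assms unfolding certified_def by blast
  have dw: "(w has_real_derivative w' t) (at t within {0..1})"
    and ric: "4 + (w t)\<^sup>2 / leg \<nu> t < w' t" if "t \<in> {0..1}" for t
    using c that unfolding riccati_certificate_def by auto
  have cw: "continuous_on {0..1} w" using dw DERIV_continuous_on by blast
  obtain K where "K-lipschitz_on {0..1} w'" using c unfolding riccati_certificate_def by auto
  then have cw': "continuous_on {0..1} w'" by (rule lipschitz_on_continuous_on)
  have ln: "leg \<nu> t \<noteq> 0" for t using leg_pos[OF nu(1), of t] by simp
  have "continuous_on {0..1} (\<lambda>t. w' t - 4 - (w t)\<^sup>2 / leg \<nu> t)"
    using cw cw' ln by (intro continuous_intros) auto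
  then obtain t0 where t0: "t0 \<in> {0..1}" "\<And>t. t \<in> {0..1} \<Longrightarrow> w' t0 - 4 - (w t0)\<^sup>2 / leg \<nu> t0 \<le> w' t - 4 - (w t)\<^sup>2 / leg \<nu> t"
    using continuous_attains_inf[of "{0..1::real}" "\<lambda>t. w' t - 4 - (w t)\<^sup>2 / leg \<nu> t"] by auto
  define m where "m = w' t0 - 4 - (w t0)\<^sup>2 / leg \<nu> t0"
  have m: "0 < m" using ric[OF t0(1)] by (simp add: m_def)
  have "continuous_on {0..1} (\<lambda>t. (w t)\<^sup>2)" using cw by (intro continuous_intros)
  then obtain t1 where t1: "t1 \<in> {0..1}" "\<And>t. t \<in> {0..1} \<Longrightarrow> (w t)\<^sup>2 \<le> (w t1)\<^sup>2"
    using continuous_attains_sup[of "{0..1::real}" "\<lambda>t. (w t)\<^sup>2"] by auto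
  define W where "W = (w t1)\<^sup>2 + 1"
  \<comment> \<open>A lower bound for the Legendre coefficients of \<nu> and of \<nu> - d at once,
    as long as d is at most k.\<close>
  define k where "k = (1 + \<nu>) / 2"
  have k: "0 < k" using nu by (simp add: k_def)
  have W: "0 < W" by (simp add: W_def add_nonneg_pos)
  define d where "d = min k (m * k * k / (2 * W))"
  have d: "0 < d" using k m W by (simp add: d_def)
  have dk: "d \<le> k" by (simp add: d_def)
  have "d \<le> m * k * k / (2 * W)" by (simp add: d_def)
  then have dW: "W * d \<le> m * k * k / 2" using W by (simp add: field_simps)
  have "riccati_certificate (\<nu> - d) w w'" unfolding riccati_certificate_def
  proof (intro conjI ballI)
    fix t :: real assume t: "t \<in> {0..1}"
    show "(w has_real_derivative w' t) (at t within {0..1})" using dw[OF t] .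
    have l2: "k \<le> leg (\<nu> - d) t" using leg_ge[of "\<nu> - d" t] dk by (simp add: k_def)
    have l1: "k \<le> leg \<nu> t" using leg_ge[of \<nu> t] nu by (simp add: k_def)
    have pos: "0 < leg (\<nu> - d) t" "0 < leg \<nu> t" using l1 l2 k by linarith+
    have "leg \<nu> t - leg (\<nu> - d) t = d" by (simp add: leg_def)
    then have "(w t)\<^sup>2 / leg (\<nu> - d) t - (w t)\<^sup>2 / leg \<nu> t = (w t)\<^sup>2 * d / (leg (\<nu> - d) t * leg \<nu> t)"
      using pos by (simp add: field_simps)
    also have "\<dots> \<le> (W * d) / (k * k)"
      using t1(2)[OF t] d k l1 l2 by (intro frac_le mult_mono) (auto simp: W_def)
    also have "\<dots> \<le> m / 2" using dW k by (simp add: field_simps)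
    also have "\<dots> < m" using m by simp
    finally have "(w t)\<^sup>2 / leg (\<nu> - d) t < (w t)\<^sup>2 / leg \<nu> t + m" by simp
    then show "4 + (w t)\<^sup>2 / leg (\<nu> - d) t < w' t" using t0(2)[OF t] by (simp add: m_def)
  qed (use c in \<open>auto simp: riccati_certificate_def\<close>)
  then have "\<nu> - d \<in> certified" using d dk nu unfolding certified_def k_def by auto
  then show ?thesis using d by (intro bexI[of _ "\<nu> - d"]) auto
qed

section \<open>The null vector at the critical parameter\<close>

locale critical_solution = cauchy_solution +
  assumes above: "\<And>\<mu>. \<nu> < \<mu> \<Longrightarrow> \<mu> < 0 \<Longrightarrow> \<mu> \<in> certified"
    and not_cert: "\<nu> \<notin> certified"
begin

lemma ext_u_C1: "C1 (ext_u \<alpha> \<beta>)"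
proof -
  have "continuous_on {0..1} (ext_z \<alpha> \<beta>)" using ext_z_deriv DERIV_continuous_on by blast
  then have "continuous_on {0..1} (\<lambda>t. - 4 * ext_z \<alpha> \<beta> t - 2 * \<beta>)" by (intro continuous_intros)
  with ext_v_deriv have "C1 (ext_v \<alpha> \<beta>)" by (rule C1_I)
  then have "C1 (\<lambda>t. ext_v \<alpha> \<beta> t * inverse (leg \<nu> t))"
    using leg_pos[OF nu(1)] by (intro C1_mult C1_inverse C1_leg) (auto simp: less_imp_neq[THEN not_sym])
  then show ?thesis by (simp add: ext_u_eq[abs_def] divide_inverse)
qed

lemma ext_u_bounded: "\<exists>K\<ge>0. \<forall>t\<in>{0..1}. (ext_u \<alpha> \<beta> t)\<^sup>2 \<le> K"
proof -
  have "continuous_on {0..1} (\<lambda>t. (ext_u \<alpha> \<beta> t)\<^sup>2)" using C1_cont[OF ext_u_C1] by (intro continuous_intros)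
  then have "\<exists>x\<in>{0..1}. \<forall>t\<in>{0..1}. (ext_u \<alpha> \<beta> t)\<^sup>2 \<le> (ext_u \<alpha> \<beta> x)\<^sup>2"
    by (intro continuous_attains_sup) auto
  then show ?thesis by (meson zero_le_power2)
qed

lemma limit_above:
  assumes "\<And>\<mu>. \<nu> < \<mu> \<Longrightarrow> \<mu> < 0 \<Longrightarrow> 0 \<le> x + (\<mu> - \<nu>) * K" and "0 \<le> K"
  shows "0 \<le> x"
proof (rule ccontr)
  assume "\<not> 0 \<le> x"
  then have x: "x < 0" by simp
  define d where "d = min (- \<nu> / 2) (- x / (2 * (K + 1)))"
  have "0 < - x / (2 * (K + 1))" using x assms(2) by (intro divide_pos_pos) auto
  then have d: "0 < d" "\<nu> + d < 0" using nu unfolding d_def by linarith+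
  have "d \<le> - x / (2 * (K + 1))" by (simp add: d_def)
  moreover have "0 < 2 * (K + 1)" using assms(2) by simp
  ultimately have "d * (2 * (K + 1)) \<le> - x" using pos_le_divide_eq by blast
  then have "2 * (d * K) + 2 * d \<le> - x" by (simp add: algebra_simps)
  then have "d * K < - x" using x d mult_nonneg_nonneg[of d K] assms(2) by linarith
  then show False using assms(1)[of "\<nu> + d"] d by simp
qed

lemma ext_form_nonneg: "0 \<le> ext_form \<alpha> \<beta>"
proof -
  obtain K where K: "0 \<le> K" "\<forall>t\<in>{0..1}. (ext_u \<alpha> \<beta> t)\<^sup>2 \<le> K" using ext_u_bounded by blast
  show ?thesis
  proof (rule limit_above[OF _ K(1)])
    fix \<mu> assume mu: "\<nu> < \<mu>" "\<mu> < 0"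
    then obtain w w' where c: "riccati_certificate \<mu> w w'" using above unfolding certified_def by blast
    show "0 \<le> ext_form \<alpha> \<beta> + (\<mu> - \<nu>) * K" unfolding ext_form_def
      by (rule form_value_ge(1)[OF c _ jacobi_path]) (use mu nu K in \<open>auto intro: mult_left_mono\<close>)
  qed
qed

text \<open>The Jacobi field of the problem without the nonlocal term: S(0) = 0 and momentum 1 at
  the start. Its zeros are the conjugate points.\<close>

abbreviation "S \<equiv> ext_z (-1) 0"
abbreviation "VS \<equiv> ext_v (-1) 0"

lemma S_deriv: "t \<in> {0..1} \<Longrightarrow> (S has_real_derivative VS t / leg \<nu> t) (at t within {0..1})"
  using ext_z_deriv[of t "-1" 0] by (simp add: ext_u_eq)

lemma VS_deriv: "t \<in> {0..1} \<Longrightarrow> (VS has_real_derivative - 4 * S t) (at t within {0..1})"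
  using ext_v_deriv[of t "-1" 0] by simp

text \<open>For a certificate at \<mu> > \<nu> the function VS S + w S^2 starts at 0 and is
  nondecreasing up to the loss (\<mu> - \<nu>) K. The bound of w that is free of \<mu> then allows
  \<mu> to tend to \<nu>.\<close>

lemma VS_S_ge:
  assumes tau: "0 \<le> \<tau>" "\<tau> < 1"
  shows "- (10 / (1 - \<tau>)) * (S \<tau>)\<^sup>2 \<le> VS \<tau> * S \<tau>"
proof -
  obtain K where K: "0 \<le> K" "\<forall>t\<in>{0..1}. (ext_u (-1) 0 t)\<^sup>2 \<le> K" using ext_u_bounded by blast
  have "0 \<le> (VS \<tau> * S \<tau> + 10 / (1 - \<tau>) * (S \<tau>)\<^sup>2)"
  proof (rule limit_above[OF _ K(1)])
    fix \<mu> assume mu: "\<nu> < \<mu>" "\<mu> < 0"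
    then obtain w w' where c: "riccati_certificate \<mu> w w'" using above unfolding certified_def by blast
    have dw: "(w has_real_derivative w' t) (at t within {0..1})"
      and ric: "4 + (w t)\<^sup>2 / leg \<mu> t < w' t" if "t \<in> {0..1}" for t
      using c that unfolding riccati_certificate_def by auto
    define H where "H = (\<lambda>t. VS t * S t + (\<mu> - \<nu>) * K * t + w t * (S t)\<^sup>2)"
    define U where "U = ext_u (-1) 0"
    define H' where "H' = (\<lambda>t. leg \<nu> t * (U t)\<^sup>2 + (\<mu> - \<nu>) * K - 4 * (S t)\<^sup>2 + w' t * (S t)\<^sup>2 + 2 * w t * S t * U t)"
    have dS: "(S has_real_derivative U t) (at t within {0..1})" if "t \<in> {0..1}" for t
      using ext_z_deriv[OF that] unfolding U_def .
    have VU: "VS t = leg \<nu> t * U t" for t unfolding U_def by (rule ext_v_eq)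
    have dH: "(H has_real_derivative H' t) (at t within {0..1})" if "t \<in> {0..1}" for t
      unfolding H_def H'_def
      by (rule derivative_eq_intros dw[OF that] dS[OF that] VS_deriv[OF that] refl)+
         (simp add: VU power2_eq_square algebra_simps)
    have nn: "0 \<le> H' t" if t: "t \<in> {0..1}" for t
    proof -
      have "0 \<le> leg \<mu> t * (U t)\<^sup>2 - 4 * (S t)\<^sup>2 + w' t * (S t)\<^sup>2 + 2 * w t * S t * U t"
        using riccati_square[of \<mu> w t w' "U t" "S t"] ric[OF t] mu nu by simp
      moreover have "leg \<mu> t * (U t)\<^sup>2 \<le> leg \<nu> t * (U t)\<^sup>2 + (\<mu> - \<nu>) * K"
        using mult_left_mono[of "(U t)\<^sup>2" K "\<mu> - \<nu>"] K(2) t mu unfolding U_def by (simp add: leg_def algebra_simps)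
      ultimately show ?thesis by (simp add: H'_def)
    qed
    have "H 0 \<le> H \<tau>" by (rule DERIV_within_nonneg_imp_le[OF dH nn]) (use tau in auto)
    then have "0 \<le> H \<tau>" by (simp add: H_def ext_z_0)
    moreover have "w \<tau> * (S \<tau>)\<^sup>2 \<le> 10 / (1 - \<tau>) * (S \<tau>)\<^sup>2"
      using riccati_certificate_upper[OF c _ mu(2) tau] mu nu by (intro mult_right_mono) auto
    moreover have "(\<mu> - \<nu>) * K * \<tau> \<le> (\<mu> - \<nu>) * K" using mu K tau by (simp add: mult_left_le)
    ultimately show "0 \<le> VS \<tau> * S \<tau> + 10 / (1 - \<tau>) * (S \<tau>)\<^sup>2 + (\<mu> - \<nu>) * K"
      unfolding H_def by linarith
  qed
  then show ?thesis by simp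
qed

text \<open>There is no conjugate point before 1. By \<open>VS_S_ge\<close> the logarithmic
  derivative of S^2 is bounded below on intervals that end before 1, so S cannot return to 0 after
  it has left it.\<close>

lemma S_nonzero:
  assumes "0 < \<tau>" "\<tau> < 1" shows "0 < S \<tau>"
proof -
  have "0 < VS 0 / leg \<nu> 0" using ext_v_0[of "-1" 0] leg_pos[OF nu(1), of 0] by simp
  then obtain d where d: "0 < d" "\<And>h. 0 < h \<Longrightarrow> 0 + h \<in> {0..1} \<Longrightarrow> h < d \<Longrightarrow> S 0 < S (0 + h)"
    using has_real_derivative_pos_inc_right[OF S_deriv[of 0]] by auto
  define k where "k = 1 + \<nu>"
  have k: "0 < k" using nu by (simp add: k_def)
  define C where "C = 20 / (1 - \<tau>) / k"
  have C: "0 \<le> C" using assms k by (simp add: C_def)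
  have key: "0 < (S t)\<^sup>2" if t: "0 < t" "t \<le> \<tau>" for t
  proof -
    define s where "s = min t (d / 2)"
    have s: "0 < s" "s \<le> t" "s < d" using t d(1) by (auto simp: s_def min_def)
    have "S 0 < S s" using d(2)[of s] s t assms by simp
    then have Ss: "0 < (S s)\<^sup>2" by (simp add: ext_z_0)
    have "(S s)\<^sup>2 * exp (C * s) \<le> (S t)\<^sup>2 * exp (C * t)"
    proof (rule DERIV_within_Icc_nonneg_imp_le[OF s(2)])
      fix x assume x: "x \<in> {s..t}"
      then have x1: "x \<in> {0..1}" "0 \<le> x" "x < 1" using s t assms by auto
      have dS: "(S has_real_derivative VS x / leg \<nu> x) (at x within {s..t})"
        by (rule DERIV_subset[OF S_deriv[OF x1(1)]]) (use s t assms in auto)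
      show "((\<lambda>t. (S t)\<^sup>2 * exp (C * t)) has_real_derivative
          (2 * S x * VS x / leg \<nu> x + C * (S x)\<^sup>2) * exp (C * x)) (at x within {s..t})"
        by (rule derivative_eq_intros dS refl)+ (simp add: algebra_simps)
      have l: "k \<le> leg \<nu> x" using leg_ge[of \<nu> x] by (simp add: k_def)
      have "- (2 * S x * VS x) \<le> 20 / (1 - x) * (S x)\<^sup>2" 
      proof -
        have "20 / (1 - x) * (S x)\<^sup>2 = 2 * (10 / (1 - x) * (S x)\<^sup>2)" by simp
        moreover have "- (10 / (1 - x)) * (S x)\<^sup>2 = - (10 / (1 - x) * (S x)\<^sup>2)" by simp
        moreover have "2 * S x * VS x = 2 * (VS x * S x)" by simp
        ultimately show ?thesis using VS_S_ge[OF x1(2,3)] by linarith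
      qed
      also have "\<dots> \<le> 20 / (1 - \<tau>) * (S x)\<^sup>2"
        using x t assms by (intro mult_right_mono divide_left_mono) auto
      finally have "- (2 * S x * VS x) / leg \<nu> x \<le> (20 / (1 - \<tau>) * (S x)\<^sup>2) / leg \<nu> x"
        using l k by (intro divide_right_mono) auto
      also have "\<dots> \<le> (20 / (1 - \<tau>) * (S x)\<^sup>2) / k"
        using l k assms by (intro divide_left_mono) auto
      finally show "0 \<le> (2 * S x * VS x / leg \<nu> x + C * (S x)\<^sup>2) * exp (C * x)"
        by (simp add: C_def)
    qed
    moreover have "0 < (S s)\<^sup>2 * exp (C * s)" using Ss by simp
    ultimately have "0 < (S t)\<^sup>2 * exp (C * t)" by linarith
    then show ?thesis by (simp add: zero_less_mult_iff)
  qed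
  show ?thesis
  proof (rule ccontr)
    assume n: "\<not> 0 < S \<tau>"
    define s where "s = min \<tau> (d / 2)"
    have s: "0 < s" "s \<le> \<tau>" "s < d" using assms d(1) by (auto simp: s_def min_def)
    have "S 0 < S s" using d(2)[of s] s assms by simp
    then have Ss: "0 \<le> S s" by (simp add: ext_z_0)
    have "continuous_on {s..\<tau>} S"
      by (rule continuous_on_subset[OF DERIV_continuous_on[OF S_deriv]]) (use s assms in auto)
    then obtain x where "s \<le> x" "x \<le> \<tau>" "S x = 0" using IVT2'[of S \<tau> 0 s] n Ss s by auto
    then show False using key[of x] s by simp
  qed
qed

text \<open>If the end point is conjugate, S itself is a null vector. Otherwise the Jacobi field Y
  with end values 2 and 3 is positive, -V / Y solves the Riccati equation exactly, and the value of
  the form on it is the slack in the boundary condition. A positive value would produce a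
  certificate at \<nu>.\<close>

lemma critical_null:
  "\<exists>\<alpha> \<beta>. (\<alpha> \<noteq> 0 \<or> \<beta> \<noteq> 0) \<and> ext_form \<alpha> \<beta> = 0"
proof (cases "S 1 \<le> 0")
  case True
  have cS: "continuous_on {0..1} S" by (rule DERIV_continuous_on[OF S_deriv])
  have "S 1 = 0"
  proof (rule ccontr)
    assume "S 1 \<noteq> 0"
    then have "S 1 < 0" using True by simp
    moreover have "0 < S (1/2)" using S_nonzero[of "1/2"] by simp
    moreover have "continuous_on {1/2..1} S" by (rule continuous_on_subset[OF cS]) auto
    ultimately obtain x where "1/2 \<le> x" "x \<le> 1" "S x = 0" using IVT2'[of S 1 0 "1/2"] by auto
    then show False using S_nonzero[of x] \<open>S 1 < 0\<close> by (cases "x = 1") auto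
  qed
  moreover have "ext_F (-1) 0 1 = VS 1 * S 1"
  proof (rule eq_of_same_deriv[OF ext_F_deriv, where g="\<lambda>t. VS t * S t" and t=1])
    fix t :: real assume t: "t \<in> {0..1}"
    show "((\<lambda>t. VS t * S t) has_real_derivative leg \<nu> t * (ext_u (- 1) 0 t)\<^sup>2 - 4 * (S t)\<^sup>2) (at t within {0..1})"
      by (rule derivative_eq_intros ext_z_deriv[OF t] VS_deriv[OF t] refl)+ (simp add: ext_v_eq power2_eq_square algebra_simps)
  qed (use jacobi_path[of "-1" 0] in \<open>auto simp: jacobi_path_def\<close>)
  ultimately have "ext_form (-1) 0 = 0" by (simp add: ext_form_def form_value_def)
  then show ?thesis by (intro exI[of _ "-1"] exI[of _ 0]) simp
next
  case False
  then have S1: "0 < S 1" by simp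
  \<comment> \<open>Normalization z(1) = 1, so \<beta> = 4 meets the requirement \<beta> = 4 z(1) of
    the nonlocal term. Solving for \<alpha> uses that S(1) is not 0.\<close>
  define \<alpha> where "\<alpha> = (4 * ext_z 0 1 1 - 1) / S 1"
  define z where "z = ext_z \<alpha> 4"
  define V where "V = ext_v \<alpha> 4"
  have "z 1 = - \<alpha> * S 1 + 4 * ext_z 0 1 1" by (simp add: z_def ext_z_def algebra_simps)
  then have z1: "z 1 = 1" using S1 by (simp add: \<alpha>_def)
  define Y where "Y = (\<lambda>t. z t + 2)"
  have dY: "(Y has_real_derivative V t / leg \<nu> t) (at t within {0..1})" if "t \<in> {0..1}" for t
    unfolding Y_def z_def V_def by (rule derivative_eq_intros ext_z_deriv[OF that] refl)+ (simp add: ext_u_eq)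
  have dV: "(V has_real_derivative - 4 * Y t) (at t within {0..1})" if "t \<in> {0..1}" for t
    unfolding Y_def z_def V_def by (rule DERIV_cong[OF ext_v_deriv[OF that]]) simp
  have Y0: "Y 0 = 2" and Y1: "Y 1 = 3" by (simp_all add: Y_def z1) (simp add: z_def ext_z_0)
  have ln: "0 < leg \<nu> t" for t using leg_pos[OF nu(1)] .
  have Spos: "0 < S t" if "0 < t" "t \<le> 1" for t using S_nonzero[of t] S1 that by (cases "t = 1") auto
  \<comment> \<open>The Wronskian is constant because Y and S solve the same equation (P x')' = -4
    x. Its sign makes Y / S decreasing, so Y inherits positivity from the end point.\<close>
  have wr: "V t * S t - Y t * VS t = - 2" if "t \<in> {0..1}" for t
  proof (rule eq_of_same_deriv[where f="\<lambda>t. V t * S t - Y t * VS t" and h="\<lambda>_. 0" and g="\<lambda>_. -2", OF _ _ _ that])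
    fix t :: real assume t: "t \<in> {0..1}"
    show "((\<lambda>t. V t * S t - Y t * VS t) has_real_derivative 0) (at t within {0..1})"
      by (rule derivative_eq_intros dY[OF t] dV[OF t] S_deriv[OF t] VS_deriv[OF t] refl)+ (simp add: algebra_simps)
  qed (auto simp: ext_z_0 Y0 ext_v_0)
  have Ypos: "0 < Y t" if t: "t \<in> {0..1}" for t
  proof (cases "t = 0")
    case False
    then have t': "0 < t" "t \<le> 1" using t by auto
    have "- (Y t / S t) \<le> - (Y 1 / S 1)"
    proof (rule DERIV_within_Icc_nonneg_imp_le[OF t'(2)])
      fix x assume x: "x \<in> {t..1}"
      then have x1: "x \<in> {0..1}" using t' by auto
      have Sx: "S x \<noteq> 0" using Spos[of x] x t' by auto
      have dS: "(S has_real_derivative VS x / leg \<nu> x) (at x within {t..1})"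
        by (rule DERIV_subset[OF S_deriv[OF x1]]) (use t' in auto)
      have dY': "(Y has_real_derivative V x / leg \<nu> x) (at x within {t..1})"
        by (rule DERIV_subset[OF dY[OF x1]]) (use t' in auto)
      have "((\<lambda>x. - (Y x / S x)) has_real_derivative - ((V x / leg \<nu> x * S x - Y x * (VS x / leg \<nu> x)) / (S x * S x))) (at x within {t..1})"
        by (intro DERIV_minus DERIV_divide dS dY' Sx)
      also have "- ((V x / leg \<nu> x * S x - Y x * (VS x / leg \<nu> x)) / (S x * S x))
          = - (V x * S x - Y x * VS x) / (leg \<nu> x * (S x * S x))"
        by (simp add: diff_divide_distrib)
      also have "\<dots> = 2 / (leg \<nu> x * (S x * S x))" using wr[OF x1] by simp
      finally show "((\<lambda>x. - (Y x / S x)) has_real_derivative 2 / (leg \<nu> x * (S x * S x))) (at x within {t..1})" .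
      show "0 \<le> 2 / (leg \<nu> x * (S x * S x))" using ln[of x] by simp
    qed
    then have "Y 1 / S 1 \<le> Y t / S t" by simp
    moreover have "0 < Y 1 / S 1" using Y1 S1 by simp
    ultimately have "0 < Y t / S t" by linarith
    then show ?thesis using Spos[OF t'] by (simp add: zero_less_divide_iff)
  qed (simp add: Y0)
  have F1: "ext_F \<alpha> 4 1 = V 1 * z 1 + 8 * ext_I \<alpha> 4 1"
  proof (rule eq_of_same_deriv[OF ext_F_deriv, where g="\<lambda>t. V t * z t + 8 * ext_I \<alpha> 4 t" and t=1])
    fix t :: real assume t: "t \<in> {0..1}"
    show "((\<lambda>t. V t * z t + 8 * ext_I \<alpha> 4 t) has_real_derivative leg \<nu> t * (ext_u \<alpha> 4 t)\<^sup>2 - 4 * (ext_z \<alpha> 4 t)\<^sup>2) (at t within {0..1})"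
      unfolding V_def z_def
      by (rule derivative_eq_intros ext_z_deriv[OF t] ext_v_deriv[OF t] ext_I_deriv[OF t] refl)+ (simp add: ext_v_eq power2_eq_square algebra_simps)
  qed (use jacobi_path[of \<alpha> 4] ext_z_0 in \<open>auto simp: jacobi_path_def z_def\<close>)
  have V1: "V 1 = V 0 - 4 * ext_I \<alpha> 4 1 - 8 * 1"
  proof (rule eq_of_same_deriv[OF dV, where g="\<lambda>t. V 0 - 4 * ext_I \<alpha> 4 t - 8 * t" and t=1])
    fix t :: real assume t: "t \<in> {0..1}"
    show "((\<lambda>t. V 0 - 4 * ext_I \<alpha> 4 t - 8 * t) has_real_derivative - 4 * Y t) (at t within {0..1})"
      unfolding Y_def z_def
      by (rule derivative_eq_intros ext_I_deriv[OF t] refl)+ (simp add: algebra_simps)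
  qed (use jacobi_path[of \<alpha> 4] in \<open>auto simp: jacobi_path_def\<close>)
  have ext_form: "ext_form \<alpha> 4 = 3 * V 1 - 2 * V 0 + 40"
    using F1 V1 z1 by (simp add: ext_form_def form_value_def flip: z_def)
  have "ext_form \<alpha> 4 = 0"
  proof (rule ccontr)
    assume "ext_form \<alpha> 4 \<noteq> 0"
    then have G: "0 < ext_form \<alpha> 4" using ext_form_nonneg[of \<alpha> 4] by simp
    have CY: "C1 Y" using C1_add[OF C1_I[OF ext_z_deriv] C1_const] C1_cont[OF ext_u_C1] unfolding Y_def z_def by blast
    obtain m where m: "0 < m" "\<And>t. t \<in> {0..1} \<Longrightarrow> m \<le> Y t"
      using continuous_attains_inf[OF _ _ C1_cont[OF CY]] Ypos by (metis atLeastAtMost_iff compact_Icc empty_iff le_numeral_extra(3) zero_le_one)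
    define \<epsilon> where "\<epsilon> = min (ext_form \<alpha> 4 / 2) (m\<^sup>2 * (1 + \<nu>) / 2)"
    have eps: "0 < \<epsilon>" "\<epsilon> < ext_form \<alpha> 4" "\<epsilon> < m\<^sup>2 * (1 + \<nu>)" using G m nu by (auto simp: \<epsilon>_def min_def)
    \<comment> \<open>The exact solution -V / Y plus \<epsilon> t / Y^2. The addition gains
      \<epsilon> / Y^2 in the Riccati inequality up to a term quadratic in \<epsilon>, leaves w(0)
      unchanged and raises 9 w(1) by exactly \<epsilon>; hence the two bounds in the choice of
      \<epsilon>.\<close>
    define w where "w = (\<lambda>t. (\<epsilon> * t * inverse (Y t) - V t) * inverse (Y t))"
    define u where "u = ext_u \<alpha> 4"
    have Vu: "V t = leg \<nu> t * u t" for t unfolding V_def u_def by (rule ext_v_eq)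
    have dY2: "(Y has_real_derivative u t) (at t within {0..1})" if "t \<in> {0..1}" for t
      using dY[OF that] ln[of t] by (simp add: Vu)
    define w' where "w' = (\<lambda>t. 4 + leg \<nu> t * (u t * inverse (Y t))\<^sup>2 + \<epsilon> * (inverse (Y t))\<^sup>2
        + (-2 * \<epsilon>) * (t * (u t * (inverse (Y t)) ^ 3)))"
    have "riccati_certificate \<nu> w w'" unfolding riccati_certificate_def
    proof (intro conjI ballI)
      fix t :: real assume t: "t \<in> {0..1}"
      have Yt: "Y t \<noteq> 0" using Ypos[OF t] by simp
      show "(w has_real_derivative w' t) (at t within {0..1})"
        unfolding w_def w'_def
        apply (rule derivative_eq_intros dY2[OF t] dV[OF t] refl Yt)+
        using Yt by (simp add: Vu field_simps power2_eq_square power3_eq_cube)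
      define r where "r = inverse (Y t)"
      have r: "0 < r" "r * Y t = 1" using Ypos[OF t] by (auto simp: r_def)
      have "w' t - 4 - (w t)\<^sup>2 / leg \<nu> t = \<epsilon> * r\<^sup>2 - (\<epsilon> * t)\<^sup>2 * (r\<^sup>2)\<^sup>2 / leg \<nu> t"
        unfolding w'_def w_def r_def[symmetric] Vu using ln[of t]
        by (simp add: field_simps power2_eq_square power3_eq_cube)
      also have "\<dots> = \<epsilon> * r\<^sup>2 * (1 - \<epsilon> * t\<^sup>2 * r\<^sup>2 / leg \<nu> t)"
        by (simp add: algebra_simps power2_eq_square)
      also have "\<dots> > 0"
      proof -
        have "\<epsilon> * t\<^sup>2 \<le> \<epsilon> * 1" using eps t by (intro mult_left_mono) (auto simp: power_le_one)
        also have "\<epsilon> * 1 < m\<^sup>2 * (1 + \<nu>)" using eps by simp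
        also have "\<dots> \<le> (Y t)\<^sup>2 * leg \<nu> t" using m t leg_ge[of \<nu> t] nu by (intro mult_mono power_mono) auto
        finally have "\<epsilon> * t\<^sup>2 * r\<^sup>2 < (Y t)\<^sup>2 * leg \<nu> t * r\<^sup>2" using r by (intro mult_strict_right_mono) auto
        also have "\<dots> = leg \<nu> t" using r(2) by (simp add: power2_eq_square mult.assoc mult.left_commute) (metis mult.commute mult.left_commute mult_1)
        finally have "\<epsilon> * t\<^sup>2 * r\<^sup>2 / leg \<nu> t < 1" using ln[of t] by simp
        then show ?thesis using eps r by simp
      qed
      finally show "4 + (w t)\<^sup>2 / leg \<nu> t < w' t" by simp
    next
      have "C1 w'" unfolding w'_def u_def
        by (intro C1_add C1_const C1_mult C1_power C1_leg C1_cmult C1_ident C1_inverse ext_u_C1 CY less_imp_neq[OF Ypos, symmetric])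
      then show "\<exists>K. K-lipschitz_on {0..1} w'" by (rule C1_lipschitz)
    next
      show "9 * w 1 < 40 + 4 * w 0" using eps(2) unfolding w_def Y0 Y1 ext_form by (simp add: field_simps)
    qed
    then show False using not_cert nu unfolding certified_def by blast
  qed
  then show ?thesis by (intro exI[of _ \<alpha>] exI[of _ 4]) simp
qed

text \<open>A null vector of a semidefinite form lies in the kernel of its matrix, which is
  therefore singular. The kernel property is obtained by moving the null vector along each
  coordinate.\<close>

lemma det_zero: "coef_pp * coef_qq - coef_pq\<^sup>2 = 0"
proof -
  obtain \<alpha> \<beta> where n: "\<alpha> \<noteq> 0 \<or> \<beta> \<noteq> 0" and q0: "ext_form \<alpha> \<beta> = 0" using critical_null by blast
  have lin: "L = 0" if "\<And>s. 0 \<le> s * L + s\<^sup>2 * M" for L M :: real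
  proof (rule ccontr)
    assume L: "L \<noteq> 0"
    define k where "k = 1 + \<bar>M\<bar>"
    have k: "0 < k" "M < k" by (auto simp: k_def)
    have "0 \<le> (- L / k) * L + (- L / k)\<^sup>2 * M" by (rule that)
    also have "\<dots> = (L / k)\<^sup>2 * (M - k)" using k by (simp add: field_simps power2_eq_square)
    also have "\<dots> < 0" using k L by (intro mult_pos_neg) auto
    finally show False by simp
  qed
  have "- (\<alpha> * coef_pp + \<beta> * coef_pq) = 0"
  proof (rule lin[of _ "- coef_pp / 2"])
    fix s show "0 \<le> s * (- (\<alpha> * coef_pp + \<beta> * coef_pq)) + s\<^sup>2 * (- coef_pp / 2)"
      using ext_form_nonneg[of "\<alpha> + s" \<beta>] q0 unfolding ext_form_eq by (simp add: power2_eq_square algebra_simps)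
  qed
  moreover have "- (\<alpha> * coef_pq + \<beta> * coef_qq) = 0"
  proof (rule lin[of _ "- coef_qq / 2"])
    fix s show "0 \<le> s * (- (\<alpha> * coef_pq + \<beta> * coef_qq)) + s\<^sup>2 * (- coef_qq / 2)"
      using ext_form_nonneg[of \<alpha> "\<beta> + s"] q0 unfolding ext_form_eq by (simp add: power2_eq_square algebra_simps)
  qed
  ultimately have e: "\<alpha> * coef_pp = - \<beta> * coef_pq" "\<alpha> * coef_pq = - \<beta> * coef_qq" by linarith+
  have "\<alpha> * (coef_pp * coef_qq - coef_pq\<^sup>2) = (\<alpha> * coef_pp) * coef_qq - coef_pq * (\<alpha> * coef_pq)" by (simp add: power2_eq_square algebra_simps)
  also have "\<dots> = 0" unfolding e by simp
  finally have 1: "\<alpha> * (coef_pp * coef_qq - coef_pq\<^sup>2) = 0" .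
  have "\<beta> * (coef_pp * coef_qq - coef_pq\<^sup>2) = coef_pp * (\<beta> * coef_qq) - coef_pq * (\<beta> * coef_pq)" by (simp add: power2_eq_square algebra_simps)
  also have "\<dots> = - coef_pp * (\<alpha> * coef_pq) + coef_pq * (\<alpha> * coef_pp)" using e by simp
  finally have 2: "\<beta> * (coef_pp * coef_qq - coef_pq\<^sup>2) = 0" by simp
  show ?thesis using 1 2 n by auto
qed

end


text \<open>The extra function \<open>N\<close> is the primitive of \<open>u\<^sup>2\<close>: along the perturbation of the Koebe function
  generated by \<open>u\<close> it measures \<open>2 - Re a\<^sub>2\<close>.\<close>

lemma threshold:
  fixes y :: "real \<Rightarrow> nat \<Rightarrow> real \<Rightarrow> real" and R :: "real set"
  assumes sol: "\<And>\<nu>. -1 < \<nu> \<Longrightarrow> \<nu> < 0 \<Longrightarrow> solves_cauchy_problem \<nu> (y \<nu>)"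
  defines "R \<equiv> {\<nu>. -1 < \<nu> \<and> \<nu> < 0 \<and>
      (\<nu> * y \<nu> 1 1 + y \<nu> 3 1 = 0 \<or>
       (\<nu> * y \<nu> 1 1 + y \<nu> 3 1) * (\<nu> * y \<nu> 7 1 + y \<nu> 9 1)
         - (\<nu> * y \<nu> 13 1 + y \<nu> 15 1)\<^sup>2 = 0)}"
  obtains \<nu> z u I F N where "\<nu> \<in> R" "\<And>\<mu>. \<mu> \<in> R \<Longrightarrow> \<mu> \<le> \<nu>" "\<And>\<mu>. \<nu> < \<mu> \<Longrightarrow> \<mu> < 0 \<Longrightarrow> \<mu> \<in> certified"
    "jacobi_path \<nu> z u I F" "form_value z I F = 0" "C1 u"
    "\<And>t. t \<in> {0..1} \<Longrightarrow> (N has_real_derivative (u t)\<^sup>2) (at t within {0..1})" "N 0 = 0" "0 < N 1"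
proof -
  define \<nu> where "\<nu> = Inf certified"
  have low: "-999/1000 \<le> \<mu>" if "\<mu> \<in> certified" for \<mu>
    using certified_mono[OF that, of "-999/1000"] not_certified by fastforce
  have bdd: "bdd_below certified" using low by (rule bdd_belowI)
  have ne: "certified \<noteq> {}" using certified_nonempty by blast
  have l: "-999/1000 \<le> \<nu>" unfolding \<nu>_def using low ne by (intro cInf_greatest)
  have "\<nu> \<le> -1/100" unfolding \<nu>_def by (rule cInf_lower[OF certified_nonempty bdd])
  with l have nu: "-1 < \<nu>" "\<nu> < 0" by linarith+
  have above: "\<mu> \<in> certified" if mu: "\<nu> < \<mu>" "\<mu> < 0" for \<mu>
  proof -
    obtain \<kappa> where "\<kappa> \<in> certified" "\<kappa> < \<mu>" using mu(1) cInf_lessD[OF ne] unfolding \<nu>_def by blast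
    then show ?thesis using certified_mono mu(2) less_imp_le by blast
  qed
  \<comment> \<open>By openness the infimum is not attained.\<close>
  have nc: "\<nu> \<notin> certified"
    using certified_open[of \<nu>] cInf_lower[OF _ bdd] unfolding \<nu>_def by fastforce
  interpret critical_solution \<nu> "y \<nu>"
    by unfold_locales (use nu sol above nc in auto)
  have "\<nu> \<in> R" using det_zero nu unfolding R_def coef_pp_def coef_pq_def coef_qq_def by blast
  moreover have "\<mu> \<le> \<nu>" if "\<mu> \<in> R" for \<mu>
  proof (rule ccontr)
    assume "\<not> \<mu> \<le> \<nu>"
    then have mu: "\<nu> < \<mu>" "-1 < \<mu>" "\<mu> < 0" using that unfolding R_def by auto
    interpret m: cauchy_solution \<mu> "y \<mu>" using mu assms(1)[OF mu(2,3)] by unfold_locales auto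
    show False using m.certified_no_root[OF above[OF mu(1,3)]] that
      unfolding R_def m.coef_pp_def m.coef_pq_def m.coef_qq_def by blast
  qed
  moreover obtain \<alpha> \<beta> where n: "\<alpha> \<noteq> 0 \<or> \<beta> \<noteq> 0" and q0: "ext_form \<alpha> \<beta> = 0" using critical_null by blast
  moreover define u where "u = ext_u \<alpha> \<beta>"
  define N where "N = (\<lambda>t. integral {0..t} (\<lambda>s. (u s)\<^sup>2))"
  have "continuous_on {0..1} (\<lambda>s. (u s)\<^sup>2)" using C1_cont[OF ext_u_C1] unfolding u_def by (intro continuous_intros)
  then have dN: "(N has_real_derivative (u t)\<^sup>2) (at t within {0..1})" if "t \<in> {0..1}" for t
    unfolding N_def using integral_has_real_derivative that by blast
  have N0: "N 0 = 0" by (simp add: N_def)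
  have mono: "N s \<le> N t" if "0 \<le> s" "s \<le> t" "t \<le> 1" for s t
    by (rule DERIV_within_nonneg_imp_le[OF dN _ that]) auto
  have "0 < N 1"
  proof (rule ccontr)
    assume "\<not> 0 < N 1"
    then have c: "N s = 0" if "s \<in> {0..1}" for s using mono[of 0 s] mono[of s 1] N0 that by auto
    have "u t = 0" if "t \<in> {0..1}" for t using DERIV_unit_constant[OF dN[OF that] that c] by simp
    note u0 = this
    have "ext_z \<alpha> \<beta> t = 0" if t: "t \<in> {0..1}" for t
    proof (rule eq_of_same_deriv[where g="\<lambda>_. 0" and h="\<lambda>_. 0", OF _ _ _ t])
      fix s :: real assume "s \<in> {0..1}"
      then show "(ext_z \<alpha> \<beta> has_real_derivative 0) (at s within {0..1})"
        using ext_z_deriv[of s \<alpha> \<beta>] u0 unfolding u_def by simp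
    qed (auto simp: ext_z_0)
    then show False using trivial_extremal n by blast
  qed
  ultimately show ?thesis
    using that[of \<nu> "ext_z \<alpha> \<beta>" u "ext_I \<alpha> \<beta>" "ext_F \<alpha> \<beta>" N] above jacobi_path[of \<alpha> \<beta>] ext_u_C1[of \<alpha> \<beta>] dN N0
    unfolding ext_form_def u_def by blast
qed

section \<open>Discretized Loewner systems\<close>

text \<open>Discretized Loewner equation for the first coefficients: the time \<open>t\<close> is one minus the
  conformal radius, and the Koebe function corresponds to \<open>\<kappa> = 1\<close>.  Estimates are uniform over a
  family of such systems.\<close>

locale loewner_family =
  fixes Sys :: "'s set" and \<eta> :: "'s \<Rightarrow> real" and n :: "'s \<Rightarrow> nat" and t :: "'s \<Rightarrow> nat \<Rightarrow> real"
    and \<kappa> a b c :: "'s \<Rightarrow> nat \<Rightarrow> complex"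
  assumes eta: "\<sigma> \<in> Sys \<Longrightarrow> 0 \<le> \<eta> \<sigma>" "\<sigma> \<in> Sys \<Longrightarrow> \<eta> \<sigma> \<le> 1"
    and t_ends: "\<sigma> \<in> Sys \<Longrightarrow> 0 \<le> t \<sigma> 0" "\<sigma> \<in> Sys \<Longrightarrow> t \<sigma> 0 \<le> \<eta> \<sigma>" "\<sigma> \<in> Sys \<Longrightarrow> 1 - \<eta> \<sigma> \<le> t \<sigma> (n \<sigma>)"
      "\<sigma> \<in> Sys \<Longrightarrow> t \<sigma> (n \<sigma>) \<le> 1"
    and t_step: "\<sigma> \<in> Sys \<Longrightarrow> k < n \<sigma> \<Longrightarrow> t \<sigma> k \<le> t \<sigma> (Suc k)" "\<sigma> \<in> Sys \<Longrightarrow> k < n \<sigma> \<Longrightarrow> t \<sigma> (Suc k) - t \<sigma> k \<le> \<eta> \<sigma>"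
    and kappa: "\<sigma> \<in> Sys \<Longrightarrow> k < n \<sigma> \<Longrightarrow> cmod (\<kappa> \<sigma> k) = 1"
    and start: "\<sigma> \<in> Sys \<Longrightarrow> cmod (a \<sigma> 0) \<le> \<eta> \<sigma>" "\<sigma> \<in> Sys \<Longrightarrow> cmod (b \<sigma> 0) \<le> \<eta> \<sigma>" "\<sigma> \<in> Sys \<Longrightarrow> cmod (c \<sigma> 0) \<le> \<eta> \<sigma>"
    and a_step: "\<sigma> \<in> Sys \<Longrightarrow> k < n \<sigma> \<Longrightarrow>
       cmod (a \<sigma> (Suc k) - a \<sigma> k - of_real (t \<sigma> (Suc k) - t \<sigma> k) * (2 * \<kappa> \<sigma> k)) \<le> \<eta> \<sigma> * (t \<sigma> (Suc k) - t \<sigma> k)"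
    and b_step: "\<sigma> \<in> Sys \<Longrightarrow> k < n \<sigma> \<Longrightarrow>
       cmod (b \<sigma> (Suc k) - b \<sigma> k - of_real (t \<sigma> (Suc k) - t \<sigma> k) *
         (4 * \<kappa> \<sigma> k * a \<sigma> k - 2 * (\<kappa> \<sigma> k)\<^sup>2 * of_real (1 - t \<sigma> k))) \<le> \<eta> \<sigma> * (t \<sigma> (Suc k) - t \<sigma> k)"
    and c_step: "\<sigma> \<in> Sys \<Longrightarrow> k < n \<sigma> \<Longrightarrow>
       cmod (c \<sigma> (Suc k) - c \<sigma> k - of_real (t \<sigma> (Suc k) - t \<sigma> k) *
         (2 * \<kappa> \<sigma> k * (2 * b \<sigma> k + (a \<sigma> k)\<^sup>2) - 6 * (\<kappa> \<sigma> k)\<^sup>2 * of_real (1 - t \<sigma> k) * a \<sigma> k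
          + 2 * (\<kappa> \<sigma> k)^3 * of_real ((1 - t \<sigma> k)\<^sup>2))) \<le> \<eta> \<sigma> * (t \<sigma> (Suc k) - t \<sigma> k)"
begin

section \<open>Discrete derivatives with uniform errors\<close>

definition "\<Delta> \<sigma> k = t \<sigma> (Suc k) - t \<sigma> k"
definition "e \<sigma> k = 1 - Re (\<kappa> \<sigma> k)"
definition "y \<sigma> k = Im (\<kappa> \<sigma> k)"
definition "En \<sigma> = (\<Sum>k<n \<sigma>. \<Delta> \<sigma> k * e \<sigma> k)"
text \<open>The common scale of smallness, of the size of \<theta> in the mean square. The summand
  \<open>\<eta> \<sigma>\<close> makes discretization errors count as order two.\<close>

definition "r \<sigma> = sqrt (En \<sigma> + \<eta> \<sigma>)"

text \<open>The discrete form of "X' is the derivative of X", with one constant for all systems of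
  the family. The one-step error is proportional to the step, so it adds up to O(\<eta>) over a
  whole chain; sum and product rules below replace differentiation.\<close>

definition rate :: "('s \<Rightarrow> nat \<Rightarrow> real) \<Rightarrow> ('s \<Rightarrow> nat \<Rightarrow> real) \<Rightarrow> bool" where
  "rate X X' \<longleftrightarrow> (\<exists>C\<ge>0. \<forall>\<sigma>\<in>Sys. (\<forall>k\<le>n \<sigma>. \<bar>X \<sigma> k\<bar> \<le> C) \<and>
     (\<forall>k<n \<sigma>. \<bar>X' \<sigma> k\<bar> \<le> C \<and> \<bar>X \<sigma> (Suc k) - X \<sigma> k - \<Delta> \<sigma> k * X' \<sigma> k\<bar> \<le> C * \<eta> \<sigma> * \<Delta> \<sigma> k))"

lemma \<Delta>_nn: "\<sigma> \<in> Sys \<Longrightarrow> k < n \<sigma> \<Longrightarrow> 0 \<le> \<Delta> \<sigma> k" and \<Delta>_le: "\<sigma> \<in> Sys \<Longrightarrow> k < n \<sigma> \<Longrightarrow> \<Delta> \<sigma> k \<le> \<eta> \<sigma>"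
  using t_step by (auto simp: \<Delta>_def)

lemma sum_\<Delta>: "(\<Sum>j<k. \<Delta> \<sigma> j) = t \<sigma> k - t \<sigma> 0"
  unfolding \<Delta>_def by (rule sum_lessThan_telescope)

lemma t_mono: "\<sigma> \<in> Sys \<Longrightarrow> j \<le> k \<Longrightarrow> k \<le> n \<sigma> \<Longrightarrow> t \<sigma> j \<le> t \<sigma> k"
proof (induction k)
  case (Suc k) then show ?case using t_step(1)[of \<sigma> k] by (cases "j = Suc k") force+
qed simp

lemma t_range: assumes "\<sigma> \<in> Sys" "k \<le> n \<sigma>" shows "0 \<le> t \<sigma> k" "t \<sigma> k \<le> 1"
  using t_mono[of \<sigma> 0 k] t_mono[of \<sigma> k "n \<sigma>"] t_ends assms by fastforce+

lemma sum_\<Delta>_le: "\<sigma> \<in> Sys \<Longrightarrow> k \<le> n \<sigma> \<Longrightarrow> (\<Sum>j<k. \<Delta> \<sigma> j) \<le> 1"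
  using t_range[of \<sigma> k] t_ends by (auto simp: sum_\<Delta> intro: order_trans[OF diff_mono])

lemma sum_\<Delta>_bound:
  assumes "\<sigma> \<in> Sys" "k \<le> n \<sigma>" "\<And>j. j < k \<Longrightarrow> f j \<le> C" "0 \<le> C"
  shows "(\<Sum>j<k. \<Delta> \<sigma> j * f j) \<le> C"
proof -
  have "(\<Sum>j<k. \<Delta> \<sigma> j * f j) \<le> (\<Sum>j<k. \<Delta> \<sigma> j * C)"
    using assms \<Delta>_nn by (intro sum_mono mult_left_mono) auto
  also have "\<dots> = (\<Sum>j<k. \<Delta> \<sigma> j) * C" by (simp add: sum_distrib_right)
  also have "\<dots> \<le> 1 * C" using sum_\<Delta>_le assms by (intro mult_right_mono) auto
  finally show ?thesis by simp
qed

lemma telescope_error: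
  assumes "\<sigma> \<in> Sys" "k \<le> n \<sigma>" "\<And>j. j < k \<Longrightarrow> \<bar>X (Suc j) - X j - \<Delta> \<sigma> j * X' j\<bar> \<le> C * \<eta> \<sigma> * \<Delta> \<sigma> j" "0 \<le> C"
  shows "\<bar>X k - X 0 - (\<Sum>j<k. \<Delta> \<sigma> j * X' j)\<bar> \<le> C * \<eta> \<sigma>"
proof -
  have "X k - X 0 = (\<Sum>j<k. X (Suc j) - X j)" by (simp add: sum_lessThan_telescope)
  then have "X k - X 0 - (\<Sum>j<k. \<Delta> \<sigma> j * X' j) = (\<Sum>j<k. X (Suc j) - X j - \<Delta> \<sigma> j * X' j)"
    by (simp add: sum_subtractf)
  then have "\<bar>X k - X 0 - (\<Sum>j<k. \<Delta> \<sigma> j * X' j)\<bar> \<le> (\<Sum>j<k. \<bar>X (Suc j) - X j - \<Delta> \<sigma> j * X' j\<bar>)" by simp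
  also have "\<dots> \<le> (\<Sum>j<k. \<Delta> \<sigma> j * (C * \<eta> \<sigma>))" using assms(3) by (intro sum_mono) (simp add: mult.commute)
  also have "\<dots> \<le> C * \<eta> \<sigma>" using assms eta by (intro sum_\<Delta>_bound) auto
  finally show ?thesis .
qed

lemma rate_telescope:
  assumes "rate X X'"
  shows "\<exists>C\<ge>0. \<forall>\<sigma>\<in>Sys. \<forall>k\<le>n \<sigma>. \<bar>X \<sigma> k - X \<sigma> 0 - (\<Sum>j<k. \<Delta> \<sigma> j * X' \<sigma> j)\<bar> \<le> C * \<eta> \<sigma>"
proof -
  obtain C where C: "0 \<le> C" "\<And>\<sigma> k. \<sigma> \<in> Sys \<Longrightarrow> k < n \<sigma> \<Longrightarrow> \<bar>X \<sigma> (Suc k) - X \<sigma> k - \<Delta> \<sigma> k * X' \<sigma> k\<bar> \<le> C * \<eta> \<sigma> * \<Delta> \<sigma> k"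
    using assms unfolding rate_def by metis
  then show ?thesis using telescope_error[of _ _ "X _" "X' _" C] by (intro exI[of _ C]) auto
qed

text \<open>A bound at the start suffices, because the total time is at most 1: initial value,
  accumulated derivative and accumulated error contribute C each.\<close>

lemma rateI:
  assumes "0 \<le> C" "\<And>\<sigma>. \<sigma> \<in> Sys \<Longrightarrow> \<bar>X \<sigma> 0\<bar> \<le> C" "\<And>\<sigma> k. \<sigma> \<in> Sys \<Longrightarrow> k < n \<sigma> \<Longrightarrow> \<bar>X' \<sigma> k\<bar> \<le> C"
    "\<And>\<sigma> k. \<sigma> \<in> Sys \<Longrightarrow> k < n \<sigma> \<Longrightarrow> \<bar>X \<sigma> (Suc k) - X \<sigma> k - \<Delta> \<sigma> k * X' \<sigma> k\<bar> \<le> C * \<eta> \<sigma> * \<Delta> \<sigma> k"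
  shows "rate X X'"
  unfolding rate_def
proof (intro exI[of _ "3 * C"] conjI ballI allI impI)
  fix \<sigma> assume s: "\<sigma> \<in> Sys"
  show "\<bar>X \<sigma> k\<bar> \<le> 3 * C" if k: "k \<le> n \<sigma>" for k
  proof -
    have "\<bar>X \<sigma> k - X \<sigma> 0 - (\<Sum>j<k. \<Delta> \<sigma> j * X' \<sigma> j)\<bar> \<le> C * \<eta> \<sigma>"
      using telescope_error[of \<sigma> k "X \<sigma>" "X' \<sigma>" C] assms s k by auto
    moreover have "C * \<eta> \<sigma> \<le> C" using eta s assms(1) by (simp add: mult_left_le)
    moreover have "\<bar>\<Sum>j<k. \<Delta> \<sigma> j * X' \<sigma> j\<bar> \<le> (\<Sum>j<k. \<Delta> \<sigma> j * \<bar>X' \<sigma> j\<bar>)"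
      using \<Delta>_nn s k by (intro order_trans[OF sum_abs] sum_mono) (auto simp: abs_mult)
    moreover have "(\<Sum>j<k. \<Delta> \<sigma> j * \<bar>X' \<sigma> j\<bar>) \<le> C" using assms s k by (intro sum_\<Delta>_bound) auto
    ultimately show ?thesis using assms(2)[OF s] by linarith
  qed
  fix k assume k: "k < n \<sigma>"
  show "\<bar>X' \<sigma> k\<bar> \<le> 3 * C" using assms(1) assms(3)[OF s k] by linarith
  have "0 \<le> C * \<eta> \<sigma> * \<Delta> \<sigma> k" using assms(1) eta s \<Delta>_nn k by simp
  then show "\<bar>X \<sigma> (Suc k) - X \<sigma> k - \<Delta> \<sigma> k * X' \<sigma> k\<bar> \<le> 3 * C * \<eta> \<sigma> * \<Delta> \<sigma> k"
    using assms(4)[OF s k] by linarith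
qed (use assms in auto)

lemma rate_cong: "rate X X' \<Longrightarrow> (\<And>\<sigma> k. \<sigma> \<in> Sys \<Longrightarrow> k \<le> n \<sigma> \<Longrightarrow> X \<sigma> k = Y \<sigma> k) \<Longrightarrow>
   (\<And>\<sigma> k. \<sigma> \<in> Sys \<Longrightarrow> k < n \<sigma> \<Longrightarrow> X' \<sigma> k = Y' \<sigma> k) \<Longrightarrow> rate Y Y'"
  unfolding rate_def by (simp cong: ball_cong)

lemma rate_const: "(\<And>\<sigma>. \<sigma> \<in> Sys \<Longrightarrow> \<bar>f \<sigma>\<bar> \<le> C) \<Longrightarrow> rate (\<lambda>\<sigma> k. f \<sigma>) (\<lambda>\<sigma> k. 0)"
  by (rule rateI[of "\<bar>C\<bar>"]) (use eta \<Delta>_nn in \<open>auto intro: order_trans[OF _ abs_ge_self]\<close>)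

lemma rate_t: "rate t (\<lambda>\<sigma> k. 1)"
  by (rule rateI[of 1]) (use eta t_ends t_range \<Delta>_nn in \<open>auto simp: \<Delta>_def\<close>)

lemma rate_add:
  assumes "rate X X'" "rate Y Y'" shows "rate (\<lambda>\<sigma> k. X \<sigma> k + Y \<sigma> k) (\<lambda>\<sigma> k. X' \<sigma> k + Y' \<sigma> k)"
proof -
  obtain C where C: "0 \<le> C" "\<And>\<sigma> k. \<sigma> \<in> Sys \<Longrightarrow> k \<le> n \<sigma> \<Longrightarrow> \<bar>X \<sigma> k\<bar> \<le> C"
    "\<And>\<sigma> k. \<sigma> \<in> Sys \<Longrightarrow> k < n \<sigma> \<Longrightarrow> \<bar>X' \<sigma> k\<bar> \<le> C"
    "\<And>\<sigma> k. \<sigma> \<in> Sys \<Longrightarrow> k < n \<sigma> \<Longrightarrow> \<bar>X \<sigma> (Suc k) - X \<sigma> k - \<Delta> \<sigma> k * X' \<sigma> k\<bar> \<le> C * \<eta> \<sigma> * \<Delta> \<sigma> k"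
    using assms(1) unfolding rate_def by metis
  obtain D where D: "0 \<le> D" "\<And>\<sigma> k. \<sigma> \<in> Sys \<Longrightarrow> k \<le> n \<sigma> \<Longrightarrow> \<bar>Y \<sigma> k\<bar> \<le> D"
    "\<And>\<sigma> k. \<sigma> \<in> Sys \<Longrightarrow> k < n \<sigma> \<Longrightarrow> \<bar>Y' \<sigma> k\<bar> \<le> D"
    "\<And>\<sigma> k. \<sigma> \<in> Sys \<Longrightarrow> k < n \<sigma> \<Longrightarrow> \<bar>Y \<sigma> (Suc k) - Y \<sigma> k - \<Delta> \<sigma> k * Y' \<sigma> k\<bar> \<le> D * \<eta> \<sigma> * \<Delta> \<sigma> k"
    using assms(2) unfolding rate_def by metis
  show ?thesis
  proof (rule rateI[of "C + D"])
    fix \<sigma> k assume s: "\<sigma> \<in> Sys" "k < n \<sigma>"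
    show "\<bar>X' \<sigma> k + Y' \<sigma> k\<bar> \<le> C + D" using C(3)[OF s] D(3)[OF s] by linarith
    show "\<bar>X \<sigma> (Suc k) + Y \<sigma> (Suc k) - (X \<sigma> k + Y \<sigma> k) - \<Delta> \<sigma> k * (X' \<sigma> k + Y' \<sigma> k)\<bar> \<le> (C + D) * \<eta> \<sigma> * \<Delta> \<sigma> k"
      using C(4)[OF s] D(4)[OF s] by (simp add: algebra_simps)
  next
    fix \<sigma> assume s: "\<sigma> \<in> Sys"
    show "\<bar>X \<sigma> 0 + Y \<sigma> 0\<bar> \<le> C + D" using C(2)[OF s, of 0] D(2)[OF s, of 0] by linarith
  qed (use C D in auto)
qed

text \<open>Compared with the usual product rule only the product of the two increments is new; it
  is quadratic in the step and is absorbed since the step is at most \<eta>.\<close>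

lemma rate_mult:
  assumes "rate X X'" "rate Y Y'"
  shows "rate (\<lambda>\<sigma> k. X \<sigma> k * Y \<sigma> k) (\<lambda>\<sigma> k. X' \<sigma> k * Y \<sigma> k + X \<sigma> k * Y' \<sigma> k)"
proof -
  obtain C where C: "0 \<le> C" "\<And>\<sigma> k. \<sigma> \<in> Sys \<Longrightarrow> k \<le> n \<sigma> \<Longrightarrow> \<bar>X \<sigma> k\<bar> \<le> C"
    "\<And>\<sigma> k. \<sigma> \<in> Sys \<Longrightarrow> k < n \<sigma> \<Longrightarrow> \<bar>X' \<sigma> k\<bar> \<le> C"
    "\<And>\<sigma> k. \<sigma> \<in> Sys \<Longrightarrow> k < n \<sigma> \<Longrightarrow> \<bar>X \<sigma> (Suc k) - X \<sigma> k - \<Delta> \<sigma> k * X' \<sigma> k\<bar> \<le> C * \<eta> \<sigma> * \<Delta> \<sigma> k"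
    using assms(1) unfolding rate_def by metis
  obtain D where D: "0 \<le> D" "\<And>\<sigma> k. \<sigma> \<in> Sys \<Longrightarrow> k \<le> n \<sigma> \<Longrightarrow> \<bar>Y \<sigma> k\<bar> \<le> D"
    "\<And>\<sigma> k. \<sigma> \<in> Sys \<Longrightarrow> k < n \<sigma> \<Longrightarrow> \<bar>Y' \<sigma> k\<bar> \<le> D"
    "\<And>\<sigma> k. \<sigma> \<in> Sys \<Longrightarrow> k < n \<sigma> \<Longrightarrow> \<bar>Y \<sigma> (Suc k) - Y \<sigma> k - \<Delta> \<sigma> k * Y' \<sigma> k\<bar> \<le> D * \<eta> \<sigma> * \<Delta> \<sigma> k"
    using assms(2) unfolding rate_def by metis
  have CD: "0 \<le> C * D" using C(1) D(1) by simp
  show ?thesis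
  proof (rule rateI[of "6 * (C * D)"])
    fix \<sigma> k assume s: "\<sigma> \<in> Sys" "k < n \<sigma>"
    then have k': "k \<le> n \<sigma>" by simp
    have m: "\<bar>X' \<sigma> k * Y \<sigma> k\<bar> \<le> C * D" "\<bar>X \<sigma> k * Y' \<sigma> k\<bar> \<le> C * D"
      unfolding abs_mult using C(2,3) D(2,3) s k' by (auto intro!: mult_mono' simp: C(1))
    show "\<bar>X' \<sigma> k * Y \<sigma> k + X \<sigma> k * Y' \<sigma> k\<bar> \<le> 6 * (C * D)" using m CD by linarith
    let ?dX = "X \<sigma> (Suc k) - X \<sigma> k" and ?dY = "Y \<sigma> (Suc k) - Y \<sigma> k"
    have d: "0 \<le> \<Delta> \<sigma> k" "\<Delta> \<sigma> k \<le> \<eta> \<sigma>" "\<eta> \<sigma> \<le> 1" using \<Delta>_nn \<Delta>_le eta s by auto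
    have "\<bar>?dX\<bar> \<le> \<Delta> \<sigma> k * \<bar>X' \<sigma> k\<bar> + C * \<eta> \<sigma> * \<Delta> \<sigma> k"
      using C(4)[OF s] abs_mult[of "\<Delta> \<sigma> k" "X' \<sigma> k"] d by simp
    also have "\<dots> \<le> \<Delta> \<sigma> k * C + C * 1 * \<Delta> \<sigma> k" using C(1,3) s d by (intro add_mono mult_mono) auto
    finally have dX: "\<bar>?dX\<bar> \<le> 2 * C * \<Delta> \<sigma> k" by simp
    have "\<bar>?dY\<bar> \<le> \<Delta> \<sigma> k * \<bar>Y' \<sigma> k\<bar> + D * \<eta> \<sigma> * \<Delta> \<sigma> k"
      using D(4)[OF s] abs_mult[of "\<Delta> \<sigma> k" "Y' \<sigma> k"] d by simp
    also have "\<dots> \<le> \<Delta> \<sigma> k * D + D * 1 * \<Delta> \<sigma> k" using D(1,3) s d by (intro add_mono mult_mono) auto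
    finally have dY: "\<bar>?dY\<bar> \<le> 2 * D * \<Delta> \<sigma> k" by simp
    have "\<bar>?dX * ?dY\<bar> \<le> (2 * C * \<Delta> \<sigma> k) * (2 * D * \<Delta> \<sigma> k)"
      unfolding abs_mult using dX dY d C D by (intro mult_mono) auto
    also have "\<dots> = 4 * (C * D) * \<Delta> \<sigma> k * \<Delta> \<sigma> k" by simp
    also have "\<dots> \<le> 4 * (C * D) * \<eta> \<sigma> * \<Delta> \<sigma> k" using d CD by (intro mult_right_mono mult_left_mono) auto
    finally have 1: "\<bar>?dX * ?dY\<bar> \<le> 4 * (C * D) * \<eta> \<sigma> * \<Delta> \<sigma> k" .
    have 2: "\<bar>(?dX - \<Delta> \<sigma> k * X' \<sigma> k) * Y \<sigma> k\<bar> \<le> (C * \<eta> \<sigma> * \<Delta> \<sigma> k) * D"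
      unfolding abs_mult using C(4)[OF s] D(2)[OF s(1) k'] C(1) d by (intro mult_mono) auto
    have 3: "\<bar>X \<sigma> k * (?dY - \<Delta> \<sigma> k * Y' \<sigma> k)\<bar> \<le> C * (D * \<eta> \<sigma> * \<Delta> \<sigma> k)"
      unfolding abs_mult using D(4)[OF s] C(2)[OF s(1) k'] D(1) C(1) d by (intro mult_mono) auto
    have "X \<sigma> (Suc k) * Y \<sigma> (Suc k) - X \<sigma> k * Y \<sigma> k - \<Delta> \<sigma> k * (X' \<sigma> k * Y \<sigma> k + X \<sigma> k * Y' \<sigma> k)
      = (?dX - \<Delta> \<sigma> k * X' \<sigma> k) * Y \<sigma> k + X \<sigma> k * (?dY - \<Delta> \<sigma> k * Y' \<sigma> k) + ?dX * ?dY"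
      by (simp add: algebra_simps)
    also have "\<bar>\<dots>\<bar> \<le> 6 * (C * D) * \<eta> \<sigma> * \<Delta> \<sigma> k" using 1 2 3 by (simp add: mult_ac)
    finally show "\<bar>X \<sigma> (Suc k) * Y \<sigma> (Suc k) - X \<sigma> k * Y \<sigma> k - \<Delta> \<sigma> k * (X' \<sigma> k * Y \<sigma> k + X \<sigma> k * Y' \<sigma> k)\<bar>
      \<le> 6 * (C * D) * \<eta> \<sigma> * \<Delta> \<sigma> k" .
  next
    fix \<sigma> assume s: "\<sigma> \<in> Sys"
    have "\<bar>X \<sigma> 0 * Y \<sigma> 0\<bar> \<le> C * D"
      unfolding abs_mult using C(1,2) D(2) s by (intro mult_mono) auto
    then show "\<bar>X \<sigma> 0 * Y \<sigma> 0\<bar> \<le> 6 * (C * D)" using CD by linarith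
  qed (use CD in auto)
qed

lemma rate_cmult: "rate X X' \<Longrightarrow> rate (\<lambda>\<sigma> k. C * X \<sigma> k) (\<lambda>\<sigma> k. C * X' \<sigma> k)"
  using rate_mult[OF rate_const[of "\<lambda>_. C" "\<bar>C\<bar>"], of X X'] by simp

lemma rate_minus: "rate X X' \<Longrightarrow> rate (\<lambda>\<sigma> k. - X \<sigma> k) (\<lambda>\<sigma> k. - X' \<sigma> k)"
  using rate_cmult[of X X' "-1"] by simp

lemma rate_diff: "rate X X' \<Longrightarrow> rate Y Y' \<Longrightarrow> rate (\<lambda>\<sigma> k. X \<sigma> k - Y \<sigma> k) (\<lambda>\<sigma> k. X' \<sigma> k - Y' \<sigma> k)"
  using rate_add[OF _ rate_minus, of X X' Y Y'] by simp

lemma rate_power2: "rate X X' \<Longrightarrow> rate (\<lambda>\<sigma> k. (X \<sigma> k)\<^sup>2) (\<lambda>\<sigma> k. 2 * X \<sigma> k * X' \<sigma> k)"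
  unfolding power2_eq_square using rate_mult[of X X' X X'] by (rule rate_cong) auto


section \<open>Energy and orders of smallness\<close>

lemma kappa_e_y:
  assumes "\<sigma> \<in> Sys" "k < n \<sigma>"
  shows "0 \<le> e \<sigma> k" "e \<sigma> k \<le> 2" "(y \<sigma> k)\<^sup>2 = e \<sigma> k * (2 - e \<sigma> k)" "\<bar>y \<sigma> k\<bar> \<le> 2 * sqrt (e \<sigma> k)" "\<bar>y \<sigma> k\<bar> \<le> 1"
    "Re (\<kappa> \<sigma> k) = 1 - e \<sigma> k" "Im (\<kappa> \<sigma> k) = y \<sigma> k"
proof -
  have n1: "(Re (\<kappa> \<sigma> k))\<^sup>2 + (Im (\<kappa> \<sigma> k))\<^sup>2 = 1"
    using kappa[OF assms] by (simp flip: cmod_power2)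
  have "\<bar>Re (\<kappa> \<sigma> k)\<bar> \<le> 1" "\<bar>Im (\<kappa> \<sigma> k)\<bar> \<le> 1" using abs_Re_le_cmod abs_Im_le_cmod kappa[OF assms] by metis+
  then show e: "0 \<le> e \<sigma> k" "e \<sigma> k \<le> 2" and "\<bar>y \<sigma> k\<bar> \<le> 1" by (auto simp: e_def y_def)
  show y2: "(y \<sigma> k)\<^sup>2 = e \<sigma> k * (2 - e \<sigma> k)" using n1 by (simp add: e_def y_def power2_eq_square algebra_simps)
  have "(y \<sigma> k)\<^sup>2 \<le> 4 * e \<sigma> k" unfolding y2 using e by (auto simp: algebra_simps intro: order_trans[of _ 0])
  then have "(y \<sigma> k)\<^sup>2 \<le> (2 * sqrt (e \<sigma> k))\<^sup>2" using e by (simp add: power_mult_distrib)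
  then show "\<bar>y \<sigma> k\<bar> \<le> 2 * sqrt (e \<sigma> k)" using e by (intro power2_le_imp_le[of "\<bar>y \<sigma> k\<bar>"]) auto
qed (auto simp: e_def y_def)

lemma En_bounds:
  assumes "\<sigma> \<in> Sys"
  shows "0 \<le> En \<sigma>" "En \<sigma> \<le> 2" "0 \<le> r \<sigma>" "r \<sigma> \<le> 2" "\<eta> \<sigma> \<le> (r \<sigma>)\<^sup>2" "En \<sigma> \<le> (r \<sigma>)\<^sup>2" "(r \<sigma>)\<^sup>2 = En \<sigma> + \<eta> \<sigma>"
proof -
  show E: "0 \<le> En \<sigma>" unfolding En_def using \<Delta>_nn kappa_e_y assms by (intro sum_nonneg) auto
  show E2: "En \<sigma> \<le> 2" unfolding En_def using assms kappa_e_y by (intro sum_\<Delta>_bound) auto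
  note h = eta[OF assms]
  show r2: "(r \<sigma>)\<^sup>2 = En \<sigma> + \<eta> \<sigma>" using E h by (simp add: r_def)
  then show "\<eta> \<sigma> \<le> (r \<sigma>)\<^sup>2" "En \<sigma> \<le> (r \<sigma>)\<^sup>2" using E h by auto
  show r0: "0 \<le> r \<sigma>" using E h by (simp add: r_def)
  have "(r \<sigma>)\<^sup>2 \<le> 2\<^sup>2" unfolding r2 using E2 h by simp
  then show "r \<sigma> \<le> 2" by (rule power2_le_imp_le) simp
qed

text \<open>Cauchy-Schwarz with total time at most 1. This is how sin \<theta>, pointwise of size
  \<open>sqrt e\<close>, becomes a quantity of order r after summation.\<close>

lemma sum_sqrt_e:
  assumes "\<sigma> \<in> Sys" shows "(\<Sum>j<n \<sigma>. \<Delta> \<sigma> j * sqrt (e \<sigma> j)) \<le> r \<sigma>"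
proof -
  have "(\<Sum>j<n \<sigma>. \<Delta> \<sigma> j * sqrt (e \<sigma> j)) = (\<Sum>j<n \<sigma>. sqrt (\<Delta> \<sigma> j) * sqrt (\<Delta> \<sigma> j * e \<sigma> j))"
    using \<Delta>_nn[OF assms] by (intro sum.cong) (auto simp: real_sqrt_mult)
  also have "\<dots> \<le> sqrt ((\<Sum>j<n \<sigma>. (sqrt (\<Delta> \<sigma> j))\<^sup>2) * (\<Sum>j<n \<sigma>. (sqrt (\<Delta> \<sigma> j * e \<sigma> j))\<^sup>2))"
    by (rule real_le_rsqrt[OF Cauchy_Schwarz_ineq_sum])
  also have "(\<Sum>j<n \<sigma>. (sqrt (\<Delta> \<sigma> j))\<^sup>2) = (\<Sum>j<n \<sigma>. \<Delta> \<sigma> j)"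
    using \<Delta>_nn[OF assms] by (intro sum.cong) auto
  also have "(\<Sum>j<n \<sigma>. (sqrt (\<Delta> \<sigma> j * e \<sigma> j))\<^sup>2) = En \<sigma>"
    unfolding En_def using \<Delta>_nn[OF assms] kappa_e_y[OF assms] by (intro sum.cong) auto
  also have "sqrt ((\<Sum>j<n \<sigma>. \<Delta> \<sigma> j) * En \<sigma>) \<le> sqrt (1 * En \<sigma>)"
    using sum_\<Delta>_le[OF assms, of "n \<sigma>"] En_bounds(1)[OF assms] by (intro real_sqrt_le_mono mult_right_mono) auto
  also have "\<dots> \<le> r \<sigma>" using eta[OF assms] by (simp add: r_def)
  finally show ?thesis .
qed

text \<open>The dictionary of orders: under the sum \<open>e\<close> counts as r^2 and
  \<open>sqrt e\<close> as r, although pointwise \<open>e\<close> is only known to be at most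
  2.\<close>

lemma sum_weighted:
  assumes "\<sigma> \<in> Sys" "k \<le> n \<sigma>" "0 \<le> C" "0 \<le> A" "0 \<le> B" "0 \<le> D"
    and "\<And>j. j < k \<Longrightarrow> \<bar>f j\<bar> \<le> C * (A + B * e \<sigma> j + D * sqrt (e \<sigma> j))"
  shows "\<bar>\<Sum>j<k. \<Delta> \<sigma> j * f j\<bar> \<le> C * (A + B * (r \<sigma>)\<^sup>2 + D * r \<sigma>)"
proof -
  let ?g = "\<lambda>j. C * (A * \<Delta> \<sigma> j + B * (\<Delta> \<sigma> j * e \<sigma> j) + D * (\<Delta> \<sigma> j * sqrt (e \<sigma> j)))"
  have nn: "0 \<le> ?g j" if "j < n \<sigma>" for j
    using \<Delta>_nn[OF assms(1) that] kappa_e_y(1)[OF assms(1) that] assms by simp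
  have "\<bar>\<Sum>j<k. \<Delta> \<sigma> j * f j\<bar> \<le> (\<Sum>j<k. \<bar>\<Delta> \<sigma> j * f j\<bar>)" by (rule sum_abs)
  also have "\<dots> \<le> (\<Sum>j<k. ?g j)"
  proof (rule sum_mono)
    fix j assume "j \<in> {..<k}"
    then have j: "j < k" "j < n \<sigma>" using assms(2) by auto
    have "\<bar>\<Delta> \<sigma> j * f j\<bar> \<le> \<Delta> \<sigma> j * (C * (A + B * e \<sigma> j + D * sqrt (e \<sigma> j)))"
      using assms(7)[OF j(1)] \<Delta>_nn[OF assms(1) j(2)] by (simp add: abs_mult mult_left_mono)
    then show "\<bar>\<Delta> \<sigma> j * f j\<bar> \<le> ?g j" by (simp add: algebra_simps)
  qed
  also have "\<dots> \<le> (\<Sum>j<n \<sigma>. ?g j)" using assms(2) nn by (intro sum_mono2) auto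
  also have "\<dots> = C * (A * (\<Sum>j<n \<sigma>. \<Delta> \<sigma> j) + B * En \<sigma> + D * (\<Sum>j<n \<sigma>. \<Delta> \<sigma> j * sqrt (e \<sigma> j)))"
    by (simp add: En_def sum.distrib flip: sum_distrib_left)
  also have "\<dots> \<le> C * (A * 1 + B * (r \<sigma>)\<^sup>2 + D * r \<sigma>)"
    using assms sum_\<Delta>_le[OF assms(1), of "n \<sigma>"] En_bounds[OF assms(1)] sum_sqrt_e[OF assms(1)]
    by (intro mult_left_mono add_mono) auto
  finally show ?thesis by simp
qed

definition small :: "('s \<Rightarrow> nat \<Rightarrow> real) \<Rightarrow> ('s \<Rightarrow> real) \<Rightarrow> bool" where
  "small X B \<longleftrightarrow> (\<exists>C\<ge>0. \<forall>\<sigma>\<in>Sys. \<forall>k\<le>n \<sigma>. \<bar>X \<sigma> k\<bar> \<le> C * B \<sigma>)"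

lemma small_of_rate:
  assumes X: "rate X X'" and X0: "\<And>\<sigma>. \<sigma> \<in> Sys \<Longrightarrow> \<bar>X \<sigma> 0\<bar> \<le> J * \<eta> \<sigma>"
    and X': "\<And>\<sigma> k. \<sigma> \<in> Sys \<Longrightarrow> k < n \<sigma> \<Longrightarrow> \<bar>X' \<sigma> k\<bar> \<le> C * (A \<sigma> + B \<sigma> * e \<sigma> k + D \<sigma> * sqrt (e \<sigma> k))"
    and nn: "0 \<le> C" "0 \<le> J" "\<And>\<sigma>. \<sigma> \<in> Sys \<Longrightarrow> 0 \<le> A \<sigma> \<and> 0 \<le> B \<sigma> \<and> 0 \<le> D \<sigma>"
    and M: "0 \<le> M" "\<And>\<sigma>. \<sigma> \<in> Sys \<Longrightarrow> A \<sigma> + B \<sigma> * (r \<sigma>)\<^sup>2 + D \<sigma> * r \<sigma> + \<eta> \<sigma> \<le> M * F \<sigma>"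
  shows "small X F"
proof -
  obtain C1 where C1: "0 \<le> C1" "\<And>\<sigma> k. \<sigma> \<in> Sys \<Longrightarrow> k \<le> n \<sigma> \<Longrightarrow> \<bar>X \<sigma> k - X \<sigma> 0 - (\<Sum>j<k. \<Delta> \<sigma> j * X' \<sigma> j)\<bar> \<le> C1 * \<eta> \<sigma>"
    using rate_telescope[OF X] by blast
  define K where "K = C + J + C1"
  have K: "0 \<le> K" using nn C1 by (simp add: K_def)
  show ?thesis unfolding small_def
  proof (intro exI[of _ "K * M"] conjI ballI allI impI)
    fix \<sigma> k assume s: "\<sigma> \<in> Sys" "k \<le> n \<sigma>"
    let ?Q = "A \<sigma> + B \<sigma> * (r \<sigma>)\<^sup>2 + D \<sigma> * r \<sigma>"
    have Q: "0 \<le> ?Q" using nn(3)[OF s(1)] En_bounds(3)[OF s(1)] by auto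
    note h = eta[OF s(1)]
    have "\<bar>\<Sum>j<k. \<Delta> \<sigma> j * X' \<sigma> j\<bar> \<le> C * ?Q"
      using s X' nn by (intro sum_weighted) auto
    then have "\<bar>X \<sigma> k\<bar> \<le> C * ?Q + J * \<eta> \<sigma> + C1 * \<eta> \<sigma>"
      using C1(2)[OF s] X0[OF s(1)] by linarith
    also have "\<dots> \<le> K * ?Q + K * \<eta> \<sigma>"
    proof -
      have "C * ?Q \<le> K * ?Q" using Q nn C1 by (intro mult_right_mono) (auto simp: K_def)
      moreover have "(J + C1) * \<eta> \<sigma> \<le> K * \<eta> \<sigma>" using h nn by (intro mult_right_mono) (auto simp: K_def)
      ultimately show ?thesis by (simp add: algebra_simps)
    qed
    also have "\<dots> = K * (?Q + \<eta> \<sigma>)" by (simp add: algebra_simps)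
    also have "\<dots> \<le> K * (M * F \<sigma>)" using M(2)[OF s(1)] K by (intro mult_left_mono) auto
    finally show "\<bar>X \<sigma> k\<bar> \<le> K * M * F \<sigma>" by simp
  qed (use K M in auto)
qed

lemma complex_rate:
  fixes X G :: "'s \<Rightarrow> nat \<Rightarrow> complex"
  assumes st: "\<And>\<sigma> k. \<sigma> \<in> Sys \<Longrightarrow> k < n \<sigma> \<Longrightarrow>
       cmod (X \<sigma> (Suc k) - X \<sigma> k - of_real (t \<sigma> (Suc k) - t \<sigma> k) * G \<sigma> k) \<le> \<eta> \<sigma> * (t \<sigma> (Suc k) - t \<sigma> k)"
    and X0: "\<And>\<sigma>. \<sigma> \<in> Sys \<Longrightarrow> cmod (X \<sigma> 0) \<le> \<eta> \<sigma>" and G: "\<And>\<sigma> k. \<sigma> \<in> Sys \<Longrightarrow> k < n \<sigma> \<Longrightarrow> cmod (G \<sigma> k) \<le> C"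
    and C: "1 \<le> C"
  shows "rate (\<lambda>\<sigma> k. Re (X \<sigma> k)) (\<lambda>\<sigma> k. Re (G \<sigma> k))" "rate (\<lambda>\<sigma> k. Im (X \<sigma> k)) (\<lambda>\<sigma> k. Im (G \<sigma> k))"
    "\<exists>K\<ge>0. \<forall>\<sigma>\<in>Sys. \<forall>k\<le>n \<sigma>. cmod (X \<sigma> k) \<le> K"
proof -
  have er: "\<bar>Re (X \<sigma> (Suc k)) - Re (X \<sigma> k) - \<Delta> \<sigma> k * Re (G \<sigma> k)\<bar> \<le> C * \<eta> \<sigma> * \<Delta> \<sigma> k"
    "\<bar>Im (X \<sigma> (Suc k)) - Im (X \<sigma> k) - \<Delta> \<sigma> k * Im (G \<sigma> k)\<bar> \<le> C * \<eta> \<sigma> * \<Delta> \<sigma> k"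
    if s: "\<sigma> \<in> Sys" "k < n \<sigma>" for \<sigma> k
  proof -
    let ?w = "X \<sigma> (Suc k) - X \<sigma> k - of_real (t \<sigma> (Suc k) - t \<sigma> k) * G \<sigma> k"
    have "0 \<le> \<eta> \<sigma> * \<Delta> \<sigma> k" using eta[OF s(1)] \<Delta>_nn[OF s] by simp
    then have "\<eta> \<sigma> * \<Delta> \<sigma> k \<le> C * (\<eta> \<sigma> * \<Delta> \<sigma> k)" using C by (simp add: mult_le_cancel_right1)
    then have "cmod ?w \<le> C * \<eta> \<sigma> * \<Delta> \<sigma> k" using st[OF s] by (simp add: \<Delta>_def mult_ac)
    then have "\<bar>Re ?w\<bar> \<le> C * \<eta> \<sigma> * \<Delta> \<sigma> k" "\<bar>Im ?w\<bar> \<le> C * \<eta> \<sigma> * \<Delta> \<sigma> k"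
      using abs_Re_le_cmod abs_Im_le_cmod order_trans by blast+
    then show "\<bar>Re (X \<sigma> (Suc k)) - Re (X \<sigma> k) - \<Delta> \<sigma> k * Re (G \<sigma> k)\<bar> \<le> C * \<eta> \<sigma> * \<Delta> \<sigma> k"
      "\<bar>Im (X \<sigma> (Suc k)) - Im (X \<sigma> k) - \<Delta> \<sigma> k * Im (G \<sigma> k)\<bar> \<le> C * \<eta> \<sigma> * \<Delta> \<sigma> k"
      by (simp_all add: \<Delta>_def)
  qed
  have i: "\<bar>Re (X \<sigma> 0)\<bar> \<le> C" "\<bar>Im (X \<sigma> 0)\<bar> \<le> C" if "\<sigma> \<in> Sys" for \<sigma>
    using abs_Re_le_cmod[of "X \<sigma> 0"] abs_Im_le_cmod[of "X \<sigma> 0"] X0[OF that] eta[OF that] C by linarith+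
  have g: "\<bar>Re (G \<sigma> k)\<bar> \<le> C" "\<bar>Im (G \<sigma> k)\<bar> \<le> C" if "\<sigma> \<in> Sys" "k < n \<sigma>" for \<sigma> k
    using abs_Re_le_cmod[of "G \<sigma> k"] abs_Im_le_cmod[of "G \<sigma> k"] G[OF that] by linarith+
  show R: "rate (\<lambda>\<sigma> k. Re (X \<sigma> k)) (\<lambda>\<sigma> k. Re (G \<sigma> k))" and I: "rate (\<lambda>\<sigma> k. Im (X \<sigma> k)) (\<lambda>\<sigma> k. Im (G \<sigma> k))"
    using er i g C by (auto intro!: rateI[of C])
  obtain K where K: "0 \<le> K" "\<And>\<sigma> k. \<sigma> \<in> Sys \<Longrightarrow> k \<le> n \<sigma> \<Longrightarrow> \<bar>Re (X \<sigma> k)\<bar> \<le> K" using R unfolding rate_def by metis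
  obtain L where L: "0 \<le> L" "\<And>\<sigma> k. \<sigma> \<in> Sys \<Longrightarrow> k \<le> n \<sigma> \<Longrightarrow> \<bar>Im (X \<sigma> k)\<bar> \<le> L" using I unfolding rate_def by metis
  show "\<exists>K\<ge>0. \<forall>\<sigma>\<in>Sys. \<forall>k\<le>n \<sigma>. cmod (X \<sigma> k) \<le> K"
  proof (intro exI[of _ "K + L"] conjI ballI allI impI)
    fix \<sigma> k assume "\<sigma> \<in> Sys" "k \<le> n \<sigma>"
    then show "cmod (X \<sigma> k) \<le> K + L" using cmod_le[of "X \<sigma> k"] K(2) L(2) by fastforce
  qed (use K L in simp)
qed

text \<open>For \<kappa> = 1 the chain is a = 2 t, b = 5 t^2 - 2 t, c = 14 t^3 - 12 t^2 + 2 t. The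
  only first order quantities are \<open>z\<close>, whose derivative is - sin \<theta>, and its
  integral \<open>\<zeta>\<close>. \<open>\<alpha>\<close> and \<open>\<beta>\<close> are the
  deviations of the real parts of a and b, \<open>\<omega>\<close> is Im b without its part linear
  in \<open>z\<close> and \<open>\<zeta>\<close>; these three are of second order.\<close>

definition "z \<sigma> k = - Im (a \<sigma> k) / 2"
definition "\<zeta> \<sigma> k = (\<Sum>j<k. \<Delta> \<sigma> j * z \<sigma> j)"
definition "\<alpha> \<sigma> k = Re (a \<sigma> k) - 2 * t \<sigma> k"
definition "\<beta> \<sigma> k = Re (b \<sigma> k) - (5 * (t \<sigma> k)\<^sup>2 - 2 * t \<sigma> k)"
definition "\<omega> \<sigma> k = Im (b \<sigma> k) - ((4 - 12 * t \<sigma> k) * z \<sigma> k + 4 * \<zeta> \<sigma> k)"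

lemma rate_a: "rate (\<lambda>\<sigma> k. Re (a \<sigma> k)) (\<lambda>\<sigma> k. 2 * (1 - e \<sigma> k))" "rate z (\<lambda>\<sigma> k. - y \<sigma> k)"
  "\<exists>K\<ge>0. \<forall>\<sigma>\<in>Sys. \<forall>k\<le>n \<sigma>. cmod (a \<sigma> k) \<le> K"
proof -
  note c = complex_rate[OF a_step start(1), of 2]
  have g: "cmod (2 * \<kappa> \<sigma> k) \<le> 2" if "\<sigma> \<in> Sys" "k < n \<sigma>" for \<sigma> k using kappa[OF that] by (simp add: norm_mult)
  show "rate (\<lambda>\<sigma> k. Re (a \<sigma> k)) (\<lambda>\<sigma> k. 2 * (1 - e \<sigma> k))"
    by (rule rate_cong[OF c(1)]) (use g in \<open>auto simp: e_def\<close>)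
  show "rate z (\<lambda>\<sigma> k. - y \<sigma> k)"
    by (rule rate_cong[OF rate_cmult[OF c(2), of "-1/2"]]) (use g in \<open>auto simp: z_def y_def\<close>)
  show "\<exists>K\<ge>0. \<forall>\<sigma>\<in>Sys. \<forall>k\<le>n \<sigma>. cmod (a \<sigma> k) \<le> K" using c(3) g by auto
qed

lemma rate_b:
  "rate (\<lambda>\<sigma> k. Re (b \<sigma> k)) (\<lambda>\<sigma> k. 4 * ((1 - e \<sigma> k) * Re (a \<sigma> k) + 2 * y \<sigma> k * z \<sigma> k)
      - 2 * (1 - t \<sigma> k) * ((1 - e \<sigma> k)\<^sup>2 - (y \<sigma> k)\<^sup>2))" (is "rate _ ?R")
  "rate (\<lambda>\<sigma> k. Im (b \<sigma> k)) (\<lambda>\<sigma> k. 4 * (y \<sigma> k * Re (a \<sigma> k) - 2 * (1 - e \<sigma> k) * z \<sigma> k)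
      - 4 * (1 - t \<sigma> k) * (1 - e \<sigma> k) * y \<sigma> k)" (is "rate _ ?I")
  "\<exists>K\<ge>0. \<forall>\<sigma>\<in>Sys. \<forall>k\<le>n \<sigma>. cmod (b \<sigma> k) \<le> K"
proof -
  obtain K where K: "0 \<le> K" "\<And>\<sigma> k. \<sigma> \<in> Sys \<Longrightarrow> k \<le> n \<sigma> \<Longrightarrow> cmod (a \<sigma> k) \<le> K" using rate_a(3) by blast
  let ?G = "\<lambda>\<sigma> k. 4 * \<kappa> \<sigma> k * a \<sigma> k - 2 * (\<kappa> \<sigma> k)\<^sup>2 * of_real (1 - t \<sigma> k)"
  have g: "cmod (?G \<sigma> k) \<le> 4 * K + 2" if s: "\<sigma> \<in> Sys" "k < n \<sigma>" for \<sigma> k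
  proof -
    have "cmod (?G \<sigma> k) \<le> cmod (4 * \<kappa> \<sigma> k * a \<sigma> k) + cmod (2 * (\<kappa> \<sigma> k)\<^sup>2 * of_real (1 - t \<sigma> k))" by (rule norm_triangle_ineq4)
    also have "\<dots> = 4 * cmod (a \<sigma> k) + 2 * \<bar>1 - t \<sigma> k\<bar>"
      by (simp only: norm_mult norm_power norm_of_real norm_numeral kappa[OF s]) simp
    also have "\<dots> \<le> 4 * K + 2" using K(2)[of \<sigma> k] t_range[of \<sigma> k] s by simp
    finally show ?thesis .
  qed
  note c = complex_rate[OF b_step start(2) g]
  show "rate (\<lambda>\<sigma> k. Re (b \<sigma> k)) ?R"
    by (rule rate_cong[OF c(1)]) (use K in \<open>auto simp: kappa_e_y z_def power2_eq_square algebra_simps\<close>)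
  show "rate (\<lambda>\<sigma> k. Im (b \<sigma> k)) ?I"
    by (rule rate_cong[OF c(2)]) (use K in \<open>auto simp: kappa_e_y z_def power2_eq_square algebra_simps\<close>)
  show "\<exists>K\<ge>0. \<forall>\<sigma>\<in>Sys. \<forall>k\<le>n \<sigma>. cmod (b \<sigma> k) \<le> K" using c(3) K by auto
qed

lemma rate_c:
  "rate (\<lambda>\<sigma> k. Re (c \<sigma> k)) (\<lambda>\<sigma> k. 2 * ((1 - e \<sigma> k) * (2 * Re (b \<sigma> k) + (Re (a \<sigma> k))\<^sup>2 - 4 * (z \<sigma> k)\<^sup>2)
       - y \<sigma> k * (2 * Im (b \<sigma> k) - 4 * Re (a \<sigma> k) * z \<sigma> k))
     - 6 * (1 - t \<sigma> k) * (((1 - e \<sigma> k)\<^sup>2 - (y \<sigma> k)\<^sup>2) * Re (a \<sigma> k) + 4 * (1 - e \<sigma> k) * y \<sigma> k * z \<sigma> k)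
     + 2 * (1 - t \<sigma> k)\<^sup>2 * ((1 - e \<sigma> k) ^ 3 - 3 * (1 - e \<sigma> k) * (y \<sigma> k)\<^sup>2))" (is "rate _ ?R")
proof -
  obtain K where K: "0 \<le> K" "\<And>\<sigma> k. \<sigma> \<in> Sys \<Longrightarrow> k \<le> n \<sigma> \<Longrightarrow> cmod (a \<sigma> k) \<le> K" using rate_a(3) by blast
  obtain L where L: "0 \<le> L" "\<And>\<sigma> k. \<sigma> \<in> Sys \<Longrightarrow> k \<le> n \<sigma> \<Longrightarrow> cmod (b \<sigma> k) \<le> L" using rate_b(3) by blast
  let ?G = "\<lambda>\<sigma> k. 2 * \<kappa> \<sigma> k * (2 * b \<sigma> k + (a \<sigma> k)\<^sup>2) - 6 * (\<kappa> \<sigma> k)\<^sup>2 * of_real (1 - t \<sigma> k) * a \<sigma> k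
          + 2 * (\<kappa> \<sigma> k)^3 * of_real ((1 - t \<sigma> k)\<^sup>2)"
  have g: "cmod (?G \<sigma> k) \<le> 2 * (2 * L + K\<^sup>2) + 6 * K + 2" if s: "\<sigma> \<in> Sys" "k < n \<sigma>" for \<sigma> k
  proof -
    have k': "k \<le> n \<sigma>" using s by simp
    note t = t_range[OF s(1) k']
    have 1: "cmod (2 * \<kappa> \<sigma> k * (2 * b \<sigma> k + (a \<sigma> k)\<^sup>2)) \<le> 2 * (2 * L + K\<^sup>2)"
    proof -
      have "cmod (2 * b \<sigma> k + (a \<sigma> k)\<^sup>2) \<le> 2 * cmod (b \<sigma> k) + (cmod (a \<sigma> k))\<^sup>2"
        by (rule order_trans[OF norm_triangle_ineq]) (simp add: norm_mult norm_power)
      also have "\<dots> \<le> 2 * L + K\<^sup>2" using K(2)[OF s(1) k'] L(2)[OF s(1) k'] by (intro add_mono mult_left_mono power_mono) auto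
      finally show ?thesis using kappa[OF s] by (simp add: norm_mult)
    qed
    have 2: "cmod (6 * (\<kappa> \<sigma> k)\<^sup>2 * of_real (1 - t \<sigma> k) * a \<sigma> k) \<le> 6 * K"
    proof -
      have "\<bar>1 - t \<sigma> k\<bar> * cmod (a \<sigma> k) \<le> 1 * K" using t K s k' by (intro mult_mono) auto
      then show ?thesis using kappa[OF s] by (simp only: norm_mult norm_power norm_of_real) simp
    qed
    have 3: "cmod (2 * (\<kappa> \<sigma> k)^3 * of_real ((1 - t \<sigma> k)\<^sup>2)) \<le> 2"
    proof -
      have "(1 - t \<sigma> k)\<^sup>2 \<le> 1" using t by (simp add: power_le_one)
      then show ?thesis using kappa[OF s] by (simp only: norm_mult norm_power norm_of_real) simp
    qed
    have "cmod (?G \<sigma> k) \<le> cmod (2 * \<kappa> \<sigma> k * (2 * b \<sigma> k + (a \<sigma> k)\<^sup>2)) + cmod (6 * (\<kappa> \<sigma> k)\<^sup>2 * of_real (1 - t \<sigma> k) * a \<sigma> k)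
        + cmod (2 * (\<kappa> \<sigma> k)^3 * of_real ((1 - t \<sigma> k)\<^sup>2))"
      by (intro order_trans[OF norm_triangle_ineq] add_right_mono norm_triangle_ineq4)
    then show ?thesis using 1 2 3 by linarith
  qed
  note c = complex_rate[OF c_step start(3) g]
  show ?thesis
    by (rule rate_cong[OF c(1)])
       (use K L in \<open>auto simp: kappa_e_y z_def power2_eq_square power3_eq_cube algebra_simps\<close>)
qed

lemma rate_\<zeta>: "rate \<zeta> z"
proof -
  obtain K where K: "0 \<le> K" "\<And>\<sigma> k. \<sigma> \<in> Sys \<Longrightarrow> k \<le> n \<sigma> \<Longrightarrow> \<bar>z \<sigma> k\<bar> \<le> K" using rate_a(2) unfolding rate_def by metis
  show ?thesis by (rule rateI[of K]) (use K eta \<Delta>_nn in \<open>auto simp: \<zeta>_def\<close>)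
qed

end

text \<open>The derivative of \<open>\<Lambda>\<close> in terms of the deviations. The multipliers
  of a, b and c solve the adjoint equation along the Koebe chain, so the terms linear in \<alpha>
  and \<beta> cancel; the terms (28 t - 4) z^2 and 16 z \<zeta> remove the products of y with z and
  \<zeta>. What survives is the second order part and products of order at least three.\<close>

lemma linear_part_identity:
  fixes t al be z ze w e y \<nu> :: real
  assumes "y * y = e * (2 - e)"
  shows "(12 + 2 * \<nu>) * 1 - 4 * (2 * t * 1) - 4 * (1 * t\<^sup>2 + t * (2 * t * 1))
    - ((0 - 10 * 1 + 2 * t * 1) * (al + 2 * t) + (\<nu> + 9 - 10 * t + t\<^sup>2) * (2 * (1 - e)))
    - 4 * ((0 - 1) * (be + (5 * t\<^sup>2 - 2 * t)) + (1 - t) * (4 * ((1 - e) * (al + 2 * t) + 2 * y * z) - 2 * (1 - t) * ((1 - e)\<^sup>2 - y\<^sup>2)))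
    - (2 * ((1 - e) * (2 * (be + (5 * t\<^sup>2 - 2 * t)) + (al + 2 * t)\<^sup>2 - 4 * z\<^sup>2)
       - y * (2 * (w + ((4 - 12 * t) * z + 4 * ze)) - 4 * (al + 2 * t) * z))
     - 6 * (1 - t) * (((1 - e)\<^sup>2 - y\<^sup>2) * (al + 2 * t) + 4 * (1 - e) * y * z)
     + 2 * (1 - t)\<^sup>2 * ((1 - e) ^ 3 - 3 * (1 - e) * y\<^sup>2))
    - ((28 * 1 - 0) * z\<^sup>2 + (28 * t - 4) * (2 * z * (- y))) + 16 * ((- y) * ze + z * z)
    = (2 * \<nu> + 2 + 8 * ((1 - t) * (2 - e) - 3/2)\<^sup>2) * e - 4 * z\<^sup>2
     + (4 * w * y - 24 * (1 - t) * y * z * e - 8 * z\<^sup>2 * e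
   + 4 * be * e + (12 * (1 - t) * e + 16 * t - 8) * al * e
   - 8 * y * z * al - 2 * (1 - e) * al\<^sup>2)"
proof -
  have y2: "y\<^sup>2 = e * (2 - e)" using assms by (simp add: power2_eq_square)
  show ?thesis unfolding y2 by (simp add: power2_eq_square power3_eq_cube algebra_simps)
qed

context loewner_family
begin

section \<open>Orders of the deviations and expansion of the defect\<close>

lemma smallE: "small X B \<Longrightarrow> (\<And>C. 0 \<le> C \<Longrightarrow> (\<And>\<sigma> k. \<sigma> \<in> Sys \<Longrightarrow> k \<le> n \<sigma> \<Longrightarrow> \<bar>X \<sigma> k\<bar> \<le> C * B \<sigma>) \<Longrightarrow> P) \<Longrightarrow> P"
  unfolding small_def by blast

lemma r_le: assumes "\<sigma> \<in> Sys"
  shows "(r \<sigma>)\<^sup>2 \<le> 2 * r \<sigma>" "(r \<sigma>)^3 = r \<sigma> * (r \<sigma>)\<^sup>2" "(r \<sigma>)^4 \<le> 2 * (r \<sigma>)^3" "(r \<sigma>)^3 \<le> 2 * (r \<sigma>)\<^sup>2"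
proof -
  note r = En_bounds(3,4)[OF assms]
  show "(r \<sigma>)\<^sup>2 \<le> 2 * r \<sigma>" using r by (simp add: power2_eq_square mult_right_mono)
  show "(r \<sigma>)^3 = r \<sigma> * (r \<sigma>)\<^sup>2" by (simp add: power2_eq_square power3_eq_cube)
  show "(r \<sigma>)^4 \<le> 2 * (r \<sigma>)^3" using mult_right_mono[of "r \<sigma>" 2 "(r \<sigma>)^3"] r by (simp add: numeral_eq_Suc)
  show "(r \<sigma>)^3 \<le> 2 * (r \<sigma>)\<^sup>2" using mult_right_mono[of "r \<sigma>" 2 "(r \<sigma>)\<^sup>2"] r by (simp add: numeral_eq_Suc)
qed

lemma rate_\<alpha>: "rate \<alpha> (\<lambda>\<sigma> k. - 2 * e \<sigma> k)"
  by (rule rate_cong[OF rate_diff[OF rate_a(1) rate_cmult[OF rate_t, of 2]]]) (auto simp: \<alpha>_def)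

lemma initial_small:
  assumes "\<sigma> \<in> Sys"
  shows "\<bar>\<alpha> \<sigma> 0\<bar> \<le> 3 * \<eta> \<sigma>" "\<bar>z \<sigma> 0\<bar> \<le> \<eta> \<sigma>" "\<zeta> \<sigma> 0 = 0" "\<bar>\<beta> \<sigma> 0\<bar> \<le> 8 * \<eta> \<sigma>" "\<bar>\<omega> \<sigma> 0\<bar> \<le> 17 * \<eta> \<sigma>"
proof -
  note h = eta[OF assms] t_ends(1,2)[OF assms] start[OF assms]
  have tt: "(t \<sigma> 0)\<^sup>2 \<le> t \<sigma> 0" using h by (simp add: power2_eq_square mult_left_le)
  have A: "\<bar>Re (a \<sigma> 0)\<bar> \<le> \<eta> \<sigma>" "\<bar>Im (a \<sigma> 0)\<bar> \<le> \<eta> \<sigma>" "\<bar>Re (b \<sigma> 0)\<bar> \<le> \<eta> \<sigma>" "\<bar>Im (b \<sigma> 0)\<bar> \<le> \<eta> \<sigma>"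
    using h abs_Re_le_cmod abs_Im_le_cmod order_trans by blast+
  show "\<bar>\<alpha> \<sigma> 0\<bar> \<le> 3 * \<eta> \<sigma>" using A h unfolding \<alpha>_def by linarith
  show z0: "\<bar>z \<sigma> 0\<bar> \<le> \<eta> \<sigma>" using A h unfolding z_def by linarith
  show ze: "\<zeta> \<sigma> 0 = 0" by (simp add: \<zeta>_def)
  have "0 \<le> (t \<sigma> 0)\<^sup>2" by simp
  then show "\<bar>\<beta> \<sigma> 0\<bar> \<le> 8 * \<eta> \<sigma>" using A h tt unfolding \<beta>_def by linarith
  have "\<bar>(4 - 12 * t \<sigma> 0) * z \<sigma> 0\<bar> \<le> 16 * \<eta> \<sigma>"
    unfolding abs_mult using h z0 by (intro mult_mono) auto
  then show "\<bar>\<omega> \<sigma> 0\<bar> \<le> 17 * \<eta> \<sigma>" using A unfolding \<omega>_def ze by linarith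
qed

lemma small_\<alpha>: "small \<alpha> (\<lambda>\<sigma>. (r \<sigma>)\<^sup>2)"
  by (rule small_of_rate[OF rate_\<alpha> initial_small(1), where C=2 and A="\<lambda>_. 0" and B="\<lambda>_. 1" and D="\<lambda>_. 0" and M=2])
     (use kappa_e_y(1) En_bounds(5) in \<open>fastforce+\<close>)

lemma small_z: "small z r"
proof (rule small_of_rate[OF rate_a(2), where J=1 and C=2 and A="\<lambda>_. 0" and B="\<lambda>_. 0" and D="\<lambda>_. 1" and M=3])
  fix \<sigma> assume s: "\<sigma> \<in> Sys"
  show "0 + 0 * (r \<sigma>)\<^sup>2 + 1 * r \<sigma> + \<eta> \<sigma> \<le> 3 * r \<sigma>" using En_bounds(5)[OF s] r_le(1)[OF s] by linarith
qed (use kappa_e_y(4) initial_small(2) in auto)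

lemma small_\<zeta>: "small \<zeta> r"
proof -
  obtain C where C: "0 \<le> C" "\<And>\<sigma> k. \<sigma> \<in> Sys \<Longrightarrow> k \<le> n \<sigma> \<Longrightarrow> \<bar>z \<sigma> k\<bar> \<le> C * r \<sigma>"
    using small_z by (rule smallE) blast
  show ?thesis
  proof (rule small_of_rate[OF rate_\<zeta>, where J=0 and C=C and A=r and B="\<lambda>_. 0" and D="\<lambda>_. 0" and M=3])
    fix \<sigma> assume s: "\<sigma> \<in> Sys"
    show "r \<sigma> + 0 * (r \<sigma>)\<^sup>2 + 0 * r \<sigma> + \<eta> \<sigma> \<le> 3 * r \<sigma>" using En_bounds(3,5)[OF s] r_le(1)[OF s] by linarith
  qed (use C initial_small(3) En_bounds(3) in auto)
qed

lemma rate_\<beta>: "rate \<beta> (\<lambda>\<sigma> k. 4 * \<alpha> \<sigma> k * (1 - e \<sigma> k) - 8 * t \<sigma> k * e \<sigma> k + 8 * y \<sigma> k * z \<sigma> k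
    + 4 * (1 - t \<sigma> k) * (e \<sigma> k * (2 - e \<sigma> k)))"
  by (rule rate_cong[OF rate_diff[OF rate_b(1) rate_diff[OF rate_cmult[OF rate_power2[OF rate_t], of 5] rate_cmult[OF rate_t, of 2]]]])
     (auto simp: \<beta>_def \<alpha>_def kappa_e_y(3) power2_eq_square[of "1 - _"] algebra_simps)

lemma small_\<beta>: "small \<beta> (\<lambda>\<sigma>. (r \<sigma>)\<^sup>2)"
proof -
  obtain C where C: "0 \<le> C" "\<And>\<sigma> k. \<sigma> \<in> Sys \<Longrightarrow> k \<le> n \<sigma> \<Longrightarrow> \<bar>z \<sigma> k\<bar> \<le> C * r \<sigma>"
    using small_z by (rule smallE) blast
  obtain D where D: "0 \<le> D" "\<And>\<sigma> k. \<sigma> \<in> Sys \<Longrightarrow> k \<le> n \<sigma> \<Longrightarrow> \<bar>\<alpha> \<sigma> k\<bar> \<le> D * (r \<sigma>)\<^sup>2"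
    using small_\<alpha> by (rule smallE) blast
  define K where "K = 16 + 16 * C + 4 * D"
  show ?thesis
  proof (rule small_of_rate[OF rate_\<beta>, where J=8 and C=K and A="\<lambda>\<sigma>. (r \<sigma>)\<^sup>2" and B="\<lambda>_. 1" and D=r and M=4])
    fix \<sigma> assume s: "\<sigma> \<in> Sys"
    show "(r \<sigma>)\<^sup>2 + 1 * (r \<sigma>)\<^sup>2 + r \<sigma> * r \<sigma> + \<eta> \<sigma> \<le> 4 * (r \<sigma>)\<^sup>2"
      using En_bounds(5)[OF s] by (simp add: power2_eq_square)
    show "0 \<le> (r \<sigma>)\<^sup>2 \<and> 0 \<le> (1::real) \<and> 0 \<le> r \<sigma>" using En_bounds(3)[OF s] by simp
    fix k assume k: "k < n \<sigma>"
    then have k': "k \<le> n \<sigma>" by simp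
    note t = t_range[OF s k'] note e = kappa_e_y[OF s k] note r = En_bounds(3)[OF s]
    have 1: "\<bar>4 * \<alpha> \<sigma> k * (1 - e \<sigma> k)\<bar> \<le> 4 * (D * (r \<sigma>)\<^sup>2) * 1"
      unfolding abs_mult using D(2)[OF s k'] D(1) e by (intro mult_mono) auto
    have 2: "\<bar>8 * t \<sigma> k * e \<sigma> k\<bar> \<le> 8 * 1 * e \<sigma> k"
      unfolding abs_mult using t e by (intro mult_mono) auto
    have 3: "\<bar>8 * y \<sigma> k * z \<sigma> k\<bar> \<le> 8 * (2 * sqrt (e \<sigma> k)) * (C * r \<sigma>)"
      unfolding abs_mult using e C(2)[OF s k'] by (intro mult_mono) auto
    have "(1 - t \<sigma> k) * (e \<sigma> k * (2 - e \<sigma> k)) \<le> 1 * (e \<sigma> k * 2)" using t e by (intro mult_mono) auto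
    moreover have "0 \<le> (1 - t \<sigma> k) * (e \<sigma> k * (2 - e \<sigma> k))" using t e by simp
    ultimately have 4: "\<bar>4 * (1 - t \<sigma> k) * (e \<sigma> k * (2 - e \<sigma> k))\<bar> \<le> 8 * e \<sigma> k"
      by (subst mult.assoc, subst abs_mult) (simp add: mult_ac)
    have 5: "D * (r \<sigma>)\<^sup>2 * 4 \<le> K * (r \<sigma>)\<^sup>2" using mult_right_mono[of "4 * D" K "(r \<sigma>)\<^sup>2"] C D by (simp add: K_def mult_ac)
    have 6: "16 * e \<sigma> k \<le> K * e \<sigma> k" using mult_right_mono[of 16 K "e \<sigma> k"] C D e by (simp add: K_def)
    have 7: "(16 * C) * (r \<sigma> * sqrt (e \<sigma> k)) \<le> K * (r \<sigma> * sqrt (e \<sigma> k))" using C D e r by (intro mult_right_mono) (auto simp: K_def)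
    have "8 * (2 * sqrt (e \<sigma> k)) * (C * r \<sigma>) = (16 * C) * (r \<sigma> * sqrt (e \<sigma> k))" by simp
    then show "\<bar>4 * \<alpha> \<sigma> k * (1 - e \<sigma> k) - 8 * t \<sigma> k * e \<sigma> k + 8 * y \<sigma> k * z \<sigma> k
        + 4 * (1 - t \<sigma> k) * (e \<sigma> k * (2 - e \<sigma> k))\<bar> \<le> K * ((r \<sigma>)\<^sup>2 + 1 * e \<sigma> k + r \<sigma> * sqrt (e \<sigma> k))"
      unfolding distrib_left using 1 2 3 4 5 6 7 by linarith
  qed (use C D initial_small(4) in \<open>auto simp: K_def\<close>)
qed

lemma rate_\<omega>: "rate \<omega> (\<lambda>\<sigma> k. 8 * z \<sigma> k * e \<sigma> k + 4 * y \<sigma> k * \<alpha> \<sigma> k + 4 * (1 - t \<sigma> k) * y \<sigma> k * e \<sigma> k)"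
proof -
  have "rate (\<lambda>\<sigma> k. 4 * z \<sigma> k - 12 * (t \<sigma> k * z \<sigma> k) + 4 * \<zeta> \<sigma> k)
     (\<lambda>\<sigma> k. 4 * (- y \<sigma> k) - 12 * (1 * z \<sigma> k + t \<sigma> k * (- y \<sigma> k)) + 4 * z \<sigma> k)"
    by (intro rate_add rate_diff rate_cmult rate_mult rate_t rate_a(2) rate_\<zeta>)
  from rate_diff[OF rate_b(2) this] show ?thesis
    by (rule rate_cong) (auto simp: \<omega>_def \<alpha>_def algebra_simps)
qed

lemma small_\<omega>: "small \<omega> (\<lambda>\<sigma>. (r \<sigma>)\<^sup>2)"
proof -
  obtain C where C: "0 \<le> C" "\<And>\<sigma> k. \<sigma> \<in> Sys \<Longrightarrow> k \<le> n \<sigma> \<Longrightarrow> \<bar>z \<sigma> k\<bar> \<le> C * r \<sigma>"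
    using small_z by (rule smallE) blast
  obtain D where D: "0 \<le> D" "\<And>\<sigma> k. \<sigma> \<in> Sys \<Longrightarrow> k \<le> n \<sigma> \<Longrightarrow> \<bar>\<alpha> \<sigma> k\<bar> \<le> D * (r \<sigma>)\<^sup>2"
    using small_\<alpha> by (rule smallE) blast
  define K where "K = 4 + 16 * C + 8 * D"
  show ?thesis
  proof (rule small_of_rate[OF rate_\<omega>, where J=17 and C=K and A="\<lambda>\<sigma>. 0" and B="\<lambda>_. 1" and D="\<lambda>\<sigma>. (r \<sigma>)\<^sup>2" and M=4])
    fix \<sigma> assume s: "\<sigma> \<in> Sys"
    show "0 + 1 * (r \<sigma>)\<^sup>2 + (r \<sigma>)\<^sup>2 * r \<sigma> + \<eta> \<sigma> \<le> 4 * (r \<sigma>)\<^sup>2"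
      using En_bounds(5)[OF s] r_le(2,4)[OF s] by (simp add: mult.commute)
    fix k assume k: "k < n \<sigma>"
    then have k': "k \<le> n \<sigma>" by simp
    note t = t_range[OF s k'] note e = kappa_e_y[OF s k] note r = En_bounds(3,4)[OF s]
    have "\<bar>z \<sigma> k\<bar> \<le> C * 2" using C(2)[OF s k'] mult_left_mono[OF r(2) C(1)] by linarith
    then have 1: "\<bar>8 * z \<sigma> k * e \<sigma> k\<bar> \<le> 8 * (C * 2) * e \<sigma> k"
      unfolding abs_mult using e by (intro mult_mono) auto
    have 2: "\<bar>4 * y \<sigma> k * \<alpha> \<sigma> k\<bar> \<le> 4 * (2 * sqrt (e \<sigma> k)) * (D * (r \<sigma>)\<^sup>2)"
      unfolding abs_mult using e D(2)[OF s k'] by (intro mult_mono) auto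
    have 3: "\<bar>4 * (1 - t \<sigma> k) * y \<sigma> k * e \<sigma> k\<bar> \<le> 4 * 1 * 1 * e \<sigma> k"
      unfolding abs_mult using e t by (intro mult_mono) auto
    have 4: "(4 + 16 * C) * e \<sigma> k \<le> K * e \<sigma> k" using C D e by (intro mult_right_mono) (auto simp: K_def)
    have 5: "(8 * D) * ((r \<sigma>)\<^sup>2 * sqrt (e \<sigma> k)) \<le> K * ((r \<sigma>)\<^sup>2 * sqrt (e \<sigma> k))" using C D e by (intro mult_right_mono) (auto simp: K_def)
    have "4 * (2 * sqrt (e \<sigma> k)) * (D * (r \<sigma>)\<^sup>2) = (8 * D) * ((r \<sigma>)\<^sup>2 * sqrt (e \<sigma> k))"
      "8 * (C * 2) * e \<sigma> k + 4 * 1 * 1 * e \<sigma> k = (4 + 16 * C) * e \<sigma> k" by (simp_all add: algebra_simps)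
    then show "\<bar>8 * z \<sigma> k * e \<sigma> k + 4 * y \<sigma> k * \<alpha> \<sigma> k + 4 * (1 - t \<sigma> k) * y \<sigma> k * e \<sigma> k\<bar>
       \<le> K * (0 + 1 * e \<sigma> k + (r \<sigma>)\<^sup>2 * sqrt (e \<sigma> k))"
      unfolding distrib_left using 1 2 3 4 5 by linarith
  qed (use C D initial_small(5) in \<open>auto simp: K_def\<close>)
qed

text \<open>At e = 0 this is twice the Legendre coefficient, and e is about \<theta>^2 / 2, so
  \<open>quad_coeff * e\<close> is the term P u^2 of the form. The dependence on e is kept exact,
  because e need not be small pointwise.\<close>

definition "quad_coeff \<nu> \<sigma> k = 2 * \<nu> + 2 + 8 * ((1 - t \<sigma> k) * (2 - e \<sigma> k) - 3/2)\<^sup>2"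
definition "Quad \<nu> \<sigma> = (\<Sum>k<n \<sigma>. \<Delta> \<sigma> k * (quad_coeff \<nu> \<sigma> k * e \<sigma> k - 4 * (z \<sigma> k)\<^sup>2))"
text \<open>The defect continued to all times. The polynomial in t makes \<open>\<Lambda>\<close>
  vanish along the Koebe chain, and at t = 1 it equals L - 24 z^2 + 16 z \<zeta>, which is how the
  boundary terms of the form arise.\<close>

definition "\<Lambda> \<nu> \<sigma> k = (12 + 2 * \<nu>) * t \<sigma> k - 4 * (t \<sigma> k)\<^sup>2 - 4 * (t \<sigma> k * (t \<sigma> k)\<^sup>2)
   - (\<nu> + 9 - 10 * t \<sigma> k + (t \<sigma> k)\<^sup>2) * Re (a \<sigma> k) - 4 * ((1 - t \<sigma> k) * Re (b \<sigma> k)) - Re (c \<sigma> k)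
   - (28 * t \<sigma> k - 4) * (z \<sigma> k)\<^sup>2 + 16 * (z \<sigma> k * \<zeta> \<sigma> k)"
definition "err \<sigma> k = 4 * \<omega> \<sigma> k * y \<sigma> k - 24 * (1 - t \<sigma> k) * y \<sigma> k * z \<sigma> k * e \<sigma> k - 8 * (z \<sigma> k)\<^sup>2 * e \<sigma> k
   + 4 * \<beta> \<sigma> k * e \<sigma> k + (12 * (1 - t \<sigma> k) * e \<sigma> k + 16 * t \<sigma> k - 8) * \<alpha> \<sigma> k * e \<sigma> k
   - 8 * y \<sigma> k * z \<sigma> k * \<alpha> \<sigma> k - 2 * (1 - e \<sigma> k) * (\<alpha> \<sigma> k)\<^sup>2"

lemma rate_\<Lambda>: "rate (\<Lambda> \<nu>) (\<lambda>\<sigma> k. quad_coeff \<nu> \<sigma> k * e \<sigma> k - 4 * (z \<sigma> k)\<^sup>2 + err \<sigma> k)"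
proof -
  have c: "rate (\<lambda>\<sigma> k. C) (\<lambda>\<sigma> k. 0)" for C using rate_const[of "\<lambda>_. C" "\<bar>C\<bar>"] by simp
  note t2 = rate_power2[OF rate_t]
  note k = rate_diff[OF rate_diff[OF rate_cmult[OF rate_t, of "12 + 2 * \<nu>"] rate_cmult[OF t2, of 4]] rate_cmult[OF rate_mult[OF rate_t t2], of 4]]
  note p = rate_mult[OF rate_add[OF rate_diff[OF c[of "\<nu> + 9"] rate_cmult[OF rate_t, of 10]] t2] rate_a(1)]
  note q = rate_cmult[OF rate_mult[OF rate_diff[OF c[of 1] rate_t] rate_b(1)], of 4]
  note ext_z = rate_mult[OF rate_diff[OF rate_cmult[OF rate_t, of 28] c[of 4]] rate_power2[OF rate_a(2)]]
  note ze = rate_cmult[OF rate_mult[OF rate_a(2) rate_\<zeta>], of 16]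
  note all = rate_add[OF rate_diff[OF rate_diff[OF rate_diff[OF rate_diff[OF k p] q] rate_c] ext_z] ze]
  show ?thesis
  proof (rule rate_cong[OF all], goal_cases)
    case (2 \<sigma> k)
    have y2: "y \<sigma> k * y \<sigma> k = e \<sigma> k * (2 - e \<sigma> k)" using kappa_e_y(3)[OF 2] by (simp add: power2_eq_square)
    have s: "Re (a \<sigma> k) = \<alpha> \<sigma> k + 2 * t \<sigma> k" "Re (b \<sigma> k) = \<beta> \<sigma> k + (5 * (t \<sigma> k)\<^sup>2 - 2 * t \<sigma> k)"
      "Im (b \<sigma> k) = \<omega> \<sigma> k + ((4 - 12 * t \<sigma> k) * z \<sigma> k + 4 * \<zeta> \<sigma> k)"
      by (simp_all add: \<alpha>_def \<beta>_def \<omega>_def)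
    show ?case unfolding s quad_coeff_def err_def by (rule linear_part_identity[OF y2])
  qed (simp add: \<Lambda>_def)
qed


text \<open>Each product in \<open>err\<close> is assigned to one of three weights, r^3, r e or r^2
  \<open>sqrt e\<close>; by \<open>sum_weighted\<close> each of them sums to order r^3.\<close>

lemma err_bound:
  "\<exists>K\<ge>0. \<forall>\<sigma>\<in>Sys. \<forall>k<n \<sigma>. \<bar>err \<sigma> k\<bar> \<le> K * ((r \<sigma>)^3 + r \<sigma> * e \<sigma> k + (r \<sigma>)\<^sup>2 * sqrt (e \<sigma> k))"
proof -
  obtain Cz where Cz: "0 \<le> Cz" "\<And>\<sigma> k. \<sigma> \<in> Sys \<Longrightarrow> k \<le> n \<sigma> \<Longrightarrow> \<bar>z \<sigma> k\<bar> \<le> Cz * r \<sigma>"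
    using small_z by (rule smallE) blast
  obtain Ca where Ca: "0 \<le> Ca" "\<And>\<sigma> k. \<sigma> \<in> Sys \<Longrightarrow> k \<le> n \<sigma> \<Longrightarrow> \<bar>\<alpha> \<sigma> k\<bar> \<le> Ca * (r \<sigma>)\<^sup>2"
    using small_\<alpha> by (rule smallE) blast
  obtain Cb where Cb: "0 \<le> Cb" "\<And>\<sigma> k. \<sigma> \<in> Sys \<Longrightarrow> k \<le> n \<sigma> \<Longrightarrow> \<bar>\<beta> \<sigma> k\<bar> \<le> Cb * (r \<sigma>)\<^sup>2"
    using small_\<beta> by (rule smallE) blast
  obtain Cw where Cw: "0 \<le> Cw" "\<And>\<sigma> k. \<sigma> \<in> Sys \<Longrightarrow> k \<le> n \<sigma> \<Longrightarrow> \<bar>\<omega> \<sigma> k\<bar> \<le> Cw * (r \<sigma>)\<^sup>2"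
    using small_\<omega> by (rule smallE) blast
  define K where "K = 8 * Cw + 24 * Cz + 16 * Cz\<^sup>2 + 8 * Cb + 96 * Ca + 32 * (Cz * Ca) + 4 * Ca\<^sup>2"
  have nn: "0 \<le> Cz\<^sup>2" "0 \<le> Cz * Ca" "0 \<le> Ca\<^sup>2" using Cz Ca by auto
  show ?thesis
  proof (intro exI[of _ K] conjI ballI allI impI)
    show K0: "0 \<le> K" using nn Cz Ca Cb Cw by (simp add: K_def)
    fix \<sigma> k assume s: "\<sigma> \<in> Sys" and k: "k < n \<sigma>"
    then have k': "k \<le> n \<sigma>" by simp
    note t = t_range[OF s k'] note e = kappa_e_y[OF s k] note r = En_bounds(3,4)[OF s] note rl = r_le[OF s]
    let ?q = "sqrt (e \<sigma> k)"
    have q: "0 \<le> ?q" using e by simp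
    have r2: "0 \<le> (r \<sigma>)\<^sup>2" by simp
    note zk = Cz(2)[OF s k'] note ak = Ca(2)[OF s k'] note bk = Cb(2)[OF s k'] note wk = Cw(2)[OF s k']
    have 1: "\<bar>4 * \<omega> \<sigma> k * y \<sigma> k\<bar> \<le> 8 * Cw * ((r \<sigma>)\<^sup>2 * ?q)"
    proof -
      have "\<bar>4 * \<omega> \<sigma> k * y \<sigma> k\<bar> \<le> 4 * (Cw * (r \<sigma>)\<^sup>2) * (2 * ?q)"
        unfolding abs_mult using wk e by (intro mult_mono) auto
      then show ?thesis by (simp add: mult_ac)
    qed
    have 2: "\<bar>24 * (1 - t \<sigma> k) * y \<sigma> k * z \<sigma> k * e \<sigma> k\<bar> \<le> 24 * Cz * (r \<sigma> * e \<sigma> k)"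
    proof -
      have "\<bar>24 * (1 - t \<sigma> k) * y \<sigma> k * z \<sigma> k * e \<sigma> k\<bar> \<le> 24 * 1 * 1 * (Cz * r \<sigma>) * e \<sigma> k"
        unfolding abs_mult using t e zk Cz r by (intro mult_mono) auto
      then show ?thesis by (simp add: mult_ac)
    qed
    have r2e: "(r \<sigma>)\<^sup>2 * e \<sigma> k \<le> 2 * (r \<sigma> * e \<sigma> k)" using mult_right_mono[OF rl(1) e(1)] by simp
    have z2: "(z \<sigma> k)\<^sup>2 \<le> Cz\<^sup>2 * (r \<sigma>)\<^sup>2"
      using power_mono[OF zk, of 2] by (simp add: power_mult_distrib)
    have 3: "\<bar>8 * (z \<sigma> k)\<^sup>2 * e \<sigma> k\<bar> \<le> 16 * Cz\<^sup>2 * (r \<sigma> * e \<sigma> k)"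
    proof -
      have "\<bar>8 * (z \<sigma> k)\<^sup>2 * e \<sigma> k\<bar> \<le> 8 * (Cz\<^sup>2 * (r \<sigma>)\<^sup>2) * e \<sigma> k"
        unfolding abs_mult using z2 e by (intro mult_mono) auto
      also have "\<dots> = 8 * Cz\<^sup>2 * ((r \<sigma>)\<^sup>2 * e \<sigma> k)" by simp
      also have "\<dots> \<le> 8 * Cz\<^sup>2 * (2 * (r \<sigma> * e \<sigma> k))" using r2e by (intro mult_left_mono) auto
      finally show ?thesis by simp
    qed
    have 4: "\<bar>4 * \<beta> \<sigma> k * e \<sigma> k\<bar> \<le> 8 * Cb * (r \<sigma> * e \<sigma> k)"
    proof -
      have "\<bar>4 * \<beta> \<sigma> k * e \<sigma> k\<bar> \<le> 4 * (Cb * (r \<sigma>)\<^sup>2) * e \<sigma> k"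
        unfolding abs_mult using bk e by (intro mult_mono) auto
      also have "\<dots> = 4 * Cb * ((r \<sigma>)\<^sup>2 * e \<sigma> k)" by simp
      also have "\<dots> \<le> 4 * Cb * (2 * (r \<sigma> * e \<sigma> k))" using r2e Cb by (intro mult_left_mono) auto
      finally show ?thesis by simp
    qed
    have 5: "\<bar>(12 * (1 - t \<sigma> k) * e \<sigma> k + 16 * t \<sigma> k - 8) * \<alpha> \<sigma> k * e \<sigma> k\<bar> \<le> 96 * Ca * (r \<sigma> * e \<sigma> k)"
    proof -
      have "(1 - t \<sigma> k) * e \<sigma> k \<le> 1 * 2" using t e by (intro mult_mono) auto
      moreover have "0 \<le> (1 - t \<sigma> k) * e \<sigma> k" using t e by simp
      ultimately have "\<bar>12 * (1 - t \<sigma> k) * e \<sigma> k + 16 * t \<sigma> k - 8\<bar> \<le> 48" using t by linarith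
      then have "\<bar>(12 * (1 - t \<sigma> k) * e \<sigma> k + 16 * t \<sigma> k - 8) * \<alpha> \<sigma> k * e \<sigma> k\<bar> \<le> 48 * (Ca * (r \<sigma>)\<^sup>2) * e \<sigma> k"
        unfolding abs_mult using ak e by (intro mult_mono) auto
      also have "\<dots> = 48 * Ca * ((r \<sigma>)\<^sup>2 * e \<sigma> k)" by simp
      also have "\<dots> \<le> 48 * Ca * (2 * (r \<sigma> * e \<sigma> k))" using r2e Ca by (intro mult_left_mono) auto
      finally show ?thesis by simp
    qed
    have 6: "\<bar>8 * y \<sigma> k * z \<sigma> k * \<alpha> \<sigma> k\<bar> \<le> 32 * (Cz * Ca) * ((r \<sigma>)\<^sup>2 * ?q)"
    proof -
      have "\<bar>8 * y \<sigma> k * z \<sigma> k * \<alpha> \<sigma> k\<bar> \<le> 8 * (2 * ?q) * (Cz * r \<sigma>) * (Ca * (r \<sigma>)\<^sup>2)"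
        unfolding abs_mult using zk ak e Cz r by (intro mult_mono) auto
      also have "\<dots> = 16 * (Cz * Ca) * ((r \<sigma>)\<^sup>2 * ?q) * r \<sigma>" by simp
      also have "\<dots> \<le> 16 * (Cz * Ca) * ((r \<sigma>)\<^sup>2 * ?q) * 2" using r q nn by (intro mult_left_mono) auto
      finally show ?thesis by simp
    qed
    have 7: "\<bar>2 * (1 - e \<sigma> k) * (\<alpha> \<sigma> k)\<^sup>2\<bar> \<le> 4 * Ca\<^sup>2 * (r \<sigma>)^3"
    proof -
      have "(\<alpha> \<sigma> k)\<^sup>2 \<le> Ca\<^sup>2 * (r \<sigma>)^4"
        using power_mono[OF ak, of 2] by (simp add: power_mult_distrib flip: power_mult)
      then have "\<bar>2 * (1 - e \<sigma> k) * (\<alpha> \<sigma> k)\<^sup>2\<bar> \<le> 2 * 1 * (Ca\<^sup>2 * (r \<sigma>)^4)"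
        unfolding abs_mult using e by (intro mult_mono) auto
      also have "\<dots> \<le> 2 * 1 * (Ca\<^sup>2 * (2 * (r \<sigma>)^3))" using rl(3) by (intro mult_left_mono) auto
      finally show ?thesis by simp
    qed
    let ?X = "r \<sigma> * e \<sigma> k" and ?Y = "(r \<sigma>)\<^sup>2 * ?q" and ?Z = "(r \<sigma>)^3"
    have "\<bar>err \<sigma> k\<bar> \<le> (24 * Cz + 16 * Cz\<^sup>2 + 8 * Cb + 96 * Ca) * ?X + (8 * Cw + 32 * (Cz * Ca)) * ?Y + 4 * Ca\<^sup>2 * ?Z"
      using 1 2 3 4 5 6 7 unfolding err_def by (simp only: distrib_right)
    also have "\<dots> \<le> K * ?X + K * ?Y + K * ?Z"
      using nn Cz Ca Cb Cw r e q by (intro add_mono mult_right_mono) (auto simp: K_def)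
    finally show "\<bar>err \<sigma> k\<bar> \<le> K * (?Z + ?X + ?Y)" by (simp add: algebra_simps)
  qed
qed

definition "L \<nu> \<sigma> = (4 - Re (c \<sigma> (n \<sigma>))) + \<nu> * (2 - Re (a \<sigma> (n \<sigma>)))"

text \<open>Telescoping of \<open>\<Lambda>\<close>. The chain starts within \<eta> of time 0 with
  coefficients below \<eta> and ends within \<eta> of time 1, so both ends contribute only
  O(\<eta>).\<close>

lemma coefficient_expansion:
  "\<exists>K\<ge>0. \<forall>\<sigma>\<in>Sys. \<bar>L \<nu> \<sigma> - (Quad \<nu> \<sigma> + 24 * (z \<sigma> (n \<sigma>))\<^sup>2 - 16 * z \<sigma> (n \<sigma>) * \<zeta> \<sigma> (n \<sigma>))\<bar> \<le> K * ((r \<sigma>)^3 + \<eta> \<sigma>)"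
proof -
  obtain E where E: "0 \<le> E" "\<And>\<sigma> k. \<sigma> \<in> Sys \<Longrightarrow> k < n \<sigma> \<Longrightarrow> \<bar>err \<sigma> k\<bar> \<le> E * ((r \<sigma>)^3 + r \<sigma> * e \<sigma> k + (r \<sigma>)\<^sup>2 * sqrt (e \<sigma> k))"
    using err_bound by blast
  obtain C1 where C1: "0 \<le> C1" "\<And>\<sigma> k. \<sigma> \<in> Sys \<Longrightarrow> k \<le> n \<sigma> \<Longrightarrow>
     \<bar>\<Lambda> \<nu> \<sigma> k - \<Lambda> \<nu> \<sigma> 0 - (\<Sum>j<k. \<Delta> \<sigma> j * (quad_coeff \<nu> \<sigma> j * e \<sigma> j - 4 * (z \<sigma> j)\<^sup>2 + err \<sigma> j))\<bar> \<le> C1 * \<eta> \<sigma>"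
    using rate_telescope[OF rate_\<Lambda>[of \<nu>]] by blast
  obtain Ka where Ka: "0 \<le> Ka" "\<And>\<sigma> k. \<sigma> \<in> Sys \<Longrightarrow> k \<le> n \<sigma> \<Longrightarrow> cmod (a \<sigma> k) \<le> Ka" using rate_a(3) by blast
  obtain Kb where Kb: "0 \<le> Kb" "\<And>\<sigma> k. \<sigma> \<in> Sys \<Longrightarrow> k \<le> n \<sigma> \<Longrightarrow> cmod (b \<sigma> k) \<le> Kb" using rate_b(3) by blast
  define J where "J = 12 + 2 * \<bar>\<nu>\<bar> + 8 + (\<bar>\<nu>\<bar> + 20) + 4 + 1 + 32"
  define M where "M = 16 + 2 * \<bar>\<nu>\<bar> + 10 * Ka + 4 * Kb + 28 * Ka\<^sup>2"
  define K where "K = 3 * E + C1 + J + M"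
  have J0: "0 \<le> J" and M0: "0 \<le> M" using Ka Kb by (auto simp: J_def M_def)
  show ?thesis
  proof (intro exI[of _ K] conjI ballI)
    show "0 \<le> K" using E C1 J0 M0 by (simp add: K_def)
    fix \<sigma> assume s: "\<sigma> \<in> Sys"
    note r = En_bounds(3,4)[OF s] note h = eta[OF s] t_ends[OF s] start[OF s]
    let ?n = "n \<sigma>"
    have A: "\<bar>\<Lambda> \<nu> \<sigma> 0\<bar> \<le> J * \<eta> \<sigma>"
    proof -
      have t1: "t \<sigma> 0 \<le> 1" using h by linarith
      have t2: "(t \<sigma> 0)\<^sup>2 \<le> t \<sigma> 0" using h t1 by (simp add: power2_eq_square mult_left_le)
      have t3: "t \<sigma> 0 * (t \<sigma> 0)\<^sup>2 \<le> 1 * t \<sigma> 0" using t1 t2 h by (intro mult_mono) auto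
      have 1: "\<bar>(12 + 2 * \<nu>) * t \<sigma> 0\<bar> \<le> (12 + 2 * \<bar>\<nu>\<bar>) * \<eta> \<sigma>" unfolding abs_mult using h by (intro mult_mono) auto
      have 2: "\<bar>4 * (t \<sigma> 0)\<^sup>2\<bar> \<le> 4 * \<eta> \<sigma>" "\<bar>4 * (t \<sigma> 0 * (t \<sigma> 0)\<^sup>2)\<bar> \<le> 4 * \<eta> \<sigma>" using t2 t3 h by auto
      have "\<bar>\<nu> + 9 - 10 * t \<sigma> 0 + (t \<sigma> 0)\<^sup>2\<bar> \<le> \<bar>\<nu>\<bar> + 20" using t1 t2 h zero_le_power2[of "t \<sigma> 0"] by linarith
      moreover have "\<bar>Re (a \<sigma> 0)\<bar> \<le> \<eta> \<sigma>" using h abs_Re_le_cmod order_trans by blast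
      ultimately have 3: "\<bar>(\<nu> + 9 - 10 * t \<sigma> 0 + (t \<sigma> 0)\<^sup>2) * Re (a \<sigma> 0)\<bar> \<le> (\<bar>\<nu>\<bar> + 20) * \<eta> \<sigma>"
        unfolding abs_mult by (intro mult_mono) auto
      have "\<bar>Re (b \<sigma> 0)\<bar> \<le> \<eta> \<sigma>" using h abs_Re_le_cmod order_trans by blast
      then have "\<bar>(1 - t \<sigma> 0) * Re (b \<sigma> 0)\<bar> \<le> 1 * \<eta> \<sigma>" unfolding abs_mult using h t1 by (intro mult_mono) auto
      then have 4: "\<bar>4 * ((1 - t \<sigma> 0) * Re (b \<sigma> 0))\<bar> \<le> 4 * \<eta> \<sigma>" by simp
      have 5: "\<bar>Re (c \<sigma> 0)\<bar> \<le> \<eta> \<sigma>" using h abs_Re_le_cmod order_trans by blast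
      have z0: "\<bar>z \<sigma> 0\<bar> \<le> \<eta> \<sigma>" using initial_small(2)[OF s] .
      then have "(z \<sigma> 0)\<^sup>2 \<le> \<eta> \<sigma>" using h mult_left_le[of "\<eta> \<sigma>" "\<eta> \<sigma>"] power_mono[OF z0, of 2] by (simp add: power2_eq_square)
      then have 6: "\<bar>(28 * t \<sigma> 0 - 4) * (z \<sigma> 0)\<^sup>2\<bar> \<le> 32 * \<eta> \<sigma>" unfolding abs_mult using h t1 by (intro mult_mono) auto
      have "\<bar>\<Lambda> \<nu> \<sigma> 0\<bar> \<le> (12 + 2 * \<bar>\<nu>\<bar>) * \<eta> \<sigma> + 4 * \<eta> \<sigma> + 4 * \<eta> \<sigma> + (\<bar>\<nu>\<bar> + 20) * \<eta> \<sigma> + 4 * \<eta> \<sigma> + \<eta> \<sigma> + 32 * \<eta> \<sigma>"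
        unfolding \<Lambda>_def initial_small(3)[OF s] using 1 2 3 4 5 6 by linarith
      then show ?thesis by (simp add: J_def algebra_simps)
    qed
    have B: "\<bar>\<Sum>j<?n. \<Delta> \<sigma> j * err \<sigma> j\<bar> \<le> 3 * E * (r \<sigma>)^3"
    proof -
      have "\<bar>\<Sum>j<?n. \<Delta> \<sigma> j * err \<sigma> j\<bar> \<le> E * ((r \<sigma>)^3 + r \<sigma> * (r \<sigma>)\<^sup>2 + (r \<sigma>)\<^sup>2 * r \<sigma>)"
        using E r s by (intro sum_weighted) auto
      then show ?thesis by (simp add: power2_eq_square power3_eq_cube)
    qed
    have D: "(\<Sum>j<?n. \<Delta> \<sigma> j * (quad_coeff \<nu> \<sigma> j * e \<sigma> j - 4 * (z \<sigma> j)\<^sup>2 + err \<sigma> j)) = Quad \<nu> \<sigma> + (\<Sum>j<?n. \<Delta> \<sigma> j * err \<sigma> j)"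
      by (simp add: Quad_def sum.distrib distrib_left)
    have F: "\<bar>L \<nu> \<sigma> - \<Lambda> \<nu> \<sigma> ?n - 24 * (z \<sigma> ?n)\<^sup>2 + 16 * z \<sigma> ?n * \<zeta> \<sigma> ?n\<bar> \<le> M * \<eta> \<sigma>"
    proof -
      let ?t = "t \<sigma> ?n"
      note t = t_range[OF s order_refl]
      \<comment> \<open>The discrepancy at the end carries the factor 1 - t, which is at most \<eta>
        there.\<close>
      have e1: "L \<nu> \<sigma> - \<Lambda> \<nu> \<sigma> ?n - 24 * (z \<sigma> ?n)\<^sup>2 + 16 * z \<sigma> ?n * \<zeta> \<sigma> ?n =
        (1 - ?t) * ((4 + 2 * \<nu> - 8 * ?t - 4 * ?t\<^sup>2) + (9 - ?t) * Re (a \<sigma> ?n) + 4 * Re (b \<sigma> ?n) - 28 * (z \<sigma> ?n)\<^sup>2)"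
        by (simp add: L_def \<Lambda>_def power2_eq_square algebra_simps)
      have "\<bar>4 + 2 * \<nu> - 8 * ?t - 4 * ?t\<^sup>2\<bar> \<le> 16 + 2 * \<bar>\<nu>\<bar>"
      proof -
        have "?t\<^sup>2 \<le> ?t" using t by (simp add: power2_eq_square mult_left_le)
        then show ?thesis using t zero_le_power2[of ?t] by linarith
      qed
      moreover have "\<bar>(9 - ?t) * Re (a \<sigma> ?n)\<bar> \<le> 10 * Ka"
        unfolding abs_mult using t Ka(1) Ka(2)[OF s order_refl] abs_Re_le_cmod[of "a \<sigma> ?n"] by (intro mult_mono) auto
      moreover have "\<bar>4 * Re (b \<sigma> ?n)\<bar> \<le> 4 * Kb" using Kb(2)[OF s order_refl] abs_Re_le_cmod[of "b \<sigma> ?n"] by simp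
      moreover have "\<bar>z \<sigma> ?n\<bar> \<le> Ka" using Ka(1) Ka(2)[OF s order_refl] abs_Im_le_cmod[of "a \<sigma> ?n"] unfolding z_def by simp
      then have "\<bar>28 * (z \<sigma> ?n)\<^sup>2\<bar> \<le> 28 * Ka\<^sup>2" using power_mono[of "\<bar>z \<sigma> ?n\<bar>" Ka 2] by simp
      ultimately have "\<bar>(4 + 2 * \<nu> - 8 * ?t - 4 * ?t\<^sup>2) + (9 - ?t) * Re (a \<sigma> ?n) + 4 * Re (b \<sigma> ?n) - 28 * (z \<sigma> ?n)\<^sup>2\<bar> \<le> M"
        unfolding M_def by linarith
      then have "\<bar>L \<nu> \<sigma> - \<Lambda> \<nu> \<sigma> ?n - 24 * (z \<sigma> ?n)\<^sup>2 + 16 * z \<sigma> ?n * \<zeta> \<sigma> ?n\<bar> \<le> \<eta> \<sigma> * M"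
        unfolding e1 abs_mult using h t by (intro mult_mono) auto
      then show ?thesis by (simp add: mult.commute)
    qed
    have "\<bar>L \<nu> \<sigma> - (Quad \<nu> \<sigma> + 24 * (z \<sigma> ?n)\<^sup>2 - 16 * z \<sigma> ?n * \<zeta> \<sigma> ?n)\<bar>
       \<le> M * \<eta> \<sigma> + C1 * \<eta> \<sigma> + J * \<eta> \<sigma> + 3 * E * (r \<sigma>)^3"
      using A B C1(2)[OF s order_refl] F unfolding D by linarith
    also have "\<dots> \<le> K * \<eta> \<sigma> + K * (r \<sigma>)^3"
    proof -
      have "(M + C1 + J) * \<eta> \<sigma> \<le> K * \<eta> \<sigma>" using E h by (intro mult_right_mono) (auto simp: K_def)
      moreover have "3 * E * (r \<sigma>)^3 \<le> K * (r \<sigma>)^3" using C1 J0 M0 r by (intro mult_right_mono) (auto simp: K_def)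
      ultimately show ?thesis by (simp add: algebra_simps)
    qed
    finally show "\<bar>L \<nu> \<sigma> - (Quad \<nu> \<sigma> + 24 * (z \<sigma> ?n)\<^sup>2 - 16 * z \<sigma> ?n * \<zeta> \<sigma> ?n)\<bar> \<le> K * ((r \<sigma>)^3 + \<eta> \<sigma>)"
      by (simp add: algebra_simps)
  qed
qed

text \<open>The equation a' = 2 \<kappa> in real parts: Re a grows at the rate 2 - 2 e, and the
  total time is 1 up to O(\<eta>).\<close>

lemma energy_eq:
  "\<exists>K\<ge>0. \<forall>\<sigma>\<in>Sys. \<bar>(2 - Re (a \<sigma> (n \<sigma>))) - 2 * En \<sigma>\<bar> \<le> K * \<eta> \<sigma>"
proof -
  obtain C where C: "0 \<le> C" "\<And>\<sigma> k. \<sigma> \<in> Sys \<Longrightarrow> k \<le> n \<sigma> \<Longrightarrow> \<bar>\<alpha> \<sigma> k - \<alpha> \<sigma> 0 - (\<Sum>j<k. \<Delta> \<sigma> j * (- 2 * e \<sigma> j))\<bar> \<le> C * \<eta> \<sigma>"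
    using rate_telescope[OF rate_\<alpha>] by blast
  show ?thesis
  proof (intro exI[of _ "C + 5"] conjI ballI)
    fix \<sigma> assume s: "\<sigma> \<in> Sys"
    have "(\<Sum>j<n \<sigma>. \<Delta> \<sigma> j * (- 2 * e \<sigma> j)) = - 2 * En \<sigma>"
      by (simp add: En_def sum_distrib_left sum_negf mult_ac)
    then have "\<bar>\<alpha> \<sigma> (n \<sigma>) - \<alpha> \<sigma> 0 + 2 * En \<sigma>\<bar> \<le> C * \<eta> \<sigma>" using C(2)[OF s order_refl] by simp
    moreover have "\<bar>\<alpha> \<sigma> 0\<bar> \<le> 3 * \<eta> \<sigma>" using initial_small(1)[OF s] .
    moreover have e1: "(2 - Re (a \<sigma> (n \<sigma>))) - 2 * En \<sigma> = 2 * (1 - t \<sigma> (n \<sigma>)) - (\<alpha> \<sigma> (n \<sigma>) + 2 * En \<sigma>)"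
      by (simp add: \<alpha>_def)
    moreover have "0 \<le> 2 * (1 - t \<sigma> (n \<sigma>))" "2 * (1 - t \<sigma> (n \<sigma>)) \<le> 2 * \<eta> \<sigma>" using t_ends[OF s] by auto
    ultimately show "\<bar>(2 - Re (a \<sigma> (n \<sigma>))) - 2 * En \<sigma>\<bar> \<le> (C + 5) * \<eta> \<sigma>"
      unfolding e1 distrib_right by linarith
  qed (use C in simp)
qed


text \<open>Pointwise comparison with the Legendre coefficient; the truncation \<open>y / (1 + N e)\<close> of
  \<open>y = sin \<theta>\<close> is needed because the inequality fails for large \<open>\<theta>\<close>.\<close>

lemma quad_coeff_ge:
  assumes nu: "-1 < \<nu>" and s: "\<sigma> \<in> Sys" "k < n \<sigma>"
  defines "N \<equiv> 4 / (1 + \<nu>)"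
  shows "leg \<nu> (t \<sigma> k) * (y \<sigma> k / (1 + N * e \<sigma> k))\<^sup>2 \<le> quad_coeff \<nu> \<sigma> k * e \<sigma> k"
proof -
  note e = kappa_e_y[OF s]
  have s': "k \<le> n \<sigma>" using s by simp
  note t = t_range[OF s(1) s']
  define S where "S = 1 - t \<sigma> k"
  have S: "0 \<le> S" "S \<le> 1" using t by (auto simp: S_def)
  have N: "0 < N" using nu by (simp add: N_def)
  define E where "E = 1 + N * e \<sigma> k"
  have E: "1 \<le> E" using N e by (simp add: E_def)
  have l: "2 * leg \<nu> (t \<sigma> k) = 2 * \<nu> + 2 + 8 * (2 * S - 3/2)\<^sup>2"
    by (simp add: leg_def S_def power2_eq_square algebra_simps)
  have g: "quad_coeff \<nu> \<sigma> k = 2 * \<nu> + 2 + 8 * (S * (2 - e \<sigma> k) - 3/2)\<^sup>2" by (simp add: quad_coeff_def S_def)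
  have "S * (4 * S - 3) \<le> 1"
  proof (cases "4 * S \<le> 3")
    case True
    then have "S * (4 * S - 3) \<le> 0" using S by (intro mult_nonneg_nonpos) auto
    then show ?thesis by simp
  next
    case False
    then have "S * (4 * S - 3) \<le> 1 * 1" using S by (intro mult_mono) auto
    then show ?thesis by simp
  qed
  moreover have "0 \<le> S * (S * e \<sigma> k)" using S e by simp
  ultimately have "e \<sigma> k * (S * (4 * S - 3) - S * (S * e \<sigma> k)) \<le> e \<sigma> k * 1"
    using e by (intro mult_left_mono) auto
  moreover have "2 * leg \<nu> (t \<sigma> k) - quad_coeff \<nu> \<sigma> k = 8 * (e \<sigma> k * (S * (4 * S - 3) - S * (S * e \<sigma> k)))"
    unfolding l g by (simp add: power2_eq_square algebra_simps)
  ultimately have 1: "2 * leg \<nu> (t \<sigma> k) \<le> quad_coeff \<nu> \<sigma> k + 8 * e \<sigma> k" by linarith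
  have gp: "2 * (1 + \<nu>) \<le> quad_coeff \<nu> \<sigma> k" unfolding g by simp
  \<comment> \<open>Putting e = 0 inside the square of \<open>quad_coeff\<close> costs at most 8 e.
    As \<open>quad_coeff\<close> is at least 2 (1 + \<nu>), the factor 1 + N e with N = 4 / (1 +
    \<nu>) covers this loss.\<close>
  have "8 * e \<sigma> k = 2 * (1 + \<nu>) * (N * e \<sigma> k)" using nu by (simp add: N_def field_simps)
  also have "\<dots> \<le> quad_coeff \<nu> \<sigma> k * (N * e \<sigma> k)" using gp N e by (intro mult_right_mono) auto
  finally have 2: "2 * leg \<nu> (t \<sigma> k) \<le> quad_coeff \<nu> \<sigma> k * E" using 1 by (simp add: E_def algebra_simps)
  have lp: "0 < leg \<nu> (t \<sigma> k)" using leg_pos[OF nu] .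
  have "leg \<nu> (t \<sigma> k) * (y \<sigma> k / E)\<^sup>2 = leg \<nu> (t \<sigma> k) * (e \<sigma> k * (2 - e \<sigma> k)) / E\<^sup>2"
    using e(3) by (simp add: power_divide)
  also have "\<dots> \<le> leg \<nu> (t \<sigma> k) * (e \<sigma> k * 2) / E\<^sup>2"
    using lp e by (intro divide_right_mono mult_left_mono) auto
  also have "\<dots> = 2 * leg \<nu> (t \<sigma> k) * e \<sigma> k / E\<^sup>2" by simp
  also have "\<dots> \<le> quad_coeff \<nu> \<sigma> k * E * e \<sigma> k / E\<^sup>2"
    using 2 e by (intro divide_right_mono mult_right_mono) auto
  also have "\<dots> = quad_coeff \<nu> \<sigma> k * e \<sigma> k / E" using E by (simp add: power2_eq_square)
  also have "\<dots> \<le> quad_coeff \<nu> \<sigma> k * e \<sigma> k / 1"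
    using E e gp nu by (intro divide_left_mono) auto
  finally show ?thesis by (simp add: E_def)
qed

text \<open>By the mean value theorem and the Lipschitz bound the one-step error is quadratic in the
  step, hence at most K \<eta> times the step.\<close>

lemma rate_of_function:
  assumes dw: "\<And>s. s \<in> {0..1} \<Longrightarrow> (w has_real_derivative w' s) (at s within {0..1})"
    and lip: "K-lipschitz_on {0..1} w'"
  shows "rate (\<lambda>\<sigma> k. w (t \<sigma> k)) (\<lambda>\<sigma> k. w' (t \<sigma> k))"
proof -
  have K: "0 \<le> K" using lip by (rule lipschitz_on_nonneg)
  define C where "C = K + \<bar>w 0\<bar> + \<bar>w' 0\<bar> + K + \<bar>w' 0\<bar>"
  have w'b: "\<bar>w' s\<bar> \<le> \<bar>w' 0\<bar> + K" if "s \<in> {0..1}" for s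
  proof -
    have "\<bar>w' s - w' 0\<bar> \<le> K * \<bar>s - 0\<bar>" using lipschitz_onD[OF lip that, of 0] by (simp add: dist_real_def)
    also have "\<dots> \<le> K * 1" using that K by (intro mult_left_mono) auto
    finally show ?thesis by linarith
  qed
  have est: "\<bar>w y - w x - (y - x) * w' x\<bar> \<le> K * (y - x) * (y - x)" if "0 \<le> x" "x \<le> y" "y \<le> 1" for x y
  proof (cases "x = y")
    case False
    then have xy: "x < y" using that by simp
    have "\<exists>\<xi>. x < \<xi> \<and> \<xi> < y \<and> w y - w x = (y - x) * w' \<xi>"
    proof -
      have "continuous_on {x..y} w"
        by (rule continuous_on_subset[OF DERIV_continuous_on[OF dw]]) (use that in auto)
      moreover have "(w has_real_derivative w' s) (at s)" if "x < s" "s < y" for s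
      proof -
        have s: "0 < s" "s < 1" using that \<open>0 \<le> x\<close> \<open>y \<le> 1\<close> by auto
        then show ?thesis using dw[of s] at_within_interior[of s "{0..1}"] by (simp add: interior_atLeastAtMost_real)
      qed
      ultimately obtain l \<xi> where "x < \<xi>" "\<xi> < y" "(w has_real_derivative l) (at \<xi>)" "w y - w x = (y - x) * l"
        using MVT[OF xy] by (metis real_differentiable_def)
      then show ?thesis using \<open>\<And>s. x < s \<Longrightarrow> s < y \<Longrightarrow> (w has_real_derivative w' s) (at s)\<close> DERIV_unique by blast
    qed
    then obtain \<xi> where xi: "x < \<xi>" "\<xi> < y" "w y - w x = (y - x) * w' \<xi>" by blast
    have "\<bar>w' \<xi> - w' x\<bar> \<le> K * \<bar>\<xi> - x\<bar>" using lipschitz_onD[OF lip, of \<xi> x] xi that by (simp add: dist_real_def)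
    also have "\<dots> \<le> K * (y - x)" using xi K by (intro mult_left_mono) auto
    finally have "(y - x) * \<bar>w' \<xi> - w' x\<bar> \<le> (y - x) * (K * (y - x))" using xy by (intro mult_left_mono) auto
    moreover have "\<bar>w y - w x - (y - x) * w' x\<bar> = (y - x) * \<bar>w' \<xi> - w' x\<bar>"
      unfolding xi(3) right_diff_distrib[symmetric] abs_mult using xy by simp
    ultimately show ?thesis by (simp add: mult_ac)
  qed simp
  show ?thesis
  proof (rule rateI[of C])
    show "0 \<le> C" using K by (simp add: C_def)
    fix \<sigma> assume s: "\<sigma> \<in> Sys"
    note h = t_ends[OF s] eta[OF s]
    have "\<bar>w (t \<sigma> 0) - w 0 - (t \<sigma> 0 - 0) * w' 0\<bar> \<le> K * (t \<sigma> 0 - 0) * (t \<sigma> 0 - 0)" using est[of 0 "t \<sigma> 0"] h by simp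
    also have "\<dots> \<le> K * 1 * 1" using h K by (intro mult_mono) auto
    finally have "\<bar>w (t \<sigma> 0)\<bar> \<le> \<bar>w 0\<bar> + \<bar>t \<sigma> 0 * w' 0\<bar> + K" by simp
    moreover have "\<bar>t \<sigma> 0 * w' 0\<bar> \<le> 1 * \<bar>w' 0\<bar>" unfolding abs_mult using h by (intro mult_right_mono) auto
    ultimately show "\<bar>w (t \<sigma> 0)\<bar> \<le> C" using K by (simp add: C_def)
    fix k assume k: "k < n \<sigma>"
    then have k': "k \<le> n \<sigma>" "Suc k \<le> n \<sigma>" by auto
    show "\<bar>w' (t \<sigma> k)\<bar> \<le> C" using w'b[of "t \<sigma> k"] t_range[OF s k'(1)] K by (simp add: C_def)
    have "\<bar>w (t \<sigma> (Suc k)) - w (t \<sigma> k) - \<Delta> \<sigma> k * w' (t \<sigma> k)\<bar> \<le> K * \<Delta> \<sigma> k * \<Delta> \<sigma> k"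
      using est[of "t \<sigma> k" "t \<sigma> (Suc k)"] t_range[OF s k'(1)] t_range[OF s k'(2)] t_step(1)[OF s k] by (simp add: \<Delta>_def)
    also have "\<dots> \<le> K * \<eta> \<sigma> * \<Delta> \<sigma> k" using \<Delta>_nn[OF s k] \<Delta>_le[OF s k] K by (intro mult_right_mono mult_left_mono) auto
    also have "\<dots> \<le> C * \<eta> \<sigma> * \<Delta> \<sigma> k" using \<Delta>_nn[OF s k] h K by (intro mult_right_mono) (auto simp: C_def)
    finally show "\<bar>w (t \<sigma> (Suc k)) - w (t \<sigma> k) - \<Delta> \<sigma> k * w' (t \<sigma> k)\<bar> \<le> C * \<eta> \<sigma> * \<Delta> \<sigma> k" .
  qed
qed

text \<open>The discrete copy of \<open>form_value_ge\<close>, with the same shift Z = z + 2 A. In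
  the square the truncated velocity v replaces -y; the difference is at most N e and is multiplied
  by Z, which is of order r, so after summation it is of third order.\<close>

lemma certified_lower_bound:
  assumes c: "riccati_certificate \<nu> w w'" and nu: "-1 < \<nu>"
  shows "\<exists>K\<ge>0. \<forall>\<sigma>\<in>Sys. - K * ((r \<sigma>)^3 + \<eta> \<sigma>) \<le> L \<nu> \<sigma>"
proof -
  have dw: "\<And>s. s \<in> {0..1} \<Longrightarrow> (w has_real_derivative w' s) (at s within {0..1})"
    and ric: "\<And>s. s \<in> {0..1} \<Longrightarrow> 4 + (w s)\<^sup>2 / leg \<nu> s < w' s" and bd: "9 * w 1 < 40 + 4 * w 0"
    using c unfolding riccati_certificate_def by auto
  obtain M where lip: "M-lipschitz_on {0..1} w'" using c unfolding riccati_certificate_def by auto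
  note rw = rate_of_function[OF dw lip]
  obtain W where W: "W-lipschitz_on {0..1} w"
    using lipschitz_of_C1[OF dw] lipschitz_on_continuous_on[OF lip] by blast
  have W0: "0 \<le> W" using W by (rule lipschitz_on_nonneg)
  define Wb where "Wb = \<bar>w 0\<bar> + W"
  have wb: "\<bar>w s\<bar> \<le> Wb" if "s \<in> {0..1}" for s
  proof -
    have "\<bar>w s - w 0\<bar> \<le> W * \<bar>s - 0\<bar>" using lipschitz_onD[OF W that, of 0] by (simp add: dist_real_def)
    also have "\<dots> \<le> W * 1" using that W0 by (intro mult_left_mono) auto
    finally show ?thesis by (simp add: Wb_def)
  qed
  obtain Cz where Cz: "0 \<le> Cz" "\<And>\<sigma> k. \<sigma> \<in> Sys \<Longrightarrow> k \<le> n \<sigma> \<Longrightarrow> \<bar>z \<sigma> k\<bar> \<le> Cz * r \<sigma>"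
    using small_z by (rule smallE) blast
  obtain E where E: "0 \<le> E" "\<And>\<sigma>. \<sigma> \<in> Sys \<Longrightarrow> \<bar>L \<nu> \<sigma> - (Quad \<nu> \<sigma> + 24 * (z \<sigma> (n \<sigma>))\<^sup>2 - 16 * z \<sigma> (n \<sigma>) * \<zeta> \<sigma> (n \<sigma>))\<bar> \<le> E * ((r \<sigma>)^3 + \<eta> \<sigma>)"
    using coefficient_expansion by blast
  define A where "A \<sigma> = z \<sigma> (n \<sigma>)" for \<sigma>
  define Z where "Z \<sigma> k = z \<sigma> k + 2 * A \<sigma>" for \<sigma> k
  have Ab: "\<bar>A \<sigma>\<bar> \<le> 2 * Cz" if "\<sigma> \<in> Sys" for \<sigma>
    using Cz(2)[OF that order_refl] mult_left_mono[OF En_bounds(4)[OF that] Cz(1)] unfolding A_def by linarith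
  have rA: "rate (\<lambda>\<sigma> k. A \<sigma>) (\<lambda>\<sigma> k. 0)" by (rule rate_const[OF Ab])
  define \<Theta> where "\<Theta> \<sigma> k = w (t \<sigma> k) * (Z \<sigma> k)\<^sup>2 - 16 * (A \<sigma> * \<zeta> \<sigma> k) - 16 * ((A \<sigma>)\<^sup>2 * t \<sigma> k)" for \<sigma> k
  define \<Theta>' where "\<Theta>' \<sigma> k = w' (t \<sigma> k) * (Z \<sigma> k)\<^sup>2 - 2 * w (t \<sigma> k) * Z \<sigma> k * y \<sigma> k
      - 16 * A \<sigma> * z \<sigma> k - 16 * (A \<sigma>)\<^sup>2" for \<sigma> k
  have "rate \<Theta> \<Theta>'"
    by (rule rate_cong[OF rate_diff[OF rate_diff[OF rate_mult[OF rw rate_power2[OF rate_add[OF rate_a(2) rate_cmult[OF rA, of 2]]]]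
         rate_cmult[OF rate_mult[OF rA rate_\<zeta>], of 16]] rate_cmult[OF rate_mult[OF rate_power2[OF rA] rate_t], of 16]]])
       (auto simp: \<Theta>_def \<Theta>'_def Z_def)
  then obtain T where T: "0 \<le> T" "\<And>\<sigma> k. \<sigma> \<in> Sys \<Longrightarrow> k \<le> n \<sigma> \<Longrightarrow> \<bar>\<Theta> \<sigma> k - \<Theta> \<sigma> 0 - (\<Sum>j<k. \<Delta> \<sigma> j * \<Theta>' \<sigma> j)\<bar> \<le> T * \<eta> \<sigma>"
    using rate_telescope by blast
  define N where "N = 4 / (1 + \<nu>)"
  have N: "0 < N" using nu by (simp add: N_def)
  define G where "G = 6 * Wb * Cz * N"
  have Wb0: "0 \<le> Wb" using W0 by (simp add: Wb_def)
  have G0: "0 \<le> G" using Wb0 Cz N by (simp add: G_def)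
  define B where "B = 36 * Cz\<^sup>2 * W + (20 * Cz + 4) * Wb + 64 * Cz\<^sup>2 + 64 * Cz\<^sup>2 + 16 * Cz\<^sup>2 * W"
  have B0: "0 \<le> B" using Wb0 Cz W0 by (simp add: B_def)
  show ?thesis
  proof (intro exI[of _ "E + T + G + B"] conjI ballI)
    show "0 \<le> E + T + G + B" using E T G0 B0 by simp
    fix \<sigma> assume s: "\<sigma> \<in> Sys"
    let ?n = "n \<sigma>"
    note rr = En_bounds(3,4)[OF s] note h = eta[OF s] t_ends[OF s]
    have pt: "- G * (r \<sigma> * e \<sigma> k) \<le> quad_coeff \<nu> \<sigma> k * e \<sigma> k - 4 * (z \<sigma> k)\<^sup>2 + \<Theta>' \<sigma> k" if k: "k < n \<sigma>" for k
    proof -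
      have k': "k \<le> n \<sigma>" using k by simp
      note e = kappa_e_y[OF s k]
      have tk: "t \<sigma> k \<in> {0..1}" using t_range[OF s k'] by simp
      define v where "v = - (y \<sigma> k / (1 + N * e \<sigma> k))"
      have 1: "leg \<nu> (t \<sigma> k) * v\<^sup>2 \<le> quad_coeff \<nu> \<sigma> k * e \<sigma> k"
        using quad_coeff_ge[OF nu s k] by (simp add: v_def N_def)
      have d: "1 \<le> 1 + N * e \<sigma> k" using N e by simp
      have "y \<sigma> k + v = y \<sigma> k * (N * e \<sigma> k) / (1 + N * e \<sigma> k)"
        unfolding v_def using d by (simp add: field_simps)
      then have "\<bar>y \<sigma> k + v\<bar> = \<bar>y \<sigma> k\<bar> * (N * e \<sigma> k) / (1 + N * e \<sigma> k)"
        using d N e by (simp add: abs_mult)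
      also have "\<dots> \<le> \<bar>y \<sigma> k\<bar> * (N * e \<sigma> k) / 1" using d N e by (intro divide_left_mono) (auto intro: add_pos_nonneg)
      also have "\<dots> \<le> 1 * (N * e \<sigma> k)" unfolding div_by_1 using e N by (intro mult_right_mono) auto
      finally have v: "\<bar>y \<sigma> k + v\<bar> \<le> N * e \<sigma> k" by simp
      have Zb: "\<bar>Z \<sigma> k\<bar> \<le> 3 * (Cz * r \<sigma>)"
        using Cz(2)[OF s k'] Cz(2)[OF s order_refl] unfolding Z_def A_def by linarith
      have "\<bar>2 * w (t \<sigma> k) * Z \<sigma> k * (y \<sigma> k + v)\<bar> \<le> 2 * Wb * (3 * (Cz * r \<sigma>)) * (N * e \<sigma> k)"
        unfolding abs_mult using wb[OF tk] Zb v Wb0 Cz(1) rr by (intro mult_mono) auto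
      then have 2: "- G * (r \<sigma> * e \<sigma> k) \<le> - (2 * w (t \<sigma> k) * Z \<sigma> k * (y \<sigma> k + v))"
        by (simp add: G_def algebra_simps)
      have 3: "0 \<le> leg \<nu> (t \<sigma> k) * v\<^sup>2 - 4 * (Z \<sigma> k)\<^sup>2 + w' (t \<sigma> k) * (Z \<sigma> k)\<^sup>2 + 2 * w (t \<sigma> k) * Z \<sigma> k * v"
        by (rule riccati_square[OF nu]) (use ric[OF tk] in simp)
      have "quad_coeff \<nu> \<sigma> k * e \<sigma> k - 4 * (z \<sigma> k)\<^sup>2 + \<Theta>' \<sigma> k
        = quad_coeff \<nu> \<sigma> k * e \<sigma> k - 4 * (Z \<sigma> k)\<^sup>2 + w' (t \<sigma> k) * (Z \<sigma> k)\<^sup>2 + 2 * w (t \<sigma> k) * Z \<sigma> k * v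
          - 2 * w (t \<sigma> k) * Z \<sigma> k * (y \<sigma> k + v)"
        by (simp add: \<Theta>'_def Z_def power2_eq_square algebra_simps)
      then show ?thesis using 1 2 3 by linarith
    qed
    have Q: "- G * (r \<sigma>)^3 \<le> Quad \<nu> \<sigma> + (\<Sum>j<?n. \<Delta> \<sigma> j * \<Theta>' \<sigma> j)"
    proof -
      have "- G * (r \<sigma>)^3 = - (G * r \<sigma>) * (r \<sigma>)\<^sup>2" by (simp add: power2_eq_square power3_eq_cube)
      also have "\<dots> \<le> - (G * r \<sigma>) * En \<sigma>"
        using En_bounds(6)[OF s] G0 rr by (intro mult_left_mono_neg) auto
      also have "\<dots> = (\<Sum>j<?n. \<Delta> \<sigma> j * (- G * (r \<sigma> * e \<sigma> j)))"
        by (simp add: En_def sum_distrib_left sum_negf mult_ac)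
      also have "\<dots> \<le> (\<Sum>j<?n. \<Delta> \<sigma> j * (quad_coeff \<nu> \<sigma> j * e \<sigma> j - 4 * (z \<sigma> j)\<^sup>2 + \<Theta>' \<sigma> j))"
        using pt \<Delta>_nn[OF s] by (intro sum_mono mult_left_mono) auto
      also have "\<dots> = Quad \<nu> \<sigma> + (\<Sum>j<?n. \<Delta> \<sigma> j * \<Theta>' \<sigma> j)"
        by (simp add: Quad_def sum.distrib distrib_left)
      finally show ?thesis .
    qed
    have tn: "t \<sigma> ?n \<in> {0..1}" "t \<sigma> 0 \<in> {0..1}" using t_range[OF s] by auto
    have w1: "\<bar>w (t \<sigma> ?n) - w 1\<bar> \<le> W * \<eta> \<sigma>" and w0: "\<bar>w (t \<sigma> 0) - w 0\<bar> \<le> W * \<eta> \<sigma>"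
    proof -
      have "\<bar>w (t \<sigma> ?n) - w 1\<bar> \<le> W * \<bar>t \<sigma> ?n - 1\<bar>" using lipschitz_onD[OF W tn(1), of 1] by (simp add: dist_real_def)
      also have "\<dots> \<le> W * \<eta> \<sigma>" using h W0 by (intro mult_left_mono) auto
      finally show "\<bar>w (t \<sigma> ?n) - w 1\<bar> \<le> W * \<eta> \<sigma>" .
      have "\<bar>w (t \<sigma> 0) - w 0\<bar> \<le> W * \<bar>t \<sigma> 0 - 0\<bar>" using lipschitz_onD[OF W tn(2), of 0] by (simp add: dist_real_def)
      also have "\<dots> \<le> W * \<eta> \<sigma>" using h W0 by (intro mult_left_mono) auto
      finally show "\<bar>w (t \<sigma> 0) - w 0\<bar> \<le> W * \<eta> \<sigma>" .
    qed
    let ?A = "A \<sigma>"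
    have A2: "?A\<^sup>2 \<le> 4 * Cz\<^sup>2" using power_mono[OF Ab[OF s], of 2] by (simp add: power_mult_distrib)
    \<comment> \<open>Here the boundary condition of the certificate enters: Z is exactly 3 A at the
      last index, and at the first one it is 2 A up to a start value of size \<eta>.\<close>
    have en: "\<Theta> \<sigma> ?n - \<Theta> \<sigma> 0 + 16 * ?A * \<zeta> \<sigma> ?n - 24 * ?A\<^sup>2
       \<le> - ?A\<^sup>2 * (40 + 4 * w 0 - 9 * w 1) + B * \<eta> \<sigma>"
    proof -
      have z0: "\<bar>z \<sigma> 0\<bar> \<le> \<eta> \<sigma>" using initial_small(2)[OF s] .
      have e1: "\<Theta> \<sigma> ?n - \<Theta> \<sigma> 0 + 16 * ?A * \<zeta> \<sigma> ?n - 24 * ?A\<^sup>2 =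
        - ?A\<^sup>2 * (40 + 4 * w 0 - 9 * w 1) + (9 * ?A\<^sup>2 * (w (t \<sigma> ?n) - w 1) - w (t \<sigma> 0) * (z \<sigma> 0 * (z \<sigma> 0 + 4 * ?A))
         + 16 * ?A\<^sup>2 * (1 - t \<sigma> ?n) + 16 * ?A\<^sup>2 * t \<sigma> 0 - 4 * ?A\<^sup>2 * (w (t \<sigma> 0) - w 0))"
        unfolding \<Theta>_def Z_def initial_small(3)[OF s] by (simp add: A_def power2_eq_square algebra_simps)
      have "\<bar>9 * ?A\<^sup>2 * (w (t \<sigma> ?n) - w 1)\<bar> \<le> 9 * (4 * Cz\<^sup>2) * (W * \<eta> \<sigma>)"
        unfolding abs_mult using A2 w1 by (intro mult_mono) auto
      moreover have "\<bar>w (t \<sigma> 0) * (z \<sigma> 0 * (z \<sigma> 0 + 4 * ?A))\<bar> \<le> Wb * (\<eta> \<sigma> * (4 + 20 * Cz))"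
      proof -
        have "\<bar>z \<sigma> 0 + 4 * ?A\<bar> \<le> 4 + 20 * Cz" using z0 h Ab[OF s] Cz(1) by linarith
        then show ?thesis unfolding abs_mult using wb[OF tn(2)] z0 Wb0 h by (intro mult_mono) auto
      qed
      moreover have "\<bar>16 * ?A\<^sup>2 * (1 - t \<sigma> ?n)\<bar> \<le> 16 * (4 * Cz\<^sup>2) * \<eta> \<sigma>"
        unfolding abs_mult using A2 h by (intro mult_mono) auto
      moreover have "\<bar>16 * ?A\<^sup>2 * t \<sigma> 0\<bar> \<le> 16 * (4 * Cz\<^sup>2) * \<eta> \<sigma>"
        unfolding abs_mult using A2 h by (intro mult_mono) auto
      moreover have "\<bar>4 * ?A\<^sup>2 * (w (t \<sigma> 0) - w 0)\<bar> \<le> 4 * (4 * Cz\<^sup>2) * (W * \<eta> \<sigma>)"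
        unfolding abs_mult using A2 w0 by (intro mult_mono) auto
      moreover have "9 * (4 * Cz\<^sup>2) * (W * \<eta> \<sigma>) + Wb * (\<eta> \<sigma> * (4 + 20 * Cz)) + 16 * (4 * Cz\<^sup>2) * \<eta> \<sigma>
        + 16 * (4 * Cz\<^sup>2) * \<eta> \<sigma> + 4 * (4 * Cz\<^sup>2) * (W * \<eta> \<sigma>) = B * \<eta> \<sigma>"
        by (simp add: B_def algebra_simps)
      ultimately show ?thesis unfolding e1 by linarith
    qed
    have nn: "0 \<le> ?A\<^sup>2 * (40 + 4 * w 0 - 9 * w 1)" using bd by simp
    have "- G * (r \<sigma>)^3 - T * \<eta> \<sigma> - B * \<eta> \<sigma> - E * ((r \<sigma>)^3 + \<eta> \<sigma>) \<le> L \<nu> \<sigma>"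
      using Q T(2)[OF s order_refl] en nn E(2)[OF s] unfolding A_def[symmetric] by linarith
    moreover have "- (E + T + G + B) * ((r \<sigma>)^3 + \<eta> \<sigma>) \<le> - G * (r \<sigma>)^3 - T * \<eta> \<sigma> - B * \<eta> \<sigma> - E * ((r \<sigma>)^3 + \<eta> \<sigma>)"
    proof -
      have "0 \<le> T * (r \<sigma>)^3" "0 \<le> B * (r \<sigma>)^3" "0 \<le> G * \<eta> \<sigma>" using T B0 G0 h rr by auto
      then show ?thesis by (simp add: algebra_simps)
    qed
    ultimately show "- (E + T + G + B) * ((r \<sigma>)^3 + \<eta> \<sigma>) \<le> L \<nu> \<sigma>" by linarith
  qed
qed

end

section \<open>Koebe's osculation\<close>

definition disc_embedding :: "(complex \<Rightarrow> complex) \<Rightarrow> bool" where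
  "disc_embedding \<phi> \<longleftrightarrow> \<phi> holomorphic_on ball 0 1 \<and> inj_on \<phi> (ball 0 1) \<and> \<phi> ` ball 0 1 \<subseteq> ball 0 1 \<and> \<phi> 0 = 0"

text \<open>The image is simply connected, so with the circle it contains the whole disc (a missing
  point would have winding number 1). The Schwarz lemma for the rescaled inverse then bounds the
  derivative.\<close>

lemma circle_covered_imp_deriv_ge:
  assumes \<phi>: "disc_embedding \<phi>" and R: "0 < R" and cov: "sphere 0 R \<subseteq> \<phi> ` ball 0 1"
  shows "R \<le> cmod (deriv \<phi> 0)"
proof -
  have hol: "\<phi> holomorphic_on ball 0 1" and inj: "inj_on \<phi> (ball 0 1)" and \<phi>0: "\<phi> 0 = 0"
    using \<phi> unfolding disc_embedding_def by auto
  let ?S = "\<phi> ` ball 0 1"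
  have op: "open ?S" using open_mapping_thm3[OF hol _ inj] by simp
  obtain g where g: "g holomorphic_on ?S" "\<And>z. z \<in> ball 0 1 \<Longrightarrow> deriv \<phi> z * deriv g (\<phi> z) = 1"
    "\<And>z. z \<in> ball 0 1 \<Longrightarrow> g (\<phi> z) = z"
    using holomorphic_has_inverse[OF hol _ inj] by auto
  have "?S homeomorphic ball (0::complex) 1"
    unfolding homeomorphic_def homeomorphism_def
    by (rule exI[of _ g], rule exI[of _ \<phi>])
       (use g hol in \<open>auto simp: image_image holomorphic_on_imp_continuous_on\<close>)
  then have sc: "simply_connected ?S"
    using homeomorphic_simply_connected_eq convex_imp_simply_connected convex_ball by blast
  have ball: "ball 0 R \<subseteq> ?S"
  proof
    fix w :: complex assume w: "w \<in> ball 0 R"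
    show "w \<in> ?S"
    proof (rule ccontr)
      assume n: "w \<notin> ?S"
      have "winding_number (circlepath 0 R) w = 0"
        using sc[unfolded simply_connected_eq_winding_number_zero[OF op]] n cov R by auto
      moreover have "winding_number (circlepath 0 R) w = 1" using w by (intro winding_number_circlepath) simp
      ultimately show False by simp
    qed
  qed
  define h where "h = (\<lambda>z. g (of_real R * z))"
  have mem: "of_real R * z \<in> ?S" if "cmod z < 1" for z
    using ball that R by (auto simp: norm_mult)
  have "h holomorphic_on ball 0 1"
    unfolding h_def using mem
    by (intro holomorphic_on_compose_gen[OF _ g(1), unfolded o_def] holomorphic_intros) auto
  moreover have "h 0 = 0" using g(3)[of 0] \<phi>0 by (simp add: h_def)
  moreover have "cmod (h z) < 1" if z: "cmod z < 1" for z
  proof -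
    obtain x where "x \<in> ball 0 1" "of_real R * z = \<phi> x" using mem[OF z] by auto
    then show ?thesis using g(3)[of x] by (simp add: h_def)
  qed
  ultimately have "cmod (deriv h 0) \<le> 1" using Schwarz_Lemma(2)[of h 0] by simp
  moreover have "deriv h 0 = deriv g 0 * of_real R"
  proof (rule DERIV_imp_deriv)
    have "0 \<in> ?S" using mem[of 0] by simp
    then have "(g has_field_derivative deriv g 0) (at (of_real R * 0))"
      using g(1) op holomorphic_derivI by simp
    then have "(g \<circ> (\<lambda>z. of_real R * z) has_field_derivative deriv g 0 * of_real R) (at 0)"
      by (rule DERIV_chain) (auto intro!: derivative_eq_intros)
    then show "(h has_field_derivative deriv g 0 * of_real R) (at 0)" by (simp add: h_def o_def)
  qed
  moreover have d: "deriv \<phi> 0 * deriv g 0 = 1" using g(2)[of 0] \<phi>0 by simp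
  ultimately have "cmod (deriv g 0) * R \<le> 1" using R by (simp add: norm_mult)
  then have "cmod (deriv \<phi> 0) * (cmod (deriv g 0) * R) \<le> cmod (deriv \<phi> 0) * 1" by (intro mult_left_mono) auto
  moreover have "cmod (deriv \<phi> 0) * cmod (deriv g 0) = 1" using d by (metis norm_mult norm_one)
  ultimately show ?thesis by (simp add: mult.assoc[symmetric])
qed

text \<open>The sign is opposite to that of \<open>Moebius_function\<close>; it makes the map an
  involution that exchanges 0 and \<open>w\<close>.\<close>

lemma disc_involution:
  fixes w z :: complex
  assumes "cmod w < 1" "cmod z < 1"
  defines "T \<equiv> \<lambda>w z. (w - z) / (1 - cnj w * z)"
  shows "cmod (T w z) < 1" "T w (T w z) = z" "1 - cnj w * z \<noteq> 0"
proof -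
  have "cmod (cnj w * z) < 1 * 1" unfolding norm_mult using assms(1,2) by (intro mult_strict_mono') auto
  then show n: "1 - cnj w * z \<noteq> 0" by auto
  have "T w z = - Moebius_function 0 w z" by (simp add: T_def Moebius_function_simple minus_divide_left)
  then show "cmod (T w z) < 1" using Moebius_function_norm_lt_1[OF assms(1,2), of 0] by simp
  have "cmod (cnj w * w) < 1 * 1" unfolding norm_mult using assms(1) by (intro mult_strict_mono') auto
  then have n2: "1 - cnj w * w \<noteq> 0" by auto
  have "w - T w z = z * (1 - cnj w * w) / (1 - cnj w * z)"
    unfolding T_def using n by (simp add: field_simps)
  moreover have "1 - cnj w * T w z = (1 - cnj w * w) / (1 - cnj w * z)"
    unfolding T_def using n by (simp add: field_simps)
  ultimately show "T w (T w z) = z"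
    using n n2 unfolding T_def by simp
qed

text \<open>Koebe's osculation: a value omitted on the circle \<open>|w| = R\<close> gives a factorization through a
  Blaschke product of degree two, which fixes the origin with derivative close to 1.\<close>

lemma osculation:
  assumes \<phi>: "disc_embedding \<phi>" and R: "0 < R" "R < 1" and d: "deriv \<phi> 0 = of_real \<rho>" "0 < \<rho>" "\<rho> < R"
  defines "b \<equiv> 2 * sqrt R / (1 + R)"
  obtains \<psi> \<kappa> where "disc_embedding \<psi>" "deriv \<psi> 0 = of_real (\<rho> / b)" "cmod \<kappa> = 1"
    "\<And>z. z \<in> ball 0 1 \<Longrightarrow> \<phi> z = \<psi> z * (of_real b - \<kappa> * \<psi> z) / (1 - of_real b * \<kappa> * \<psi> z)"
proof -
  have hol: "\<phi> holomorphic_on ball 0 1" and inj: "inj_on \<phi> (ball 0 1)" and \<phi>0: "\<phi> 0 = 0"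
    and im: "\<phi> ` ball 0 1 \<subseteq> ball 0 1"
    using \<phi> unfolding disc_embedding_def by auto
  have dis: "cmod (\<phi> z) < 1" if "cmod z < 1" for z using im that by (auto simp: image_subset_iff)
  \<comment> \<open>As \<rho> < R, some point w of the circle is omitted. Moving w to 0 leaves a map
    without zeros on the disc, which has a holomorphic square root.\<close>
  have "\<not> sphere 0 R \<subseteq> \<phi> ` ball 0 1"
    using circle_covered_imp_deriv_ge[OF \<phi> R(1)] d by auto
  then obtain w where "w \<in> sphere 0 R" and w': "w \<notin> \<phi> ` ball 0 1" by blast
  then have w: "cmod w = R" "w \<notin> \<phi> ` ball 0 1" by auto
  define T where "T = (\<lambda>w z. (w - z) / (1 - cnj w * z) :: complex)"
  have inv: "cmod (T u v) < 1" "T u (T u v) = v" "1 - cnj u * v \<noteq> 0" if "cmod u < 1" "cmod v < 1" for u v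
    using disc_involution[OF that] unfolding T_def by auto
  have w1: "cmod w < 1" using w R by simp
  define f where "f = (\<lambda>z. T w (\<phi> z))"
  have "f holomorphic_on ball 0 1"
    unfolding f_def T_def using hol inv(3)[OF w1 dis] by (intro holomorphic_intros) auto
  moreover have "f z \<noteq> 0" if "z \<in> ball 0 1" for z
    unfolding f_def T_def using inv(3)[OF w1 dis] that w(2) by auto
  ultimately obtain h where h: "h holomorphic_on ball 0 1" "\<And>z. z \<in> ball 0 1 \<Longrightarrow> f z = (h z)\<^sup>2"
    using contractible_imp_holomorphic_sqrt[of f "ball 0 1"] convex_imp_contractible[OF convex_ball] by blast
  have h1: "cmod (h z) < 1" if "cmod z < 1" for z
  proof -
    have "cmod ((h z)\<^sup>2) < 1" using h(2)[of z] inv(1)[OF w1 dis[OF that]] that by (simp add: f_def)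
    then show ?thesis by (simp add: norm_power power_less_one_iff)
  qed
  define q where "q = h 0"
  have q1: "cmod q < 1" using h1 by (simp add: q_def)
  have q2: "q\<^sup>2 = w" using h(2)[of 0] by (simp add: q_def f_def T_def \<phi>0)
  have qR: "(cmod q)\<^sup>2 = R" using q2 w(1) by (metis norm_power)
  have qs: "cmod q = sqrt R" using qR by (metis norm_ge_zero real_sqrt_unique)
  have q0: "q \<noteq> 0" using qR R by auto
  have qq: "cnj q * q = of_real R" using qR complex_norm_square[of q] by (simp add: mult.commute)
  \<comment> \<open>The rotation that makes the derivative of the new map real and positive.\<close>
  define \<epsilon> where "\<epsilon> = q / of_real (cmod q)"
  have eps: "cmod \<epsilon> = 1" "cnj \<epsilon> * \<epsilon> = 1"
  proof -
    show 1: "cmod \<epsilon> = 1" using q0 by (simp add: \<epsilon>_def norm_divide)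
    show "cnj \<epsilon> * \<epsilon> = 1" using complex_norm_square[of \<epsilon>] 1 by (simp add: mult.commute)
  qed
  have q\<epsilon>: "q = of_real (sqrt R) * \<epsilon>" using q0 qs R by (simp add: \<epsilon>_def)
  \<comment> \<open>The square root has value q at 0, and \<open>T q\<close> brings it back to the
    origin. Reversing the three maps expresses \<phi> through a Blaschke product of degree
    two.\<close>
  define \<zeta> where "\<zeta> = (\<lambda>z. T q (h z))"
  define \<psi> where "\<psi> = (\<lambda>z. \<zeta> z * \<epsilon>)"
  have zeta1: "cmod (\<zeta> z) < 1" if "cmod z < 1" for z using inv(1)[OF q1 h1[OF that]] by (simp add: \<zeta>_def)
  have psi1: "cmod (\<psi> z) < 1" if "cmod z < 1" for z using zeta1[OF that] eps(1) by (simp add: \<psi>_def norm_mult)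
  have hz: "h z = T q (\<zeta> z)" if "cmod z < 1" for z using inv(2)[OF q1 h1[OF that]] by (simp add: \<zeta>_def)
  have phi_eq: "\<phi> z = T w ((T q (\<zeta> z))\<^sup>2)" if "cmod z < 1" for z
    using inv(2)[OF w1 dis[OF that]] h(2)[of z] hz[OF that] that by (simp add: f_def)
  have b: "0 < b" "b < 1"
  proof -
    show "0 < b" using R by (simp add: b_def)
    have "0 < (1 - sqrt R)\<^sup>2" using R by simp
    then have "2 * sqrt R < 1 + R" using R by (simp add: power2_eq_square algebra_simps)
    then show "b < 1" using R by (simp add: b_def)
  qed
  define \<kappa> where "\<kappa> = (cnj \<epsilon>)\<^sup>2"
  have k1: "cmod \<kappa> = 1" using eps(1) by (simp add: \<kappa>_def norm_power)
  have formula: "\<phi> z = \<psi> z * (of_real b - \<kappa> * \<psi> z) / (1 - of_real b * \<kappa> * \<psi> z)" if z: "cmod z < 1" for z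
  proof -
    define Q where "Q = cnj q"
    define x where "x = \<zeta> z"
    define N where "N = 1 - Q * x"
    define r where "r = (of_real R :: complex)"
    have qQ: "q * Q = r" using qq by (simp add: Q_def r_def mult.commute)
    have x1: "cmod x < 1" using zeta1[OF z] by (simp add: x_def)
    have N0: "N \<noteq> 0" using inv(3)[OF q1 x1] by (simp add: N_def Q_def)
    have "1 - r = of_real (1 - R)" "1 + r = of_real (1 + R)" by (simp_all add: r_def)
    then have r0: "1 - r \<noteq> 0" and r1: "1 + r \<noteq> 0" using R by (simp_all only: of_real_eq_0_iff)
    have D0: "1 + r - 2 * Q * x \<noteq> 0"
    proof
      assume "1 + r - 2 * Q * x = 0"
      then have "cmod (of_real (1 + R)) = cmod (2 * Q * x)" by (simp add: r_def)
      then have "1 + R = 2 * sqrt R * cmod x" using R by (simp add: norm_mult Q_def qs del: of_real_add)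
      also have "\<dots> \<le> 2 * sqrt R" using x1 R by (simp add: mult_left_le)
      also have "\<dots> < 1 + R" using b(2) R by (simp add: b_def)
      finally show False by simp
    qed
    have e1: "q\<^sup>2 * N\<^sup>2 - (q - x)\<^sup>2 = (1 - r) * (x * (2 * q - (1 + r) * x))"
      unfolding N_def qQ[symmetric] by (simp add: power2_eq_square algebra_simps)
    have e2: "N\<^sup>2 - Q\<^sup>2 * (q - x)\<^sup>2 = (1 - r) * (1 + r - 2 * Q * x)"
      unfolding N_def qQ[symmetric] by (simp add: power2_eq_square algebra_simps)
    have "\<phi> z = (w - ((q - x) / N)\<^sup>2) / (1 - cnj w * ((q - x) / N)\<^sup>2)"
      using phi_eq[OF z] by (simp add: T_def x_def N_def Q_def)
    also have "\<dots> = (q\<^sup>2 * N\<^sup>2 - (q - x)\<^sup>2) / (N\<^sup>2 - Q\<^sup>2 * (q - x)\<^sup>2)"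
    proof -
      have "w - ((q - x) / N)\<^sup>2 = (q\<^sup>2 * N\<^sup>2 - (q - x)\<^sup>2) / N\<^sup>2"
        unfolding power_divide q2 using N0 by (simp add: field_simps)
      moreover have "1 - cnj w * ((q - x) / N)\<^sup>2 = (N\<^sup>2 - Q\<^sup>2 * (q - x)\<^sup>2) / N\<^sup>2"
        unfolding power_divide q2[symmetric] Q_def using N0 by (simp add: field_simps)
      ultimately show ?thesis using N0 by simp
    qed
    also have "\<dots> = x * (2 * q - (1 + r) * x) / (1 + r - 2 * Q * x)" unfolding e1 e2 using r0 by simp
    also have "\<dots> = \<psi> z * (of_real b - \<kappa> * \<psi> z) / (1 - of_real b * \<kappa> * \<psi> z)"
    proof -
      have x: "x = \<psi> z * cnj \<epsilon>" using eps(2) by (simp add: \<psi>_def x_def mult.assoc mult.commute[of \<epsilon>])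
      have br: "of_real b = 2 * of_real (sqrt R) / (1 + r)" by (simp add: b_def r_def)
      have q': "q = of_real (sqrt R) * \<epsilon>" by (rule q\<epsilon>)
      have Q': "Q = of_real (sqrt R) * cnj \<epsilon>" unfolding Q_def q\<epsilon> by simp
      have n: "x * (2 * q - (1 + r) * x) = (1 + r) * (\<psi> z * (of_real b - \<kappa> * \<psi> z))"
      proof -
        have "x * (2 * q - (1 + r) * x) = 2 * of_real (sqrt R) * (cnj \<epsilon> * \<epsilon>) * \<psi> z - (1 + r) * (\<kappa> * (\<psi> z)\<^sup>2)"
          unfolding x q' \<kappa>_def by (simp add: power2_eq_square algebra_simps)
        also have "\<dots> = (1 + r) * (\<psi> z * (of_real b - \<kappa> * \<psi> z))"
          unfolding eps(2) br using r1 by (simp add: power2_eq_square field_simps)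
        finally show ?thesis .
      qed
      have d: "1 + r - 2 * Q * x = (1 + r) * (1 - of_real b * \<kappa> * \<psi> z)"
        unfolding x Q' br \<kappa>_def using r1 by (simp add: power2_eq_square field_simps)
      show ?thesis unfolding n d using r1 by simp
    qed
    finally show ?thesis .
  qed
  have holpsi: "\<psi> holomorphic_on ball 0 1"
    unfolding \<psi>_def \<zeta>_def T_def using h(1) inv(3)[OF q1 h1] by (intro holomorphic_intros) auto
  have psi0: "\<psi> 0 = 0" by (simp add: \<psi>_def \<zeta>_def T_def q_def)
  have "inj_on \<psi> (ball 0 1)"
  proof (rule inj_onI)
    fix x y :: complex assume xy: "x \<in> ball 0 1" "y \<in> ball 0 1" "\<psi> x = \<psi> y"
    then have "\<phi> x = \<phi> y" using formula[of x] formula[of y] by simp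
    then show "x = y" using inj xy by (auto dest: inj_onD)
  qed
  then have emb: "disc_embedding \<psi>" using holpsi psi0 psi1 unfolding disc_embedding_def by auto
  have "(\<psi> has_field_derivative deriv \<psi> 0) (at 0)"
    using holpsi by (intro holomorphic_derivI[of _ "ball 0 1"]) auto
  then have "((\<lambda>z. \<psi> z * (of_real b - \<kappa> * \<psi> z) / (1 - of_real b * \<kappa> * \<psi> z)) has_field_derivative
     deriv \<psi> 0 * of_real b) (at 0)"
    by (auto intro!: derivative_eq_intros simp: psi0)
  then have "(\<phi> has_field_derivative deriv \<psi> 0 * of_real b) (at 0)"
    by (rule has_field_derivative_transform_within_open[of _ _ _ "ball 0 1"]) (auto simp: formula)
  then have "deriv \<psi> 0 * of_real b = of_real \<rho>" using d(1) DERIV_imp_deriv by metis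
  then have "deriv \<psi> 0 = of_real (\<rho> / b)" using b by (simp add: field_simps)
  then show ?thesis using that[OF emb _ k1] formula by auto
qed

text \<open>One rational step serves two purposes. With l = \<kappa>, m = b \<kappa>, d = 1 - b it
  is the factor of Koebe's osculation; with l = m it is an Euler step of the Loewner equation with
  driving value close to -l.\<close>

lemma fps_loewner_step:
  fixes F :: "complex fps" and l m d :: complex
  assumes F0: "fps_nth F 0 = 0"
  defines "G \<equiv> F * (1 - fps_const d * ((1 + fps_const l * F) * inverse (1 - fps_const m * F)))"
  shows "fps_nth G 1 = (1 - d) * fps_nth F 1"
    "fps_nth G 2 = (1 - d) * fps_nth F 2 - d * (l + m) * (fps_nth F 1)\<^sup>2"
    "fps_nth G 3 = (1 - d) * fps_nth F 3 - d * (l + m) * (2 * fps_nth F 1 * fps_nth F 2 + m * (fps_nth F 1)^3)"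
    "fps_nth G 4 = (1 - d) * fps_nth F 4 - d * (l + m) * (2 * fps_nth F 1 * fps_nth F 3 + (fps_nth F 2)\<^sup>2
        + 3 * m * (fps_nth F 1)\<^sup>2 * fps_nth F 2 + m\<^sup>2 * (fps_nth F 1)^4)"
proof -
  define E where "E = fps_shift 1 F"
  have FE: "F = fps_X * E" using F0 by (intro fps_ext) (simp add: E_def)
  define H where "H = inverse (1 - fps_const m * F)"
  have H: "(1 - fps_const m * F) * H = 1" unfolding H_def using F0 by (intro inverse_mult_eq_1') simp
  have H1: "H = 1 + fps_const m * F * H" using H by (simp add: algebra_simps)
  \<comment> \<open>Three terms of the geometric series suffice: after multiplication by F^2 the
    tail starts at order 5.\<close>
  have H4: "H = 1 + fps_const m * F + (fps_const m)\<^sup>2 * F\<^sup>2 + (fps_const m)^3 * F^3 * H"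
  proof -
    have "H = 1 + fps_const m * F * (1 + fps_const m * F * (1 + fps_const m * F * H))" using H1 by metis
    then show ?thesis by (simp add: power2_eq_square power3_eq_cube algebra_simps)
  qed
  have "(1 + fps_const l * F) * H = (1 - fps_const m * F) * H + (fps_const l + fps_const m) * (F * H)"
    by (simp add: algebra_simps flip: fps_const_add)
  also have "\<dots> = 1 + fps_const (l + m) * (F * H)" unfolding H by (simp only: fps_const_add)
  finally have "G = F * (1 - fps_const d * (1 + fps_const (l + m) * (F * H)))" unfolding G_def H_def by simp
  also have "\<dots> = fps_const (1 - d) * F - fps_const (d * (l + m)) * (F\<^sup>2 * H)"
    by (simp add: power2_eq_square algebra_simps flip: fps_const_sub fps_const_mult)
  also have "F\<^sup>2 * H = F\<^sup>2 + fps_const m * F^3 + fps_const (m\<^sup>2) * F^4 + F^5 * (fps_const (m^3) * H)"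
    by (subst H4) (simp add: numeral_eq_Suc algebra_simps flip: fps_const_mult)
  also have "F\<^sup>2 = fps_X^2 * E\<^sup>2" by (simp add: FE power_mult_distrib)
  also have "F^3 = fps_X^3 * E^3" by (simp add: FE power_mult_distrib)
  also have "F^4 = fps_X^4 * E^4" by (simp add: FE power_mult_distrib)
  also have "F^5 * (fps_const (m^3) * H) = fps_X^5 * (E^5 * (fps_const (m^3) * H))" by (simp add: FE power_mult_distrib)
  finally have G: "G = fps_const (1 - d) * F - fps_const (d * (l + m)) * (fps_X^2 * E\<^sup>2 + fps_const m * (fps_X^3 * E^3)
     + fps_const (m\<^sup>2) * (fps_X^4 * E^4) + fps_X^5 * (E^5 * (fps_const (m^3) * H)))" .
  have E: "fps_nth E k = fps_nth F (Suc k)" for k by (simp add: E_def)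
  have E2: "fps_nth (E\<^sup>2) 0 = (fps_nth F 1)\<^sup>2" "fps_nth (E\<^sup>2) 1 = 2 * fps_nth F 1 * fps_nth F 2"
    "fps_nth (E\<^sup>2) 2 = 2 * fps_nth F 1 * fps_nth F 3 + (fps_nth F 2)\<^sup>2"
    by (simp_all add: power2_eq_square fps_mult_nth E numeral_eq_Suc algebra_simps)
  have E3: "fps_nth (E^3) 0 = (fps_nth F 1)^3" "fps_nth (E^3) 1 = 3 * (fps_nth F 1)\<^sup>2 * fps_nth F 2"
    by (simp_all add: power2_eq_square power3_eq_cube fps_mult_nth E numeral_eq_Suc algebra_simps)
  have E4: "fps_nth (E^4) 0 = (fps_nth F 1)^4" by (simp add: fps_power_zeroth E)
  have nth: "fps_nth G n = (1 - d) * fps_nth F n - d * (l + m) * ((if n < 2 then 0 else fps_nth (E\<^sup>2) (n - 2))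
     + m * (if n < 3 then 0 else fps_nth (E^3) (n - 3)) + m\<^sup>2 * (if n < 4 then 0 else fps_nth (E^4) (n - 4))
     + (if n < 5 then 0 else fps_nth (E^5 * (fps_const (m^3) * H)) (n - 5)))" for n
    by (subst G) (simp only: fps_sub_nth fps_add_nth fps_mult_left_const_nth fps_X_power_mult_nth)
  show "fps_nth G 1 = (1 - d) * fps_nth F 1" by (subst nth) simp
  show "fps_nth G 2 = (1 - d) * fps_nth F 2 - d * (l + m) * (fps_nth F 1)\<^sup>2"
    by (subst nth) (simp add: E2[simplified])
  show "fps_nth G 3 = (1 - d) * fps_nth F 3 - d * (l + m) * (2 * fps_nth F 1 * fps_nth F 2 + m * (fps_nth F 1)^3)"
    by (subst nth) (simp add: E2[simplified] E3[simplified])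
  show "fps_nth G 4 = (1 - d) * fps_nth F 4 - d * (l + m) * (2 * fps_nth F 1 * fps_nth F 3 + (fps_nth F 2)\<^sup>2
        + 3 * m * (fps_nth F 1)\<^sup>2 * fps_nth F 2 + m\<^sup>2 * (fps_nth F 1)^4)"
    by (subst nth) (simp add: E2[simplified] E3[simplified] E4[simplified])
qed

text \<open>When l and m are near -\<kappa>, the exact change of the normalized coefficients is the
  Euler step driven by \<kappa>, up to a relative error of order \<delta> + \<epsilon>. The bounds 5
  and 45 are 1 + 4 t and 1 + 44 t at t = 1; the last two estimates propagate these invariants. The
  factor 300 is a crude common constant.\<close>

lemma loewner_step_error:
  fixes \<kappa> l m A B C :: complex and \<delta> s \<epsilon> :: real
  assumes k: "cmod \<kappa> = 1" and lm: "cmod l \<le> 1" "cmod m \<le> 1" "cmod (l + \<kappa>) \<le> \<epsilon>" "cmod (m + \<kappa>) \<le> \<epsilon>"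
    and d: "0 \<le> \<delta>" "\<delta> \<le> 1/2" and s: "0 \<le> s" "s \<le> 1" and AB: "cmod A \<le> 5" "cmod B \<le> 45"
  defines "\<Delta> \<equiv> \<delta> * s" and "h \<equiv> of_real (\<delta> * s / (1 - \<delta>)) :: complex" and "e \<equiv> 300 * (2 * \<delta> + \<epsilon>)"
  shows "cmod ((A - h * (l + m)) - A - of_real \<Delta> * (2 * \<kappa>)) \<le> e * \<Delta>"
    "cmod ((B - h * (l + m) * (2 * A + m * of_real s)) - B - of_real \<Delta> * (4 * \<kappa> * A - 2 * \<kappa>\<^sup>2 * of_real s)) \<le> e * \<Delta>"
    "cmod ((C - h * (l + m) * (2 * B + A\<^sup>2 + 3 * m * of_real s * A + m\<^sup>2 * of_real (s\<^sup>2))) - C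
       - of_real \<Delta> * (2 * \<kappa> * (2 * B + A\<^sup>2) - 6 * \<kappa>\<^sup>2 * of_real s * A + 2 * \<kappa>^3 * of_real (s\<^sup>2))) \<le> e * \<Delta>"
    "cmod (A - h * (l + m)) \<le> cmod A + 4 * \<Delta>"
    "cmod (B - h * (l + m) * (2 * A + m * of_real s)) \<le> cmod B + 44 * \<Delta>"
proof -
  \<comment> \<open>This factor stems from dividing by the new derivative, which is 1 - \<delta>
    times the old one.\<close>
  define \<theta> where "\<theta> = 1 / (1 - \<delta>)"
  have th: "1 \<le> \<theta>" "\<theta> \<le> 2" "\<theta> - 1 \<le> 2 * \<delta>"
    using d mult_left_mono[of "2 * \<delta>" 1 \<delta>] by (auto simp: \<theta>_def field_simps)
  define M where "M = - of_real \<theta> * (l + m) / 2"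
  define p where "p = - m"
  define \<epsilon>' where "\<epsilon>' = 2 * \<delta> + \<epsilon>"
  have e0: "0 \<le> \<epsilon>" using lm(3) norm_ge_zero order_trans by blast
  have D0: "0 \<le> \<Delta>" using d s by (simp add: \<Delta>_def)
  have hM: "- h * (l + m) = of_real \<Delta> * (2 * M)"
  proof -
    have "h = of_real \<Delta> * of_real \<theta>" by (simp add: h_def \<Delta>_def \<theta>_def)
    then show ?thesis by (simp add: M_def)
  qed
  have lmk: "cmod (- (l + m) / 2 - \<kappa>) \<le> \<epsilon>"
  proof -
    have "- (l + m) / 2 - \<kappa> = - (l + \<kappa>) / 2 + - (m + \<kappa>) / 2" by (simp add: field_simps)
    then have "cmod (- (l + m) / 2 - \<kappa>) \<le> cmod (l + \<kappa>) / 2 + cmod (m + \<kappa>) / 2"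
      by (metis norm_triangle_ineq norm_divide norm_minus_cancel norm_numeral)
    then show ?thesis using lm by linarith
  qed
  have lm2: "cmod (- (l + m) / 2) \<le> 1"
    using norm_triangle_ineq[of l m] lm by (simp only: norm_divide norm_minus_cancel norm_numeral)
  have Mk: "cmod (M - \<kappa>) \<le> \<epsilon>'"
  proof -
    have "M - \<kappa> = of_real (\<theta> - 1) * (- (l + m) / 2) + (- (l + m) / 2 - \<kappa>)" by (simp add: M_def field_simps)
    then have "cmod (M - \<kappa>) \<le> cmod (of_real (\<theta> - 1) * (- (l + m) / 2)) + cmod (- (l + m) / 2 - \<kappa>)"
      by (metis norm_triangle_ineq)
    also have "cmod (of_real (\<theta> - 1) * (- (l + m) / 2)) \<le> (\<theta> - 1) * 1"
      unfolding norm_mult norm_of_real using lm2 th by (intro mult_mono) auto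
    finally show ?thesis using lmk th by (simp add: \<epsilon>'_def)
  qed
  have M2: "cmod M \<le> 2"
  proof -
    have "M = of_real \<theta> * (- (l + m) / 2)" by (simp add: M_def algebra_simps)
    then have "cmod M = \<theta> * cmod (- (l + m) / 2)" using th by (simp only: norm_mult norm_of_real)
    also have "\<dots> \<le> 2 * 1" using lm2 th by (intro mult_mono) auto
    finally show ?thesis by simp
  qed
  have pk: "cmod (\<kappa> - p) \<le> \<epsilon>" using lm(4) by (simp add: p_def add.commute)
  have p1: "cmod p \<le> 1" using lm by (simp add: p_def)
  have ps: "cmod (p * of_real s) \<le> 1"
    unfolding norm_mult using p1 s mult_mono[of "cmod p" 1 s 1] by simp
  have A2: "cmod (2 * A - p * of_real s) \<le> 11"
    using norm_triangle_ineq4[of "2 * A" "p * of_real s"] ps AB by (simp add: norm_mult)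
  have D: "cmod (of_real \<Delta> * x) \<le> e * \<Delta>" if "cmod x \<le> 300 * \<epsilon>'" for x
    using that D0 by (simp add: norm_mult e_def \<epsilon>'_def mult.commute mult_left_mono)
  have ee: "0 \<le> \<epsilon>'" "\<epsilon> \<le> \<epsilon>'" using e0 d by (auto simp: \<epsilon>'_def)
  show "cmod ((A - h * (l + m)) - A - of_real \<Delta> * (2 * \<kappa>)) \<le> e * \<Delta>"
  proof -
    have "(A - h * (l + m)) - A - of_real \<Delta> * (2 * \<kappa>) = of_real \<Delta> * (2 * (M - \<kappa>))"
      using hM by (simp add: algebra_simps)
    moreover have "cmod (2 * (M - \<kappa>)) \<le> 300 * \<epsilon>'" unfolding norm_mult using Mk ee by simp
    ultimately show ?thesis using D[of "2 * (M - \<kappa>)"] by (simp only:)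
  qed
  show "cmod ((B - h * (l + m) * (2 * A + m * of_real s)) - B - of_real \<Delta> * (4 * \<kappa> * A - 2 * \<kappa>\<^sup>2 * of_real s)) \<le> e * \<Delta>"
  proof -
    let ?X = "2 * (M - \<kappa>) * (2 * A - p * of_real s) + 2 * \<kappa> * ((\<kappa> - p) * of_real s)"
    have "(B - h * (l + m) * (2 * A + m * of_real s)) - B - of_real \<Delta> * (4 * \<kappa> * A - 2 * \<kappa>\<^sup>2 * of_real s)
      = (- h * (l + m)) * (2 * A - p * of_real s) - of_real \<Delta> * (4 * \<kappa> * A - 2 * \<kappa>\<^sup>2 * of_real s)"
      by (simp add: p_def algebra_simps)
    also have "\<dots> = of_real \<Delta> * ?X" unfolding hM by (simp add: power2_eq_square algebra_simps)
    finally have *: "(B - h * (l + m) * (2 * A + m * of_real s)) - B - of_real \<Delta> * (4 * \<kappa> * A - 2 * \<kappa>\<^sup>2 * of_real s) = of_real \<Delta> * ?X" .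
    have "cmod (2 * (M - \<kappa>) * (2 * A - p * of_real s)) \<le> 2 * \<epsilon>' * 11"
      unfolding norm_mult using Mk A2 ee by (intro mult_mono) auto
    moreover have "cmod (2 * \<kappa> * ((\<kappa> - p) * of_real s)) \<le> 2 * 1 * (\<epsilon> * 1)"
      unfolding norm_mult using k pk s e0 by (intro mult_mono) auto
    ultimately have "cmod ?X \<le> 300 * \<epsilon>'" using norm_triangle_ineq[of "2 * (M - \<kappa>) * (2 * A - p * of_real s)" "2 * \<kappa> * ((\<kappa> - p) * of_real s)"] ee
      by linarith
    then show ?thesis unfolding * by (rule D)
  qed
  show "cmod ((C - h * (l + m) * (2 * B + A\<^sup>2 + 3 * m * of_real s * A + m\<^sup>2 * of_real (s\<^sup>2))) - C
       - of_real \<Delta> * (2 * \<kappa> * (2 * B + A\<^sup>2) - 6 * \<kappa>\<^sup>2 * of_real s * A + 2 * \<kappa>^3 * of_real (s\<^sup>2))) \<le> e * \<Delta>"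
  proof -
    let ?Y = "2 * B + A\<^sup>2 - 3 * p * of_real s * A + p\<^sup>2 * of_real (s\<^sup>2)"
    let ?Z = "(\<kappa> + p) * of_real (s\<^sup>2) - 3 * of_real s * A"
    let ?X = "2 * (M - \<kappa>) * ?Y + - 2 * \<kappa> * ((\<kappa> - p) * ?Z)"
    have "(C - h * (l + m) * (2 * B + A\<^sup>2 + 3 * m * of_real s * A + m\<^sup>2 * of_real (s\<^sup>2))) - C
       - of_real \<Delta> * (2 * \<kappa> * (2 * B + A\<^sup>2) - 6 * \<kappa>\<^sup>2 * of_real s * A + 2 * \<kappa>^3 * of_real (s\<^sup>2))
      = (- h * (l + m)) * ?Y - of_real \<Delta> * (2 * \<kappa> * (2 * B + A\<^sup>2) - 6 * \<kappa>\<^sup>2 * of_real s * A + 2 * \<kappa>^3 * of_real (s\<^sup>2))"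
      by (simp add: p_def algebra_simps)
    also have "\<dots> = of_real \<Delta> * ?X" unfolding hM by (simp add: power2_eq_square power3_eq_cube algebra_simps)
    finally have *: "(C - h * (l + m) * (2 * B + A\<^sup>2 + 3 * m * of_real s * A + m\<^sup>2 * of_real (s\<^sup>2))) - C
       - of_real \<Delta> * (2 * \<kappa> * (2 * B + A\<^sup>2) - 6 * \<kappa>\<^sup>2 * of_real s * A + 2 * \<kappa>^3 * of_real (s\<^sup>2)) = of_real \<Delta> * ?X" .
    have s2: "0 \<le> s\<^sup>2" "s\<^sup>2 \<le> 1" using s by (auto simp: power_le_one)
    have y1: "cmod (2 * B + A\<^sup>2) \<le> 115"
    proof -
      have "cmod (2 * B + A\<^sup>2) \<le> 2 * cmod B + (cmod A)\<^sup>2"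
        by (rule order_trans[OF norm_triangle_ineq]) (simp add: norm_mult norm_power)
      also have "(cmod A)\<^sup>2 \<le> 5\<^sup>2" using AB by (intro power_mono) auto
      finally show ?thesis using AB by simp
    qed
    have y2: "cmod (3 * p * of_real s * A) \<le> 3 * 1 * 1 * 5"
      unfolding norm_mult using p1 s AB by (intro mult_mono) auto
    have y3: "cmod (p\<^sup>2 * of_real (s\<^sup>2)) \<le> 1 * 1"
      unfolding norm_mult norm_power norm_of_real using p1 s2 s by (intro mult_mono) (auto simp: power_le_one)
    have Y: "cmod ?Y \<le> 131"
      using norm_triangle_ineq[of "2 * B + A\<^sup>2 - 3 * p * of_real s * A" "p\<^sup>2 * of_real (s\<^sup>2)"]
        norm_triangle_ineq4[of "2 * B + A\<^sup>2" "3 * p * of_real s * A"] y1 y2 y3 by linarith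
    have z1: "cmod ((\<kappa> + p) * of_real (s\<^sup>2)) \<le> 2 * 1"
      unfolding norm_mult norm_of_real using norm_triangle_ineq[of \<kappa> p] k p1 s2 by (intro mult_mono) auto
    have z2: "cmod (3 * of_real s * A) \<le> 3 * 1 * 5" unfolding norm_mult using s AB by (intro mult_mono) auto
    have Z: "cmod ?Z \<le> 17" using norm_triangle_ineq4[of "(\<kappa> + p) * of_real (s\<^sup>2)" "3 * of_real s * A"] z1 z2 by linarith
    have x1: "cmod (2 * (M - \<kappa>) * ?Y) \<le> 2 * \<epsilon>' * 131"
      unfolding norm_mult[of _ ?Y] norm_mult[of 2 "M - \<kappa>"] using Mk Y ee by (intro mult_mono) auto
    have x2: "cmod (- 2 * \<kappa> * ((\<kappa> - p) * ?Z)) \<le> 2 * 1 * (\<epsilon> * 17)"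
      unfolding norm_mult[of _ "(\<kappa> - p) * ?Z"] norm_mult[of _ ?Z] norm_mult[of _ \<kappa>]
      using k pk Z e0 by (intro mult_mono) auto
    have "cmod ?X \<le> 300 * \<epsilon>'"
      using norm_triangle_ineq[of "2 * (M - \<kappa>) * ?Y" "- 2 * \<kappa> * ((\<kappa> - p) * ?Z)"] x1 x2 ee by linarith
    then show ?thesis unfolding * by (rule D)
  qed
  show "cmod (A - h * (l + m)) \<le> cmod A + 4 * \<Delta>"
  proof -
    have "cmod (of_real \<Delta> * (2 * M)) \<le> \<Delta> * (2 * 2)"
      unfolding norm_mult norm_of_real using M2 D0 by (intro mult_mono) auto
    then show ?thesis using norm_triangle_ineq[of A "- h * (l + m)"] unfolding hM by (simp flip: hM)
  qed
  show "cmod (B - h * (l + m) * (2 * A + m * of_real s)) \<le> cmod B + 44 * \<Delta>"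
  proof -
    have "cmod (of_real \<Delta> * (2 * M) * (2 * A - p * of_real s)) \<le> \<Delta> * (2 * 2) * 11"
      unfolding norm_mult[of _ "2 * A - _"] norm_mult[of "of_real \<Delta>"] norm_mult[of 2 M] norm_of_real
      using M2 D0 A2 by (intro mult_mono) auto
    moreover have eq: "B - h * (l + m) * (2 * A + m * of_real s) = B + of_real \<Delta> * (2 * M) * (2 * A - p * of_real s)"
      unfolding hM[symmetric] p_def by (simp add: algebra_simps)
    ultimately show ?thesis unfolding eq
      using norm_triangle_ineq[of B "of_real \<Delta> * (2 * M) * (2 * A - p * of_real s)"] by linarith
  qed
qed

text \<open>The function \<phi>(z) / z maps into the half-plane Re < 1 unless \<rho> = 1, and has
  value \<rho> at 0. The Schwarz lemma for the half-plane bounds its deviation from \<rho> by 2 (1 -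
  \<rho>) on |z| = 1/2, and Cauchy's inequality on that circle gives the coefficients.\<close>

lemma near_identity_coeffs:
  assumes \<phi>: "disc_embedding \<phi>" and d: "deriv \<phi> 0 = of_real \<rho>" "0 < \<rho>" and j: "2 \<le> j"
  shows "\<rho> \<le> 1" "cmod (taylor_coeff \<phi> j) \<le> 2 ^ j * (1 - \<rho>)"
proof -
  have hol: "\<phi> holomorphic_on ball 0 1" and \<phi>0: "\<phi> 0 = 0" and im: "\<phi> ` ball 0 1 \<subseteq> ball 0 1"
    using \<phi> unfolding disc_embedding_def by auto
  have dis: "cmod (\<phi> z) < 1" if "cmod z < 1" for z using im that by (auto simp: image_subset_iff)
  note S = Schwarz_Lemma[OF hol \<phi>0 dis]
  show r1: "\<rho> \<le> 1" using S(2)[of 0] d by simp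
  have key: "cmod (\<phi> z - of_real \<rho> * z) \<le> 1 - \<rho>" if z: "cmod z = 1/2" for z
  proof (cases "\<rho> = 1")
    case True
    then have "cmod (deriv \<phi> 0) = 1" using d by simp
    then obtain \<alpha> where al: "\<And>z. cmod z < 1 \<Longrightarrow> \<phi> z = \<alpha> * z" using S(3)[of 0] by auto
    have "((\<lambda>z. \<alpha> * z) has_field_derivative \<alpha>) (at 0)" by (auto intro!: derivative_eq_intros)
    then have "(\<phi> has_field_derivative \<alpha>) (at 0)"
      by (rule has_field_derivative_transform_within_open[of _ _ _ "ball 0 1"]) (auto simp: al)
    then have "\<alpha> = 1" using d True DERIV_imp_deriv by fastforce
    then show ?thesis using al[of z] z True by simp
  next
    case False
    then have r: "\<rho> < 1" using r1 by simp
    obtain q where q: "q holomorphic_on ball 0 1" "\<And>z. cmod z < 1 \<Longrightarrow> \<phi> z = z * q z" "deriv \<phi> 0 = q 0"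
      using Schwarz3[OF hol \<phi>0] by blast
    have q0: "q 0 = of_real \<rho>" using q(3) d by simp
    have Re1: "Re (q x) < 1" if x: "cmod x < 1" for x
    proof (cases "x = 0")
      case True then show ?thesis using q0 r by simp
    next
      case False
      have "cmod x * cmod (q x) \<le> cmod x * 1" using S(1)[of x] q(2)[OF x] x by (simp add: norm_mult)
      then have le: "cmod (q x) \<le> 1" using False by (simp add: mult_le_cancel_left)
      show ?thesis
      proof (rule ccontr)
        assume "\<not> Re (q x) < 1"
        then have "cmod (q x) = 1" using le abs_Re_le_cmod[of "q x"] by linarith
        then have "cmod (\<phi> x) = cmod x" using q(2)[OF x] by (simp add: norm_mult)
        then obtain \<alpha> where al: "\<And>z. cmod z < 1 \<Longrightarrow> \<phi> z = \<alpha> * z" "cmod \<alpha> = 1" using S(3)[of 0] False x by auto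
        have "((\<lambda>z. \<alpha> * z) has_field_derivative \<alpha>) (at 0)" by (auto intro!: derivative_eq_intros)
        then have "(\<phi> has_field_derivative \<alpha>) (at 0)"
          by (rule has_field_derivative_transform_within_open[of _ _ _ "ball 0 1"]) (auto simp: al)
        then have "\<alpha> = of_real \<rho>" using d DERIV_imp_deriv by fastforce
        then show False using al(2) d r by simp
      qed
    qed
    \<comment> \<open>The Moebius map of the half-plane onto the disc that sends \<rho> to 0; 2 -
      \<rho> is the mirror image of \<rho> in the line Re = 1.\<close>
    define T where "T = (\<lambda>z. (of_real \<rho> - q z) / (of_real (2 - \<rho>) - q z))"
    have den: "of_real (2 - \<rho>) - q x \<noteq> 0" if "cmod x < 1" for x
    proof
      assume "of_real (2 - \<rho>) - q x = 0"
      then have "Re (q x) = 2 - \<rho>" by (simp add: complex_eq_iff)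
      then show False using Re1[OF that] r by simp
    qed
    have T1: "cmod (T x) < 1" if x: "cmod x < 1" for x
    proof -
      have "(cmod (of_real (2 - \<rho>) - q x))\<^sup>2 - (cmod (of_real \<rho> - q x))\<^sup>2 = 4 * (1 - \<rho>) * (1 - Re (q x))"
        unfolding cmod_power2 by (simp add: power2_eq_square algebra_simps)
      also have "\<dots> > 0" using r Re1[OF x] by simp
      finally have "(cmod (of_real \<rho> - q x))\<^sup>2 < (cmod (of_real (2 - \<rho>) - q x))\<^sup>2" by simp
      then have "cmod (of_real \<rho> - q x) < cmod (of_real (2 - \<rho>) - q x)" by (rule power_less_imp_less_base) simp
      then show ?thesis using den[OF x] by (simp add: T_def norm_divide)
    qed
    have holT: "T holomorphic_on ball 0 1" unfolding T_def using q(1) den by (intro holomorphic_intros) auto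
    have T0: "T 0 = 0" by (simp add: T_def q0)
    have z1: "cmod z < 1" using z by simp
    have "cmod (T z) \<le> 1/2" using Schwarz_Lemma(1)[OF holT T0 T1 z1] z by simp
    then have "cmod (of_real \<rho> - q z) \<le> 1/2 * cmod (of_real (2 - \<rho>) - q z)"
      using den[OF z1] by (simp add: T_def norm_divide field_simps)
    also have "cmod (of_real (2 - \<rho>) - q z) \<le> 2 * (1 - \<rho>) + cmod (of_real \<rho> - q z)"
    proof -
      have "of_real (2 - \<rho>) - q z = of_real (2 * (1 - \<rho>)) + (of_real \<rho> - q z)" by simp
      then show ?thesis using norm_triangle_ineq[of "of_real (2 * (1 - \<rho>))" "of_real \<rho> - q z"] r
        by (metis abs_of_nonneg diff_ge_0_iff_ge less_imp_le mult_nonneg_nonneg norm_of_real zero_le_numeral)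
    qed
    finally have "cmod (of_real \<rho> - q z) \<le> 2 * (1 - \<rho>)" by simp
    moreover have "\<phi> z - of_real \<rho> * z = - z * (of_real \<rho> - q z)" using q(2)[OF z1] by (simp add: algebra_simps)
    then have "cmod (\<phi> z - of_real \<rho> * z) = 1/2 * cmod (of_real \<rho> - q z)"
      by (simp only: norm_mult norm_minus_cancel z)
    ultimately show ?thesis by simp
  qed
  define G where "G = (\<lambda>z. \<phi> z - of_real \<rho> * z)"
  have holG: "G holomorphic_on ball 0 1" unfolding G_def using hol by (intro holomorphic_intros)
  have hG: "G holomorphic_on cball 0 (1/2)" by (rule holomorphic_on_subset[OF holG]) auto
  have "cmod ((deriv ^^ j) G 0) \<le> fact j * (1 - \<rho>) / (1/2) ^ j"
  proof (rule Cauchy_inequality)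
    show "G holomorphic_on ball 0 (1/2)" using hG by (rule holomorphic_on_subset) auto
    show "continuous_on (cball 0 (1/2)) G" using hG holomorphic_on_imp_continuous_on by blast
    show "cmod (G x) \<le> 1 - \<rho>" if "cmod (0 - x) = 1/2" for x using key[of x] that by (simp add: G_def)
  qed simp
  then have 1: "cmod (taylor_coeff G j) \<le> 2 ^ j * (1 - \<rho>)"
    by (simp add: fps_expansion_def norm_divide field_simps power_one_over)
  have "\<phi> has_fps_expansion fps_expansion \<phi> 0" using hol by (intro has_fps_expansion_fps_expansion[of "ball 0 1"]) auto
  then have "G has_fps_expansion fps_expansion \<phi> 0 - fps_const (of_real \<rho>) * fps_X"
    unfolding G_def by (intro fps_expansion_intros)
  then have "fps_expansion G 0 = fps_expansion \<phi> 0 - fps_const (of_real \<rho>) * fps_X" by (rule fps_expansion_eqI)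
  then have "taylor_coeff G j = taylor_coeff \<phi> j" using j by simp
  then show "cmod (taylor_coeff \<phi> j) \<le> 2 ^ j * (1 - \<rho>)" using 1 by simp
qed

section \<open>Discrete chains built from univalent maps\<close>

datatype loewner_system = LSys (s_eta: real) (s_n: nat) (s_t: "nat \<Rightarrow> real") (s_kap: "nat \<Rightarrow> complex")
  (s_a: "nat \<Rightarrow> complex") (s_b: "nat \<Rightarrow> complex") (s_c: "nat \<Rightarrow> complex")

text \<open>The conditions of \<open>loewner_family\<close> that persist when a step is appended;
  that the final time comes within \<eta> of 1 is added only in \<open>admissible\<close>. All
  admissible systems form a single family, so the constants of its lemmas depend neither on the
  number of steps nor on \<eta>.\<close>

definition loewner_chain ::
    "real \<Rightarrow> nat \<Rightarrow> (nat \<Rightarrow> real) \<Rightarrow> (nat \<Rightarrow> complex) \<Rightarrow> (nat \<Rightarrow> complex) \<Rightarrow> (nat \<Rightarrow> complex) \<Rightarrow> (nat \<Rightarrow> complex) \<Rightarrow> bool" where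
  "loewner_chain \<eta> n t \<kappa> a b c \<longleftrightarrow> 0 \<le> t 0 \<and> t 0 \<le> \<eta> \<and> cmod (a 0) \<le> \<eta> \<and> cmod (b 0) \<le> \<eta> \<and> cmod (c 0) \<le> \<eta> \<and>
     (\<forall>k<n. t k \<le> t (Suc k) \<and> t (Suc k) - t k \<le> \<eta> \<and> cmod (\<kappa> k) = 1 \<and>
       cmod (a (Suc k) - a k - of_real (t (Suc k) - t k) * (2 * \<kappa> k)) \<le> \<eta> * (t (Suc k) - t k) \<and>
       cmod (b (Suc k) - b k - of_real (t (Suc k) - t k) *
         (4 * \<kappa> k * a k - 2 * (\<kappa> k)\<^sup>2 * of_real (1 - t k))) \<le> \<eta> * (t (Suc k) - t k) \<and>
       cmod (c (Suc k) - c k - of_real (t (Suc k) - t k) *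
         (2 * \<kappa> k * (2 * b k + (a k)\<^sup>2) - 6 * (\<kappa> k)\<^sup>2 * of_real (1 - t k) * a k
          + 2 * (\<kappa> k)^3 * of_real ((1 - t k)\<^sup>2))) \<le> \<eta> * (t (Suc k) - t k))"

definition admissible :: "loewner_system set" where
  "admissible = {\<sigma>. loewner_chain (s_eta \<sigma>) (s_n \<sigma>) (s_t \<sigma>) (s_kap \<sigma>) (s_a \<sigma>) (s_b \<sigma>) (s_c \<sigma>) \<and>
     0 \<le> s_eta \<sigma> \<and> s_eta \<sigma> \<le> 1 \<and> 1 - s_eta \<sigma> \<le> s_t \<sigma> (s_n \<sigma>) \<and> s_t \<sigma> (s_n \<sigma>) \<le> 1}"

interpretation LF: loewner_family admissible s_eta s_n s_t s_kap s_a s_b s_c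
  by unfold_locales (auto simp: admissible_def loewner_chain_def)

text \<open>The growth bounds on a and b are carried along because \<open>loewner_step_error\<close>
  needs them at the next step. Keeping the earlier entries unchanged matters for
  \<open>driven_chain\<close>, where the driving value depends on the time.\<close>

lemma loewner_chain_append:
  assumes ch: "loewner_chain \<eta> n t \<kappa> a b c"
    and k: "cmod k = 1" and lm: "cmod l \<le> 1" "cmod m \<le> 1" "cmod (l + k) \<le> \<epsilon>" "cmod (m + k) \<le> \<epsilon>"
    and d: "0 \<le> \<delta>" "\<delta> \<le> 1/2" "300 * (2 * \<delta> + \<epsilon>) \<le> \<eta>" and s: "0 \<le> s" "s \<le> 1" "t n = 1 - s"
    and ab: "cmod (a n) \<le> 1 + 4 * t n" "cmod (b n) \<le> 1 + 44 * t n"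
  defines "h \<equiv> of_real (\<delta> * s / (1 - \<delta>)) :: complex"
  shows "\<exists>t' \<kappa>' a' b' c'. loewner_chain \<eta> (Suc n) t' \<kappa>' a' b' c' \<and> t' (Suc n) = 1 - (1 - \<delta>) * s \<and>
     a' (Suc n) = a n - h * (l + m) \<and> b' (Suc n) = b n - h * (l + m) * (2 * a n + m * of_real s) \<and>
     c' (Suc n) = c n - h * (l + m) * (2 * b n + (a n)\<^sup>2 + 3 * m * of_real s * a n + m\<^sup>2 * of_real (s\<^sup>2)) \<and>
     cmod (a' (Suc n)) \<le> 1 + 4 * t' (Suc n) \<and> cmod (b' (Suc n)) \<le> 1 + 44 * t' (Suc n) \<and>
     (\<forall>j\<le>n. t' j = t j \<and> a' j = a j \<and> b' j = b j \<and> c' j = c j) \<and> (\<forall>j<n. \<kappa>' j = \<kappa> j) \<and> \<kappa>' n = k"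
proof -
  define T where "T = 1 - (1 - \<delta>) * s"
  have T: "T - t n = \<delta> * s" by (simp add: T_def s(3) algebra_simps)
  have AB: "cmod (a n) \<le> 5" "cmod (b n) \<le> 45" using ab s by auto
  note E = loewner_step_error[OF k lm d(1,2) s(1,2) AB, folded h_def]
  have D0: "0 \<le> \<delta> * s" using d s by simp
  have De: "\<delta> * s \<le> \<eta>"
  proof -
    have "0 \<le> \<epsilon>" using lm(3) norm_ge_zero order_trans by blast
    moreover have "\<delta> * s \<le> \<delta> * 1" using d s by (intro mult_left_mono) auto
    moreover have "300 * (2 * \<delta> + \<epsilon>) = 600 * \<delta> + 300 * \<epsilon>" by simp
    ultimately show ?thesis using d by linarith
  qed
  have up: "x \<le> \<eta> * (\<delta> * s)" if "x \<le> 300 * (2 * \<delta> + \<epsilon>) * (\<delta> * s)" for x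
    using that mult_right_mono[OF d(3) D0] by linarith
  let ?t = "t(Suc n := T)" and ?k = "\<kappa>(n := k)" and ?a = "a(Suc n := a n - h * (l + m))"
    and ?b = "b(Suc n := b n - h * (l + m) * (2 * a n + m * of_real s))"
    and ?c = "c(Suc n := c n - h * (l + m) * (2 * b n + (a n)\<^sup>2 + 3 * m * of_real s * a n + m\<^sup>2 * of_real (s\<^sup>2)))"
  have "loewner_chain \<eta> (Suc n) ?t ?k ?a ?b ?c"
    unfolding loewner_chain_def
  proof (intro conjI allI impI)
    have st: "1 - t n = s" by (simp add: s(3))
    fix j assume j: "j < Suc n"
    have c0: "j < n \<or> j = n" using j by auto
    show "?t j \<le> ?t (Suc j)" using c0 ch T D0 by (auto simp: loewner_chain_def)
    show "?t (Suc j) - ?t j \<le> \<eta>" using c0 ch T De by (auto simp: loewner_chain_def)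
    show "cmod (?k j) = 1" using c0 ch k by (auto simp: loewner_chain_def)
    show "cmod (?a (Suc j) - ?a j - of_real (?t (Suc j) - ?t j) * (2 * ?k j)) \<le> \<eta> * (?t (Suc j) - ?t j)"
      using c0
    proof
      assume "j = n" then show ?thesis using up[OF E(1)] T by simp
    qed (use ch in \<open>auto simp: loewner_chain_def\<close>)
    show "cmod (?b (Suc j) - ?b j - of_real (?t (Suc j) - ?t j) *
         (4 * ?k j * ?a j - 2 * (?k j)\<^sup>2 * of_real (1 - ?t j))) \<le> \<eta> * (?t (Suc j) - ?t j)"
      using c0
    proof
      assume "j = n" then show ?thesis using up[OF E(2)] T st by simp
    qed (use ch in \<open>auto simp: loewner_chain_def\<close>)
    show "cmod (?c (Suc j) - ?c j - of_real (?t (Suc j) - ?t j) *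
         (2 * ?k j * (2 * ?b j + (?a j)\<^sup>2) - 6 * (?k j)\<^sup>2 * of_real (1 - ?t j) * ?a j
          + 2 * (?k j)^3 * of_real ((1 - ?t j)\<^sup>2))) \<le> \<eta> * (?t (Suc j) - ?t j)"
      using c0
    proof
      assume "j = n" then show ?thesis using up[OF E(3)] T st by simp
    qed (use ch in \<open>auto simp: loewner_chain_def\<close>)
  qed (use ch in \<open>auto simp: loewner_chain_def\<close>)
  moreover have "cmod (?a (Suc n)) \<le> 1 + 4 * ?t (Suc n)" "cmod (?b (Suc n)) \<le> 1 + 44 * ?t (Suc n)"
    using E(4,5) ab T by simp_all
  ultimately show ?thesis
    by (intro exI[of _ ?t] exI[of _ ?k] exI[of _ ?a] exI[of _ ?b] exI[of _ ?c]) (simp add: T_def)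
qed

lemma composed_coeffs:
  assumes hol: "\<psi> holomorphic_on ball 0 1" and \<psi>0: "\<psi> 0 = 0" and d\<psi>: "deriv \<psi> 0 = of_real s" "0 < s"
    and d: "\<delta> < 1"
    and \<phi>: "\<And>z. z \<in> ball 0 1 \<Longrightarrow> \<phi> z = \<psi> z * (1 - of_real \<delta> * ((1 + l * \<psi> z) / (1 - m * \<psi> z)))"
  defines "h \<equiv> of_real (\<delta> * s / (1 - \<delta>)) :: complex" and "\<rho> \<equiv> (1 - \<delta>) * s"
    and "A \<equiv> taylor_coeff \<psi> 2 / of_real s" and "B \<equiv> taylor_coeff \<psi> 3 / of_real s" and "C \<equiv> taylor_coeff \<psi> 4 / of_real s"
  shows "taylor_coeff \<phi> 1 = of_real \<rho>" "taylor_coeff \<phi> 2 / of_real \<rho> = A - h * (l + m)"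
    "taylor_coeff \<phi> 3 / of_real \<rho> = B - h * (l + m) * (2 * A + m * of_real s)"
    "taylor_coeff \<phi> 4 / of_real \<rho> = C - h * (l + m) * (2 * B + A\<^sup>2 + 3 * m * of_real s * A + m\<^sup>2 * of_real (s\<^sup>2))"
proof -
  define F where "F = fps_expansion \<psi> 0"
  have F: "\<psi> has_fps_expansion F" unfolding F_def using hol by (intro has_fps_expansion_fps_expansion[of "ball 0 1"]) auto
  have F0: "fps_nth F 0 = 0" by (simp add: F_def fps_expansion_def \<psi>0)
  have F1: "fps_nth F 1 = of_real s" by (simp add: F_def fps_expansion_def d\<psi>)
  define G where "G = F * (1 - fps_const (of_real \<delta>) * ((1 + fps_const l * F) * inverse (1 - fps_const m * F)))"
  have 1: "(\<lambda>z. \<psi> z * (1 - of_real \<delta> * ((1 + l * \<psi> z) * inverse (1 - m * \<psi> z)))) has_fps_expansion G"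
    unfolding G_def by (intro fps_expansion_intros F) (simp add: F0)
  have 2: "eventually (\<lambda>z. \<psi> z * (1 - of_real \<delta> * ((1 + l * \<psi> z) * inverse (1 - m * \<psi> z))) = \<phi> z) (nhds 0)"
    using eventually_nhds_in_open[of "ball 0 1" "0::complex"] by (auto elim!: eventually_mono simp: \<phi> divide_inverse)
  have "\<phi> has_fps_expansion G" by (rule has_fps_expansion_cong[THEN iffD1, OF 2 refl 1])
  then have G: "fps_expansion \<phi> 0 = G" by (rule fps_expansion_eqI)
  note S = fps_loewner_step[OF F0, where d="of_real \<delta>" and l=l and m=m, folded G_def, unfolded F1]
  have ABC: "fps_nth F 2 = of_real s * A" "fps_nth F 3 = of_real s * B" "fps_nth F 4 = of_real s * C"
    using d\<psi>(2) by (simp_all add: A_def B_def C_def F_def)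
  define x where "x = (of_real s :: complex)"
  define y where "y = (1 - of_real \<delta> :: complex)"
  have x0: "x \<noteq> 0" using d\<psi>(2) by (simp add: x_def)
  have "y = of_real (1 - \<delta>)" by (simp add: y_def)
  then have y0: "y \<noteq> 0" using d by (simp only: of_real_eq_0_iff)
  have r: "of_real \<rho> = y * x" by (simp add: \<rho>_def x_def y_def)
  have h: "h = of_real \<delta> * x / y" by (simp add: h_def x_def y_def)
  show "taylor_coeff \<phi> 1 = of_real \<rho>" unfolding G S(1) r by (simp add: x_def y_def)
  show "taylor_coeff \<phi> 2 / of_real \<rho> = A - h * (l + m)"
    unfolding G S(2) r h ABC x_def[symmetric] y_def[symmetric] using x0 y0 by (simp add: field_simps power2_eq_square)
  show "taylor_coeff \<phi> 3 / of_real \<rho> = B - h * (l + m) * (2 * A + m * of_real s)"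
    unfolding G S(3) r h ABC x_def[symmetric] y_def[symmetric] using x0 y0
    by (simp add: field_simps power2_eq_square power3_eq_cube)
  show "taylor_coeff \<phi> 4 / of_real \<rho> = C - h * (l + m) * (2 * B + A\<^sup>2 + 3 * m * of_real s * A + m\<^sup>2 * of_real (s\<^sup>2))"
    unfolding G S(4) r h ABC of_real_power x_def[symmetric] y_def[symmetric] using x0 y0
    by (simp add: field_simps power2_eq_square power3_eq_cube power4_eq_xxxx)
qed

definition ends_at where
  "ends_at \<eta> \<phi> \<rho> \<longleftrightarrow> (\<exists>n t \<kappa> a b c. loewner_chain \<eta> n t \<kappa> a b c \<and> t n = 1 - \<rho> \<and>
     a n = taylor_coeff \<phi> 2 / of_real \<rho> \<and> b n = taylor_coeff \<phi> 3 / of_real \<rho> \<and> c n = taylor_coeff \<phi> 4 / of_real \<rho> \<and>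
     cmod (a n) \<le> 1 + 4 * t n \<and> cmod (b n) \<le> 1 + 44 * t n)"

text \<open>Each osculation divides the derivative by b, so a derivative of at least R b^N exceeds R
  after at most N of them; the innermost map is then so close to the identity that a chain without
  steps represents it. Since b is at least R = 1 - \<eta> / 1000, the step \<delta> = 1 - b
  satisfies the tolerance 900 \<delta> \<le> \<eta>.\<close>

lemma osculation_chain:
  assumes eta: "0 < \<eta>" "\<eta> \<le> 1"
  defines "R \<equiv> 1 - \<eta> / 1000" and "b \<equiv> 2 * sqrt (1 - \<eta> / 1000) / (1 + (1 - \<eta> / 1000))"
  assumes "disc_embedding \<phi>" "deriv \<phi> 0 = of_real \<rho>" "0 < \<rho>" "R * b ^ N \<le> \<rho>"
  shows "ends_at \<eta> \<phi> \<rho>"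
  using assms(5-8)
proof (induction N arbitrary: \<phi> \<rho>)
  have R: "1/2 \<le> R" "R < 1" using eta by (auto simp: R_def)
  have b: "0 < b" "R \<le> b" "b < 1"
  proof -
    have b': "b = 2 * sqrt R / (1 + R)" by (simp add: b_def R_def)
    show "0 < b" unfolding b' using R by simp
    have "R * R \<le> R * 1" using R by (intro mult_left_mono) auto
    then have "R \<le> sqrt R" using R by (intro real_le_rsqrt) (simp add: power2_eq_square)
    moreover have "R * (1 + R) \<le> R * 2" using R by (intro mult_left_mono) auto
    ultimately have "R * (1 + R) \<le> 2 * sqrt R" by linarith
    then show "R \<le> b" unfolding b' using R by (simp add: pos_le_divide_eq)
    have "0 < (1 - sqrt R)\<^sup>2" using R by simp
    then have "2 * sqrt R < 1 + R" using R by (simp add: power2_eq_square algebra_simps)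
    then show "b < 1" unfolding b' using R by simp
  qed
  have base: "ends_at \<eta> \<phi> \<rho>" if \<phi>: "disc_embedding \<phi>" "deriv \<phi> 0 = of_real \<rho>" "R \<le> \<rho>" for \<phi> \<rho>
  proof -
    have r0: "0 < \<rho>" using that R by linarith
    note c = near_identity_coeffs[OF \<phi>(1,2) r0]
    have r1: "\<rho> \<le> 1" using c(1)[of 2] by simp
    have q: "cmod (taylor_coeff \<phi> j / of_real \<rho>) \<le> \<eta>" if "2 \<le> j" "j \<le> 4" for j
    proof -
      have "2 ^ j \<le> (2::real) ^ 4" using that by (intro power_increasing) auto
      then have "2 ^ j * (1 - \<rho>) \<le> 16 * (1 - \<rho>)" using r1 by (intro mult_right_mono) auto
      moreover have "1 - \<rho> \<le> \<eta> / 1000" using \<phi>(3) by (simp add: R_def)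
      moreover have "cmod (taylor_coeff \<phi> j) \<le> 2 ^ j * (1 - \<rho>)" by (rule c(2)[OF that(1)])
      ultimately have "cmod (taylor_coeff \<phi> j) \<le> 16 * (\<eta> / 1000)" by (meson mult_left_mono order_trans zero_le_numeral)
      then have "cmod (taylor_coeff \<phi> j) \<le> \<eta> / 2" using eta by simp
      also have "\<dots> \<le> \<eta> * \<rho>" using \<phi>(3) R eta by simp
      finally show ?thesis using r0 by (simp add: norm_divide pos_divide_le_eq)
    qed
    have "1 - \<rho> \<le> \<eta>" using \<phi>(3) eta by (simp add: R_def)
    then have "loewner_chain \<eta> 0 (\<lambda>_. 1 - \<rho>) (\<lambda>_. 1) (\<lambda>_. taylor_coeff \<phi> 2 / of_real \<rho>)
        (\<lambda>_. taylor_coeff \<phi> 3 / of_real \<rho>) (\<lambda>_. taylor_coeff \<phi> 4 / of_real \<rho>)"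
      using q[of 2] q[of 3] q[of 4] r1 by (simp add: loewner_chain_def)
    moreover have "cmod (taylor_coeff \<phi> 2 / of_real \<rho>) \<le> 1 + 4 * (1 - \<rho>)" "cmod (taylor_coeff \<phi> 3 / of_real \<rho>) \<le> 1 + 44 * (1 - \<rho>)"
    proof -
      have "cmod (taylor_coeff \<phi> 2 / of_real \<rho>) \<le> 1" "cmod (taylor_coeff \<phi> 3 / of_real \<rho>) \<le> 1"
        using order_trans[OF q[of 2] eta(2)] order_trans[OF q[of 3] eta(2)] by simp_all
      moreover have "0 \<le> 4 * (1 - \<rho>)" "0 \<le> 44 * (1 - \<rho>)" using r1 by auto
      ultimately show "cmod (taylor_coeff \<phi> 2 / of_real \<rho>) \<le> 1 + 4 * (1 - \<rho>)"
        "cmod (taylor_coeff \<phi> 3 / of_real \<rho>) \<le> 1 + 44 * (1 - \<rho>)" by linarith+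
    qed
    ultimately show ?thesis unfolding ends_at_def
      by (intro exI[of _ 0] exI[of _ "\<lambda>_. 1 - \<rho>"] exI[of _ "\<lambda>_. 1"] exI[of _ "\<lambda>_. taylor_coeff \<phi> 2 / of_real \<rho>"]
         exI[of _ "\<lambda>_. taylor_coeff \<phi> 3 / of_real \<rho>"] exI[of _ "\<lambda>_. taylor_coeff \<phi> 4 / of_real \<rho>"]) simp
  qed
  {
    case 0 then show ?case using base by simp
  next
    case (Suc N)
    show ?case
    proof (cases "R \<le> \<rho>")
      case True then show ?thesis using base Suc.prems by blast
    next
      case False
      obtain \<psi> \<kappa> where \<psi>: "disc_embedding \<psi>" "deriv \<psi> 0 = of_real (\<rho> / b)" "cmod \<kappa> = 1"
        "\<And>z. z \<in> ball 0 1 \<Longrightarrow> \<phi> z = \<psi> z * (of_real b - \<kappa> * \<psi> z) / (1 - of_real b * \<kappa> * \<psi> z)"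
        using osculation[OF Suc.prems(1) _ _ Suc.prems(2,3), of R] R False unfolding b_def R_def by auto
      define s where "s = \<rho> / b"
      have s: "0 < s" "R * b ^ N \<le> s" "\<rho> = b * s" using Suc.prems(3,4) b by (auto simp: s_def field_simps)
      have "ends_at \<eta> \<psi> s" using Suc.IH[OF \<psi>(1) _ s(1,2)] \<psi>(2) by (simp add: s_def)
      then obtain n t k a bb c where ch: "loewner_chain \<eta> n t k a bb c" "t n = 1 - s"
         "a n = taylor_coeff \<psi> 2 / of_real s" "bb n = taylor_coeff \<psi> 3 / of_real s" "c n = taylor_coeff \<psi> 4 / of_real s"
         "cmod (a n) \<le> 1 + 4 * t n" "cmod (bb n) \<le> 1 + 44 * t n" unfolding ends_at_def by blast
      have s1: "s \<le> 1" using near_identity_coeffs(1)[OF \<psi>(1) _ s(1), of 2] \<psi>(2) by (simp add: s_def)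
      define \<delta> where "\<delta> = 1 - b"
      have dl: "0 \<le> \<delta>" "\<delta> \<le> 1/2" "\<delta> < 1" "300 * (2 * \<delta> + \<delta>) \<le> \<eta>" using b R eta by (auto simp: \<delta>_def R_def)
      have hol: "\<psi> holomorphic_on ball 0 1" "\<psi> 0 = 0" and im: "\<psi> ` ball 0 1 \<subseteq> ball 0 1" using \<psi>(1) unfolding disc_embedding_def by auto
      have eq: "\<phi> z = \<psi> z * (1 - of_real \<delta> * ((1 + \<kappa> * \<psi> z) / (1 - (of_real b * \<kappa>) * \<psi> z)))" if z: "z \<in> ball 0 1" for z
      proof -
        have "\<psi> z \<in> ball 0 1" using im z by blast
        then have p: "cmod (\<psi> z) < 1" by simp
        have "cmod (of_real b * \<kappa> * \<psi> z) = b * cmod (\<psi> z)" using b \<psi>(3) by (simp add: norm_mult)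
        also have "\<dots> < 1" using b p mult_strict_mono'[of b 1 "cmod (\<psi> z)" 1] by simp
        finally have n: "1 - of_real b * \<kappa> * \<psi> z \<noteq> 0" by auto
        show ?thesis unfolding \<psi>(4)[OF z] using n by (simp add: \<delta>_def field_simps)
      qed
      have ds: "deriv \<psi> 0 = of_real s" using \<psi>(2) by (simp add: s_def)
      have cc: "taylor_coeff \<phi> 2 / of_real ((1 - \<delta>) * s) = a n - of_real (\<delta> * s / (1 - \<delta>)) * (\<kappa> + of_real b * \<kappa>)"
        "taylor_coeff \<phi> 3 / of_real ((1 - \<delta>) * s) = bb n - of_real (\<delta> * s / (1 - \<delta>)) * (\<kappa> + of_real b * \<kappa>) *
           (2 * a n + of_real b * \<kappa> * of_real s)"
        "taylor_coeff \<phi> 4 / of_real ((1 - \<delta>) * s) = c n - of_real (\<delta> * s / (1 - \<delta>)) * (\<kappa> + of_real b * \<kappa>) *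
           (2 * bb n + (a n)\<^sup>2 + 3 * (of_real b * \<kappa>) * of_real s * a n + (of_real b * \<kappa>)\<^sup>2 * of_real (s\<^sup>2))"
        unfolding ch(3-5) by (rule composed_coeffs(2-4)[OF hol ds s(1) dl(3)], rule eq, assumption)+
      have m: "cmod (of_real b * \<kappa>) \<le> 1" "cmod (of_real b * \<kappa> + - \<kappa>) \<le> \<delta>"
      proof -
        show "cmod (of_real b * \<kappa>) \<le> 1" using b \<psi>(3) by (simp add: norm_mult)
        have "of_real b * \<kappa> + - \<kappa> = of_real (- \<delta>) * \<kappa>" by (simp add: \<delta>_def algebra_simps)
        then have "cmod (of_real b * \<kappa> + - \<kappa>) = \<bar>- \<delta>\<bar> * cmod \<kappa>" by (simp only: norm_mult norm_of_real)
        then show "cmod (of_real b * \<kappa> + - \<kappa>) \<le> \<delta>" using \<psi>(3) dl by simp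
      qed
      \<comment> \<open>The driving value is -\<kappa>, with l = \<kappa> and m = b \<kappa>; so l
        deviates by 0 and m by \<delta>.\<close>
      have p: "cmod (- \<kappa>) = 1" "cmod \<kappa> \<le> 1" "cmod (\<kappa> + - \<kappa>) \<le> \<delta>" using \<psi>(3) dl by auto
      note ap = loewner_chain_append[OF ch(1) p(1,2) m(1) p(3) m(2) dl(1,2,4) less_imp_le[OF s(1)] s1 ch(2,6,7),
          folded cc]
      then obtain t' k' a' b' c' where N: "loewner_chain \<eta> (Suc n) t' k' a' b' c'" "t' (Suc n) = 1 - (1 - \<delta>) * s"
         "a' (Suc n) = taylor_coeff \<phi> 2 / of_real ((1 - \<delta>) * s)" "b' (Suc n) = taylor_coeff \<phi> 3 / of_real ((1 - \<delta>) * s)"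
         "c' (Suc n) = taylor_coeff \<phi> 4 / of_real ((1 - \<delta>) * s)"
         "cmod (a' (Suc n)) \<le> 1 + 4 * t' (Suc n)" "cmod (b' (Suc n)) \<le> 1 + 44 * t' (Suc n)"
        by blast
      have rs: "(1 - \<delta>) * s = \<rho>" using s(3) by (simp add: \<delta>_def)
      show ?thesis using N unfolding rs ends_at_def by blast
    qed
  }
qed

text \<open>Division by K \<ge> 1 / \<eta> makes f a self-map of the disc with derivative 1 / K, so
  its chain ends at time 1 - 1 / K, within \<eta> of 1. Normalizing by the derivative restores the
  coefficients of f.\<close>

lemma bounded_S_bound:
  fixes f :: "complex \<Rightarrow> complex"
  assumes f: "f \<in> class_S" and bd: "\<And>z. z \<in> ball 0 1 \<Longrightarrow> cmod (f z) \<le> M" and eta: "0 < \<eta>" "\<eta> \<le> 1"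
  obtains \<sigma> where "\<sigma> \<in> admissible" "s_eta \<sigma> = \<eta>" "s_a \<sigma> (s_n \<sigma>) = taylor_coeff f 2" "s_b \<sigma> (s_n \<sigma>) = taylor_coeff f 3"
    "s_c \<sigma> (s_n \<sigma>) = taylor_coeff f 4"
proof -
  have hol: "f holomorphic_on ball 0 1" and inj: "inj_on f (ball 0 1)" and f0: "f 0 = 0" and f1: "deriv f 0 = 1"
    using f unfolding class_S_def by auto
  define K where "K = \<bar>M\<bar> + 1 / \<eta> + 1"
  have "0 < 1 / \<eta>" using eta by simp
  then have K: "0 < K" "M < K" "1 / \<eta> \<le> K" unfolding K_def by linarith+
  define \<phi> where "\<phi> = (\<lambda>z. f z / of_real K)"
  have Ke: "1 / K \<le> \<eta>" using K eta by (simp add: field_simps)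
  have emb: "disc_embedding \<phi>" unfolding disc_embedding_def
  proof (intro conjI)
    show "\<phi> holomorphic_on ball 0 1" unfolding \<phi>_def using hol K by (intro holomorphic_intros) auto
    show "inj_on \<phi> (ball 0 1)" using inj K by (auto simp: inj_on_def \<phi>_def)
    show "\<phi> ` ball 0 1 \<subseteq> ball 0 1"
    proof
      fix w assume "w \<in> \<phi> ` ball 0 1"
      then obtain z where z: "z \<in> ball 0 1" "w = \<phi> z" by auto
      have "cmod (f z) < K" using bd[OF z(1)] K by simp
      then show "w \<in> ball 0 1" using K z by (simp add: \<phi>_def norm_divide)
    qed
    show "\<phi> 0 = 0" by (simp add: \<phi>_def f0)
  qed
  have "(f has_field_derivative 1) (at 0)" using hol f1 holomorphic_derivI[of f "ball 0 1" 0] by simp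
  then have "(\<phi> has_field_derivative 1 / of_real K) (at 0)" unfolding \<phi>_def using K by (intro DERIV_cdivide)
  then have d: "deriv \<phi> 0 = of_real (1 / K)" by (simp add: DERIV_imp_deriv)
  have F: "f has_fps_expansion fps_expansion f 0" using hol by (intro has_fps_expansion_fps_expansion[of "ball 0 1"]) auto
  have "\<phi> = (\<lambda>z. inverse (of_real K) * f z)" by (simp add: \<phi>_def field_simps)
  then have "\<phi> has_fps_expansion fps_const (inverse (of_real K)) * fps_expansion f 0"
    using F by (auto intro!: fps_expansion_intros)
  then have e: "fps_expansion \<phi> 0 = fps_const (inverse (of_real K)) * fps_expansion f 0" by (rule fps_expansion_eqI)
  have tc: "taylor_coeff \<phi> j / of_real (1 / K) = taylor_coeff f j" for j
    unfolding e using K by simp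
  define b where "b = 2 * sqrt (1 - \<eta> / 1000) / (1 + (1 - \<eta> / 1000))"
  have R: "0 < 1 - \<eta> / 1000" "1 - \<eta> / 1000 < 1" using eta by auto
  have b: "0 \<le> b" "b < 1"
  proof -
    define R where "R = 1 - \<eta> / 1000"
    have R': "0 < R" "R < 1" using R by (auto simp: R_def)
    have "0 < (1 - sqrt R)\<^sup>2" using R' by simp
    then have "2 * sqrt R < 1 + R" using R' by (simp add: power2_eq_square algebra_simps)
    then show "b < 1" "0 \<le> b" unfolding b_def R_def[symmetric] using R' by simp_all
  qed
  have "(\<lambda>N. (1 - \<eta> / 1000) * b ^ N) \<longlonglongrightarrow> (1 - \<eta> / 1000) * 0"
    using b by (intro tendsto_intros LIMSEQ_power_zero) auto
  then have "eventually (\<lambda>N. (1 - \<eta> / 1000) * b ^ N < 1 / K) sequentially"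
    by (rule order_tendstoD(2)) (use K in simp)
  then obtain N where N: "(1 - \<eta> / 1000) * b ^ N < 1 / K" by (meson eventually_happens trivial_limit_sequentially)
  have "ends_at \<eta> \<phi> (1 / K)"
    by (rule osculation_chain[OF eta emb d, of N]) (use K N in \<open>auto simp: b_def\<close>)
  then obtain n t k a bb c where ch: "loewner_chain \<eta> n t k a bb c" "t n = 1 - 1 / K"
     "a n = taylor_coeff f 2" "bb n = taylor_coeff f 3" "c n = taylor_coeff f 4"
    unfolding ends_at_def tc by blast
  have "LSys \<eta> n t k a bb c \<in> admissible" using ch(1,2) eta Ke K by (simp add: admissible_def)
  then show ?thesis by (rule that) (use ch in auto)
qed

lemma S_dilate:
  assumes f: "f \<in> class_S" and r: "0 < r" "r < 1"
  defines "g \<equiv> \<lambda>z. f (of_real r * z) / of_real r"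
  shows "g \<in> class_S" "\<exists>M. \<forall>z\<in>ball 0 1. cmod (g z) \<le> M" "taylor_coeff g (Suc j) = of_real (r ^ j) * taylor_coeff f (Suc j)"
proof -
  have hol: "f holomorphic_on ball 0 1" and inj: "inj_on f (ball 0 1)" and f0: "f 0 = 0" and f1: "deriv f 0 = 1"
    using f unfolding class_S_def by auto
  have mem: "of_real r * z \<in> cball 0 r" if "z \<in> ball 0 1" for z :: complex
    using that r by (simp add: norm_mult)
  have sub: "cball 0 r \<subseteq> ball (0::complex) 1" using r by auto
  have holg: "g holomorphic_on ball 0 1" unfolding g_def
    using mem sub r by (intro holomorphic_intros holomorphic_on_compose_gen[OF _ hol, unfolded o_def]) auto
  have "inj_on g (ball 0 1)"
  proof (rule inj_onI)
    fix x y :: complex assume xy: "x \<in> ball 0 1" "y \<in> ball 0 1" "g x = g y"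
    then have "f (of_real r * x) = f (of_real r * y)" using r by (simp add: g_def)
    then have "of_real r * x = of_real r * y" using inj mem xy sub by (meson inj_onD subsetD)
    then show "x = y" using r by simp
  qed
  moreover have "g 0 = 0" by (simp add: g_def f0)
  moreover have "deriv g 0 = 1"
  proof (rule DERIV_imp_deriv)
    have "(f has_field_derivative 1) (at (of_real r * 0))" using hol f1 holomorphic_derivI[of f "ball 0 1" 0] by simp
    then have "(f \<circ> (\<lambda>z. of_real r * z) has_field_derivative 1 * of_real r) (at 0)"
      by (rule DERIV_chain) (auto intro!: derivative_eq_intros)
    then have "((\<lambda>z. f (of_real r * z)) has_field_derivative of_real r) (at 0)" by (simp add: o_def)
    then have "(g has_field_derivative of_real r / of_real r) (at 0)" unfolding g_def by (rule DERIV_cdivide)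
    then show "(g has_field_derivative 1) (at 0)" using r by simp
  qed
  ultimately show "g \<in> class_S" using holg unfolding class_S_def by auto
  have "continuous_on (cball 0 r) f"
    by (rule holomorphic_on_imp_continuous_on, rule holomorphic_on_subset[OF hol sub])
  then have "bounded (f ` cball 0 r)" by (intro compact_imp_bounded compact_continuous_image) auto
  then obtain B where B: "\<And>x. x \<in> cball 0 r \<Longrightarrow> cmod (f x) \<le> B" unfolding bounded_iff by blast
  show "\<exists>M. \<forall>z\<in>ball 0 1. cmod (g z) \<le> M"
    by (rule exI[of _ "B / r"]) (use B mem r in \<open>auto simp: g_def norm_divide divide_right_mono\<close>)
  have F: "f has_fps_expansion fps_expansion f 0" using hol by (intro has_fps_expansion_fps_expansion[of "ball 0 1"]) auto
  have "(f \<circ> (\<lambda>z. of_real r * z)) has_fps_expansion fps_compose (fps_expansion f 0) (fps_const (of_real r) * fps_X)"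
    by (intro has_fps_expansion_compose F fps_expansion_intros) simp
  then have "(\<lambda>z. inverse (of_real r) * f (of_real r * z)) has_fps_expansion
     fps_const (inverse (of_real r)) * fps_compose (fps_expansion f 0) (fps_const (of_real r) * fps_X)"
    by (intro fps_expansion_intros) (simp add: o_def)
  moreover have "(\<lambda>z. inverse (of_real r) * f (of_real r * z)) = g" by (simp add: g_def field_simps)
  ultimately have "fps_expansion g 0 = fps_const (inverse (of_real r)) * fps_compose (fps_expansion f 0) (fps_const (of_real r) * fps_X)"
    using fps_expansion_eqI by metis
  then show "taylor_coeff g (Suc j) = of_real (r ^ j) * taylor_coeff f (Suc j)"
    using r by (simp add: fps_nth_compose_linear fps_mult_left_const_nth )
qed

definition defect where "defect \<nu> f = (4 - Re (taylor_coeff f 4)) + \<nu> * (2 - Re (taylor_coeff f 2))"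

text \<open>K and J are fixed before \<eta>. For a bounded function \<eta> tends to 0, which removes
  all traces of the discretization; the dilations f(r z) / r with r tending to 1 then reach the
  whole class, since only two coefficients are involved.\<close>

lemma local_lower_bound:
  assumes c: "\<nu> \<in> certified"
  shows "\<exists>K\<ge>0. \<forall>f\<in>class_S. 0 \<le> 2 - Re (taylor_coeff f 2) \<and>
     - K * (sqrt ((2 - Re (taylor_coeff f 2)) / 2))^3 \<le> defect \<nu> f"
proof -
  obtain w w' where w: "riccati_certificate \<nu> w w'" and nu: "-1 < \<nu>" using c unfolding certified_def by blast
  obtain K where K: "0 \<le> K" "\<And>\<sigma>. \<sigma> \<in> admissible \<Longrightarrow> - K * ((LF.r \<sigma>)^3 + s_eta \<sigma>) \<le> LF.L \<nu> \<sigma>"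
    using LF.certified_lower_bound[OF w nu] by blast
  obtain J where J: "0 \<le> J" "\<And>\<sigma>. \<sigma> \<in> admissible \<Longrightarrow> \<bar>(2 - Re (s_a \<sigma> (s_n \<sigma>))) - 2 * LF.En \<sigma>\<bar> \<le> J * s_eta \<sigma>"
    using LF.energy_eq by blast
  have step: "0 \<le> 2 - Re (taylor_coeff f 2) + J * \<eta> \<and>
     - K * ((sqrt ((2 - Re (taylor_coeff f 2)) / 2 + (J + 1) * \<eta>))^3 + \<eta>) \<le> defect \<nu> f"
    if f: "f \<in> class_S" "\<exists>M. \<forall>z\<in>ball 0 1. cmod (f z) \<le> M" and eta: "0 < \<eta>" "\<eta> \<le> 1" for f \<eta>
  proof -
    obtain M where "\<And>z. z \<in> ball 0 1 \<Longrightarrow> cmod (f z) \<le> M" using f(2) by blast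
    from bounded_S_bound[OF f(1) this eta] obtain \<sigma> where s: "\<sigma> \<in> admissible" "s_eta \<sigma> = \<eta>" "s_a \<sigma> (s_n \<sigma>) = taylor_coeff f 2"
       "s_c \<sigma> (s_n \<sigma>) = taylor_coeff f 4" by metis
    have L: "LF.L \<nu> \<sigma> = defect \<nu> f" by (simp add: LF.L_def defect_def s)
    have En: "\<bar>(2 - Re (taylor_coeff f 2)) - 2 * LF.En \<sigma>\<bar> \<le> J * \<eta>" using J(2)[OF s(1)] s by simp
    have E0: "0 \<le> LF.En \<sigma>" using LF.En_bounds[OF s(1)] by simp
    have Jn: "0 \<le> J * \<eta>" using J eta by simp
    have "LF.En \<sigma> + \<eta> \<le> (2 - Re (taylor_coeff f 2)) / 2 + (J + 1) * \<eta>"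
    proof -
      have "2 * LF.En \<sigma> \<le> (2 - Re (taylor_coeff f 2)) + J * \<eta>" using En by (simp add: abs_le_iff)
      also have "\<dots> \<le> (2 - Re (taylor_coeff f 2)) + 2 * (J * \<eta>)" using Jn by simp
      finally show ?thesis by (simp add: field_simps)
    qed
    then have "LF.r \<sigma> \<le> sqrt ((2 - Re (taylor_coeff f 2)) / 2 + (J + 1) * \<eta>)" unfolding LF.r_def s(2) by (rule real_sqrt_le_mono)
    then have "(LF.r \<sigma>)^3 \<le> (sqrt ((2 - Re (taylor_coeff f 2)) / 2 + (J + 1) * \<eta>))^3"
      using LF.En_bounds(3)[OF s(1)] by (intro power_mono) auto
    then have "- K * ((sqrt ((2 - Re (taylor_coeff f 2)) / 2 + (J + 1) * \<eta>))^3 + \<eta>) \<le> - K * ((LF.r \<sigma>)^3 + \<eta>)"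
      using K(1) by (intro mult_left_mono_neg) auto
    also have "\<dots> \<le> defect \<nu> f" using K(2)[OF s(1)] s L by simp
    finally show ?thesis using En E0 by simp
  qed
  have lim: "(\<lambda>m. inverse (real (Suc m))) \<longlonglongrightarrow> 0" by (rule LIMSEQ_inverse_real_of_nat)
  have bdd: "0 \<le> 2 - Re (taylor_coeff f 2) \<and> - K * (sqrt ((2 - Re (taylor_coeff f 2)) / 2))^3 \<le> defect \<nu> f"
    if f: "f \<in> class_S" "\<exists>M. \<forall>z\<in>ball 0 1. cmod (f z) \<le> M" for f
  proof
    let ?e = "2 - Re (taylor_coeff f 2)"
    note st = step[OF f, of "inverse (real (Suc m))" for m]
    have "(\<lambda>m. ?e + J * inverse (real (Suc m))) \<longlonglongrightarrow> ?e + J * 0" by (intro tendsto_intros lim)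
    then have "0 \<le> ?e + J * 0" by (rule LIMSEQ_le_const) (use st in \<open>auto simp: inverse_le_1_iff\<close>)
    then show "0 \<le> ?e" by simp
    have "(\<lambda>m. - K * ((sqrt (?e / 2 + (J + 1) * inverse (real (Suc m))))^3 + inverse (real (Suc m))))
       \<longlonglongrightarrow> - K * ((sqrt (?e / 2 + (J + 1) * 0))^3 + 0)" by (intro tendsto_intros lim)
    then have "- K * ((sqrt (?e / 2 + (J + 1) * 0))^3 + 0) \<le> defect \<nu> f"
      by (rule LIMSEQ_le_const2) (use st in \<open>auto simp: inverse_le_1_iff\<close>)
    then show "- K * (sqrt (?e / 2))^3 \<le> defect \<nu> f" by simp
  qed
  show ?thesis
  proof (intro exI[of _ K] conjI ballI K(1))
    fix f assume f: "f \<in> class_S"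
    define r where "r = (\<lambda>m. 1 - inverse (real (Suc (Suc m))))"
    have r: "0 < r m" "r m < 1" for m by (auto simp: r_def inverse_less_1_iff)
    have rl: "r \<longlonglongrightarrow> 1 - 0" unfolding r_def by (intro tendsto_intros LIMSEQ_Suc[OF lim])
    define g where "g = (\<lambda>m z. f (of_real (r m) * z) / of_real (r m))"
    have gm: "g m = (\<lambda>z. f (of_real (r m) * z) / of_real (r m))" for m by (simp add: g_def)
    note D = S_dilate[OF f r, folded gm]
    have g2: "Re (taylor_coeff (g m) 2) = r m * Re (taylor_coeff f 2)" for m
      using D(3)[of m 1] by (simp add: numeral_2_eq_2)
    have g4: "Re (taylor_coeff (g m) 4) = (r m)^3 * Re (taylor_coeff f 4)" for m
      using D(3)[of m 3] by (simp add: numeral_eq_Suc)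
    have D2: "\<exists>M. \<forall>z\<in>ball 0 1. cmod (g m z) \<le> M" for m
      using S_dilate(2)[OF f r, of m] by (simp add: g_def)
    note b = bdd[OF D(1) D2]
    let ?e = "2 - Re (taylor_coeff f 2)"
    have l2: "(\<lambda>m. 2 - r m * Re (taylor_coeff f 2)) \<longlonglongrightarrow> 2 - (1 - 0) * Re (taylor_coeff f 2)" by (intro tendsto_intros rl)
    then have "0 \<le> 2 - (1 - 0) * Re (taylor_coeff f 2)"
      by (rule LIMSEQ_le_const) (use b g2 in auto)
    then show "0 \<le> ?e" by simp
    have "(\<lambda>m. (4 - (r m)^3 * Re (taylor_coeff f 4)) + \<nu> * (2 - r m * Re (taylor_coeff f 2))
         - (- K * (sqrt ((2 - r m * Re (taylor_coeff f 2)) / 2))^3))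
       \<longlonglongrightarrow> (4 - (1 - 0)^3 * Re (taylor_coeff f 4)) + \<nu> * (2 - (1 - 0) * Re (taylor_coeff f 2))
         - (- K * (sqrt ((2 - (1 - 0) * Re (taylor_coeff f 2)) / 2))^3)"
      by (intro tendsto_intros rl) auto
    then have "0 \<le> (4 - (1 - 0)^3 * Re (taylor_coeff f 4)) + \<nu> * (2 - (1 - 0) * Re (taylor_coeff f 2))
         - (- K * (sqrt ((2 - (1 - 0) * Re (taylor_coeff f 2)) / 2))^3)"
    proof (rule LIMSEQ_le_const)
      show "\<exists>M. \<forall>m\<ge>M. 0 \<le> (4 - (r m)^3 * Re (taylor_coeff f 4)) + \<nu> * (2 - r m * Re (taylor_coeff f 2))
         - (- K * (sqrt ((2 - r m * Re (taylor_coeff f 2)) / 2))^3)"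
      proof (intro exI allI impI)
        fix m
        have "- K * (sqrt ((2 - r m * Re (taylor_coeff f 2)) / 2))^3 \<le> (4 - (r m)^3 * Re (taylor_coeff f 4)) + \<nu> * (2 - r m * Re (taylor_coeff f 2))"
          using b[of m] unfolding defect_def g2 g4 by blast
        then show "0 \<le> (4 - (r m)^3 * Re (taylor_coeff f 4)) + \<nu> * (2 - r m * Re (taylor_coeff f 2))
         - (- K * (sqrt ((2 - r m * Re (taylor_coeff f 2)) / 2))^3)" by linarith
      qed
    qed
    then show "- K * (sqrt (?e / 2))^3 \<le> defect \<nu> f" by (simp add: defect_def)
  qed
qed

section \<open>Perturbations of the Koebe function\<close>

lemma sin_cos_estimates:
  fixes x :: real
  shows "\<bar>sin x - x\<bar> \<le> \<bar>x\<bar>^3" "\<bar>2 * (1 - cos x) - x\<^sup>2\<bar> \<le> x^4" "1 - cos x \<le> x\<^sup>2 / 2"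
proof -
  have s: "\<bar>sin x - x\<bar> \<le> \<bar>x\<bar>^3 / 6" for x :: real
    using Maclaurin_sin_bound[of x 3] by (simp add: sin_coeff_def numeral_eq_Suc field_simps)
  have "0 \<le> \<bar>x\<bar>^3" by simp
  then show "\<bar>sin x - x\<bar> \<le> \<bar>x\<bar>^3" using s[of x] by linarith
  have c: "1 - cos x = 2 * (sin (x/2))\<^sup>2" using cos_double_sin[of "x/2"] by simp
  have sx: "\<bar>sin (x/2)\<bar> \<le> \<bar>x\<bar> / 2" using abs_sin_x_le_abs_x[of "x/2"] by simp
  show "1 - cos x \<le> x\<^sup>2 / 2" using power_mono[OF sx, of 2] by (simp add: c power_divide)
  have "\<bar>2 * sin (x/2) - x\<bar> = 2 * \<bar>sin (x/2) - x/2\<bar>" by (simp add: abs_if)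
  also have "\<dots> \<le> 2 * (\<bar>x/2\<bar>^3 / 6)" using s[of "x/2"] by simp
  also have "\<bar>x/2\<bar>^3 = \<bar>x\<bar>^3 / 8" by (simp add: power_divide)
  finally have "\<bar>2 * sin (x/2) - x\<bar> \<le> \<bar>x\<bar>^3 / 2" using \<open>0 \<le> \<bar>x\<bar>^3\<close> by linarith
  moreover have "\<bar>2 * sin (x/2) + x\<bar> \<le> 2 * \<bar>x\<bar>" using sx by linarith
  ultimately have "\<bar>2 * sin (x/2) - x\<bar> * \<bar>2 * sin (x/2) + x\<bar> \<le> (\<bar>x\<bar>^3 / 2) * (2 * \<bar>x\<bar>)"
    using \<open>0 \<le> \<bar>x\<bar>^3\<close> by (intro mult_mono) auto
  moreover have "2 * (1 - cos x) - x\<^sup>2 = (2 * sin (x/2) - x) * (2 * sin (x/2) + x)"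
    unfolding c by (simp add: power2_eq_square algebra_simps)
  moreover have "(\<bar>x\<bar>^3 / 2) * (2 * \<bar>x\<bar>) = x^4" by (simp add: numeral_eq_Suc)
  ultimately show "\<bar>2 * (1 - cos x) - x\<^sup>2\<bar> \<le> x^4" by (simp add: abs_mult)
qed

context loewner_family
begin

text \<open>The mesh \<epsilon>^3 puts the discretization errors on the level of the cubic
  remainder. The driving angle -\<epsilon> u makes \<open>z\<close> close to \<epsilon> z0,
  \<open>\<zeta>\<close> close to \<epsilon> I0 and 2 e close to \<epsilon>^2 u^2, and the expansion
  of the defect is evaluated on these.\<close>

lemma perturbation_expansion:
  assumes ep: "\<And>\<sigma>. \<sigma> \<in> Sys \<Longrightarrow> 0 \<le> \<epsilon> \<sigma>" "\<And>\<sigma>. \<sigma> \<in> Sys \<Longrightarrow> \<epsilon> \<sigma> \<le> 1" "\<And>\<sigma>. \<sigma> \<in> Sys \<Longrightarrow> \<eta> \<sigma> = \<epsilon> \<sigma> ^ 3"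
    and kap: "\<And>\<sigma> k. \<sigma> \<in> Sys \<Longrightarrow> k < n \<sigma> \<Longrightarrow> \<kappa> \<sigma> k = cis (- (\<epsilon> \<sigma> * u (t \<sigma> k)))"
    and jp: "jacobi_path \<nu> z0 u I0 F0" and u1: "C1 u"
    and dN: "\<And>s. s \<in> {0..1} \<Longrightarrow> (N has_real_derivative (u s)\<^sup>2) (at s within {0..1})" "N 0 = 0"
  shows "\<exists>K\<ge>0. \<forall>\<sigma>\<in>Sys. \<bar>L \<nu> \<sigma> - (\<epsilon> \<sigma>)\<^sup>2 * form_value z0 I0 F0\<bar> \<le> K * \<epsilon> \<sigma> ^ 3 \<and>
     \<bar>(2 - Re (a \<sigma> (n \<sigma>))) - (\<epsilon> \<sigma>)\<^sup>2 * N 1\<bar> \<le> K * \<epsilon> \<sigma> ^ 3"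
proof -
  have dz: "(z0 has_real_derivative u s) (at s within {0..1})"
    and dI: "(I0 has_real_derivative z0 s) (at s within {0..1})"
    and dF: "(F0 has_real_derivative (leg \<nu> s * (u s)\<^sup>2 - 4 * (z0 s)\<^sup>2)) (at s within {0..1})" if "s \<in> {0..1}" for s
    using jp that unfolding jacobi_path_def by auto
  have z00: "z0 0 = 0" "I0 0 = 0" "F0 0 = 0" using jp unfolding jacobi_path_def by auto
  have Cz0: "C1 z0" using dz C1_cont[OF u1] by (rule C1_I)
  have CI0: "C1 I0" using dI C1_cont[OF Cz0] by (rule C1_I)
  define F' where "F' s = leg \<nu> s * (u s)\<^sup>2 - 4 * (z0 s)\<^sup>2" for s
  have CF': "C1 F'" unfolding F'_def[abs_def] diff_conv_add_uminus
    using C1_add[OF C1_mult[OF C1_leg C1_power[OF u1]] C1_cmult[OF C1_power[OF Cz0], of "-4"]] by simp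
  have CF0: "C1 F0" using dF C1_cont[OF CF', unfolded F'_def[abs_def]] by (rule C1_I)
  have Cu2: "C1 (\<lambda>s. (u s)\<^sup>2)" using u1 by (rule C1_power)
  have CN: "C1 N" using dN(1) C1_cont[OF Cu2] by (rule C1_I)
  obtain Lu LF LN2 where lu: "Lu-lipschitz_on {0..1} u" and lF: "LF-lipschitz_on {0..1} F'" and lN2: "LN2-lipschitz_on {0..1} (\<lambda>s. (u s)\<^sup>2)"
    using C1_lipschitz[OF u1] C1_lipschitz[OF CF'] C1_lipschitz[OF Cu2] by blast
  obtain Lz LI LF0 LN where lz: "Lz-lipschitz_on {0..1} z0" and lI: "LI-lipschitz_on {0..1} I0" and lF0: "LF0-lipschitz_on {0..1} F0"
     and lN: "LN-lipschitz_on {0..1} N"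
    using C1_lipschitz[OF Cz0] C1_lipschitz[OF CI0] C1_lipschitz[OF CF0] C1_lipschitz[OF CN] by blast
  note rz0 = rate_of_function[OF dz lu] and rI0 = rate_of_function[OF dI lz]
  have rF0: "rate (\<lambda>\<sigma> k. F0 (t \<sigma> k)) (\<lambda>\<sigma> k. F' (t \<sigma> k))" by (rule rate_of_function[OF _ lF]) (simp add: F'_def dF)
  note rN = rate_of_function[OF dN(1) lN2]
  have lip0: "\<bar>f (t \<sigma> 0)\<bar> \<le> M * \<eta> \<sigma>" and lip1: "\<bar>f (t \<sigma> (n \<sigma>)) - f 1\<bar> \<le> M * \<eta> \<sigma>"
    if l: "M-lipschitz_on {0..1} f" "f 0 = 0" and s: "\<sigma> \<in> Sys" for f M \<sigma>
  proof -
    have M: "0 \<le> M" using l(1) by (rule lipschitz_on_nonneg)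
    note h = t_ends[OF s] eta[OF s]
    have "\<bar>f (t \<sigma> 0) - f 0\<bar> \<le> M * \<bar>t \<sigma> 0 - 0\<bar>" using lipschitz_onD[OF l(1), of "t \<sigma> 0" 0] h by (simp add: dist_real_def)
    also have "\<dots> \<le> M * \<eta> \<sigma>" using h M by (intro mult_left_mono) auto
    finally show "\<bar>f (t \<sigma> 0)\<bar> \<le> M * \<eta> \<sigma>" using l(2) by simp
    have "\<bar>f (t \<sigma> (n \<sigma>)) - f 1\<bar> \<le> M * \<bar>t \<sigma> (n \<sigma>) - 1\<bar>"
      using lipschitz_onD[OF l(1), of "t \<sigma> (n \<sigma>)" 1] h t_range[OF s order_refl] by (simp add: dist_real_def)
    also have "\<dots> \<le> M * \<eta> \<sigma>" using h M by (intro mult_left_mono) auto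
    finally show "\<bar>f (t \<sigma> (n \<sigma>)) - f 1\<bar> \<le> M * \<eta> \<sigma>" .
  qed
  have bounded: "\<exists>B\<ge>1. \<forall>s\<in>{0..1}. \<bar>f s\<bar> \<le> B" if "C1 f" for f
  proof -
    have "bounded (f ` {0..1})" using C1_cont[OF that] compact_Icc compact_continuous_image compact_imp_bounded by blast
    then obtain B where "\<And>s. s \<in> {0..1} \<Longrightarrow> \<bar>f s\<bar> \<le> B" unfolding bounded_iff by (metis imageI real_norm_def)
    then show ?thesis by (intro exI[of _ "max 1 B"]) (auto simp: le_max_iff_disj)
  qed
  obtain U where U: "1 \<le> U" "\<And>s. s \<in> {0..1} \<Longrightarrow> \<bar>u s\<bar> \<le> U" using bounded[OF u1] by blast
  obtain Z where Z: "1 \<le> Z" "\<And>s. s \<in> {0..1} \<Longrightarrow> \<bar>z0 s\<bar> \<le> Z" using bounded[OF Cz0] by blast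
  obtain Y where Y: "1 \<le> Y" "\<And>s. s \<in> {0..1} \<Longrightarrow> \<bar>I0 s\<bar> \<le> Y" using bounded[OF CI0] by blast
  have ey: "\<bar>- y \<sigma> k - \<epsilon> \<sigma> * u (t \<sigma> k)\<bar> \<le> U^3 * \<epsilon> \<sigma> ^ 3" "\<bar>2 * e \<sigma> k - (\<epsilon> \<sigma>)\<^sup>2 * (u (t \<sigma> k))\<^sup>2\<bar> \<le> U^4 * \<epsilon> \<sigma> ^ 3"
    "e \<sigma> k \<le> U\<^sup>2 * (\<epsilon> \<sigma>)\<^sup>2"
    if s: "\<sigma> \<in> Sys" and k: "k < n \<sigma>" for \<sigma> k
  proof -
    define x where "x = \<epsilon> \<sigma> * u (t \<sigma> k)"
    have tk: "t \<sigma> k \<in> {0..1}" using t_range[OF s, of k] k by simp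
    have x: "\<bar>x\<bar> \<le> U * \<epsilon> \<sigma>" unfolding x_def abs_mult
      using mult_left_mono[OF U(2)[OF tk] ep(1)[OF s]] ep(1)[OF s] by (simp add: mult.commute)
    have yy: "y \<sigma> k = - sin x" and e: "e \<sigma> k = 1 - cos x" unfolding y_def e_def kap[OF s k] x_def by simp_all
    have "\<bar>- y \<sigma> k - \<epsilon> \<sigma> * u (t \<sigma> k)\<bar> \<le> \<bar>x\<bar>^3" using sin_cos_estimates(1)[of x] unfolding yy x_def[symmetric] by simp
    also have "\<dots> \<le> (U * \<epsilon> \<sigma>)^3" using x by (intro power_mono) auto
    finally show "\<bar>- y \<sigma> k - \<epsilon> \<sigma> * u (t \<sigma> k)\<bar> \<le> U^3 * \<epsilon> \<sigma> ^ 3" by (simp add: power_mult_distrib)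
    have "\<bar>2 * e \<sigma> k - x\<^sup>2\<bar> \<le> x^4" using sin_cos_estimates(2)[of x] unfolding e by simp
    also have "\<dots> = \<bar>x\<bar>^4" by simp
    also have "\<dots> \<le> (U * \<epsilon> \<sigma>)^4" using x by (intro power_mono) auto
    also have "\<dots> = U^4 * \<epsilon> \<sigma> ^ 4" by (simp add: power_mult_distrib)
    also have "\<dots> \<le> U^4 * \<epsilon> \<sigma> ^ 3" using ep[OF s] U(1) by (intro mult_left_mono power_decreasing) auto
    finally show "\<bar>2 * e \<sigma> k - (\<epsilon> \<sigma>)\<^sup>2 * (u (t \<sigma> k))\<^sup>2\<bar> \<le> U^4 * \<epsilon> \<sigma> ^ 3" by (simp add: x_def power_mult_distrib)
    have "e \<sigma> k \<le> x\<^sup>2 / 2" using sin_cos_estimates(3)[of x] unfolding e .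
    also have "\<dots> \<le> \<bar>x\<bar>\<^sup>2" by simp
    also have "\<dots> \<le> (U * \<epsilon> \<sigma>)\<^sup>2" using x by (intro power_mono) auto
    finally show "e \<sigma> k \<le> U\<^sup>2 * (\<epsilon> \<sigma>)\<^sup>2" by (simp add: power_mult_distrib)
  qed
  have e32: "\<epsilon> \<sigma> ^ 3 \<le> (\<epsilon> \<sigma>)\<^sup>2" "\<epsilon> \<sigma> ^ 3 \<le> \<epsilon> \<sigma>" "0 \<le> \<epsilon> \<sigma> ^ 3" if "\<sigma> \<in> Sys" for \<sigma>
    using ep(1,2)[OF that] power_decreasing[of 2 3 "\<epsilon> \<sigma>"] power_decreasing[of 1 3 "\<epsilon> \<sigma>"] by auto
  have reps: "rate (\<lambda>\<sigma> k. \<epsilon> \<sigma>) (\<lambda>\<sigma> k. 0)" by (rule rate_const[of \<epsilon> 1]) (use ep in auto)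
  have r1: "rate (\<lambda>\<sigma> k. z \<sigma> k - \<epsilon> \<sigma> * z0 (t \<sigma> k)) (\<lambda>\<sigma> k. - y \<sigma> k - \<epsilon> \<sigma> * u (t \<sigma> k))"
    by (rule rate_cong[OF rate_diff[OF rate_a(2) rate_mult[OF reps rz0]]]) auto
  have "small (\<lambda>\<sigma> k. z \<sigma> k - \<epsilon> \<sigma> * z0 (t \<sigma> k)) (\<lambda>\<sigma>. \<epsilon> \<sigma> ^ 3)"
  proof (rule small_of_rate[OF r1, where J="1 + Lz" and C="U^3" and A="\<lambda>\<sigma>. \<epsilon> \<sigma> ^ 3" and B="\<lambda>_. 0" and D="\<lambda>_. 0" and M=2])
    fix \<sigma> assume s: "\<sigma> \<in> Sys"
    have "\<bar>\<epsilon> \<sigma> * z0 (t \<sigma> 0)\<bar> \<le> 1 * (Lz * \<eta> \<sigma>)"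
      unfolding abs_mult using ep[OF s] lip0[OF lz z00(1) s] by (intro mult_mono) auto
    then show "\<bar>z \<sigma> 0 - \<epsilon> \<sigma> * z0 (t \<sigma> 0)\<bar> \<le> (1 + Lz) * \<eta> \<sigma>"
      using initial_small(2)[OF s] unfolding distrib_right by linarith
  qed (use ey U ep lipschitz_on_nonneg[OF lz] in auto)
  then obtain C1' where C1': "0 \<le> C1'" "\<And>\<sigma> k. \<sigma> \<in> Sys \<Longrightarrow> k \<le> n \<sigma> \<Longrightarrow> \<bar>z \<sigma> k - \<epsilon> \<sigma> * z0 (t \<sigma> k)\<bar> \<le> C1' * \<epsilon> \<sigma> ^ 3"
    by (rule smallE) blast
  have r2: "rate (\<lambda>\<sigma> k. \<zeta> \<sigma> k - \<epsilon> \<sigma> * I0 (t \<sigma> k)) (\<lambda>\<sigma> k. z \<sigma> k - \<epsilon> \<sigma> * z0 (t \<sigma> k))"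
    by (rule rate_cong[OF rate_diff[OF rate_\<zeta> rate_mult[OF reps rI0]]]) auto
  have "small (\<lambda>\<sigma> k. \<zeta> \<sigma> k - \<epsilon> \<sigma> * I0 (t \<sigma> k)) (\<lambda>\<sigma>. \<epsilon> \<sigma> ^ 3)"
  proof (rule small_of_rate[OF r2, where J="LI" and C="C1'" and A="\<lambda>\<sigma>. \<epsilon> \<sigma> ^ 3" and B="\<lambda>_. 0" and D="\<lambda>_. 0" and M=2])
    fix \<sigma> assume s: "\<sigma> \<in> Sys"
    have "\<bar>\<epsilon> \<sigma> * I0 (t \<sigma> 0)\<bar> \<le> 1 * (LI * \<eta> \<sigma>)"
      unfolding abs_mult using ep[OF s] lip0[OF lI z00(2) s] by (intro mult_mono) auto
    then show "\<bar>\<zeta> \<sigma> 0 - \<epsilon> \<sigma> * I0 (t \<sigma> 0)\<bar> \<le> LI * \<eta> \<sigma>" unfolding initial_small(3)[OF s] by simp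
  qed (use C1' ep lipschitz_on_nonneg[OF lI] in auto)
  then obtain C2 where C2: "0 \<le> C2" "\<And>\<sigma> k. \<sigma> \<in> Sys \<Longrightarrow> k \<le> n \<sigma> \<Longrightarrow> \<bar>\<zeta> \<sigma> k - \<epsilon> \<sigma> * I0 (t \<sigma> k)\<bar> \<le> C2 * \<epsilon> \<sigma> ^ 3"
    by (rule smallE) blast
  obtain CF where CF: "0 \<le> CF" "\<And>\<sigma> k. \<sigma> \<in> Sys \<Longrightarrow> k \<le> n \<sigma> \<Longrightarrow> \<bar>F0 (t \<sigma> k) - F0 (t \<sigma> 0) - (\<Sum>j<k. \<Delta> \<sigma> j * F' (t \<sigma> j))\<bar> \<le> CF * \<eta> \<sigma>"
    using rate_telescope[OF rF0] by blast
  obtain CU where CU: "0 \<le> CU" "\<And>\<sigma> k. \<sigma> \<in> Sys \<Longrightarrow> k \<le> n \<sigma> \<Longrightarrow> \<bar>N (t \<sigma> k) - N (t \<sigma> 0) - (\<Sum>j<k. \<Delta> \<sigma> j * (u (t \<sigma> j))\<^sup>2)\<bar> \<le> CU * \<eta> \<sigma>"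
    using rate_telescope[OF rN] by blast
  obtain J where J: "0 \<le> J" "\<And>\<sigma>. \<sigma> \<in> Sys \<Longrightarrow> \<bar>(2 - Re (a \<sigma> (n \<sigma>))) - 2 * En \<sigma>\<bar> \<le> J * \<eta> \<sigma>"
    using energy_eq by blast
  obtain E where E: "0 \<le> E" "\<And>\<sigma>. \<sigma> \<in> Sys \<Longrightarrow> \<bar>L \<nu> \<sigma> - (Quad \<nu> \<sigma> + 24 * (z \<sigma> (n \<sigma>))\<^sup>2 - 16 * z \<sigma> (n \<sigma>) * \<zeta> \<sigma> (n \<sigma>))\<bar> \<le> E * ((r \<sigma>)^3 + \<eta> \<sigma>)"
    using coefficient_expansion by blast
  define G where "G = 12 + \<bar>\<nu>\<bar>"
  define KQ where "KQ = 40 * U^4 + G * U^4 + 4 * C1' * (2 * Z + C1')"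
  define KF where "KF = CF + LF0 + LF0"
  define KZ where "KZ = (C1' + Lz) * (2 * Z + C1' + Lz)"
  define KI where "KI = (C1' + Lz) * (Y + C2 + LI) + Z * (C2 + LI)"
  define KE where "KE = E * ((U + 1)^3 + 1)"
  define KN where "KN = J + U^4 + CU + LN + LN"
  have Ln: "0 \<le> Lz" "0 \<le> LI" "0 \<le> LF0" "0 \<le> LN" using lipschitz_on_nonneg lz lI lF0 lN by blast+
  have G0: "0 \<le> G" by (simp add: G_def)
  have nn: "0 \<le> KQ" "0 \<le> KF" "0 \<le> KZ" "0 \<le> KI" "0 \<le> KE" "0 \<le> KN"
    using Ln G0 U Z Y C1' C2 CF CU J E by (simp_all add: KQ_def KF_def KZ_def KI_def KE_def KN_def)
  show ?thesis
  proof (intro exI[of _ "KQ + KF + 24 * KZ + 16 * KI + KE + KN"] conjI ballI)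
    show "0 \<le> KQ + KF + 24 * KZ + 16 * KI + KE + KN" using nn by simp
    fix \<sigma> assume s: "\<sigma> \<in> Sys"
    let ?n = "n \<sigma>" and ?e = "\<epsilon> \<sigma>"
    note e = ep[OF s] e32[OF s]
    have e2: "0 \<le> ?e\<^sup>2" "?e\<^sup>2 \<le> 1" using e by (auto simp: power_le_one)
    have rb: "r \<sigma> \<le> (U + 1) * ?e"
    proof (rule power2_le_imp_le)
      have "En \<sigma> \<le> U\<^sup>2 * ?e\<^sup>2" unfolding En_def using ey(3) s by (intro sum_\<Delta>_bound) auto
      then have "(r \<sigma>)\<^sup>2 \<le> U\<^sup>2 * ?e\<^sup>2 + ?e\<^sup>2" using En_bounds(7)[OF s] e by linarith
      also have "\<dots> \<le> (U\<^sup>2 + 1 + 2 * U) * ?e\<^sup>2" using U(1) e2 by (simp add: algebra_simps)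
      also have "\<dots> = ((U + 1) * ?e)\<^sup>2" by (simp add: power2_eq_square algebra_simps)
      finally show "(r \<sigma>)\<^sup>2 \<le> ((U + 1) * ?e)\<^sup>2" .
      show "0 \<le> (U + 1) * ?e" using U e by simp
    qed
    have r3: "(r \<sigma>)^3 \<le> (U + 1)^3 * ?e^3"
      using power_mono[OF rb En_bounds(3)[OF s], of 3] by (simp add: power_mult_distrib)
    have Eb: "E * ((r \<sigma>)^3 + \<eta> \<sigma>) \<le> KE * ?e^3"
    proof -
      have "E * ((r \<sigma>)^3 + \<eta> \<sigma>) \<le> E * ((U + 1)^3 * ?e^3 + ?e^3)" using r3 e E by (intro mult_left_mono add_mono) auto
      then show ?thesis by (simp add: KE_def algebra_simps)
    qed
    have Qb: "\<bar>Quad \<nu> \<sigma> - ?e\<^sup>2 * (\<Sum>j<?n. \<Delta> \<sigma> j * F' (t \<sigma> j))\<bar> \<le> KQ * ?e^3"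
    proof -
      have "Quad \<nu> \<sigma> - ?e\<^sup>2 * (\<Sum>j<?n. \<Delta> \<sigma> j * F' (t \<sigma> j)) = (\<Sum>j<?n. \<Delta> \<sigma> j * (quad_coeff \<nu> \<sigma> j * e \<sigma> j - 4 * (z \<sigma> j)\<^sup>2 - ?e\<^sup>2 * F' (t \<sigma> j)))"
        by (simp add: Quad_def sum_distrib_left right_diff_distrib sum_subtractf mult_ac)
      also have "\<bar>\<dots>\<bar> \<le> (KQ * ?e^3) * (1 + 0 * (r \<sigma>)\<^sup>2 + 0 * r \<sigma>)"
      proof (rule sum_weighted[OF s order_refl])
        show "0 \<le> KQ * ?e^3" using nn e by simp
        fix j assume j: "j < ?n"
        then have j': "j \<le> ?n" by simp
        have tj: "t \<sigma> j \<in> {0..1}" using t_range[OF s j'] by simp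
        define S where "S = 1 - t \<sigma> j"
        have S: "0 \<le> S" "S \<le> 1" using tj by (auto simp: S_def)
        note ej = kappa_e_y(1,2)[OF s j] and y3 = ey[OF s j]
        have g1: "quad_coeff \<nu> \<sigma> j - 2 * leg \<nu> (t \<sigma> j) = - 8 * (e \<sigma> j * (S * (4 * S - 3 - S * e \<sigma> j)))"
          unfolding quad_coeff_def leg_def S_def by (simp add: power2_eq_square algebra_simps)
        have "\<bar>S * (4 * S - 3 - S * e \<sigma> j)\<bar> \<le> 1 * 5"
        proof -
          have "0 \<le> S * e \<sigma> j" "S * e \<sigma> j \<le> 1 * 2" using S ej mult_mono[of S 1 "e \<sigma> j" 2] by auto
          then have "\<bar>4 * S - 3 - S * e \<sigma> j\<bar> \<le> 5" using S by linarith
          then show ?thesis unfolding abs_mult using S by (intro mult_mono) auto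
        qed
        then have "\<bar>quad_coeff \<nu> \<sigma> j - 2 * leg \<nu> (t \<sigma> j)\<bar> \<le> 8 * (e \<sigma> j * 5)"
          unfolding g1 abs_mult using ej by (intro mult_mono) auto
        then have "\<bar>(quad_coeff \<nu> \<sigma> j - 2 * leg \<nu> (t \<sigma> j)) * e \<sigma> j\<bar> \<le> 8 * (e \<sigma> j * 5) * e \<sigma> j"
          unfolding abs_mult[of _ "e \<sigma> j"] using ej by (intro mult_mono) auto
        also have "\<dots> = 40 * (e \<sigma> j)\<^sup>2" by (simp add: power2_eq_square)
        also have "\<dots> \<le> 40 * (U\<^sup>2 * ?e\<^sup>2)\<^sup>2" using y3(3) ej by (intro mult_left_mono power_mono) auto
        also have "\<dots> = 40 * U^4 * ?e^4" by (simp add: power_mult_distrib flip: power_mult)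
        also have "\<dots> \<le> 40 * U^4 * ?e^3" using e U by (intro mult_left_mono power_decreasing) auto
        finally have 1: "\<bar>(quad_coeff \<nu> \<sigma> j - 2 * leg \<nu> (t \<sigma> j)) * e \<sigma> j\<bar> \<le> 40 * U^4 * ?e^3" .
        have "(t \<sigma> j)\<^sup>2 \<le> t \<sigma> j" using tj by (simp add: power2_eq_square mult_left_le)
        then have "\<bar>leg \<nu> (t \<sigma> j)\<bar> \<le> G" using tj zero_le_power2[of "t \<sigma> j"] unfolding leg_def G_def atLeastAtMost_iff by linarith
        then have 2: "\<bar>leg \<nu> (t \<sigma> j) * (2 * e \<sigma> j - ?e\<^sup>2 * (u (t \<sigma> j))\<^sup>2)\<bar> \<le> G * (U^4 * ?e^3)"
          unfolding abs_mult using y3(2) G0 by (intro mult_mono) auto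
        define d where "d = z \<sigma> j - ?e * z0 (t \<sigma> j)"
        have d: "\<bar>d\<bar> \<le> C1' * ?e^3" using C1'(2)[OF s j'] by (simp add: d_def)
        have dd: "\<bar>d\<bar> \<le> C1'" using d mult_left_mono[of "?e^3" 1 C1'] C1'(1) power_le_one[OF e(1,2), of 3] by linarith
        have ext_z: "\<bar>?e * z0 (t \<sigma> j)\<bar> \<le> 1 * Z" unfolding abs_mult using e Z(2)[OF tj] by (intro mult_mono) auto
        have "(z \<sigma> j)\<^sup>2 - ?e\<^sup>2 * (z0 (t \<sigma> j))\<^sup>2 = d * (2 * (?e * z0 (t \<sigma> j)) + d)"
          by (simp add: d_def power2_eq_square algebra_simps)
        then have "\<bar>4 * ((z \<sigma> j)\<^sup>2 - ?e\<^sup>2 * (z0 (t \<sigma> j))\<^sup>2)\<bar> = 4 * (\<bar>d\<bar> * \<bar>2 * (?e * z0 (t \<sigma> j)) + d\<bar>)"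
          by (simp only: abs_mult abs_numeral)
        also have "\<dots> \<le> 4 * ((C1' * ?e^3) * (2 * Z + C1'))"
          using d dd ext_z C1'(1) e by (intro mult_left_mono mult_mono) auto
        finally have 3: "\<bar>4 * ((z \<sigma> j)\<^sup>2 - ?e\<^sup>2 * (z0 (t \<sigma> j))\<^sup>2)\<bar> \<le> 4 * C1' * (2 * Z + C1') * ?e^3"
          by (simp only: mult_ac)
        have "quad_coeff \<nu> \<sigma> j * e \<sigma> j - 4 * (z \<sigma> j)\<^sup>2 - ?e\<^sup>2 * F' (t \<sigma> j) = (quad_coeff \<nu> \<sigma> j - 2 * leg \<nu> (t \<sigma> j)) * e \<sigma> j
           + leg \<nu> (t \<sigma> j) * (2 * e \<sigma> j - ?e\<^sup>2 * (u (t \<sigma> j))\<^sup>2) - 4 * ((z \<sigma> j)\<^sup>2 - ?e\<^sup>2 * (z0 (t \<sigma> j))\<^sup>2)"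
          by (simp add: F'_def algebra_simps)
        also have "\<bar>\<dots>\<bar> \<le> 40 * U^4 * ?e^3 + G * (U^4 * ?e^3) + 4 * C1' * (2 * Z + C1') * ?e^3" using 1 2 3 by linarith
        also have "\<dots> = KQ * ?e^3" by (simp add: KQ_def algebra_simps)
        finally show "\<bar>quad_coeff \<nu> \<sigma> j * e \<sigma> j - 4 * (z \<sigma> j)\<^sup>2 - ?e\<^sup>2 * F' (t \<sigma> j)\<bar> \<le> KQ * ?e^3 * (1 + 0 * e \<sigma> j + 0 * sqrt (e \<sigma> j))" by simp
      qed auto
      finally show ?thesis by simp
    qed
    have Fb: "\<bar>?e\<^sup>2 * (\<Sum>j<?n. \<Delta> \<sigma> j * F' (t \<sigma> j)) - ?e\<^sup>2 * F0 1\<bar> \<le> KF * ?e^3"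
    proof -
      have "\<bar>(\<Sum>j<?n. \<Delta> \<sigma> j * F' (t \<sigma> j)) - F0 1\<bar> \<le> KF * \<eta> \<sigma>"
        using CF(2)[OF s order_refl] lip0[OF lF0 z00(3) s] lip1[OF lF0 z00(3) s] unfolding KF_def distrib_right by linarith
      then have "?e\<^sup>2 * \<bar>(\<Sum>j<?n. \<Delta> \<sigma> j * F' (t \<sigma> j)) - F0 1\<bar> \<le> 1 * (KF * \<eta> \<sigma>)" using e2 by (intro mult_mono) auto
      then show ?thesis using e(3) by (simp add: abs_mult flip: right_diff_distrib)
    qed
    define z1 where "z1 = ?e * z0 1"
    define i1 where "i1 = ?e * I0 1"
    have zn: "\<bar>z \<sigma> ?n - z1\<bar> \<le> (C1' + Lz) * ?e^3"
    proof -
      have "\<bar>?e * (z0 (t \<sigma> ?n) - z0 1)\<bar> \<le> 1 * (Lz * ?e^3)"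
        unfolding abs_mult e(3)[symmetric] using e lip1[OF lz z00(1) s] by (intro mult_mono) auto
      then show ?thesis using C1'(2)[OF s order_refl] unfolding z1_def distrib_right right_diff_distrib by linarith
    qed
    have zin: "\<bar>\<zeta> \<sigma> ?n - i1\<bar> \<le> (C2 + LI) * ?e^3"
    proof -
      have "\<bar>?e * (I0 (t \<sigma> ?n) - I0 1)\<bar> \<le> 1 * (LI * ?e^3)"
        unfolding abs_mult e(3)[symmetric] using e lip1[OF lI z00(2) s] by (intro mult_mono) auto
      then show ?thesis using C2(2)[OF s order_refl] unfolding i1_def distrib_right right_diff_distrib by linarith
    qed
    have z1b: "\<bar>z1\<bar> \<le> Z" "\<bar>i1\<bar> \<le> Y"
      unfolding z1_def i1_def abs_mult using e Z(2)[of 1] Y(2)[of 1] mult_mono[of ?e 1 "\<bar>z0 1\<bar>" Z] mult_mono[of ?e 1 "\<bar>I0 1\<bar>" Y] by auto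
    have e31: "?e^3 \<le> 1" using e by (simp add: power_le_one)
    have zn': "\<bar>z \<sigma> ?n - z1\<bar> \<le> C1' + Lz"
      by (rule order_trans[OF zn]) (rule order_trans[OF mult_left_mono[OF e31 add_nonneg_nonneg[OF C1'(1) Ln(1)]]], simp)
    have zin': "\<bar>\<zeta> \<sigma> ?n - i1\<bar> \<le> C2 + LI"
      by (rule order_trans[OF zin]) (rule order_trans[OF mult_left_mono[OF e31 add_nonneg_nonneg[OF C2(1) Ln(2)]]], simp)
    have Zb: "\<bar>(z \<sigma> ?n)\<^sup>2 - z1\<^sup>2\<bar> \<le> KZ * ?e^3"
    proof -
      have "\<bar>z \<sigma> ?n - z1\<bar> * \<bar>z \<sigma> ?n + z1\<bar> \<le> ((C1' + Lz) * ?e^3) * (2 * Z + C1' + Lz)"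
        using zn zn' z1b C1'(1) Ln e by (intro mult_mono) auto
      then show ?thesis by (simp add: KZ_def square_diff_square_factored abs_mult power2_eq_square mult_ac)
    qed
    have Ib: "\<bar>z \<sigma> ?n * \<zeta> \<sigma> ?n - z1 * i1\<bar> \<le> KI * ?e^3"
    proof -
      have "z \<sigma> ?n * \<zeta> \<sigma> ?n - z1 * i1 = (z \<sigma> ?n - z1) * \<zeta> \<sigma> ?n + z1 * (\<zeta> \<sigma> ?n - i1)" by (simp add: algebra_simps)
      moreover have "\<bar>(z \<sigma> ?n - z1) * \<zeta> \<sigma> ?n\<bar> \<le> ((C1' + Lz) * ?e^3) * (Y + C2 + LI)"
        unfolding abs_mult using zn zin' z1b C1'(1) Ln e by (intro mult_mono) auto
      moreover have "\<bar>z1 * (\<zeta> \<sigma> ?n - i1)\<bar> \<le> Z * ((C2 + LI) * ?e^3)"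
        unfolding abs_mult using zin z1b Z by (intro mult_mono) auto
      moreover have "((C1' + Lz) * ?e^3) * (Y + C2 + LI) + Z * ((C2 + LI) * ?e^3) = KI * ?e^3"
        by (simp add: KI_def algebra_simps)
      ultimately show ?thesis by linarith
    qed
    have fv: "?e\<^sup>2 * form_value z0 I0 F0 = ?e\<^sup>2 * F0 1 + 24 * z1\<^sup>2 - 16 * (z1 * i1)"
      by (simp add: form_value_def z1_def i1_def power2_eq_square algebra_simps)
    have "16 * z \<sigma> ?n * \<zeta> \<sigma> ?n = 16 * (z \<sigma> ?n * \<zeta> \<sigma> ?n)" by simp
    then have "\<bar>L \<nu> \<sigma> - ?e\<^sup>2 * form_value z0 I0 F0\<bar> \<le> KE * ?e^3 + KQ * ?e^3 + KF * ?e^3 + 24 * (KZ * ?e^3) + 16 * (KI * ?e^3)"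
      using E(2)[OF s] Eb Qb Fb Zb Ib unfolding fv by linarith
    moreover have "0 \<le> KN * ?e^3" using nn e by simp
    ultimately show "\<bar>L \<nu> \<sigma> - ?e\<^sup>2 * form_value z0 I0 F0\<bar> \<le> (KQ + KF + 24 * KZ + 16 * KI + KE + KN) * ?e^3"
      unfolding distrib_right mult.assoc by linarith
    have Nb: "\<bar>2 * En \<sigma> - ?e\<^sup>2 * (\<Sum>j<?n. \<Delta> \<sigma> j * (u (t \<sigma> j))\<^sup>2)\<bar> \<le> U^4 * ?e^3"
    proof -
      have "2 * En \<sigma> - ?e\<^sup>2 * (\<Sum>j<?n. \<Delta> \<sigma> j * (u (t \<sigma> j))\<^sup>2) = (\<Sum>j<?n. \<Delta> \<sigma> j * (2 * e \<sigma> j - ?e\<^sup>2 * (u (t \<sigma> j))\<^sup>2))"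
        by (simp add: En_def sum_distrib_left right_diff_distrib sum_subtractf mult_ac)
      also have "\<bar>\<dots>\<bar> \<le> (U^4 * ?e^3) * (1 + 0 * (r \<sigma>)\<^sup>2 + 0 * r \<sigma>)"
        by (rule sum_weighted[OF s order_refl]) (use ey(2)[OF s] e U in auto)
      finally show ?thesis by simp
    qed
    have Nb2: "\<bar>?e\<^sup>2 * (\<Sum>j<?n. \<Delta> \<sigma> j * (u (t \<sigma> j))\<^sup>2) - ?e\<^sup>2 * N 1\<bar> \<le> (CU + LN + LN) * ?e^3"
    proof -
      have "\<bar>(\<Sum>j<?n. \<Delta> \<sigma> j * (u (t \<sigma> j))\<^sup>2) - N 1\<bar> \<le> (CU + LN + LN) * \<eta> \<sigma>"
        using CU(2)[OF s order_refl] lip0[OF lN dN(2) s] lip1[OF lN dN(2) s] unfolding distrib_right by linarith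
      then have "?e\<^sup>2 * \<bar>(\<Sum>j<?n. \<Delta> \<sigma> j * (u (t \<sigma> j))\<^sup>2) - N 1\<bar> \<le> 1 * ((CU + LN + LN) * \<eta> \<sigma>)" using e2 by (intro mult_mono) auto
      then show ?thesis using e(3) by (simp add: abs_mult flip: right_diff_distrib)
    qed
    have "\<bar>(2 - Re (a \<sigma> ?n)) - ?e\<^sup>2 * N 1\<bar> \<le> J * ?e^3 + U^4 * ?e^3 + (CU + LN + LN) * ?e^3"
      using J(2)[OF s, unfolded e(3)] Nb Nb2 by linarith
    also have "\<dots> = KN * ?e^3" by (simp add: KN_def algebra_simps)
    also have "\<dots> \<le> (KQ + KF + 24 * KZ + 16 * KI + KE + KN) * ?e^3" using nn e by (intro mult_right_mono) auto
    finally show "\<bar>(2 - Re (a \<sigma> ?n)) - ?e\<^sup>2 * N 1\<bar> \<le> (KQ + KF + 24 * KZ + 16 * KI + KE + KN) * ?e^3" .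
  qed
qed

end

text \<open>The Koebe function linearizes the flow driven by 1. In the notation of the proof 1 - p -
  2 x vanishes for l = -1, so the part of the relative error that is linear in \<delta> is
  proportional to 1 + l. Q measures the distance to the unit circle.\<close>

lemma koebe_step:
  fixes w l :: complex
  assumes Q: "1 \<le> Q" and w: "1 / Q \<le> 1 - cmod w" and l: "cmod l \<le> 1" "cmod (1 + l) \<le> \<epsilon>"
    and d: "0 \<le> \<delta>" "\<delta> \<le> 1/2" "4 * Q\<^sup>2 * \<delta> \<le> 1"
  shows "cmod (koebe (w * (1 - of_real \<delta> * ((1 + l * w) / (1 - l * w)))) / of_real (1 - \<delta>) - koebe w)
     \<le> cmod (koebe w) * (64 * Q^4 * (\<epsilon> + \<delta>) * \<delta>)"
proof -
  define D where "D = (of_real \<delta> :: complex)"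
  define p where "p = (1 + l * w) / (1 - l * w)"
  define x where "x = w * p / (1 - w)"
  have w1: "cmod w < 1" using w Q by (smt (verit) zero_less_divide_1_iff)
  have lw: "cmod (l * w) \<le> cmod w" using l by (simp add: norm_mult mult_left_le_one_le)
  have den: "1 / Q \<le> cmod (1 - l * w)" "1 / Q \<le> cmod (1 - w)"
    using norm_triangle_ineq2[of 1 "l * w"] norm_triangle_ineq2[of 1 w] lw w by auto
  have Qp: "0 < 1 / Q" using Q by simp
  have n0: "1 - l * w \<noteq> 0" "1 - w \<noteq> 0" using den Qp by auto
  have inv: "1 / cmod (1 - l * w) \<le> Q" "1 / cmod (1 - w) \<le> Q"
    using den Qp Q n0 by (auto simp: divide_simps mult.commute split: if_splits)
  have p: "cmod p \<le> 2 * Q"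
  proof -
    have "cmod (1 + l * w) \<le> 2" using norm_triangle_ineq[of 1 "l * w"] lw w1 by simp
    then have "cmod (1 + l * w) * (1 / cmod (1 - l * w)) \<le> 2 * Q" using inv by (intro mult_mono) auto
    then show ?thesis by (simp add: p_def norm_divide)
  qed
  have x: "cmod x \<le> 2 * Q\<^sup>2"
  proof -
    have "cmod w * cmod p * (1 / cmod (1 - w)) \<le> 1 * (2 * Q) * Q"
      using w1 p inv Q by (intro mult_mono) auto
    then show ?thesis by (simp add: x_def norm_divide norm_mult power2_eq_square)
  qed
  have dx: "cmod (D * x) \<le> 1/2"
  proof -
    have "cmod (D * x) \<le> \<delta> * (2 * Q\<^sup>2)" unfolding norm_mult D_def using x d by (simp add: mult_left_mono)
    then show ?thesis using d(3) by (simp add: mult_ac)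
  qed
  have b: "1/2 \<le> cmod (1 + D * x)" using norm_triangle_ineq2[of 1 "- (D * x)"] dx by simp
  have dd: "1/2 \<le> cmod (1 - D)" "1 - D \<noteq> 0"
  proof -
    have "1 - D = of_real (1 - \<delta>)" by (simp add: D_def)
    then have "cmod (1 - D) = \<bar>1 - \<delta>\<bar>" by (simp only: norm_of_real)
    then show "1/2 \<le> cmod (1 - D)" using d by simp
    then show "1 - D \<noteq> 0" by auto
  qed
  have b0: "1 + D * x \<noteq> 0" using b by auto
  define \<theta> where "\<theta> = (D * (1 - p - 2 * x) + D\<^sup>2 * (2 * x - (1 - D) * x\<^sup>2)) / ((1 - D) * (1 + D * x)\<^sup>2)"
  have eq: "koebe (w * (1 - D * p)) / (1 - D) - koebe w = koebe w * \<theta>"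
  proof -
    have "1 - w * (1 - D * p) = (1 - w) * (1 + D * x)" using n0 by (simp add: x_def field_simps)
    then have "koebe (w * (1 - D * p)) = koebe w * ((1 - D * p) / (1 + D * x)\<^sup>2)"
      by (simp add: koebe_def power_mult_distrib)
    then have "koebe (w * (1 - D * p)) / (1 - D) - koebe w = koebe w * ((1 - D * p) / ((1 - D) * (1 + D * x)\<^sup>2) - 1)"
      by (simp add: algebra_simps)
    also have "(1 - D * p) / ((1 - D) * (1 + D * x)\<^sup>2) - 1 = \<theta>"
    proof -
      have "(1 - D * p) - (1 - D) * (1 + D * x)\<^sup>2 = D * (1 - p - 2 * x) + D\<^sup>2 * (2 * x - (1 - D) * x\<^sup>2)"
        by (simp add: power2_eq_square algebra_simps)
      then show ?thesis unfolding \<theta>_def using dd(2) b0 by (simp add: diff_divide_distrib[symmetric] divide_simps)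
    qed
    finally show ?thesis .
  qed
  have "1 - p - 2 * x = - 2 * w * (1 + l) / ((1 - l * w) * (1 - w))"
    unfolding x_def p_def using n0 by (simp add: divide_simps) (simp add: algebra_simps)
  then have "cmod (1 - p - 2 * x) = 2 * cmod w * cmod (1 + l) * (1 / cmod (1 - l * w)) * (1 / cmod (1 - w))"
    by (simp add: norm_divide norm_mult)
  also have "\<dots> \<le> 2 * 1 * \<epsilon> * Q * Q"
    using w1 l(2) inv Q order_trans[OF norm_ge_zero l(2)] by (intro mult_mono mult_nonneg_nonneg) auto
  finally have t1: "cmod (1 - p - 2 * x) \<le> 2 * \<epsilon> * Q\<^sup>2" by (simp add: power2_eq_square mult_ac)
  have t2: "cmod (2 * x - (1 - D) * x\<^sup>2) \<le> 8 * Q^4"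
  proof -
    have D1: "cmod (1 - D) \<le> 1"
    proof -
      have "1 - D = of_real (1 - \<delta>)" by (simp add: D_def)
      then have "cmod (1 - D) = \<bar>1 - \<delta>\<bar>" by (simp only: norm_of_real)
      then show ?thesis using d by simp
    qed
    have "cmod ((1 - D) * x\<^sup>2) \<le> 1 * (2 * Q\<^sup>2)\<^sup>2"
      unfolding norm_mult norm_power using D1 x by (intro mult_mono power_mono) auto
    moreover have "cmod (2 * x) \<le> 4 * Q\<^sup>2" using x by (simp add: norm_mult)
    moreover have "Q\<^sup>2 \<le> Q^4" using Q by (intro power_increasing) auto
    moreover have "(2 * Q\<^sup>2)\<^sup>2 = 4 * Q^4" by (simp add: power_mult_distrib flip: power_mult)
    ultimately show ?thesis using norm_triangle_ineq4[of "2 * x" "(1 - D) * x\<^sup>2"] by linarith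
  qed
  have th: "cmod \<theta> \<le> 64 * Q^4 * (\<epsilon> + \<delta>) * \<delta>"
  proof -
    have e0: "0 \<le> \<epsilon>" using l(2) norm_ge_zero order_trans by blast
    let ?n = "D * (1 - p - 2 * x) + D\<^sup>2 * (2 * x - (1 - D) * x\<^sup>2)"
    have cD: "cmod D = \<delta>" using d by (simp add: D_def)
    have "cmod ?n \<le> cmod (D * (1 - p - 2 * x)) + cmod (D\<^sup>2 * (2 * x - (1 - D) * x\<^sup>2))" by (rule norm_triangle_ineq)
    also have "\<dots> \<le> \<delta> * (2 * \<epsilon> * Q\<^sup>2) + \<delta>\<^sup>2 * (8 * Q^4)"
      unfolding norm_mult norm_power cD using t1 t2 d by (intro add_mono mult_left_mono) auto
    also have "\<dots> \<le> \<delta> * (8 * \<epsilon> * Q^4) + \<delta>\<^sup>2 * (8 * Q^4)"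
    proof -
      have "Q\<^sup>2 \<le> Q^4" using Q by (intro power_increasing) auto
      then have "2 * \<epsilon> * Q\<^sup>2 \<le> 8 * \<epsilon> * Q^4" using e0 Q by (intro mult_mono) auto
      then show ?thesis using d by (intro add_right_mono mult_left_mono) auto
    qed
    finally have nb: "cmod ?n \<le> 8 * Q^4 * (\<epsilon> + \<delta>) * \<delta>" by (simp add: power2_eq_square algebra_simps)
    have "1/2 * (1/2)\<^sup>2 \<le> cmod (1 - D) * (cmod (1 + D * x))\<^sup>2"
      using dd b by (intro mult_mono power_mono) auto
    then have db: "1/8 \<le> cmod ((1 - D) * (1 + D * x)\<^sup>2)" by (simp add: norm_mult norm_power power2_eq_square)
    have "cmod \<theta> = cmod ?n / cmod ((1 - D) * (1 + D * x)\<^sup>2)" by (simp add: \<theta>_def norm_divide)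
    also have "\<dots> \<le> (8 * Q^4 * (\<epsilon> + \<delta>) * \<delta>) / (1/8)"
      using nb db order_trans[OF norm_ge_zero nb] by (intro frac_le) auto
    finally show ?thesis by simp
  qed
  have "cmod (koebe w * \<theta>) \<le> cmod (koebe w) * (64 * Q^4 * (\<epsilon> + \<delta>) * \<delta>)"
    unfolding norm_mult using th by (rule mult_left_mono) simp
  then show ?thesis unfolding p_def[symmetric] of_real_diff of_real_1 D_def[symmetric] eq .
qed

text \<open>For small \<delta> the factor has modulus at most 1, because (1 + v) / (1 - v) has
  positive real part; injectivity follows by dividing the difference of two values by a - b. With
  |l| \<le> r < 1 the denominators stay above 1 - r on the whole disc, so one step size works
  everywhere.\<close>

lemma disc_embedding_euler_step:
  assumes \<phi>: "disc_embedding \<phi>" and l: "cmod l \<le> r" and r: "0 \<le> r" "r < 1" and d: "0 \<le> \<delta>" "\<delta> \<le> (1 - r)^3 / 8"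
  defines "\<psi> \<equiv> \<lambda>z. \<phi> z * (1 - of_real \<delta> * ((1 + l * \<phi> z) / (1 - l * \<phi> z)))"
  shows "disc_embedding \<psi>"
proof -
  have hol: "\<phi> holomorphic_on ball 0 1" and inj: "inj_on \<phi> (ball 0 1)" and \<phi>0: "\<phi> 0 = 0"
    and im: "\<phi> ` ball 0 1 \<subseteq> ball 0 1"
    using \<phi> unfolding disc_embedding_def by auto
  have dis: "cmod (\<phi> z) < 1" if "z \<in> ball 0 1" for z using im that by (auto simp: image_subset_iff)
  define g where "g = 1 - r"
  have g: "0 < g" "g \<le> 1" "\<delta> \<le> g^3 / 8" using r d by (auto simp: g_def)
  have lw: "cmod (l * w) \<le> r" if "cmod w < 1" for w
    unfolding norm_mult using l that r mult_mono[of "cmod l" r "cmod w" 1] by simp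
  have den: "g \<le> cmod (1 - l * w)" "1 - l * w \<noteq> 0" if "cmod w < 1" for w
  proof -
    show "g \<le> cmod (1 - l * w)" using norm_triangle_ineq2[of 1 "l * w"] lw[OF that] by (simp add: g_def)
    then show "1 - l * w \<noteq> 0" using g by auto
  qed
  have le: "cmod (1 - of_real \<delta> * ((1 + l * w) / (1 - l * w))) \<le> 1" if w: "cmod w < 1" for w
  proof -
    define v where "v = l * w"
    have v: "cmod v \<le> r" using lw[OF w] by (simp add: v_def)
    have dv: "1 - v \<noteq> 0" "g \<le> cmod (1 - v)" using den[OF w] by (auto simp: v_def)
    have "cmod ((1 - v) - of_real \<delta> * (1 + v)) \<le> cmod (1 - v)"
    proof (rule power2_le_imp_le)
      have "(cmod (1 - v))\<^sup>2 - (cmod ((1 - v) - of_real \<delta> * (1 + v)))\<^sup>2 = 2 * \<delta> * (1 - (cmod v)\<^sup>2) - \<delta>\<^sup>2 * (cmod (1 + v))\<^sup>2"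
        unfolding cmod_power2 by (simp add: power2_eq_square algebra_simps)
      moreover have "\<delta>\<^sup>2 * (cmod (1 + v))\<^sup>2 \<le> 2 * \<delta> * (1 - (cmod v)\<^sup>2)"
      proof -
        have "cmod (1 + v) \<le> 2" using norm_triangle_ineq[of 1 v] v r by simp
        then have "(cmod (1 + v))\<^sup>2 \<le> 2\<^sup>2" by (intro power_mono) auto
        then have "\<delta> * (cmod (1 + v))\<^sup>2 \<le> (g^3 / 8) * 4" using g d by (intro mult_mono) auto
        also have "\<dots> \<le> 2 * g" using g power_decreasing[of 1 3 g] by simp
        also have "g \<le> 1 - (cmod v)\<^sup>2"
        proof -
          have "(cmod v)\<^sup>2 \<le> cmod v * 1" unfolding power2_eq_square using v r by (intro mult_left_mono) auto
          then show ?thesis using v by (simp add: g_def)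
        qed
        finally have "\<delta> * (\<delta> * (cmod (1 + v))\<^sup>2) \<le> \<delta> * (2 * (1 - (cmod v)\<^sup>2))" using d by (intro mult_left_mono) auto
        then show ?thesis by (simp add: power2_eq_square mult_ac)
      qed
      ultimately show "(cmod ((1 - v) - of_real \<delta> * (1 + v)))\<^sup>2 \<le> (cmod (1 - v))\<^sup>2" by linarith
    qed simp
    moreover have "1 - of_real \<delta> * ((1 + v) / (1 - v)) = ((1 - v) - of_real \<delta> * (1 + v)) / (1 - v)"
      using dv by (simp add: field_simps)
    ultimately show ?thesis using dv g by (simp add: norm_divide flip: v_def)
  qed
  have "\<psi> holomorphic_on ball 0 1"
    unfolding \<psi>_def using hol den(2)[OF dis] by (intro holomorphic_intros) auto
  moreover have "\<psi> 0 = 0" by (simp add: \<psi>_def \<phi>0)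
  moreover have "\<psi> ` ball 0 1 \<subseteq> ball 0 1"
  proof
    fix y assume "y \<in> \<psi> ` ball 0 1"
    then obtain z where z: "z \<in> ball 0 1" "y = \<psi> z" by auto
    have "cmod (\<psi> z) \<le> cmod (\<phi> z) * 1" unfolding \<psi>_def norm_mult[of "\<phi> z"] using le[OF dis[OF z(1)]] by (intro mult_left_mono) auto
    then show "y \<in> ball 0 1" using dis[OF z(1)] z by simp
  qed
  moreover have "inj_on \<psi> (ball 0 1)"
  proof (rule inj_onI, rule ccontr)
    fix x y :: complex assume xy: "x \<in> ball 0 1" "y \<in> ball 0 1" "\<psi> x = \<psi> y" "x \<noteq> y"
    define a where "a = \<phi> x"
    define b where "b = \<phi> y"
    have ab: "cmod a < 1" "cmod b < 1" "a \<noteq> b" using dis xy inj by (auto simp: a_def b_def dest: inj_onD)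
    note da = den[OF ab(1)] and db = den[OF ab(2)]
    have "0 = \<psi> x - \<psi> y" using xy by simp
    also have "\<dots> = (a - b) * (1 - of_real \<delta> * (2 / ((1 - l * a) * (1 - l * b)) - 1))"
      unfolding \<psi>_def a_def[symmetric] b_def[symmetric] using da db by (simp add: divide_simps) (simp add: algebra_simps)
    finally have "1 = of_real \<delta> * (2 / ((1 - l * a) * (1 - l * b)) - 1)" using ab(3) by simp
    then have "1 = cmod (of_real \<delta> * (2 / ((1 - l * a) * (1 - l * b)) - 1))" by (metis norm_one)
    also have "\<dots> = \<delta> * cmod (2 / ((1 - l * a) * (1 - l * b)) - 1)" using d by (simp add: norm_mult)
    also have "\<dots> \<le> (g^3 / 8) * (2 / (g * g) + 1)"
    proof (intro mult_mono)
      have "cmod (2 / ((1 - l * a) * (1 - l * b)) - 1) \<le> cmod (2 / ((1 - l * a) * (1 - l * b))) + 1"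
        using norm_triangle_ineq4[of _ 1] by (metis norm_one)
      also have "cmod (2 / ((1 - l * a) * (1 - l * b))) \<le> 2 / (g * g)"
        unfolding norm_divide norm_mult using da db g by (intro frac_le mult_mono) auto
      finally show "cmod (2 / ((1 - l * a) * (1 - l * b)) - 1) \<le> 2 / (g * g) + 1" by simp
    qed (use g d in auto)
    also have "\<dots> = g / 4 + g^3 / 8" using g by (simp add: field_simps power3_eq_cube)
    also have "\<dots> < 1" using g power_decreasing[of 1 3 g] by simp
    finally show False by simp
  qed
  ultimately show ?thesis unfolding disc_embedding_def by blast
qed

text \<open>The quantity koebe(\<phi>) / s is the one to compare with K, since it is invariant under
  the exact flow driven by 1. The exponential collects the factors 1 + C \<delta> of all steps, as
  the sum of the \<delta> is at most ln (1 / s); \<open>d\<close> bounds the single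
  \<delta>.\<close>

definition koebe_near :: "real \<Rightarrow> real \<Rightarrow> (complex \<Rightarrow> complex) \<Rightarrow> real \<Rightarrow> bool" where
  "koebe_near \<epsilon> d \<phi> s \<longleftrightarrow> (\<forall>z Q. 1 \<le> Q \<longrightarrow> 1 / Q \<le> 1 - cmod z \<longrightarrow> 4 * Q\<^sup>2 * d \<le> 1 \<longrightarrow>
     cmod (koebe (\<phi> z) / of_real s - koebe z) \<le> cmod (koebe z) * (exp (64 * Q^4 * (\<epsilon> + d) * ln (1 / s)) - 1))"

lemma koebe_near_step:
  assumes \<phi>: "disc_embedding \<phi>" and near: "koebe_near \<epsilon> d \<phi> s" and s: "0 < s"
    and l: "cmod l \<le> 1" "cmod (1 + l) \<le> \<epsilon>" and d: "0 \<le> \<delta>" "\<delta> \<le> d" "\<delta> \<le> 1/2"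
  shows "koebe_near \<epsilon> d (\<lambda>z. \<phi> z * (1 - of_real \<delta> * ((1 + l * \<phi> z) / (1 - l * \<phi> z)))) ((1 - \<delta>) * s)"
  unfolding koebe_near_def
proof (intro allI impI)
  fix z :: complex and Q :: real
  assume Q: "1 \<le> Q" and z: "1 / Q \<le> 1 - cmod z" and Qd: "4 * Q\<^sup>2 * d \<le> 1"
  define w where "w = \<phi> z"
  define \<psi> where "\<psi> = w * (1 - of_real \<delta> * ((1 + l * w) / (1 - l * w)))"
  define C where "C = 64 * Q^4 * (\<epsilon> + d)"
  define G where "G = exp (C * ln (1 / s))"
  have e0: "0 \<le> \<epsilon>" by (rule order_trans[OF norm_ge_zero l(2)])
  have C0: "0 \<le> C" unfolding C_def using Q d e0 by (intro mult_nonneg_nonneg) auto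
  have "0 < 1 / Q" using Q by simp
  then have z1: "cmod z < 1" using z by linarith
  have "cmod (\<phi> z) \<le> cmod z"
    using Schwarz_Lemma[of \<phi> z] \<phi> z1 unfolding disc_embedding_def by (auto simp: image_subset_iff)
  then have w: "1 / Q \<le> 1 - cmod w" using z by (simp add: w_def)
  have "4 * Q\<^sup>2 * \<delta> \<le> 4 * Q\<^sup>2 * d" using d by (intro mult_left_mono) auto
  then have st: "cmod (koebe \<psi> / of_real (1 - \<delta>) - koebe w) \<le> cmod (koebe w) * (64 * Q^4 * (\<epsilon> + \<delta>) * \<delta>)"
    unfolding \<psi>_def using Qd by (intro koebe_step Q w l d) auto
  have "64 * Q^4 * (\<epsilon> + \<delta>) * \<delta> \<le> C * \<delta>" unfolding C_def using d Q by (intro mult_right_mono mult_left_mono) auto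
  then have st: "cmod (koebe \<psi> / of_real (1 - \<delta>) - koebe w) \<le> cmod (koebe w) * (C * \<delta>)"
    using st mult_left_mono[of _ "C * \<delta>" "cmod (koebe w)"] by (meson norm_ge_zero order_trans)
  have n1: "cmod (koebe w / of_real s - koebe z) \<le> cmod (koebe z) * (G - 1)"
    using near Q z Qd unfolding koebe_near_def w_def G_def C_def by auto
  have P: "cmod (koebe w / of_real s) \<le> cmod (koebe z) * G"
    using norm_triangle_ineq2[of "koebe w / of_real s" "koebe z"] n1 by (simp add: algebra_simps)
  have n2: "cmod ((koebe \<psi> / of_real (1 - \<delta>) - koebe w) / of_real s) \<le> cmod (koebe z) * G * (C * \<delta>)"
  proof -
    have "cmod ((koebe \<psi> / of_real (1 - \<delta>) - koebe w) / of_real s) \<le> cmod (koebe w) * (C * \<delta>) / s"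
      using st s by (simp add: norm_divide divide_right_mono)
    also have "\<dots> = cmod (koebe w / of_real s) * (C * \<delta>)" using s by (simp add: norm_divide)
    also have "\<dots> \<le> cmod (koebe z) * G * (C * \<delta>)" using P C0 d by (intro mult_right_mono) auto
    finally show ?thesis .
  qed
  \<comment> \<open>The new factor 1 + C \<delta> is at most exp (- C ln (1 - \<delta>)), which is
    exactly the growth of the exponential when s becomes (1 - \<delta>) s.\<close>
  have E: "exp (C * ln (1 / ((1 - \<delta>) * s))) \<ge> G * (1 + C * \<delta>)"
  proof -
    have "1 + C * \<delta> \<le> exp (C * \<delta>)" by (rule exp_ge_add_one_self)
    also have "\<delta> \<le> - ln (1 - \<delta>)" using ln_add_one_self_le_self2[of "- \<delta>"] d by simp
    then have "exp (C * \<delta>) \<le> exp (C * - ln (1 - \<delta>))" using C0 by (intro iffD2[OF exp_le_cancel_iff] mult_left_mono)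
    finally have "G * (1 + C * \<delta>) \<le> G * exp (C * - ln (1 - \<delta>))" by (intro mult_left_mono) (auto simp: G_def)
    also have "\<dots> = exp (C * ln (1 / ((1 - \<delta>) * s)))"
    proof -
      have "ln (1 / ((1 - \<delta>) * s)) = ln (1 / s) + - ln (1 - \<delta>)" using s d ln_mult[of "1 - \<delta>" s] by (simp add: ln_div)
      then show ?thesis by (simp only: G_def exp_add[symmetric] distrib_left)
    qed
    finally show ?thesis .
  qed
  have "koebe \<psi> / of_real ((1 - \<delta>) * s) - koebe z
      = (koebe \<psi> / of_real (1 - \<delta>) - koebe w) / of_real s + (koebe w / of_real s - koebe z)"
    by (simp add: diff_divide_distrib)
  then have "cmod (koebe \<psi> / of_real ((1 - \<delta>) * s) - koebe z) \<le> cmod (koebe z) * G * (C * \<delta>) + cmod (koebe z) * (G - 1)"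
    using norm_triangle_le[OF add_mono[OF n2 n1]] by metis
  also have "\<dots> = cmod (koebe z) * (G * (1 + C * \<delta>) - 1)" by (simp add: algebra_simps)
  also have "\<dots> \<le> cmod (koebe z) * (exp (C * ln (1 / ((1 - \<delta>) * s))) - 1)" using E by (intro mult_left_mono) auto
  finally show "cmod (koebe (\<phi> z * (1 - of_real \<delta> * ((1 + l * \<phi> z) / (1 - l * \<phi> z)))) / of_real ((1 - \<delta>) * s) - koebe z)
    \<le> cmod (koebe z) * (exp (64 * Q^4 * (\<epsilon> + d) * ln (1 / ((1 - \<delta>) * s))) - 1)"
    unfolding C_def \<psi>_def w_def .
qed

section \<open>Euler chains with prescribed driving angle\<close>

lemma cis_minus_one_le: "cmod (1 - cis x) \<le> \<bar>x\<bar>"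
proof (rule power2_le_imp_le)
  have "(cmod (1 - cis x))\<^sup>2 = 2 * (1 - cos x)"
    unfolding cmod_power2 using sin_cos_squared_add[of x] by (simp add: power2_eq_square algebra_simps)
  also have "\<dots> \<le> \<bar>x\<bar>\<^sup>2" using sin_cos_estimates(3)[of x] by simp
  finally show "(cmod (1 - cis x))\<^sup>2 \<le> \<bar>x\<bar>\<^sup>2" .
qed simp

text \<open>The steps are equal in the conformal radius s, so the relative step \<Delta> / s grows
  as s falls to its lower bound \<eta>; hence the condition \<Delta> \<le> d \<eta>. The cubic bound
  on d is that of \<open>disc_embedding_euler_step\<close> for r = 1 - \<eta> / 1000.\<close>

lemma driven_chain:
  assumes eta: "0 < \<eta>" "\<eta> \<le> 1" and \<theta>: "\<And>s. s \<in> {0..1} \<Longrightarrow> \<bar>\<theta> s\<bar> \<le> \<epsilon>"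
    and D: "0 \<le> \<Delta>" "\<Delta> \<le> d * \<eta>" "d \<le> (\<eta> / 1000)^3 / 8" and k: "real k * \<Delta> \<le> 1 - \<eta>"
  shows "\<exists>\<phi> t \<kappa> a b c. disc_embedding \<phi> \<and> deriv \<phi> 0 = of_real (1 - real k * \<Delta>) \<and> loewner_chain \<eta> k t \<kappa> a b c \<and>
     t k = real k * \<Delta> \<and> (\<forall>j<k. \<kappa> j = cis (- \<theta> (t j))) \<and> a k = taylor_coeff \<phi> 2 / of_real (1 - real k * \<Delta>) \<and>
     b k = taylor_coeff \<phi> 3 / of_real (1 - real k * \<Delta>) \<and> c k = taylor_coeff \<phi> 4 / of_real (1 - real k * \<Delta>) \<and>
     cmod (a k) \<le> 1 + 4 * t k \<and> cmod (b k) \<le> 1 + 44 * t k \<and> koebe_near (\<epsilon> + \<eta> / 1000) d \<phi> (1 - real k * \<Delta>)"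
  using k
proof (induction k)
  case 0
  have e: "fps_expansion (\<lambda>z::complex. z) 0 = fps_X" by (rule fps_expansion_eqI) (rule fps_expansion_intros)
  show ?case
    by (rule exI[of _ "\<lambda>z. z"], rule exI[of _ "\<lambda>_. 0"], rule exI[of _ "\<lambda>_. 1"], (rule exI[of _ "\<lambda>_. 0"])+)
       (use eta in \<open>auto simp: disc_embedding_def loewner_chain_def koebe_near_def e fps_X_def\<close>)
next
  case (Suc k)
  define s where "s = 1 - real k * \<Delta>"
  have k': "real k * \<Delta> \<le> 1 - \<eta>" using Suc.prems D by (simp add: algebra_simps)
  obtain \<phi> t \<kappa> a b c where \<phi>: "disc_embedding \<phi>" and d\<phi>: "deriv \<phi> 0 = of_real s" and ch: "loewner_chain \<eta> k t \<kappa> a b c"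
    and tk: "t k = real k * \<Delta>" and kap: "\<And>j. j < k \<Longrightarrow> \<kappa> j = cis (- \<theta> (t j))"
    and cf: "a k = taylor_coeff \<phi> 2 / of_real s" "b k = taylor_coeff \<phi> 3 / of_real s" "c k = taylor_coeff \<phi> 4 / of_real s"
    and bd: "cmod (a k) \<le> 1 + 4 * t k" "cmod (b k) \<le> 1 + 44 * t k" and near: "koebe_near (\<epsilon> + \<eta> / 1000) d \<phi> s"
    using Suc.IH[OF k'] unfolding s_def by blast
  have s: "\<eta> \<le> s" "0 < s" "s \<le> 1" "t k = 1 - s" using k' eta D by (auto simp: s_def tk)
  define \<delta> where "\<delta> = \<Delta> / s"
  have ds: "(1 - \<delta>) * s = 1 - real (Suc k) * \<Delta>" using s by (simp add: \<delta>_def field_simps) (simp add: s_def algebra_simps)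
  have "(\<eta> / 1000)^3 \<le> (\<eta> / 1000)^1" using eta by (intro power_decreasing) auto
  then have d: "d \<le> \<eta> / 8000" using D(3) by simp
  have dl: "0 \<le> \<delta>" "\<delta> \<le> d" "\<delta> \<le> 1/2" "\<delta> < 1"
  proof -
    show "0 \<le> \<delta>" using D s by (simp add: \<delta>_def)
    have "d \<ge> 0" using D eta by (smt (verit) mult_neg_pos)
    then have "d * \<eta> \<le> d * s" using s by (intro mult_left_mono) auto
    then show "\<delta> \<le> d" using D s by (simp add: \<delta>_def pos_divide_le_eq)
    then show "\<delta> \<le> 1/2" "\<delta> < 1" using d eta by linarith+
  qed
  define r where "r = 1 - \<eta> / 1000"
  have r: "0 \<le> r" "r < 1" using eta by (auto simp: r_def)
  define K where "K = cis (- \<theta> (t k))"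
  have K: "cmod K = 1" by (simp add: K_def)
  \<comment> \<open>Slightly inside the unit circle for univalence; the deviation \<eta> / 1000 from
    -K is within the tolerance of \<open>loewner_chain_append\<close>.\<close>
  define l where "l = - of_real r * K"
  have l1: "cmod l = r" using r by (simp add: l_def norm_mult K)
  have lK: "cmod (l + K) = \<eta> / 1000"
  proof -
    have "l + K = of_real (\<eta> / 1000) * K" by (simp add: l_def r_def algebra_simps)
    then have "cmod (l + K) = cmod (of_real (\<eta> / 1000)) * cmod K" by (simp only: norm_mult)
    also have "cmod (of_real (\<eta> / 1000)) = \<bar>\<eta> / 1000\<bar>" by (simp only: norm_of_real)
    finally show ?thesis using eta by (simp add: K)
  qed
  have l2: "cmod (1 + l) \<le> \<epsilon> + \<eta> / 1000"
  proof -
    have "cmod (1 - K) \<le> \<bar>- \<theta> (t k)\<bar>" unfolding K_def by (rule cis_minus_one_le)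
    also have "\<dots> \<le> \<epsilon>" using \<theta>[of "t k"] s eta by simp
    finally have "cmod (1 - K) \<le> \<epsilon>" .
    then show ?thesis using norm_triangle_ineq[of "1 - K" "l + K"] lK by simp
  qed
  define \<psi> where "\<psi> = (\<lambda>z. \<phi> z * (1 - of_real \<delta> * ((1 + l * \<phi> z) / (1 - l * \<phi> z))))"
  have "disc_embedding \<psi>" unfolding \<psi>_def
    by (rule disc_embedding_euler_step[OF \<phi>, where r=r]) (use l1 r dl D in \<open>auto simp: r_def\<close>)
  moreover have hol: "\<phi> holomorphic_on ball 0 1" and p0: "\<phi> 0 = 0" using \<phi> by (auto simp: disc_embedding_def)
  have "koebe_near (\<epsilon> + \<eta> / 1000) d \<psi> (1 - real (Suc k) * \<Delta>)"
    unfolding \<psi>_def ds[symmetric] using near s l1 l2 r dl by (intro koebe_near_step[OF \<phi>]) auto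
  moreover note cc = composed_coeffs[OF hol p0 d\<phi> s(2) dl(4), of \<psi> l l, unfolded \<psi>_def, OF refl, folded \<psi>_def cf, unfolded ds]
  have "deriv \<psi> 0 = taylor_coeff \<psi> 1" by (simp add: fps_expansion_def)
  then have "deriv \<psi> 0 = of_real (1 - real (Suc k) * \<Delta>)" using cc(1) by simp
  moreover have "300 * (2 * \<delta> + \<eta> / 1000) \<le> \<eta>" using dl d by simp
  then obtain t' \<kappa>' a' b' c' where T: "loewner_chain \<eta> (Suc k) t' \<kappa>' a' b' c'" "t' (Suc k) = 1 - (1 - \<delta>) * s"
     "a' (Suc k) = a k - of_real (\<delta> * s / (1 - \<delta>)) * (l + l)"
     "b' (Suc k) = b k - of_real (\<delta> * s / (1 - \<delta>)) * (l + l) * (2 * a k + l * of_real s)"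
     "c' (Suc k) = c k - of_real (\<delta> * s / (1 - \<delta>)) * (l + l) * (2 * b k + (a k)\<^sup>2 + 3 * l * of_real s * a k + l\<^sup>2 * of_real (s\<^sup>2))"
     "cmod (a' (Suc k)) \<le> 1 + 4 * t' (Suc k)" "cmod (b' (Suc k)) \<le> 1 + 44 * t' (Suc k)"
     "\<forall>j\<le>k. t' j = t j \<and> a' j = a j \<and> b' j = b j \<and> c' j = c j" "\<forall>j<k. \<kappa>' j = \<kappa> j" "\<kappa>' k = K"
    using loewner_chain_append[OF ch K, of l l "\<eta> / 1000" \<delta> s] l1 lK r dl s bd by auto
  have "t' (Suc k) = real (Suc k) * \<Delta>" using T(2) ds by simp
  moreover have "\<kappa>' j = cis (- \<theta> (t' j))" if "j < Suc k" for j
    using T(8-10) kap[of j] that by (cases "j = k") (auto simp: K_def)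
  ultimately show ?case
    using T cc by (intro exI[of _ \<psi>] exI[of _ t'] exI[of _ \<kappa>'] exI[of _ a'] exI[of _ b'] exI[of _ c']) simp
qed

text \<open>The chain is stopped at conformal radius \<eta> = \<epsilon>^3 and rescaled by it. The
  number -3 ln \<epsilon> is ln (1 / \<eta>), the logarithmic time over which deviations of size
  \<epsilon> accumulate; \<epsilon> ln \<epsilon> tends to 0, so f tends to K on compact
  sets.\<close>

lemma koebe_perturbation:
  assumes \<epsilon>: "0 < \<epsilon>" "\<epsilon> \<le> 1" and u: "\<And>s. s \<in> {0..1} \<Longrightarrow> \<bar>u s\<bar> \<le> U"
  shows "\<exists>f\<in>class_S. \<exists>\<sigma>\<in>admissible. s_eta \<sigma> = \<epsilon>^3 \<and> (\<forall>k<s_n \<sigma>. s_kap \<sigma> k = cis (- (\<epsilon> * u (s_t \<sigma> k)))) \<and>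
     s_a \<sigma> (s_n \<sigma>) = taylor_coeff f 2 \<and> s_c \<sigma> (s_n \<sigma>) = taylor_coeff f 4 \<and>
     (\<forall>z Q. 1 \<le> Q \<longrightarrow> 1 / Q \<le> 1 - cmod z \<longrightarrow> Q\<^sup>2 * \<epsilon> \<le> 1 \<longrightarrow>
       cmod (f z - koebe z) \<le> Q\<^sup>2 * (exp (64 * Q^4 * (U + 2) * (\<epsilon> * (-3 * ln \<epsilon>))) - 1)
          + 12 * \<epsilon>^3 * (Q\<^sup>2 * exp (64 * Q^4 * (U + 2) * (\<epsilon> * (-3 * ln \<epsilon>))))\<^sup>2)"
proof -
  define \<eta> where "\<eta> = \<epsilon>^3"
  have eta: "0 < \<eta>" "\<eta> \<le> 1" "\<eta> \<le> \<epsilon>"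
    using \<epsilon> power_decreasing[of 1 3 \<epsilon>] by (auto simp: \<eta>_def power_le_one)
  define d where "d = (\<eta> / 1000)^3 / 8"
  have d: "0 < d" "d \<le> \<eta> / 8000"
  proof -
    show "0 < d" using eta by (simp add: d_def)
    have "(\<eta> / 1000)^3 \<le> (\<eta> / 1000)^1" using eta by (intro power_decreasing) auto
    then show "d \<le> \<eta> / 8000" by (simp add: d_def)
  qed
  obtain n where n: "(1 - \<eta>) / (d * \<eta>) < real n" using reals_Archimedean2 by blast
  have n0: "0 < n" using n eta d by (metis divide_nonneg_pos diff_ge_0_iff_ge less_irrefl mult_pos_pos not_gr_zero of_nat_0 order_le_less_trans)
  define \<Delta> where "\<Delta> = (1 - \<eta>) / real n"
  have D: "0 \<le> \<Delta>" "\<Delta> \<le> d * \<eta>" "real n * \<Delta> = 1 - \<eta>"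
    using n n0 eta d by (auto simp: \<Delta>_def field_simps)
  have th: "\<bar>\<epsilon> * u s\<bar> \<le> \<epsilon> * U" if "s \<in> {0..1}" for s using u[OF that] \<epsilon> by (simp add: abs_mult)
  have n1: "1 - real n * \<Delta> = \<eta>" using D by simp
  obtain \<phi> t \<kappa> a b c where \<phi>: "disc_embedding \<phi>" and d\<phi>: "deriv \<phi> 0 = of_real \<eta>" and ch: "loewner_chain \<eta> n t \<kappa> a b c"
    and tn: "t n = 1 - \<eta>" and kap: "\<forall>j<n. \<kappa> j = cis (- (\<epsilon> * u (t j)))" and cf: "a n = taylor_coeff \<phi> 2 / of_real \<eta>"
    "c n = taylor_coeff \<phi> 4 / of_real \<eta>" and near: "koebe_near (\<epsilon> * U + \<eta> / 1000) d \<phi> \<eta>"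
    using driven_chain[where \<theta>="\<lambda>s. \<epsilon> * u s", OF eta(1,2) th D(1,2), where k=n] unfolding n1 D(3) d_def by auto
  define f where "f = (\<lambda>z. \<phi> z / of_real \<eta>)"
  have hol: "\<phi> holomorphic_on ball 0 1" and inj: "inj_on \<phi> (ball 0 1)" and p0: "\<phi> 0 = 0"
    and pim: "\<And>z. cmod z < 1 \<Longrightarrow> cmod (\<phi> z) < 1"
    using \<phi> unfolding disc_embedding_def by (auto simp: image_subset_iff)
  have "(\<phi> has_field_derivative of_real \<eta>) (at 0)" using hol d\<phi> holomorphic_derivI[of \<phi> "ball 0 1" 0] by simp
  then have "(f has_field_derivative of_real \<eta> / of_real \<eta>) (at 0)" unfolding f_def using eta by (intro DERIV_cdivide)
  then have "deriv f 0 = 1" using eta by (simp add: DERIV_imp_deriv)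
  moreover have "f holomorphic_on ball 0 1" unfolding f_def using hol eta by (intro holomorphic_intros) auto
  ultimately have f: "f \<in> class_S" using inj eta by (auto simp: class_S_def inj_on_def f_def p0)
  have F: "\<phi> has_fps_expansion fps_expansion \<phi> 0" using hol by (intro has_fps_expansion_fps_expansion[of "ball 0 1"]) auto
  have "f = (\<lambda>z. inverse (of_real \<eta>) * \<phi> z)" by (simp add: f_def field_simps)
  then have "f has_fps_expansion fps_const (inverse (of_real \<eta>)) * fps_expansion \<phi> 0"
    using F by (auto intro!: fps_expansion_intros)
  then have e: "fps_expansion f 0 = fps_const (inverse (of_real \<eta>)) * fps_expansion \<phi> 0" by (rule fps_expansion_eqI)
  have tc: "taylor_coeff f j = taylor_coeff \<phi> j / of_real \<eta>" for j unfolding e by (simp add: field_simps)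
  define \<sigma> where "\<sigma> = LSys \<eta> n t \<kappa> a b c"
  have adm: "\<sigma> \<in> admissible" using ch tn eta by (simp add: admissible_def \<sigma>_def)
  have cl: "cmod (f z - koebe z) \<le> Q\<^sup>2 * (exp (64 * Q^4 * (U + 2) * (\<epsilon> * (-3 * ln \<epsilon>))) - 1)
          + 12 * \<epsilon>^3 * (Q\<^sup>2 * exp (64 * Q^4 * (U + 2) * (\<epsilon> * (-3 * ln \<epsilon>))))\<^sup>2"
    if Q: "1 \<le> Q" "1 / Q \<le> 1 - cmod z" "Q\<^sup>2 * \<epsilon> \<le> 1" for z Q
  proof -
    define G where "G = exp (64 * Q^4 * (U + 2) * (\<epsilon> * (-3 * ln \<epsilon>)))"
    define Y where "Y = koebe (\<phi> z) / of_real \<eta>"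
    have Qp: "0 < 1 / Q" using Q by simp
    then have z1: "cmod z < 1" using Q by linarith
    have k: "cmod (koebe z) \<le> Q\<^sup>2"
    proof -
      have "1 / Q \<le> cmod (1 - z)" using norm_triangle_ineq2[of 1 z] Q by simp
      then have "(1 / Q)\<^sup>2 \<le> (cmod (1 - z))\<^sup>2" using Qp by (intro power_mono) auto
      then have "cmod z / (cmod (1 - z))\<^sup>2 \<le> 1 / (1 / Q)\<^sup>2" by (intro frac_le less_imp_le[OF z1] zero_less_power[OF Qp]) auto
      then show ?thesis by (simp add: koebe_def norm_divide norm_power power_divide)
    qed
    have l0: "0 \<le> -3 * ln \<epsilon>" using \<epsilon> by simp
    have le: "64 * Q^4 * ((\<epsilon> * U + \<eta> / 1000) + d) * ln (1 / \<eta>) \<le> 64 * Q^4 * (U + 2) * (\<epsilon> * (-3 * ln \<epsilon>))"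
    proof -
      have "ln (1 / \<eta>) = -3 * ln \<epsilon>" using \<epsilon> by (simp add: \<eta>_def ln_div ln_realpow)
      moreover have "(\<epsilon> * U + \<eta> / 1000) + d \<le> (U + 2) * \<epsilon>" using d eta by (simp add: algebra_simps)
      ultimately have "64 * Q^4 * ((\<epsilon> * U + \<eta> / 1000) + d) * ln (1 / \<eta>) \<le> 64 * Q^4 * ((U + 2) * \<epsilon>) * (-3 * ln \<epsilon>)"
        using l0 Q by (simp only:) (intro mult_right_mono mult_left_mono, auto)
      then show ?thesis by (simp only: mult.assoc)
    qed
    have "4 * Q\<^sup>2 * d \<le> Q\<^sup>2 * \<epsilon>"
    proof -
      have "Q\<^sup>2 * (4 * d) \<le> Q\<^sup>2 * \<epsilon>" using d eta by (intro mult_left_mono) auto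
      then show ?thesis by simp
    qed
    then have "4 * Q\<^sup>2 * d \<le> 1" using Q(3) by linarith
    then have "cmod (Y - koebe z) \<le> cmod (koebe z) * (exp (64 * Q^4 * ((\<epsilon> * U + \<eta> / 1000) + d) * ln (1 / \<eta>)) - 1)"
      using near Q(1,2) unfolding koebe_near_def Y_def by blast
    also have "\<dots> \<le> cmod (koebe z) * (G - 1)" unfolding G_def using le by (intro mult_left_mono) auto
    also have "\<dots> \<le> Q\<^sup>2 * (G - 1)"
    proof (rule mult_right_mono[OF k])
      have "0 \<le> 64 * Q^4 * (U + 2) * (\<epsilon> * (-3 * ln \<epsilon>))"
      proof -
        have "0 \<le> U" using u[of 0] by simp
        then have "0 \<le> 64 * Q^4 * (U + 2)" by simp
        moreover have "0 \<le> \<epsilon> * (-3 * ln \<epsilon>)" by (rule mult_nonneg_nonneg[OF less_imp_le[OF \<epsilon>(1)] l0])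
        ultimately show ?thesis by (rule mult_nonneg_nonneg)
      qed
      then show "0 \<le> G - 1" unfolding G_def by simp
    qed
    finally have Yk: "cmod (Y - koebe z) \<le> Q\<^sup>2 * (G - 1)" .
    then have Yb: "cmod Y \<le> Q\<^sup>2 * G"
      using norm_triangle_ineq2[of Y "koebe z"] k by (simp add: algebra_simps)
    define w where "w = \<phi> z"
    have w: "cmod w < 1" using pim[OF z1] by (simp add: w_def)
    then have w0: "1 - w \<noteq> 0" by auto
    \<comment> \<open>The definition of Y solved for w. It shows that w is of size \<eta>, so f = Y
      (1 - w)^2 differs little from Y.\<close>
    have wY: "w = of_real \<eta> * Y * (1 - w)\<^sup>2" using eta w0 by (simp add: Y_def koebe_def w_def[symmetric])
    have "cmod (1 - w) \<le> 2" using norm_triangle_ineq4[of 1 w] w by simp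
    then have "(cmod (1 - w))\<^sup>2 \<le> 2\<^sup>2" by (intro power_mono) auto
    then have "\<eta> * cmod Y * (cmod (1 - w))\<^sup>2 \<le> \<eta> * cmod Y * 4" using eta by (intro mult_left_mono) auto
    moreover have "cmod w = \<eta> * cmod Y * (cmod (1 - w))\<^sup>2" using eta by (subst wY) (simp add: norm_mult norm_power)
    ultimately have wb: "cmod w \<le> 4 * \<eta> * cmod Y" by simp
    have "f z = w / of_real \<eta>" by (simp add: f_def w_def)
    also have "\<dots> = Y * (1 - w)\<^sup>2" using eta by (subst wY) simp
    finally have fz: "f z - koebe z = (Y - koebe z) + Y * (w * (w - 2))" by (simp add: power2_eq_square algebra_simps)
    have fz2: "cmod (Y * (w * (w - 2))) \<le> 12 * \<eta> * (Q\<^sup>2 * G)\<^sup>2"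
    proof -
      have "cmod (w - 2) \<le> 3" using norm_triangle_ineq4[of w 2] w by simp
      then have "cmod (Y * (w * (w - 2))) \<le> cmod Y * ((4 * \<eta> * cmod Y) * 3)"
        unfolding norm_mult using wb eta by (intro mult_left_mono mult_mono) auto
      also have "\<dots> = 12 * \<eta> * (cmod Y)\<^sup>2" by (simp add: power2_eq_square)
      also have "\<dots> \<le> 12 * \<eta> * (Q\<^sup>2 * G)\<^sup>2" using Yb eta by (intro mult_left_mono power_mono) auto
      finally show ?thesis .
    qed
    have "cmod (f z - koebe z) \<le> Q\<^sup>2 * (G - 1) + 12 * \<eta> * (Q\<^sup>2 * G)\<^sup>2"
      unfolding fz by (rule norm_triangle_mono[OF Yk fz2])
    then show ?thesis unfolding G_def \<eta>_def .
  qed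
  show ?thesis
    by (intro bexI[OF _ f] bexI[OF _ adm]) (use kap cf cl in \<open>auto simp: \<sigma>_def tc \<eta>_def\<close>)
qed

section \<open>The Bombieri number\<close>

text \<open>Compact subsets are directed under union, so the infimum of the filters is reached on
  single compact sets.\<close>

lemma eventually_locally_uniformly_on:
  "eventually P (locally_uniformly_on U g) \<longleftrightarrow>
     (\<exists>C e. compact C \<and> C \<subseteq> U \<and> 0 < e \<and> (\<forall>f. (\<forall>x\<in>C. dist (f x) (g x) < e) \<longrightarrow> P f))"
proof -
  have u: "eventually Q (uniformly_on C g) \<longleftrightarrow> (\<exists>e>0. \<forall>f. (\<forall>x\<in>C. dist (f x) (g x) < e) \<longrightarrow> Q f)" for Q and C :: "complex set"
    unfolding uniformly_on_def
    by (subst eventually_INF_base)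
       (auto simp: eventually_principal inf_principal Ball_def greaterThan_iff intro!: bexI[where x="min _ _"] dest: order.strict_trans2)
  have mono: "uniformly_on (C \<union> D) g \<le> uniformly_on C g" for C D
    by (rule filter_leI) (fastforce simp: u)
  have "eventually P (locally_uniformly_on U g) \<longleftrightarrow> (\<exists>C\<in>{C. compact C \<and> C \<subseteq> U}. eventually P (uniformly_on C g))"
    unfolding locally_uniformly_on_def
  proof (rule eventually_INF_base)
    show "{C. compact C \<and> C \<subseteq> U} \<noteq> {}" using compact_empty by blast
    fix A B assume "A \<in> {C. compact C \<and> C \<subseteq> U}" "B \<in> {C. compact C \<and> C \<subseteq> U}"
    then show "\<exists>x\<in>{C. compact C \<and> C \<subseteq> U}. uniformly_on x g \<le> inf (uniformly_on A g) (uniformly_on B g)"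
      using mono[of A B] mono[of B A] by (intro bexI[of _ "A \<union> B"]) (auto simp: Un_commute)
  qed
  then show ?thesis unfolding u by blast
qed

lemma koebe_holomorphic: "koebe holomorphic_on ball 0 1"
  unfolding koebe_def by (intro holomorphic_intros) auto

lemma taylor_coeff_koebe_2: "taylor_coeff koebe 2 = 2"
proof -
  define F where "F = fps_expansion koebe 0"
  have F: "koebe has_fps_expansion F" unfolding F_def
    using koebe_holomorphic by (intro has_fps_expansion_fps_expansion[of "ball 0 1"]) auto
  have 1: "(\<lambda>z. koebe z * (1 - z) * (1 - z)) has_fps_expansion F * (1 - fps_X) * (1 - fps_X)"
    by (intro fps_expansion_intros F)
  have 2: "eventually (\<lambda>z. koebe z * (1 - z) * (1 - z) = z) (nhds (0::complex))"
    using eventually_nhds_in_open[of "ball 0 1" "0::complex"]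
    by (auto elim!: eventually_mono simp: koebe_def power2_eq_square)
  have "(\<lambda>z. z) has_fps_expansion F * (1 - fps_X) * (1 - fps_X)"
    by (rule has_fps_expansion_cong[THEN iffD1, OF 2 refl 1])
  then have "fps_expansion (\<lambda>z. z) 0 = F * (1 - fps_X) * (1 - fps_X)" by (rule fps_expansion_eqI)
  moreover have "fps_expansion (\<lambda>z::complex. z) 0 = fps_X" by (rule fps_expansion_eqI) (rule fps_expansion_intros)
  ultimately have e: "F * (1 - fps_X) * (1 - fps_X) = fps_X" by simp
  define G where "G = F - F * fps_X"
  have "G - G * fps_X = F * (1 - fps_X) * (1 - fps_X)" by (simp add: G_def algebra_simps)
  then have e: "G - G * fps_X = fps_X" by (simp only: e)
  have G: "fps_nth G k - (if k = 0 then 0 else fps_nth G (k - 1)) = (if k = 1 then 1 else 0)" for k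
    using arg_cong[OF e, of "\<lambda>f. fps_nth f k"] by simp
  have FG: "fps_nth G k = fps_nth F k - (if k = 0 then 0 else fps_nth F (k - 1))" for k by (simp add: G_def)
  have "fps_nth F 2 = 2" using G[of 0] G[of 1] G[of 2] FG[of 0] FG[of 1] FG[of 2] by simp
  then show ?thesis by (simp add: F_def)
qed

text \<open>Cauchy's inequality for K - f on the circle |z| = 1/2; closeness on this one compact set
  is all that the lower bound uses.\<close>

lemma taylor_coeff_2_close:
  assumes f: "f \<in> class_S" and cl: "\<And>z. z \<in> cball 0 (1/2) \<Longrightarrow> dist (f z) (koebe z) < e"
  shows "2 - Re (taylor_coeff f 2) \<le> 4 * e"
proof -
  have hol: "f holomorphic_on ball 0 1" using f by (simp add: class_S_def)
  define h where "h = (\<lambda>z. koebe z - f z)"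
  have hh: "h holomorphic_on ball 0 1" unfolding h_def using hol koebe_holomorphic by (intro holomorphic_intros)
  have "h has_fps_expansion fps_expansion koebe 0 - fps_expansion f 0"
    unfolding h_def using hol koebe_holomorphic
    by (intro fps_expansion_intros has_fps_expansion_fps_expansion[of "ball 0 1"]) auto
  then have tc: "taylor_coeff h 2 = 2 - taylor_coeff f 2"
    using fps_expansion_eqI[of h] taylor_coeff_koebe_2 by auto
  have "cmod ((deriv ^^ 2) h 0) \<le> fact 2 * e / (1/2)^2"
  proof (rule Cauchy_inequality)
    show "h holomorphic_on ball 0 (1/2)" using hh by (rule holomorphic_on_subset) auto
    show "continuous_on (cball 0 (1/2)) h" using hh by (intro holomorphic_on_imp_continuous_on) (rule holomorphic_on_subset, auto)
    show "cmod (h x) \<le> e" if "cmod (0 - x) = 1/2" for x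
      using cl[of x] that by (simp add: h_def dist_norm norm_minus_commute)
  qed simp
  then have "cmod (taylor_coeff h 2) \<le> 4 * e" by (simp add: fps_expansion_def norm_divide power2_eq_square)
  then show ?thesis using complex_Re_le_cmod[of "taylor_coeff h 2"] unfolding tc by simp
qed

lemma bombieri_number_2_4:
  "bombieri_number 2 4 = Liminf (inf (locally_uniformly_on (ball 0 1) koebe) (principal {f \<in> class_S. 2 - Re (taylor_coeff f 2) \<noteq> 0}))
     (\<lambda>f. ereal ((4 - Re (taylor_coeff f 4)) / (2 - Re (taylor_coeff f 2))))"
  unfolding bombieri_number_def of_nat_numeral ..

text \<open>For r < -\<nu> there is a certified \<mu> with gap g = -\<mu> - r > 0. With E = 2 - Re
  a_2 and x = sqrt (E / 2), the remainder K x^3 equals (K x) (E / 2), and near K the factor K x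
  drops below g.\<close>

lemma bombieri_number_ge:
  assumes \<nu>: "\<nu> < 0" and cert: "\<And>\<mu>. \<nu> < \<mu> \<Longrightarrow> \<mu> < 0 \<Longrightarrow> \<mu> \<in> certified"
  shows "ereal (- \<nu>) \<le> bombieri_number 2 4"
  unfolding bombieri_number_2_4 le_Liminf_iff
proof (intro allI impI)
  fix y :: ereal assume "y < ereal (- \<nu>)"
  then obtain r where r: "y < ereal r" "r < - \<nu>" using ereal_dense2[of y "ereal (- \<nu>)"] by auto
  \<comment> \<open>The minimum keeps \<mu> negative when r is negative.\<close>
  define \<mu> where "\<mu> = (\<nu> + min (- r) 0) / 2"
  have mu: "\<nu> < \<mu>" "\<mu> < 0" "\<mu> < - r" using r \<nu> by (auto simp: \<mu>_def min_def)
  define g where "g = - \<mu> - r"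
  have g: "0 < g" using mu by (simp add: g_def)
  obtain K where K: "0 \<le> K" "\<And>f. f \<in> class_S \<Longrightarrow> 0 \<le> 2 - Re (taylor_coeff f 2) \<and>
     - K * (sqrt ((2 - Re (taylor_coeff f 2)) / 2))^3 \<le> defect \<mu> f"
    using local_lower_bound[OF cert[OF mu(1,2)]] by blast
  \<comment> \<open>Chosen so that E \<le> 4 e gives x \<le> g / (K + 1).\<close>
  define e where "e = (g / (K + 1))\<^sup>2 / 2"
  have e: "0 < e" using g K by (simp add: e_def)
  have main: "r < (4 - Re (taylor_coeff f 4)) / (2 - Re (taylor_coeff f 2))"
    if f: "f \<in> class_S" "2 - Re (taylor_coeff f 2) \<noteq> 0" and cl: "\<forall>z\<in>cball 0 (1/2). dist (f z) (koebe z) < e" for f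
  proof -
    define E where "E = 2 - Re (taylor_coeff f 2)"
    have E: "0 < E" using K(2)[OF f(1)] f(2) by (simp add: E_def)
    define x where "x = sqrt (E / 2)"
    have x2: "x\<^sup>2 = E / 2" using E by (simp add: x_def)
    have "E \<le> 4 * e" unfolding E_def using taylor_coeff_2_close[OF f(1)] cl by blast
    then have "x\<^sup>2 \<le> (g / (K + 1))\<^sup>2" using x2 by (simp add: e_def)
    moreover have "0 \<le> g / (K + 1)" using g K(1) by simp
    ultimately have "x \<le> g / (K + 1)" by (rule power2_le_imp_le)
    then have "K * x \<le> K * (g / (K + 1))" by (rule mult_left_mono) (rule K(1))
    also have "\<dots> < g" using K(1) g by (simp add: pos_divide_less_eq distrib_left)
    finally have Kx: "K * x < g" .
    have "x^3 = (E / 2) * x" using x2 by (simp add: power3_eq_cube power2_eq_square)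
    then have "- K * x^3 = - (K * x) * (E / 2)" by simp
    moreover have "- K * x^3 \<le> defect \<mu> f" using K(2)[OF f(1)] unfolding x_def E_def by blast
    ultimately have "- (K * x) * (E / 2) \<le> defect \<mu> f" by linarith
    moreover have "(K * x) * (E / 2) < g * E"
    proof -
      have "0 \<le> K * x" using K E by (simp add: x_def)
      then have "(K * x) * (E / 2) \<le> (K * x) * E" using E by (intro mult_left_mono) auto
      also have "\<dots> < g * E" using Kx E by simp
      finally show ?thesis .
    qed
    ultimately have "- g * E < (4 - Re (taylor_coeff f 4)) + \<mu> * E" by (simp add: defect_def E_def)
    then have "r * E < 4 - Re (taylor_coeff f 4)" by (simp add: g_def algebra_simps)
    then show ?thesis using E by (simp add: E_def[symmetric] pos_less_divide_eq)
  qed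
  have "eventually (\<lambda>f. \<forall>z\<in>cball 0 (1/2). dist (f z) (koebe z) < e) (locally_uniformly_on (ball 0 1) koebe)"
    unfolding eventually_locally_uniformly_on by (intro exI[of _ "cball 0 (1/2)"] exI[of _ e]) (use e in auto)
  then show "eventually (\<lambda>f. y < ereal ((4 - Re (taylor_coeff f 4)) / (2 - Re (taylor_coeff f 2))))
     (inf (locally_uniformly_on (ball 0 1) koebe) (principal {f \<in> class_S. 2 - Re (taylor_coeff f 2) \<noteq> 0}))"
    unfolding eventually_inf_principal
    by (rule eventually_mono) (use main r(1) in \<open>auto intro: less_trans\<close>)
qed

text \<open>Along the perturbations driven by the null vector the defect is O(\<epsilon>^3), while 2
  - Re a_2 is at least of size \<epsilon>^2 N(1) / 2. So the quotient cannot stay above any r >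
  -\<nu>.\<close>

lemma bombieri_number_le:
  assumes jp: "jacobi_path \<nu> z u I F" "form_value z I F = 0" and u1: "C1 u"
    and N: "\<And>t. t \<in> {0..1} \<Longrightarrow> (N has_real_derivative (u t)\<^sup>2) (at t within {0..1})" "N 0 = 0" "0 < N 1"
  shows "bombieri_number 2 4 \<le> ereal (- \<nu>)"
proof (rule ccontr)
  assume "\<not> bombieri_number 2 4 \<le> ereal (- \<nu>)"
  then have "ereal (- \<nu>) < bombieri_number 2 4" by simp
  then obtain r where r: "- \<nu> < r" "ereal r < bombieri_number 2 4"
    using ereal_dense2[of "ereal (- \<nu>)" "bombieri_number 2 4"] by auto
  obtain C e where C: "compact C" "C \<subseteq> ball 0 1" "0 < e" and
    big: "\<And>f. (\<And>x. x \<in> C \<Longrightarrow> dist (f x) (koebe x) < e) \<Longrightarrow> f \<in> class_S \<Longrightarrow> 2 - Re (taylor_coeff f 2) \<noteq> 0 \<Longrightarrow>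
      r < (4 - Re (taylor_coeff f 4)) / (2 - Re (taylor_coeff f 2))"
    using less_LiminfD[OF r(2)[unfolded bombieri_number_2_4]]
    unfolding eventually_inf_principal eventually_locally_uniformly_on by auto
  \<comment> \<open>The parameter \<epsilon> is recovered from the system as the cube root of its
    mesh, so the perturbations for all \<epsilon> belong to one family and share the constant
    K.\<close>
  define Sys where "Sys = {\<sigma> \<in> admissible. \<forall>k<s_n \<sigma>. s_kap \<sigma> k = cis (- (root 3 (s_eta \<sigma>) * u (s_t \<sigma> k)))}"
  interpret P: loewner_family Sys s_eta s_n s_t s_kap s_a s_b s_c
    by unfold_locales (auto simp: Sys_def admissible_def loewner_chain_def)
  have "\<exists>K\<ge>0. \<forall>\<sigma>\<in>Sys. \<bar>P.L \<nu> \<sigma> - (root 3 (s_eta \<sigma>))\<^sup>2 * form_value z I F\<bar> \<le> K * root 3 (s_eta \<sigma>) ^ 3 \<and>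
     \<bar>(2 - Re (s_a \<sigma> (s_n \<sigma>))) - (root 3 (s_eta \<sigma>))\<^sup>2 * N 1\<bar> \<le> K * root 3 (s_eta \<sigma>) ^ 3"
    by (rule P.perturbation_expansion[OF _ _ _ _ jp(1) u1 N(1,2)]) (auto simp: Sys_def admissible_def)
  then obtain K where K: "0 \<le> K" "\<And>\<sigma>. \<sigma> \<in> Sys \<Longrightarrow> \<bar>P.L \<nu> \<sigma>\<bar> \<le> K * root 3 (s_eta \<sigma>) ^ 3"
     "\<And>\<sigma>. \<sigma> \<in> Sys \<Longrightarrow> \<bar>(2 - Re (s_a \<sigma> (s_n \<sigma>))) - (root 3 (s_eta \<sigma>))\<^sup>2 * N 1\<bar> \<le> K * root 3 (s_eta \<sigma>) ^ 3"
    unfolding jp(2) by auto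
  have "bounded (u ` {0..1})" using C1_cont[OF u1] compact_Icc compact_continuous_image compact_imp_bounded by blast
  then obtain U where U: "\<And>s. s \<in> {0..1} \<Longrightarrow> \<bar>u s\<bar> \<le> U" unfolding bounded_iff by (metis imageI real_norm_def)
  obtain Q where Q: "1 \<le> Q" "\<And>x. x \<in> C \<Longrightarrow> 1 / Q \<le> 1 - cmod x"
  proof (cases "C = {}")
    case False
    then obtain x where x: "x \<in> C" "\<And>y. y \<in> C \<Longrightarrow> cmod y \<le> cmod x"
      using continuous_attains_sup[OF C(1), of cmod] by (auto intro: continuous_intros)
    have x1: "cmod x < 1" using x C by auto
    show ?thesis
    proof (rule that)
      show "1 \<le> 1 / (1 - cmod x)" using x1 by (simp add: field_simps)
      show "1 / (1 / (1 - cmod x)) \<le> 1 - cmod y" if "y \<in> C" for y using x(2)[OF that] by simp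
    qed
  qed (use that[of 1] in auto)
  define B where "B \<epsilon> = Q\<^sup>2 * (exp (64 * Q^4 * (U + 2) * (\<epsilon> * (-3 * ln \<epsilon>))) - 1)
          + 12 * \<epsilon>^3 * (Q\<^sup>2 * exp (64 * Q^4 * (U + 2) * (\<epsilon> * (-3 * ln \<epsilon>))))\<^sup>2" for \<epsilon> :: real
  have l0: "((\<lambda>\<epsilon>::real. \<epsilon> * (-3 * ln \<epsilon>)) \<longlongrightarrow> 0) (at_right 0)" by real_asymp
  have "(B \<longlongrightarrow> Q\<^sup>2 * (exp (64 * Q^4 * (U + 2) * 0) - 1) + 12 * 0^3 * (Q\<^sup>2 * exp (64 * Q^4 * (U + 2) * 0))\<^sup>2) (at_right 0)"
    unfolding B_def[abs_def] by (intro tendsto_intros l0)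
  then have "(B \<longlongrightarrow> 0) (at_right 0)" by simp
  then have ev: "eventually (\<lambda>\<epsilon>. B \<epsilon> < e) (at_right 0)" using C(3) by (rule order_tendstoD)
  have small: "eventually (\<lambda>\<epsilon>. \<epsilon> < x) (at_right 0)" if "0 < x" for x :: real
    using that by (simp add: eventually_at_right_field) blast
  \<comment> \<open>The first bound brings f into the given neighbourhood, and \<epsilon> < 1 / Q^2
    admits the estimate on C. The bound by N(1) / (2 (K + 1)) keeps at least half of the main term
    of 2 - Re a_2, and the one with r + \<nu> lets it dominate the cubic remainder.\<close>
  have "eventually (\<lambda>\<epsilon>. B \<epsilon> < e \<and> \<epsilon> < 1 \<and> \<epsilon> < 1 / Q\<^sup>2 \<and> \<epsilon> < N 1 / (2 * (K + 1)) \<and> \<epsilon> < (r + \<nu>) * N 1 / (2 * (K + 1)) \<and> 0 < \<epsilon>) (at_right 0)"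
    using N(3) K(1) r(1) Q(1) by (intro eventually_conj ev small eventually_at_right_less) auto
  then obtain \<epsilon> where \<epsilon>: "B \<epsilon> < e" "\<epsilon> < 1" "\<epsilon> < 1 / Q\<^sup>2" "\<epsilon> < N 1 / (2 * (K + 1))" "\<epsilon> < (r + \<nu>) * N 1 / (2 * (K + 1))" "0 < \<epsilon>"
    using eventually_happens by (metis (mono_tags, lifting) trivial_limit_at_right_real)
  obtain f \<sigma> where f: "f \<in> class_S" and s: "\<sigma> \<in> admissible" "s_eta \<sigma> = \<epsilon>^3"
     "\<forall>k<s_n \<sigma>. s_kap \<sigma> k = cis (- (\<epsilon> * u (s_t \<sigma> k)))" and cf: "s_a \<sigma> (s_n \<sigma>) = taylor_coeff f 2" "s_c \<sigma> (s_n \<sigma>) = taylor_coeff f 4"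
     and cl: "\<And>z Q. 1 \<le> Q \<Longrightarrow> 1 / Q \<le> 1 - cmod z \<Longrightarrow> Q\<^sup>2 * \<epsilon> \<le> 1 \<Longrightarrow>
       cmod (f z - koebe z) \<le> Q\<^sup>2 * (exp (64 * Q^4 * (U + 2) * (\<epsilon> * (-3 * ln \<epsilon>))) - 1)
          + 12 * \<epsilon>^3 * (Q\<^sup>2 * exp (64 * Q^4 * (U + 2) * (\<epsilon> * (-3 * ln \<epsilon>))))\<^sup>2"
    using koebe_perturbation[where u=u and U=U, OF \<epsilon>(6) less_imp_le[OF \<epsilon>(2)] U] by blast
  have rt: "root 3 (s_eta \<sigma>) = \<epsilon>" using s(2) \<epsilon>(6) by (simp add: real_root_power_cancel)
  have sS: "\<sigma> \<in> Sys" unfolding Sys_def mem_Collect_eq rt using s(1,3) by blast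
  define E where "E = 2 - Re (taylor_coeff f 2)"
  have ke: "K * \<epsilon> \<le> (K + 1) * \<epsilon>" using \<epsilon>(6) by simp
  have kN: "(K + 1) * \<epsilon> < N 1 / 2" using \<epsilon>(4) K(1) by (simp add: field_simps)
  have kr: "(K + 1) * \<epsilon> < (r + \<nu>) * (N 1 / 2)" using \<epsilon>(5) K(1) by (simp add: field_simps)
  have e2: "0 < \<epsilon>\<^sup>2" using \<epsilon>(6) by simp
  have c3: "K * \<epsilon>^3 \<le> \<epsilon>\<^sup>2 * ((K + 1) * \<epsilon>)"
    using mult_left_mono[OF ke, of "\<epsilon>\<^sup>2"] by (simp add: power3_eq_cube power2_eq_square mult_ac)
  have E: "\<epsilon>\<^sup>2 * (N 1 / 2) < E"
  proof -
    have "\<epsilon>\<^sup>2 * ((K + 1) * \<epsilon>) < \<epsilon>\<^sup>2 * (N 1 / 2)" using kN e2 by (rule mult_strict_left_mono)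
    moreover have "\<epsilon>\<^sup>2 * N 1 = \<epsilon>\<^sup>2 * (N 1 / 2) + \<epsilon>\<^sup>2 * (N 1 / 2)" by simp
    ultimately show ?thesis using K(3)[OF sS] c3 unfolding rt cf E_def by linarith
  qed
  have E0: "0 < E" using E e2 N(3) by (smt (verit) mult_pos_pos half_gt_zero)
  have "(4 - Re (taylor_coeff f 4)) + \<nu> * E \<le> K * \<epsilon>^3" using K(2)[OF sS] unfolding rt P.L_def cf E_def by linarith
  also have "\<dots> \<le> \<epsilon>\<^sup>2 * ((K + 1) * \<epsilon>)" by (rule c3)
  also have "\<dots> < \<epsilon>\<^sup>2 * ((r + \<nu>) * (N 1 / 2))" using kr e2 by (rule mult_strict_left_mono)
  also have "\<dots> = (r + \<nu>) * (\<epsilon>\<^sup>2 * (N 1 / 2))" by simp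
  also have "\<dots> \<le> (r + \<nu>) * E" using E r(1) by (intro mult_left_mono) auto
  finally have "4 - Re (taylor_coeff f 4) < r * E" by (simp add: algebra_simps)
  moreover have "r < (4 - Re (taylor_coeff f 4)) / E" unfolding E_def
  proof (rule big[OF _ f])
    show "2 - Re (taylor_coeff f 2) \<noteq> 0" using E0 by (simp add: E_def)
    fix x assume x: "x \<in> C"
    have "Q\<^sup>2 * \<epsilon> \<le> 1" using \<epsilon>(3) Q(1) by (simp add: field_simps)
    then have "cmod (f x - koebe x) \<le> B \<epsilon>" unfolding B_def using cl[OF Q(1) Q(2)[OF x]] by blast
    then show "dist (f x) (koebe x) < e" using \<epsilon>(1) by (simp add: dist_norm)
  qed
  ultimately show False using E0 by (simp add: pos_less_divide_eq)
qed

theorem theorem10: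
  fixes y :: "real \<Rightarrow> nat \<Rightarrow> real \<Rightarrow> real" and R :: "real set"
  assumes sol: "\<And>\<nu>. -1 < \<nu> \<Longrightarrow> \<nu> < 0 \<Longrightarrow> solves_cauchy_problem \<nu> (y \<nu>)"
  defines "R \<equiv> {\<nu>. -1 < \<nu> \<and> \<nu> < 0 \<and>
      (\<nu> * y \<nu> 1 1 + y \<nu> 3 1 = 0 \<or>
       (\<nu> * y \<nu> 1 1 + y \<nu> 3 1) * (\<nu> * y \<nu> 7 1 + y \<nu> 9 1)
         - (\<nu> * y \<nu> 13 1 + y \<nu> 15 1)\<^sup>2 = 0)}"
  shows "\<exists>\<nu>m. \<nu>m \<in> R \<and> (\<forall>\<nu>\<in>R. \<nu> \<le> \<nu>m) \<and> bombieri_number 2 4 = ereal (- \<nu>m)"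
proof -
  obtain \<nu> z u I F N where R: "\<nu> \<in> R" "\<And>\<mu>. \<mu> \<in> R \<Longrightarrow> \<mu> \<le> \<nu>" and cert: "\<And>\<mu>. \<nu> < \<mu> \<Longrightarrow> \<mu> < 0 \<Longrightarrow> \<mu> \<in> certified"
    and jp: "jacobi_path \<nu> z u I F" "form_value z I F = 0" "C1 u"
    and N: "\<And>t. t \<in> {0..1} \<Longrightarrow> (N has_real_derivative (u t)\<^sup>2) (at t within {0..1})" "N 0 = 0" "0 < N 1"
    using threshold[OF sol] unfolding R_def by blast
  have "\<nu> < 0" using R(1) by (simp add: R_def)
  then have "bombieri_number 2 4 = ereal (- \<nu>)"
    using bombieri_number_ge[OF _ cert] bombieri_number_le[OF jp N] by (intro antisym) auto
  then show ?thesis using R by blast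
qed

end
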